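(* Let $\mathcal{C}$ be a path category. Then $\mathrm{Hex}(\mathcal{C})$ is the exact completion of $\mathrm{Ho}(\mathcal{C})$ as a weakly lex category, via the functor $\mathrm{Ho}(\mathcal{C}) \to \mathrm{Hex}(\mathcal{C})$ induced by $i: \mathcal{C} \to \mathrm{Hex}(\mathcal{C})$, $X \mapsto (X, PX)$.
   Context: A path category is a category $\mathcal{C}$ with two classes of maps, fibrations and weak equivalences (maps in both classes are called acyclic fibrations), such that: (1) fibrations are closed under composition; (2) the pullback of a fibration along any map exists and is a fibration; (3) the pullback of an acyclic fibration along any map is an acyclic fibration; (4) 2-out-of-6: if $f:A\to B$, $g:B\to C$, $h:C\to D$ and $gf$, $hg$ are weak equivalences, then so are $f,g,h,hgf$; (5) isomorphisms are acyclic fibrations and every acyclic fibration has a section; (6) every object $B$ has a path object, i.e. a factorisation of the diagonal $B \to B\times B$ as a weak equivalence $r: B \to PB$ followed by a fibration $(s,t): PB \to B \times B$; (7) there is a terminal object $1$ and every map $X \to 1$ is a fibration. In a path category, $f,g: Y \to X$ are homotopic, $f \simeq g$, if for some path object $PX$ there is $h: Y \to PX$ with $sh = f$, $th = g$; this is a congruence independent of the choice of path object, and the homotopy category $\mathrm{Ho}(\mathcal{C})$ is the quotient of $\mathcal{C}$ by $\simeq$. A homotopy equivalence relation on $X$ in $\mathcal{C}$ is a fibration $p=(p_1,p_2): R \to X \times X$ such that there exist: $\rho: X \to R$ with $p\rho = \Delta_X$; $\sigma: R \to R$ with $p_1\sigma = p_2$, $p_2\sigma = p_1$; and, for the pullback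 $R\times_X R$ of $p_2$ and $p_1$ with projections $q_1,q_2$ (so $p_2q_1 = p_1q_2$), a map $\tau: R\times_X R \to R$ with $p_1\tau = p_1q_1$ and $p_2\tau = p_2q_2$. Every path object $(s,t): PX \to X\times X$ is a homotopy equivalence relation. $\mathrm{Hex}(\mathcal{C})$ has as objects the pairs $(X, \rho: R \to X\times X)$ with $\rho$ a homotopy equivalence relation in $\mathcal{C}$. A morphism $(X,\rho:R\to X\times X) \to (Y,\sigma: S\to Y\times Y)$ is an equivalence class of maps $f: X \to Y$ in $\mathcal{C}$ for which there is $\varphi: R \to S$ with $\sigma\varphi = (f\times f)\rho$; two such $f,g$ are identified if there is $H: X \to S$ with $\sigma H = (f,g)$. The functor $i: \mathcal{C}\to\mathrm{Hex}(\mathcal{C})$ sends $X$ to $(X,PX)$ and $f$ to the class of $f$; it identifies homotopic maps, hence factors through $\mathrm{Ho}(\mathcal{C})$. A category is weakly lex if it has weak finite limits (limits with uniqueness of the mediating map dropped). A category is exact if it is regular and every equivalence relation is a kernel pair; an exact functor between exact categories is one preserving finite limits and regular epimorphisms. A functor $F: \mathcal{W} \to \mathcal{E}$ from a weakly lex category to an exact category is left covering if, for every finite diagram $L$ in $\mathcal{W}$ and every weak limit $W$ of $L$, the canonical map $F(W) \to \lim F L$ is a regular epimorphism. The exact completion of a weakly lex category $\mathcal{W}$ is an exact category $\mathcal{W}_{ex}$ with a left covering functor $\Gamma: \mathcal{W}\to\mathcal{W}_{ex}$ such that, for every exact category $\mathcal{E}$, composition with $\Gamma$ is an equivalence between the category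 of exact functors $\mathcal{W}_{ex}\to\mathcal{E}$ and the category of left covering functors $\mathcal{W}\to\mathcal{E}$. *)

theory Defs
  imports Main "HOL-Library.FuncSet"
begin

section \<open>Categories, functors, natural transformations\<close>

text \<open>Composition is written in diagram-reversed order, \<open>g \<cdot> f\<close> meaning "f, then g"; its value
  on non-composable arguments is irrelevant.\<close>

record ('o, 'a) cat =
  Obj :: "'o set"
  Arr :: "'a set"
  Dom :: "'a \<Rightarrow> 'o"
  Cod :: "'a \<Rightarrow> 'o"
  Ide :: "'o \<Rightarrow> 'a"
  Comp :: "'a \<Rightarrow> 'a \<Rightarrow> 'a" (infixr "\<cdot>\<index>" 70)

definition hom :: "('o, 'a) cat \<Rightarrow> 'o \<Rightarrow> 'o \<Rightarrow> 'a set" where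
  "hom C X Y = {f \<in> Arr C. Dom C f = X \<and> Cod C f = Y}"

locale category =
  fixes C :: "('o, 'a) cat"
  assumes Dom_in_Obj: "f \<in> Arr C \<Longrightarrow> Dom C f \<in> Obj C"
    and Cod_in_Obj: "f \<in> Arr C \<Longrightarrow> Cod C f \<in> Obj C"
    and Ide_in_hom: "X \<in> Obj C \<Longrightarrow> Ide C X \<in> hom C X X"
    and Comp_in_hom: "\<lbrakk>f \<in> hom C X Y; g \<in> hom C Y Z\<rbrakk> \<Longrightarrow> g \<cdot>\<^bsub>C\<^esub> f \<in> hom C X Z"
    and Comp_Ide_right: "f \<in> hom C X Y \<Longrightarrow> f \<cdot>\<^bsub>C\<^esub> Ide C X = f"
    and Comp_Ide_left: "f \<in> hom C X Y \<Longrightarrow> Ide C Y \<cdot>\<^bsub>C\<^esub> f = f"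
    and Comp_assoc: "\<lbrakk>f \<in> hom C X Y; g \<in> hom C Y Z; h \<in> hom C Z V\<rbrakk>
      \<Longrightarrow> (h \<cdot>\<^bsub>C\<^esub> g) \<cdot>\<^bsub>C\<^esub> f = h \<cdot>\<^bsub>C\<^esub> (g \<cdot>\<^bsub>C\<^esub> f)"

definition is_iso :: "('o, 'a) cat \<Rightarrow> 'a \<Rightarrow> bool" where
  "is_iso C f \<longleftrightarrow> f \<in> Arr C \<and> (\<exists>g \<in> hom C (Cod C f) (Dom C f).
     g \<cdot>\<^bsub>C\<^esub> f = Ide C (Dom C f) \<and> f \<cdot>\<^bsub>C\<^esub> g = Ide C (Cod C f))"

record ('o, 'a, 'p, 'b) ftr =
  FO :: "'o \<Rightarrow> 'p"
  FA :: "'a \<Rightarrow> 'b"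

text \<open>The object and arrow parts of functors, and the components of natural transformations, are
  extensional (\<open>undefined\<close> off the carrier), so that HOL equality of these data is the
  mathematical equality.\<close>

definition is_functor ::
  "('o, 'a) cat \<Rightarrow> ('p, 'b) cat \<Rightarrow> ('o, 'a, 'p, 'b) ftr \<Rightarrow> bool" where
  "is_functor A B F \<longleftrightarrow> category A \<and> category B \<and>
     FO F \<in> Obj A \<rightarrow>\<^sub>E Obj B \<and> FA F \<in> extensional (Arr A) \<and>
     (\<forall>f \<in> Arr A. FA F f \<in> hom B (FO F (Dom A f)) (FO F (Cod A f))) \<and>
     (\<forall>X \<in> Obj A. FA F (Ide A X) = Ide B (FO F X)) \<and>
     (\<forall>f \<in> Arr A. \<forall>g \<in> Arr A. Dom A g = Cod A f \<longrightarrow>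
        FA F (g \<cdot>\<^bsub>A\<^esub> f) = FA F g \<cdot>\<^bsub>B\<^esub> FA F f)"

definition id_ftr :: "('o, 'a) cat \<Rightarrow> ('o, 'a, 'o, 'a) ftr" where
  "id_ftr A = \<lparr>FO = (\<lambda>X \<in> Obj A. X), FA = (\<lambda>f \<in> Arr A. f)\<rparr>"

text \<open>\<open>comp_ftr A G F\<close> is \<open>G \<circ> F\<close>, where \<open>A\<close> is the domain of \<open>F\<close>.\<close>

definition comp_ftr :: "('o, 'a) cat \<Rightarrow> ('p, 'b, 'q, 'c) ftr \<Rightarrow> ('o, 'a, 'p, 'b) ftr
    \<Rightarrow> ('o, 'a, 'q, 'c) ftr" where
  "comp_ftr A G F =
     \<lparr>FO = (\<lambda>X \<in> Obj A. FO G (FO F X)), FA = (\<lambda>f \<in> Arr A. FA G (FA F f))\<rparr>"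

definition nat_trans :: "('o, 'a) cat \<Rightarrow> ('p, 'b) cat \<Rightarrow> ('o, 'a, 'p, 'b) ftr
    \<Rightarrow> ('o, 'a, 'p, 'b) ftr \<Rightarrow> ('o \<Rightarrow> 'b) \<Rightarrow> bool" where
  "nat_trans A B F G \<theta> \<longleftrightarrow> is_functor A B F \<and> is_functor A B G \<and>
     \<theta> \<in> extensional (Obj A) \<and>
     (\<forall>X \<in> Obj A. \<theta> X \<in> hom B (FO F X) (FO G X)) \<and>
     (\<forall>f \<in> Arr A. \<theta> (Cod A f) \<cdot>\<^bsub>B\<^esub> FA F f = FA G f \<cdot>\<^bsub>B\<^esub> \<theta> (Dom A f))"

definition naturally_iso :: "('o, 'a) cat \<Rightarrow> ('p, 'b) cat \<Rightarrow> ('o, 'a, 'p, 'b) ftr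
    \<Rightarrow> ('o, 'a, 'p, 'b) ftr \<Rightarrow> bool" where
  "naturally_iso A B F G \<longleftrightarrow>
     (\<exists>\<theta>. nat_trans A B F G \<theta> \<and> (\<forall>X \<in> Obj A. is_iso B (\<theta> X)))"

definition is_equivalence ::
  "('o, 'a) cat \<Rightarrow> ('p, 'b) cat \<Rightarrow> ('o, 'a, 'p, 'b) ftr \<Rightarrow> bool" where
  "is_equivalence A B K \<longleftrightarrow> is_functor A B K \<and>
     (\<exists>L. is_functor B A L \<and>
        naturally_iso A A (comp_ftr A L K) (id_ftr A) \<and>
        naturally_iso B B (comp_ftr B K L) (id_ftr B))"

text \<open>The full subcategory, on the functors satisfying \<open>P\<close>, of the category of functors from
  \<open>A\<close> to \<open>B\<close>. A natural transformation is tagged with its source and target functors.\<close>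

definition functor_cat :: "('o, 'a) cat \<Rightarrow> ('p, 'b) cat \<Rightarrow> (('o, 'a, 'p, 'b) ftr \<Rightarrow> bool)
    \<Rightarrow> (('o, 'a, 'p, 'b) ftr,
        ('o, 'a, 'p, 'b) ftr \<times> ('o \<Rightarrow> 'b) \<times> ('o, 'a, 'p, 'b) ftr) cat" where
  "functor_cat A B P =
     \<lparr>Obj = {F. is_functor A B F \<and> P F},
      Arr = {(F, \<theta>, G). P F \<and> P G \<and> nat_trans A B F G \<theta>},
      Dom = (\<lambda>(F, \<theta>, G). F),
      Cod = (\<lambda>(F, \<theta>, G). G),
      Ide = (\<lambda>F. (F, (\<lambda>X \<in> Obj A. Ide B (FO F X)), F)),
      Comp = (\<lambda>(G', \<eta>, H) (F, \<theta>, G). (F, (\<lambda>X \<in> Obj A. \<eta> X \<cdot>\<^bsub>B\<^esub> \<theta> X), H))\<rparr>"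

text \<open>Precomposition with \<open>\<Gamma>\<close> (whose domain is \<open>W\<close>), as a functor defined on a category \<open>S\<close> of
  functors.\<close>

definition precomp_ftr :: "('w, 'v) cat \<Rightarrow> ('w, 'v, 'o, 'a) ftr
    \<Rightarrow> (('o, 'a, 'p, 'b) ftr,
        ('o, 'a, 'p, 'b) ftr \<times> ('o \<Rightarrow> 'b) \<times> ('o, 'a, 'p, 'b) ftr) cat
    \<Rightarrow> (('o, 'a, 'p, 'b) ftr,
        ('o, 'a, 'p, 'b) ftr \<times> ('o \<Rightarrow> 'b) \<times> ('o, 'a, 'p, 'b) ftr,
        ('w, 'v, 'p, 'b) ftr,
        ('w, 'v, 'p, 'b) ftr \<times> ('w \<Rightarrow> 'b) \<times> ('w, 'v, 'p, 'b) ftr) ftr" where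
  "precomp_ftr W \<Gamma> S =
     \<lparr>FO = (\<lambda>F \<in> Obj S. comp_ftr W F \<Gamma>),
      FA = restrict (\<lambda>(F, \<theta>, G). (comp_ftr W F \<Gamma>, (\<lambda>X \<in> Obj W. \<theta> (FO \<Gamma> X)), comp_ftr W G \<Gamma>))
             (Arr S)\<rparr>"


section \<open>Limits and exact categories\<close>

text \<open>Finite diagrams are functors from a finite category whose objects and arrows are natural
  numbers; every finite category is isomorphic to such a one.\<close>

definition finite_diagram ::
  "(nat, nat) cat \<Rightarrow> ('o, 'a) cat \<Rightarrow> (nat, nat, 'o, 'a) ftr \<Rightarrow> bool" where
  "finite_diagram J C D \<longleftrightarrow> is_functor J C D \<and> finite (Obj J) \<and> finite (Arr J)"

definition is_cone :: "('j, 'i) cat \<Rightarrow> ('o, 'a) cat \<Rightarrow> ('j, 'i, 'o, 'a) ftr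
    \<Rightarrow> 'o \<Rightarrow> ('j \<Rightarrow> 'a) \<Rightarrow> bool" where
  "is_cone J C D V c \<longleftrightarrow> V \<in> Obj C \<and>
     (\<forall>j \<in> Obj J. c j \<in> hom C V (FO D j)) \<and>
     (\<forall>u \<in> Arr J. FA D u \<cdot>\<^bsub>C\<^esub> c (Dom J u) = c (Cod J u))"

definition is_weak_limit :: "('j, 'i) cat \<Rightarrow> ('o, 'a) cat \<Rightarrow> ('j, 'i, 'o, 'a) ftr
    \<Rightarrow> 'o \<Rightarrow> ('j \<Rightarrow> 'a) \<Rightarrow> bool" where
  "is_weak_limit J C D V c \<longleftrightarrow> is_cone J C D V c \<and>
     (\<forall>U b. is_cone J C D U b \<longrightarrow>
        (\<exists>h. h \<in> hom C U V \<and> (\<forall>j \<in> Obj J. c j \<cdot>\<^bsub>C\<^esub> h = b j)))"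

definition is_limit :: "('j, 'i) cat \<Rightarrow> ('o, 'a) cat \<Rightarrow> ('j, 'i, 'o, 'a) ftr
    \<Rightarrow> 'o \<Rightarrow> ('j \<Rightarrow> 'a) \<Rightarrow> bool" where
  "is_limit J C D V c \<longleftrightarrow> is_cone J C D V c \<and>
     (\<forall>U b. is_cone J C D U b \<longrightarrow>
        (\<exists>!h. h \<in> hom C U V \<and> (\<forall>j \<in> Obj J. c j \<cdot>\<^bsub>C\<^esub> h = b j)))"

definition weakly_lex :: "('o, 'a) cat \<Rightarrow> bool" where
  "weakly_lex C \<longleftrightarrow> category C \<and>
     (\<forall>J D. finite_diagram J C D \<longrightarrow> (\<exists>V c. is_weak_limit J C D V c))"

definition finitely_complete :: "('o, 'a) cat \<Rightarrow> bool" where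
  "finitely_complete C \<longleftrightarrow> category C \<and>
     (\<forall>J D. finite_diagram J C D \<longrightarrow> (\<exists>V c. is_limit J C D V c))"

definition is_terminal :: "('o, 'a) cat \<Rightarrow> 'o \<Rightarrow> bool" where
  "is_terminal C T \<longleftrightarrow> T \<in> Obj C \<and> (\<forall>X \<in> Obj C. \<exists>!f. f \<in> hom C X T)"

definition is_product :: "('o, 'a) cat \<Rightarrow> 'o \<Rightarrow> 'o \<Rightarrow> 'a \<Rightarrow> 'a \<Rightarrow> bool" where
  "is_product C X Y p q \<longleftrightarrow> p \<in> hom C (Dom C p) X \<and> q \<in> hom C (Dom C p) Y \<and>
     (\<forall>U. \<forall>f \<in> hom C U X. \<forall>g \<in> hom C U Y.
        \<exists>!h. h \<in> hom C U (Dom C p) \<and> p \<cdot>\<^bsub>C\<^esub> h = f \<and> q \<cdot>\<^bsub>C\<^esub> h = g)"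

text \<open>\<open>is_pullback C f g p q\<close>: \<open>p\<close> and \<open>q\<close> are the projections of a pullback of \<open>f\<close> and \<open>g\<close>,
  with \<open>f \<cdot> p = g \<cdot> q\<close>. In particular \<open>q\<close> is a pullback of \<open>f\<close> along \<open>g\<close>.\<close>

definition is_pullback :: "('o, 'a) cat \<Rightarrow> 'a \<Rightarrow> 'a \<Rightarrow> 'a \<Rightarrow> 'a \<Rightarrow> bool" where
  "is_pullback C f g p q \<longleftrightarrow> f \<in> Arr C \<and> g \<in> Arr C \<and> Cod C f = Cod C g \<and>
     p \<in> hom C (Dom C p) (Dom C f) \<and> q \<in> hom C (Dom C p) (Dom C g) \<and>
     f \<cdot>\<^bsub>C\<^esub> p = g \<cdot>\<^bsub>C\<^esub> q \<and>
     (\<forall>U. \<forall>a \<in> hom C U (Dom C f). \<forall>b \<in> hom C U (Dom C g). f \<cdot>\<^bsub>C\<^esub> a = g \<cdot>\<^bsub>C\<^esub> b \<longrightarrow>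
        (\<exists>!h. h \<in> hom C U (Dom C p) \<and> p \<cdot>\<^bsub>C\<^esub> h = a \<and> q \<cdot>\<^bsub>C\<^esub> h = b))"

definition is_coequalizer :: "('o, 'a) cat \<Rightarrow> 'a \<Rightarrow> 'a \<Rightarrow> 'a \<Rightarrow> bool" where
  "is_coequalizer C a b e \<longleftrightarrow> a \<in> hom C (Dom C a) (Dom C e) \<and> b \<in> hom C (Dom C a) (Dom C e) \<and>
     e \<in> Arr C \<and> e \<cdot>\<^bsub>C\<^esub> a = e \<cdot>\<^bsub>C\<^esub> b \<and>
     (\<forall>Z. \<forall>f \<in> hom C (Dom C e) Z. f \<cdot>\<^bsub>C\<^esub> a = f \<cdot>\<^bsub>C\<^esub> b \<longrightarrow>
        (\<exists>!h. h \<in> hom C (Cod C e) Z \<and> h \<cdot>\<^bsub>C\<^esub> e = f))"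

definition regular_epi :: "('o, 'a) cat \<Rightarrow> 'a \<Rightarrow> bool" where
  "regular_epi C e \<longleftrightarrow> (\<exists>a b. is_coequalizer C a b e)"

definition is_kernel_pair :: "('o, 'a) cat \<Rightarrow> 'a \<Rightarrow> 'a \<Rightarrow> 'a \<Rightarrow> bool" where
  "is_kernel_pair C f p q \<longleftrightarrow> is_pullback C f f p q"

definition regular_category :: "('o, 'a) cat \<Rightarrow> bool" where
  "regular_category C \<longleftrightarrow> finitely_complete C \<and>
     (\<forall>f p q. is_kernel_pair C f p q \<longrightarrow> (\<exists>e. is_coequalizer C p q e)) \<and>
     (\<forall>f g p q. is_pullback C f g p q \<longrightarrow> regular_epi C f \<longrightarrow> regular_epi C q)"

definition is_equivalence_relation :: "('o, 'a) cat \<Rightarrow> 'o \<Rightarrow> 'a \<Rightarrow> 'a \<Rightarrow> bool" where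
  "is_equivalence_relation C X r\<^sub>1 r\<^sub>2 \<longleftrightarrow> (let R = Dom C r\<^sub>1 in
     r\<^sub>1 \<in> hom C R X \<and> r\<^sub>2 \<in> hom C R X \<and>
     (\<forall>U. \<forall>a \<in> hom C U R. \<forall>b \<in> hom C U R.
        r\<^sub>1 \<cdot>\<^bsub>C\<^esub> a = r\<^sub>1 \<cdot>\<^bsub>C\<^esub> b \<and> r\<^sub>2 \<cdot>\<^bsub>C\<^esub> a = r\<^sub>2 \<cdot>\<^bsub>C\<^esub> b \<longrightarrow> a = b) \<and>
     (\<exists>\<rho> \<in> hom C X R. r\<^sub>1 \<cdot>\<^bsub>C\<^esub> \<rho> = Ide C X \<and> r\<^sub>2 \<cdot>\<^bsub>C\<^esub> \<rho> = Ide C X) \<and>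
     (\<exists>\<sigma> \<in> hom C R R. r\<^sub>1 \<cdot>\<^bsub>C\<^esub> \<sigma> = r\<^sub>2 \<and> r\<^sub>2 \<cdot>\<^bsub>C\<^esub> \<sigma> = r\<^sub>1) \<and>
     (\<exists>q\<^sub>1 q\<^sub>2. is_pullback C r\<^sub>2 r\<^sub>1 q\<^sub>1 q\<^sub>2 \<and>
        (\<exists>\<tau> \<in> hom C (Dom C q\<^sub>1) R.
           r\<^sub>1 \<cdot>\<^bsub>C\<^esub> \<tau> = r\<^sub>1 \<cdot>\<^bsub>C\<^esub> q\<^sub>1 \<and> r\<^sub>2 \<cdot>\<^bsub>C\<^esub> \<tau> = r\<^sub>2 \<cdot>\<^bsub>C\<^esub> q\<^sub>2)))"

definition exact_category :: "('o, 'a) cat \<Rightarrow> bool" where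
  "exact_category C \<longleftrightarrow> regular_category C \<and>
     (\<forall>X r\<^sub>1 r\<^sub>2. is_equivalence_relation C X r\<^sub>1 r\<^sub>2 \<longrightarrow> (\<exists>f. is_kernel_pair C f r\<^sub>1 r\<^sub>2))"

definition exact_functor ::
  "('o, 'a) cat \<Rightarrow> ('p, 'b) cat \<Rightarrow> ('o, 'a, 'p, 'b) ftr \<Rightarrow> bool" where
  "exact_functor A B F \<longleftrightarrow> is_functor A B F \<and>
     (\<forall>J D V c. finite_diagram J A D \<and> is_limit J A D V c \<longrightarrow>
        is_limit J B (comp_ftr J F D) (FO F V) (\<lambda>j. FA F (c j))) \<and>
     (\<forall>e. regular_epi A e \<longrightarrow> regular_epi B (FA F e))"

definition left_covering ::
  "('o, 'a) cat \<Rightarrow> ('p, 'b) cat \<Rightarrow> ('o, 'a, 'p, 'b) ftr \<Rightarrow> bool" where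
  "left_covering W E F \<longleftrightarrow> is_functor W E F \<and>
     (\<forall>J D V c L l h. finite_diagram J W D \<and> is_weak_limit J W D V c \<and>
        is_limit J E (comp_ftr J F D) L l \<and>
        h \<in> hom E (FO F V) L \<and> (\<forall>j \<in> Obj J. l j \<cdot>\<^bsub>E\<^esub> h = FA F (c j)) \<longrightarrow>
        regular_epi E h)"

text \<open>The universal property refers to all exact categories. Since HOL formulas cannot quantify
  over types, the object and arrow types \<open>'p\<close> and \<open>'b\<close> of the test categories are a parameter;
  a theorem with \<open>'p\<close> and \<open>'b\<close> left schematic covers all of them.\<close>

definition exact_completion :: "('p, 'b) cat itself \<Rightarrow> ('w, 'v) cat \<Rightarrow> ('o, 'a) cat
    \<Rightarrow> ('w, 'v, 'o, 'a) ftr \<Rightarrow> bool" where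
  "exact_completion _ W X \<Gamma> \<longleftrightarrow> weakly_lex W \<and> exact_category X \<and> left_covering W X \<Gamma> \<and>
     (\<forall>E :: ('p, 'b) cat. exact_category E \<longrightarrow>
        is_equivalence
          (functor_cat X E (exact_functor X E))
          (functor_cat W E (left_covering W E))
          (precomp_ftr W \<Gamma> (functor_cat X E (exact_functor X E))))"


section \<open>Path categories\<close>

text \<open>Chosen binary products \<open>X \<times> Y\<close>; meaningful whenever a product exists, as it always does in a
  path category.\<close>

definition chosen_product :: "('o, 'a) cat \<Rightarrow> 'o \<Rightarrow> 'o \<Rightarrow> 'a \<times> 'a" where
  "chosen_product C X Y = (SOME (p, q). is_product C X Y p q)"

definition proj\<^sub>1 :: "('o, 'a) cat \<Rightarrow> 'o \<Rightarrow> 'o \<Rightarrow> 'a" where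
  "proj\<^sub>1 C X Y = fst (chosen_product C X Y)"

definition proj\<^sub>2 :: "('o, 'a) cat \<Rightarrow> 'o \<Rightarrow> 'o \<Rightarrow> 'a" where
  "proj\<^sub>2 C X Y = snd (chosen_product C X Y)"

definition prod_obj :: "('o, 'a) cat \<Rightarrow> 'o \<Rightarrow> 'o \<Rightarrow> 'o" where
  "prod_obj C X Y = Dom C (proj\<^sub>1 C X Y)"

definition pairing :: "('o, 'a) cat \<Rightarrow> 'a \<Rightarrow> 'a \<Rightarrow> 'a" where
  "pairing C f g = (THE h. h \<in> hom C (Dom C f) (prod_obj C (Cod C f) (Cod C g)) \<and>
     proj\<^sub>1 C (Cod C f) (Cod C g) \<cdot>\<^bsub>C\<^esub> h = f \<and> proj\<^sub>2 C (Cod C f) (Cod C g) \<cdot>\<^bsub>C\<^esub> h = g)"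

definition diagonal :: "('o, 'a) cat \<Rightarrow> 'o \<Rightarrow> 'a" where
  "diagonal C X = pairing C (Ide C X) (Ide C X)"

definition prod_map :: "('o, 'a) cat \<Rightarrow> 'a \<Rightarrow> 'a \<Rightarrow> 'a" where
  "prod_map C f g = pairing C
     (f \<cdot>\<^bsub>C\<^esub> proj\<^sub>1 C (Dom C f) (Dom C g)) (g \<cdot>\<^bsub>C\<^esub> proj\<^sub>2 C (Dom C f) (Dom C g))"

text \<open>\<open>e = (s,t) : PB \<rightarrow> B \<times> B\<close> is kept as a single arrow.\<close>

definition is_path_object ::
  "('o, 'a) cat \<Rightarrow> 'a set \<Rightarrow> 'a set \<Rightarrow> 'o \<Rightarrow> 'a \<Rightarrow> 'a \<Rightarrow> bool" where
  "is_path_object C Fib Weq B r e \<longleftrightarrow> r \<in> Weq \<and> e \<in> Fib \<and>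
     r \<in> hom C B (Dom C e) \<and> e \<in> hom C (Dom C e) (prod_obj C B B) \<and>
     e \<cdot>\<^bsub>C\<^esub> r = diagonal C B"

locale path_category = category C
  for C :: "('o, 'a) cat" and Fib :: "'a set" and Weq :: "'a set" +
  assumes Fib_Arr: "Fib \<subseteq> Arr C"
    and Weq_Arr: "Weq \<subseteq> Arr C"
    and Fib_Comp: "\<lbrakk>f \<in> Fib; g \<in> Fib; Dom C g = Cod C f\<rbrakk> \<Longrightarrow> g \<cdot>\<^bsub>C\<^esub> f \<in> Fib"
    and Fib_pullback_exists: "\<lbrakk>f \<in> Fib; g \<in> Arr C; Cod C g = Cod C f\<rbrakk>
      \<Longrightarrow> \<exists>p q. is_pullback C f g p q"
    and Fib_pullback: "\<lbrakk>f \<in> Fib; is_pullback C f g p q\<rbrakk> \<Longrightarrow> q \<in> Fib"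
    and acyclic_pullback: "\<lbrakk>f \<in> Fib \<inter> Weq; is_pullback C f g p q\<rbrakk> \<Longrightarrow> q \<in> Fib \<inter> Weq"
    and two_out_of_six: "\<lbrakk>f \<in> hom C A B; g \<in> hom C B D; h \<in> hom C D E;
        g \<cdot>\<^bsub>C\<^esub> f \<in> Weq; h \<cdot>\<^bsub>C\<^esub> g \<in> Weq\<rbrakk>
      \<Longrightarrow> f \<in> Weq \<and> g \<in> Weq \<and> h \<in> Weq \<and> h \<cdot>\<^bsub>C\<^esub> (g \<cdot>\<^bsub>C\<^esub> f) \<in> Weq"
    and iso_acyclic: "is_iso C f \<Longrightarrow> f \<in> Fib \<inter> Weq"
    and acyclic_section: "f \<in> Fib \<inter> Weq
      \<Longrightarrow> \<exists>s \<in> hom C (Cod C f) (Dom C f). f \<cdot>\<^bsub>C\<^esub> s = Ide C (Cod C f)"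
    and path_object_exists: "B \<in> Obj C \<Longrightarrow> \<exists>r e. is_path_object C Fib Weq B r e"
    and terminal_exists: "\<exists>T. is_terminal C T \<and> (\<forall>f \<in> Arr C. Cod C f = T \<longrightarrow> f \<in> Fib)"

definition homotopic :: "('o, 'a) cat \<Rightarrow> 'a set \<Rightarrow> 'a set \<Rightarrow> 'a \<Rightarrow> 'a \<Rightarrow> bool" where
  "homotopic C Fib Weq f g \<longleftrightarrow> f \<in> Arr C \<and> g \<in> hom C (Dom C f) (Cod C f) \<and>
     (\<exists>r e. is_path_object C Fib Weq (Cod C f) r e \<and>
        (\<exists>h \<in> hom C (Dom C f) (Dom C e).
           (proj\<^sub>1 C (Cod C f) (Cod C f) \<cdot>\<^bsub>C\<^esub> e) \<cdot>\<^bsub>C\<^esub> h = f \<and>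
           (proj\<^sub>2 C (Cod C f) (Cod C f) \<cdot>\<^bsub>C\<^esub> e) \<cdot>\<^bsub>C\<^esub> h = g))"

definition ho_class :: "('o, 'a) cat \<Rightarrow> 'a set \<Rightarrow> 'a set \<Rightarrow> 'a \<Rightarrow> 'a set" where
  "ho_class C Fib Weq f = {g. homotopic C Fib Weq f g}"

text \<open>Arrows of the homotopy category are homotopy classes, tagged with source and target; the
  composite of two classes is the union of the classes of the composites of representatives.\<close>

definition Ho :: "('o, 'a) cat \<Rightarrow> 'a set \<Rightarrow> 'a set \<Rightarrow> ('o, 'o \<times> 'o \<times> 'a set) cat" where
  "Ho C Fib Weq =
     \<lparr>Obj = Obj C,
      Arr = {(Dom C f, Cod C f, ho_class C Fib Weq f) | f. f \<in> Arr C},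
      Dom = (\<lambda>(X, Y, c). X),
      Cod = (\<lambda>(X, Y, c). Y),
      Ide = (\<lambda>X. (X, X, ho_class C Fib Weq (Ide C X))),
      Comp = (\<lambda>(Y', Z, d) (X, Y, c). (X, Z, \<Union>g \<in> d. \<Union>f \<in> c. ho_class C Fib Weq (g \<cdot>\<^bsub>C\<^esub> f)))\<rparr>"

definition ho_quotient ::
  "('o, 'a) cat \<Rightarrow> 'a set \<Rightarrow> 'a set \<Rightarrow> ('o, 'a, 'o, 'o \<times> 'o \<times> 'a set) ftr" where
  "ho_quotient C Fib Weq =
     \<lparr>FO = (\<lambda>X \<in> Obj C. X),
      FA = (\<lambda>f \<in> Arr C. (Dom C f, Cod C f, ho_class C Fib Weq f))\<rparr>"


section \<open>Homotopy equivalence relations and the homotopy exact completion\<close>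

definition homotopy_equivalence_relation ::
  "('o, 'a) cat \<Rightarrow> 'a set \<Rightarrow> 'o \<Rightarrow> 'a \<Rightarrow> bool" where
  "homotopy_equivalence_relation C Fib X p \<longleftrightarrow>
     (let R = Dom C p; p\<^sub>1 = proj\<^sub>1 C X X \<cdot>\<^bsub>C\<^esub> p; p\<^sub>2 = proj\<^sub>2 C X X \<cdot>\<^bsub>C\<^esub> p in
      X \<in> Obj C \<and> p \<in> Fib \<and> p \<in> hom C R (prod_obj C X X) \<and>
      (\<exists>\<rho> \<in> hom C X R. p \<cdot>\<^bsub>C\<^esub> \<rho> = diagonal C X) \<and>
      (\<exists>\<sigma> \<in> hom C R R. p\<^sub>1 \<cdot>\<^bsub>C\<^esub> \<sigma> = p\<^sub>2 \<and> p\<^sub>2 \<cdot>\<^bsub>C\<^esub> \<sigma> = p\<^sub>1) \<and>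
      (\<exists>q\<^sub>1 q\<^sub>2. is_pullback C p\<^sub>2 p\<^sub>1 q\<^sub>1 q\<^sub>2 \<and>
         (\<exists>\<tau> \<in> hom C (Dom C q\<^sub>1) R.
            p\<^sub>1 \<cdot>\<^bsub>C\<^esub> \<tau> = p\<^sub>1 \<cdot>\<^bsub>C\<^esub> q\<^sub>1 \<and> p\<^sub>2 \<cdot>\<^bsub>C\<^esub> \<tau> = p\<^sub>2 \<cdot>\<^bsub>C\<^esub> q\<^sub>2)))"

definition hex_map :: "('o, 'a) cat \<Rightarrow> 'o \<times> 'a \<Rightarrow> 'o \<times> 'a \<Rightarrow> 'a set" where
  "hex_map C = (\<lambda>(X, \<rho>) (Y, \<sigma>). {f \<in> hom C X Y.
     \<exists>\<phi> \<in> hom C (Dom C \<rho>) (Dom C \<sigma>). \<sigma> \<cdot>\<^bsub>C\<^esub> \<phi> = prod_map C f f \<cdot>\<^bsub>C\<^esub> \<rho>})"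

definition hex_class :: "('o, 'a) cat \<Rightarrow> 'o \<times> 'a \<Rightarrow> 'o \<times> 'a \<Rightarrow> 'a \<Rightarrow> 'a set" where
  "hex_class C A B f =
     {g \<in> hex_map C A B. \<exists>H \<in> hom C (fst A) (Dom C (snd B)). snd B \<cdot>\<^bsub>C\<^esub> H = pairing C f g}"

definition Hex :: "('o, 'a) cat \<Rightarrow> 'a set
    \<Rightarrow> ('o \<times> 'a, ('o \<times> 'a) \<times> ('o \<times> 'a) \<times> 'a set) cat" where
  "Hex C Fib =
     (let Ob = {(X, \<rho>). homotopy_equivalence_relation C Fib X \<rho>} in
     \<lparr>Obj = Ob,
      Arr = {(A, B, hex_class C A B f) | A B f. A \<in> Ob \<and> B \<in> Ob \<and> f \<in> hex_map C A B},
      Dom = (\<lambda>(A, B, c). A),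
      Cod = (\<lambda>(A, B, c). B),
      Ide = (\<lambda>A. (A, A, hex_class C A A (Ide C (fst A)))),
      Comp = (\<lambda>(B', D, d) (A, B, c). (A, D, \<Union>g \<in> d. \<Union>f \<in> c. hex_class C A D (g \<cdot>\<^bsub>C\<^esub> f)))\<rparr>)"

text \<open>The functor \<open>i\<close>, for a given choice \<open>P\<close> of path objects \<open>P X = (s,t) : PX \<rightarrow> X \<times> X\<close>.\<close>

definition hex_incl :: "('o, 'a) cat \<Rightarrow> ('o \<Rightarrow> 'a)
    \<Rightarrow> ('o, 'a, 'o \<times> 'a, ('o \<times> 'a) \<times> ('o \<times> 'a) \<times> 'a set) ftr" where
  "hex_incl C P =
     \<lparr>FO = (\<lambda>X \<in> Obj C. (X, P X)),
      FA = (\<lambda>f \<in> Arr C. let A = (Dom C f, P (Dom C f)); B = (Cod C f, P (Cod C f)) in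
              (A, B, hex_class C A B f))\<rparr>"

end

theory Submission imports Defs begin

text \<open>
  The objects \<open>(X, p)\<close> of the homotopy exact completion are setoids in the path category \<open>C\<close>, and the
  proof is that of the classical fact that setoids form an exact completion, with homotopy in the
  place of equality. It has two halves.

  The first half is a criterion (theorem \<open>exact_completion\<close>): an exact category \<open>X\<close> is the exact
  completion of \<open>W\<close> via \<open>\<Gamma>\<close> as soon as \<open>\<Gamma>\<close> is fully faithful, its values are projective, and every
  object of \<open>X\<close> is covered, by a regular epimorphism, by a value of \<open>\<Gamma>\<close>. Weak limits in \<open>W\<close> are then
  the covers of the limits in \<open>X\<close>, so \<open>W\<close> is weakly lex and \<open>\<Gamma>\<close> is left covering. An exact functor
  preserves covers and their kernel pairs, hence natural transformations between exact functors are
  the same as those between their restrictions along \<open>\<Gamma>\<close> (\<open>restriction_faithful\<close>,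
  \<open>restriction_full\<close>). Conversely, a left covering functor \<open>F\<close> is extended by sending an object \<open>A\<close>
  with cover \<open>\<Gamma> V \<rightarrow> A\<close> to the quotient of \<open>F V\<close> by the image of \<open>F R\<close>, where \<open>R\<close> is a weak kernel pair
  of the cover in \<open>W\<close>. To see that the extension is exact, one works with generalized elements,
  and locally, that is, up to restriction along covers. That \<open>F\<close> is left covering says that a
  finite cone of elements over a diagram in the image of \<open>F\<close> comes locally from one element of
  \<open>F V\<close> and a cone in \<open>W\<close> (\<open>local_cone\<close>). It follows that an element of the value at \<open>A\<close> is locally
  represented by an arrow \<open>\<Gamma> V \<rightarrow> A\<close> and an element of \<open>F V\<close>, and that two arrows represent the same
  element iff they become equal on a refinement of this element (\<open>kap_eqD\<close>). The universal property
  of a limit in \<open>X\<close> then carries over to its image in \<open>E\<close>, representative by representative.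

  The second half verifies the criterion for the functor \<open>X \<mapsto> (X, P X)\<close>. A fibration into \<open>X \<times> X\<close> is a
  homotopy equivalence relation iff it induces an equivalence relation on the generalized elements
  of \<open>X\<close> (\<open>herD\<close>, \<open>herI\<close>). Fibrations admit substitution, conjunction and existential quantification,
  which is what the usual constructions of products, equalizers, images and quotients of setoids
  require; so the completion is exact (\<open>exact_Hex\<close>). Homotopy theory enters through one fact: a
  path object on \<open>X\<close> is the least homotopy equivalence relation on \<open>X\<close> (\<open>path_object_rel\<close>), by a
  weak form of lifting of weak equivalences against fibrations. Therefore every map \<open>U \<rightarrow> X\<close> of \<open>C\<close>
  is an arrow \<open>(U, P U) \<rightarrow> (X, p)\<close>. Arrows between objects of the form \<open>(X, P X)\<close> are thus homotopy
  classes of maps; and since the regular epimorphisms are the arrows with a section in \<open>C\<close> up to the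
  relation of the codomain (\<open>Hex_cover_iff\<close>), such objects are projective and the identity of \<open>X\<close> covers
  every \<open>(X, p)\<close> by \<open>(X, P X)\<close>.
\<close>


section \<open>Arrows, composites and pullbacks\<close>

lemma hom_iff: "f \<in> hom C X Y \<longleftrightarrow> f \<in> Arr C \<and> Dom C f = X \<and> Cod C f = Y"
  by (auto simp: hom_def)

definition is_mono :: "('o, 'a) cat \<Rightarrow> 'a \<Rightarrow> bool" where
  "is_mono C m \<longleftrightarrow> m \<in> Arr C \<and>
     (\<forall>U. \<forall>a \<in> hom C U (Dom C m). \<forall>b \<in> hom C U (Dom C m). m \<cdot>\<^bsub>C\<^esub> a = m \<cdot>\<^bsub>C\<^esub> b \<longrightarrow> a = b)"

text \<open>Declaring \<open>C\<close> as a structure lets composition in \<open>C\<close> be written without subscript.\<close>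

locale category_notation = category C for C :: "('o, 'a) cat" (structure)

sublocale category \<subseteq> category_notation C
  by unfold_locales

context category_notation
begin

lemma Comp_closed [simp]:
  assumes "f \<in> Arr C" "g \<in> Arr C" "Dom C g = Cod C f"
  shows "g \<cdot> f \<in> Arr C" "Dom C (g \<cdot> f) = Dom C f" "Cod C (g \<cdot> f) = Cod C g"
  using Comp_in_hom[of f "Dom C f" "Cod C f" g "Cod C g"] assms by (auto simp: hom_iff)

lemma Comp_assoc_Arr [simp]:
  assumes "f \<in> Arr C" "g \<in> Arr C" "h \<in> Arr C" "Dom C g = Cod C f" "Dom C h = Cod C g"
  shows "(h \<cdot> g) \<cdot> f = h \<cdot> (g \<cdot> f)"
  using Comp_assoc[of f "Dom C f" "Cod C f" g "Cod C g" h "Cod C h"] assms by (auto simp: hom_iff)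

lemma Ide_closed [simp]:
  assumes "X \<in> Obj C"
  shows "Ide C X \<in> Arr C" "Dom C (Ide C X) = X" "Cod C (Ide C X) = X"
  using Ide_in_hom[OF assms] by (auto simp: hom_iff)

lemma Comp_Ide [simp]:
  "\<lbrakk>f \<in> Arr C; Cod C f = Y\<rbrakk> \<Longrightarrow> Ide C Y \<cdot> f = f"
  "\<lbrakk>f \<in> Arr C; Dom C f = X\<rbrakk> \<Longrightarrow> f \<cdot> Ide C X = f"
  using Comp_Ide_left[of f "Dom C f" "Cod C f"] Comp_Ide_right[of f "Dom C f" "Cod C f"]
  by (auto simp: hom_iff)

lemmas Dom_Cod_Obj [simp] = Dom_in_Obj Cod_in_Obj

lemma hom_Obj: "f \<in> hom C X Y \<Longrightarrow> X \<in> Obj C" "f \<in> hom C X Y \<Longrightarrow> Y \<in> Obj C"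
  by (auto simp: hom_iff)

text \<open>Composites are normalised to the right, so an equation between two composites applies
  inside a longer one only in the following form.\<close>

lemma Comp_whisker:
  assumes "g \<cdot> f = k" "f \<in> Arr C" "g \<in> Arr C" "Dom C g = Cod C f" "h \<in> Arr C" "Cod C h = Dom C f"
  shows "g \<cdot> (f \<cdot> h) = k \<cdot> h"
  using assms by (metis Comp_assoc_Arr)

lemma is_isoE:
  assumes "is_iso C f" "f \<in> hom C X Y"
  obtains g where "g \<in> hom C Y X" "g \<cdot> f = Ide C X" "f \<cdot> g = Ide C Y"
  using assms by (auto simp: is_iso_def hom_iff)

lemma is_isoI:
  assumes "f \<in> hom C X Y" "g \<in> hom C Y X" "g \<cdot> f = Ide C X" "f \<cdot> g = Ide C Y"
  shows "is_iso C f"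
  using assms by (auto simp: is_iso_def hom_iff)

lemma is_pullbackD:
  assumes "is_pullback C f g p q"
  shows "f \<in> Arr C" "g \<in> Arr C" "Cod C f = Cod C g" "p \<in> Arr C" "q \<in> Arr C"
    "Cod C p = Dom C f" "Cod C q = Dom C g" "Dom C q = Dom C p" "f \<cdot> p = g \<cdot> q"
  using assms by (auto simp: is_pullback_def hom_iff)

lemma pullback_lift:
  assumes "is_pullback C f g p q" "a \<in> hom C U (Dom C f)" "b \<in> hom C U (Dom C g)"
    "f \<cdot> a = g \<cdot> b"
  obtains h where "h \<in> hom C U (Dom C p)" "p \<cdot> h = a" "q \<cdot> h = b"
  using assms unfolding is_pullback_def by blast

lemma pullback_unique:
  assumes pb: "is_pullback C f g p q" and h: "h \<in> hom C U (Dom C p)" "h' \<in> hom C U (Dom C p)"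
    and eq: "p \<cdot> h = p \<cdot> h'" "q \<cdot> h = q \<cdot> h'"
  shows "h = h'"
proof -
  note D = is_pullbackD[OF pb]
  have "f \<cdot> (p \<cdot> h) = g \<cdot> (q \<cdot> h)"
    using D h by (simp add: hom_iff Comp_whisker[OF D(9)])
  moreover have "p \<cdot> h \<in> hom C U (Dom C f)" "q \<cdot> h \<in> hom C U (Dom C g)"
    using D h by (auto simp: hom_iff)
  ultimately have "\<exists>!k. k \<in> hom C U (Dom C p) \<and> p \<cdot> k = p \<cdot> h \<and> q \<cdot> k = q \<cdot> h"
    using pb unfolding is_pullback_def by blast
  then show ?thesis using h eq by metis
qed

lemma is_pullbackI:
  assumes "f \<in> hom C X Z" "g \<in> hom C Y Z" "p \<in> hom C P X" "q \<in> hom C P Y" "f \<cdot> p = g \<cdot> q"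
    and "\<And>U a b. \<lbrakk>a \<in> hom C U X; b \<in> hom C U Y; f \<cdot> a = g \<cdot> b\<rbrakk>
       \<Longrightarrow> \<exists>h \<in> hom C U P. p \<cdot> h = a \<and> q \<cdot> h = b"
    and "\<And>U h h'. \<lbrakk>h \<in> hom C U P; h' \<in> hom C U P; p \<cdot> h = p \<cdot> h'; q \<cdot> h = q \<cdot> h'\<rbrakk> \<Longrightarrow> h = h'"
  shows "is_pullback C f g p q"
  unfolding is_pullback_def
proof (intro conjI allI ballI impI)
  fix U a b assume ab: "a \<in> hom C U (Dom C f)" "b \<in> hom C U (Dom C g)" "f \<cdot> a = g \<cdot> b"
  moreover have "Dom C f = X" "Dom C g = Y" using assms(1,2) by (simp_all add: hom_iff)
  ultimately obtain h where "h \<in> hom C U P" "p \<cdot> h = a" "q \<cdot> h = b"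
    using assms(6)[of a U b] by auto
  moreover have "Dom C p = P" using assms(3) by (simp add: hom_iff)
  ultimately show "\<exists>!h. h \<in> hom C U (Dom C p) \<and> p \<cdot> h = a \<and> q \<cdot> h = b"
    using assms(7)[of _ U] by auto
qed (use assms in \<open>auto simp: hom_iff\<close>)

lemma is_mono_cancel:
  assumes "is_mono C m" "m \<cdot> a = m \<cdot> b" "a \<in> hom C U (Dom C m)" "b \<in> hom C U (Dom C m)"
  shows "a = b"
  using assms unfolding is_mono_def by blast

end

lemma is_functorD:
  assumes "is_functor A B F"
  shows "category A" "category B" "X \<in> Obj A \<Longrightarrow> FO F X \<in> Obj B"
    "f \<in> Arr A \<Longrightarrow> FA F f \<in> Arr B"
    "f \<in> Arr A \<Longrightarrow> Dom B (FA F f) = FO F (Dom A f)"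
    "f \<in> Arr A \<Longrightarrow> Cod B (FA F f) = FO F (Cod A f)"
    "X \<in> Obj A \<Longrightarrow> FA F (Ide A X) = Ide B (FO F X)"
    "f \<in> Arr A \<Longrightarrow> g \<in> Arr A \<Longrightarrow> Dom A g = Cod A f \<Longrightarrow> FA F (g \<cdot>\<^bsub>A\<^esub> f) = FA F g \<cdot>\<^bsub>B\<^esub> FA F f"
  using assms by (auto simp: is_functor_def hom_iff)

lemma is_functor_hom: "is_functor A B F \<Longrightarrow> f \<in> hom A X Y \<Longrightarrow> FA F f \<in> hom B (FO F X) (FO F Y)"
  by (auto simp: is_functor_def hom_iff)

lemma is_functor_comp:
  assumes F: "is_functor A B F" and G: "is_functor B C G"
  shows "is_functor A C (comp_ftr A G F)"
proof -
  interpret A: category A using F by (rule is_functorD)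
  show ?thesis
    using is_functorD[OF F] is_functorD[OF G]
    by (auto simp: is_functor_def comp_ftr_def hom_iff)
qed


section \<open>Finite diagrams made of two levels of objects\<close>

text \<open>Terminal objects, products, equalizers and pullbacks are all limits of diagrams with a set
  \<open>A\<close> of upper objects, a set \<open>B\<close> of lower objects, and two arrows out of each upper object \<open>n\<close>,
  into the lower objects \<open>s n\<close> and \<open>t n\<close>: only the upper objects have outgoing arrows, so nothing
  but identities can be composed. The arrows \<open>3 n\<close>, \<open>3 n + 1\<close>, \<open>3 n + 2\<close> are the identity of \<open>n\<close> and
  the arrows to \<open>s n\<close> and to \<open>t n\<close>.\<close>

definition two_level :: "nat set \<Rightarrow> nat set \<Rightarrow> (nat \<Rightarrow> nat) \<Rightarrow> (nat \<Rightarrow> nat) \<Rightarrow> (nat, nat) cat" where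
  "two_level A B s t =
     \<lparr>Obj = A \<union> B,
      Arr = {a. a div 3 \<in> A \<union> B \<and> (a mod 3 = 0 \<or> a div 3 \<in> A)},
      Dom = (\<lambda>a. a div 3),
      Cod = (\<lambda>a. if a mod 3 = 0 then a div 3 else if a mod 3 = 1 then s (a div 3) else t (a div 3)),
      Ide = (\<lambda>n. 3 * n),
      Comp = (\<lambda>b a. if a mod 3 = 0 then b else a)\<rparr>"

definition two_level_diagram :: "('o, 'a) cat \<Rightarrow> nat set \<Rightarrow> nat set \<Rightarrow> (nat \<Rightarrow> 'o) \<Rightarrow> (nat \<Rightarrow> 'a)
    \<Rightarrow> (nat \<Rightarrow> 'a) \<Rightarrow> (nat, nat, 'o, 'a) ftr" where
  "two_level_diagram C A B D f g =
     \<lparr>FO = restrict D (A \<union> B),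
      FA = restrict (\<lambda>a. if a mod 3 = 0 then Ide C (D (a div 3))
                         else if a mod 3 = 1 then f (a div 3) else g (a div 3))
             {a. a div 3 \<in> A \<union> B \<and> (a mod 3 = 0 \<or> a div 3 \<in> A)}\<rparr>"

locale two_level_shape =
  fixes A B :: "nat set" and s t :: "nat \<Rightarrow> nat"
  assumes finite_levels: "finite A" "finite B" and disjoint_levels: "A \<inter> B = {}"
    and lower: "n \<in> A \<Longrightarrow> s n \<in> B" "n \<in> A \<Longrightarrow> t n \<in> B"
begin

abbreviation "J \<equiv> two_level A B s t"

lemma category_J: "category J"
proof
  show "(h \<cdot>\<^bsub>J\<^esub> g) \<cdot>\<^bsub>J\<^esub> f = h \<cdot>\<^bsub>J\<^esub> (g \<cdot>\<^bsub>J\<^esub> f)" for f g h X Y Z V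
    by (simp add: two_level_def)
  show "g \<cdot>\<^bsub>J\<^esub> f \<in> hom J X Z" if "f \<in> hom J X Y" "g \<in> hom J Y Z" for f g X Y Z
  proof (cases "f mod 3 = 0")
    case False
    then have "Y \<in> B" using that(1) lower by (auto simp: two_level_def hom_iff split: if_splits)
    then have "Y \<notin> A" using disjoint_levels by auto
    then show ?thesis using that False by (auto simp: two_level_def hom_iff)
  qed (use that in \<open>auto simp: two_level_def hom_iff\<close>)
qed (use lower in \<open>auto simp: two_level_def hom_iff\<close>)

lemma finite_J: "finite (Obj J)" "finite (Arr J)"
proof -
  have "Arr J \<subseteq> {.. 3 * Max (insert 0 (A \<union> B)) + 2}"
  proof
    fix a assume "a \<in> Arr J"
    then have "a div 3 \<le> Max (insert 0 (A \<union> B))"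
      using finite_levels by (intro Max_ge) (auto simp: two_level_def)
    then show "a \<in> {.. 3 * Max (insert 0 (A \<union> B)) + 2}" by simp
  qed
  then show "finite (Arr J)" by (rule finite_subset) simp
  show "finite (Obj J)" using finite_levels by (simp add: two_level_def)
qed

lemma finite_diagram_J:
  assumes "category C" and D: "\<And>n. n \<in> A \<union> B \<Longrightarrow> D n \<in> Obj C"
    and fg: "\<And>n. n \<in> A \<Longrightarrow> f n \<in> hom C (D n) (D (s n))" "\<And>n. n \<in> A \<Longrightarrow> g n \<in> hom C (D n) (D (t n))"
  shows "finite_diagram J C (two_level_diagram C A B D f g)"
proof -
  interpret category C by fact
  let ?F = "two_level_diagram C A B D f g"
  have FA: "FA ?F a = (if a mod 3 = 0 then Ide C (D (a div 3))
      else if a mod 3 = 1 then f (a div 3) else g (a div 3))" if "a \<in> Arr J" for a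
    using that by (simp add: two_level_def two_level_diagram_def)
  have FO: "FO ?F n = D n" if "n \<in> A \<union> B" for n
    using that by (simp add: two_level_diagram_def)
  have hom: "FA ?F a \<in> hom C (FO ?F (Dom J a)) (FO ?F (Cod J a))" if a: "a \<in> Arr J" for a
  proof -
    have a': "a div 3 \<in> A \<union> B" "a mod 3 = 0 \<or> a div 3 \<in> A"
      using a by (simp_all add: two_level_def)
    show ?thesis
    proof (cases "a mod 3 = 0")
      case True
      then show ?thesis unfolding FA[OF a] using FO[OF a'(1)] D[OF a'(1)]
        by (simp add: two_level_def hom_iff)
    next
      case False
      then have "a div 3 \<in> A" using a' by simp
      then show ?thesis unfolding FA[OF a] using False fg[of "a div 3"] FO[of "a div 3"]
        FO[of "s (a div 3)"] FO[of "t (a div 3)"] lower[of "a div 3"]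
        by (simp add: two_level_def)
    qed
  qed
  have comp: "FA ?F (b \<cdot>\<^bsub>J\<^esub> a) = FA ?F b \<cdot>\<^bsub>C\<^esub> FA ?F a"
    if ab: "a \<in> Arr J" "b \<in> Arr J" "Dom J b = Cod J a" for a b
  proof (cases "a mod 3 = 0")
    case True
    then show ?thesis using hom[OF ab(2)] ab FO[of "b div 3"]
      by (simp add: FA[OF ab(1)]) (simp add: two_level_def hom_iff)
  next
    case False
    then have "b div 3 \<in> B" using ab lower by (auto simp: two_level_def)
    then have "b mod 3 = 0" using ab disjoint_levels by (auto simp: two_level_def)
    then show ?thesis using hom[OF ab(1)] ab False FO[of "b div 3"] \<open>b div 3 \<in> B\<close>
      by (simp add: FA[OF ab(2)]) (simp add: two_level_def hom_iff)
  qed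
  have "is_functor J C ?F"
    unfolding is_functor_def
    using category_J \<open>category C\<close> hom comp D FO
    by (auto simp: FA) (auto simp: two_level_diagram_def two_level_def)
  then show ?thesis using finite_J by (simp add: finite_diagram_def)
qed

lemma two_level_cone:
  assumes "category C" and D: "\<And>n. n \<in> A \<union> B \<Longrightarrow> D n \<in> Obj C"
  shows "is_cone J C (two_level_diagram C A B D f g) V c \<longleftrightarrow> V \<in> Obj C \<and>
    (\<forall>n \<in> A \<union> B. c n \<in> hom C V (D n)) \<and> (\<forall>n \<in> A. f n \<cdot>\<^bsub>C\<^esub> c n = c (s n) \<and> g n \<cdot>\<^bsub>C\<^esub> c n = c (t n))"
    (is "?cone \<longleftrightarrow> ?R")
proof -
  interpret category C by fact
  let ?F = "two_level_diagram C A B D f g"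
  have FO: "FO ?F n = D n" if "n \<in> A \<union> B" for n
    using that by (simp add: two_level_diagram_def)
  show ?thesis
  proof
    assume c: ?cone
    have "f n \<cdot>\<^bsub>C\<^esub> c n = c (s n) \<and> g n \<cdot>\<^bsub>C\<^esub> c n = c (t n)" if "n \<in> A" for n
    proof -
      have [simp]: "Suc (3 * n) div 3 = n" "Suc (3 * n) mod 3 = 1"
        "Suc (Suc (3 * n)) div 3 = n" "Suc (Suc (3 * n)) mod 3 = 2" by presburger+
      have "3 * n + 1 \<in> Arr J" "3 * n + 2 \<in> Arr J" using that by (auto simp: two_level_def)
      moreover have "\<forall>u \<in> Arr J. FA ?F u \<cdot>\<^bsub>C\<^esub> c (Dom J u) = c (Cod J u)"
        using c by (simp add: is_cone_def)
      moreover have "Dom J (3 * n + 1) = n" "Cod J (3 * n + 1) = s n"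
        "Dom J (3 * n + 2) = n" "Cod J (3 * n + 2) = t n" by (simp_all add: two_level_def)
      ultimately have "FA ?F (3 * n + 1) \<cdot>\<^bsub>C\<^esub> c n = c (s n)" "FA ?F (3 * n + 2) \<cdot>\<^bsub>C\<^esub> c n = c (t n)"
        by metis+
      then show ?thesis using that by (simp add: two_level_diagram_def)
    qed
    then show ?R using c FO by (auto simp: is_cone_def two_level_def)
  next
    assume R: ?R
    have "FA ?F u \<cdot>\<^bsub>C\<^esub> c (Dom J u) = c (Cod J u)" if "u \<in> Arr J" for u
      using that R by (auto simp: two_level_def two_level_diagram_def hom_iff)
    then show ?cone using R FO by (auto simp: is_cone_def two_level_def)
  qed
qed

lemma comp_two_level_diagram:
  assumes F: "is_functor C E F" and D: "\<And>n. n \<in> A \<union> B \<Longrightarrow> D n \<in> Obj C"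
  shows "comp_ftr J F (two_level_diagram C A B D f g)
    = two_level_diagram E A B (\<lambda>n. FO F (D n)) (\<lambda>n. FA F (f n)) (\<lambda>n. FA F (g n))"
  using D is_functorD(7)[OF F]
  by (auto simp: comp_ftr_def two_level_diagram_def two_level_def fun_eq_iff)

end

locale finite_limits = category_notation C for C :: "('o, 'a) cat" (structure) +
  assumes finitely_complete: "finitely_complete C"
begin

lemma limit_ex: "finite_diagram J C D \<Longrightarrow> \<exists>V c. is_limit J C D V c"
  using finitely_complete unfolding finitely_complete_def by blast

lemma product_ex:
  assumes "X \<in> Obj C" "Y \<in> Obj C"
  obtains p q where "is_product C X Y p q"
proof -
  interpret S: two_level_shape "{}" "{0, 1}" id id by unfold_locales auto
  let ?D = "\<lambda>n. if n = (0::nat) then X else Y"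
  have D: "?D n \<in> Obj C" for n using assms by simp
  have "finite_diagram S.J C (two_level_diagram C {} {0, 1} ?D undefined undefined)"
    using S.finite_diagram_J[OF category_axioms, of ?D] D by auto
  then obtain V c where "is_limit S.J C (two_level_diagram C {} {0, 1} ?D undefined undefined) V c"
    using limit_ex by blast
  then have V: "V \<in> Obj C" "c 0 \<in> hom C V X" "c 1 \<in> hom C V Y"
    and univ: "\<And>U b. U \<in> Obj C \<Longrightarrow> b 0 \<in> hom C U X \<Longrightarrow> b 1 \<in> hom C U Y \<Longrightarrow>
      \<exists>!h. h \<in> hom C U V \<and> (\<forall>j \<in> {0, 1::nat}. c j \<cdot> h = b j)"
    unfolding is_limit_def using S.two_level_cone[OF category_axioms, of ?D] D
    by (auto simp: two_level_def)
  have "is_product C X Y (c 0) (c 1)"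
    unfolding is_product_def
  proof (intro conjI allI ballI)
    fix U f g assume "f \<in> hom C U X" "g \<in> hom C U Y"
    then have "\<exists>!h. h \<in> hom C U V \<and> (\<forall>j \<in> {0, 1::nat}. c j \<cdot> h = (if j = 0 then f else g))"
      by (intro univ) (auto simp: hom_iff)
    then show "\<exists>!h. h \<in> hom C U (Dom C (c 0)) \<and> c 0 \<cdot> h = f \<and> c 1 \<cdot> h = g"
      using V by (auto simp: hom_iff)
  qed (use V in \<open>auto simp: hom_iff\<close>)
  then show thesis by (rule that)
qed

end

text \<open>A pullback is a limit over upper objects \<open>0\<close> and \<open>1\<close>, whose two arrows into the lower object
  \<open>2\<close> coincide.\<close>

definition cospan :: "(nat, nat) cat" where
  "cospan = two_level {0, 1} {2} (\<lambda>_. 2) (\<lambda>_. 2)"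

definition cospan_diagram :: "('o, 'a) cat \<Rightarrow> 'a \<Rightarrow> 'a \<Rightarrow> (nat, nat, 'o, 'a) ftr" where
  "cospan_diagram C f g = two_level_diagram C {0, 1} {2}
     (\<lambda>n. if n = 0 then Dom C f else if n = 1 then Dom C g else Cod C f)
     (\<lambda>n. if n = 0 then f else g) (\<lambda>n. if n = 0 then f else g)"

definition cospan_cone :: "('o, 'a) cat \<Rightarrow> 'a \<Rightarrow> 'a \<Rightarrow> 'a \<Rightarrow> nat \<Rightarrow> 'a" where
  "cospan_cone C f p q n = (if n = 0 then p else if n = 1 then q else f \<cdot>\<^bsub>C\<^esub> p)"

lemma cospan_shape: "two_level_shape {0, 1} {2} (\<lambda>_. 2) (\<lambda>_. 2)"
  by unfold_locales auto

context category_notation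
begin

lemma finite_cospan_diagram:
  assumes "f \<in> Arr C" "g \<in> Arr C" "Cod C f = Cod C g"
  shows "finite_diagram cospan C (cospan_diagram C f g)"
  unfolding cospan_def cospan_diagram_def
  using assms by (intro two_level_shape.finite_diagram_J cospan_shape category_axioms)
    (auto simp: hom_iff)

lemma cospan_is_cone:
  assumes "f \<in> Arr C" "g \<in> Arr C" "Cod C f = Cod C g"
  shows "is_cone cospan C (cospan_diagram C f g) V c \<longleftrightarrow>
    c 0 \<in> hom C V (Dom C f) \<and> c 1 \<in> hom C V (Dom C g) \<and> f \<cdot> c 0 = c 2 \<and> g \<cdot> c 1 = c 2"
proof -
  have "f \<cdot> c 0 \<in> hom C V (Cod C f)" if "c 0 \<in> hom C V (Dom C f)"
    using that assms by (simp add: hom_iff)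
  moreover have "V \<in> Obj C" if "c 0 \<in> hom C V (Dom C f)"
    using that by (rule hom_Obj)
  ultimately show ?thesis
    unfolding cospan_def cospan_diagram_def using assms
    by (subst two_level_shape.two_level_cone[OF cospan_shape category_axioms]) auto
qed

lemma limit_is_pullback:
  assumes fg: "f \<in> Arr C" "g \<in> Arr C" "Cod C f = Cod C g"
    and lim: "is_limit cospan C (cospan_diagram C f g) V c"
  shows "is_pullback C f g (c 0) (c 1)"
proof (rule is_pullbackI)
  have c: "c 0 \<in> hom C V (Dom C f)" "c 1 \<in> hom C V (Dom C g)" "f \<cdot> c 0 = c 2" "g \<cdot> c 1 = c 2"
    using lim cospan_is_cone[OF fg] by (auto simp: is_limit_def)
  then show "c 0 \<in> hom C V (Dom C f)" "c 1 \<in> hom C V (Dom C g)" "f \<cdot> c 0 = g \<cdot> c 1" by auto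
  show "f \<in> hom C (Dom C f) (Cod C f)" "g \<in> hom C (Dom C g) (Cod C f)"
    using fg by (auto simp: hom_iff)
  have ob: "Obj cospan = {0, 1, 2}" by (auto simp: cospan_def two_level_def)
  have univ: "\<exists>!h. h \<in> hom C U V \<and> c 0 \<cdot> h = a \<and> c 1 \<cdot> h = b"
    if "a \<in> hom C U (Dom C f)" "b \<in> hom C U (Dom C g)" "f \<cdot> a = g \<cdot> b" for U a b
  proof -
    have "is_cone cospan C (cospan_diagram C f g) U (cospan_cone C f a b)"
      using that cospan_is_cone[OF fg] by (auto simp: cospan_cone_def)
    then have "\<exists>!h. h \<in> hom C U V \<and> (\<forall>j \<in> {0, 1, 2}. c j \<cdot> h = cospan_cone C f a b j)"
      using lim unfolding is_limit_def ob by blast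
    moreover have "(\<forall>j \<in> {0, 1, 2}. c j \<cdot> h = cospan_cone C f a b j) \<longleftrightarrow> c 0 \<cdot> h = a \<and> c 1 \<cdot> h = b"
      if "h \<in> hom C U V" for h
    proof -
      have "c 2 \<cdot> h = f \<cdot> (c 0 \<cdot> h)"
        using that c(1,2) fg by (simp add: hom_iff Comp_whisker[OF c(3)])
      then show ?thesis by (simp add: cospan_cone_def) metis
    qed
    ultimately show ?thesis by (metis (no_types, lifting))
  qed
  show "\<exists>h \<in> hom C U V. c 0 \<cdot> h = a \<and> c 1 \<cdot> h = b"
    if "a \<in> hom C U (Dom C f)" "b \<in> hom C U (Dom C g)" "f \<cdot> a = g \<cdot> b" for U a b
    using univ[OF that] by blast
  show "h = h'" if h: "h \<in> hom C U V" "h' \<in> hom C U V" "c 0 \<cdot> h = c 0 \<cdot> h'" "c 1 \<cdot> h = c 1 \<cdot> h'"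
    for U h h'
  proof -
    have "f \<cdot> (c 0 \<cdot> h) = c 2 \<cdot> h" "g \<cdot> (c 1 \<cdot> h) = c 2 \<cdot> h"
      by (rule Comp_whisker; use c h fg in \<open>simp add: hom_iff\<close>)+
    then have "f \<cdot> (c 0 \<cdot> h) = g \<cdot> (c 1 \<cdot> h)" by simp
    then show ?thesis using univ[of "c 0 \<cdot> h" U "c 1 \<cdot> h"] h c fg by (auto simp: hom_iff)
  qed
qed

lemma pullback_is_limit:
  assumes pb: "is_pullback C f g p q"
  shows "is_limit cospan C (cospan_diagram C f g) (Dom C p) (cospan_cone C f p q)"
proof -
  note D = is_pullbackD[OF pb]
  have ob: "Obj cospan = {0, 1, 2}" by (auto simp: cospan_def two_level_def)
  have "\<exists>!h. h \<in> hom C U (Dom C p) \<and> (\<forall>j \<in> {0, 1, 2}. cospan_cone C f p q j \<cdot> h = b j)"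
    if b: "is_cone cospan C (cospan_diagram C f g) U b" for U b
  proof -
    have b': "b 0 \<in> hom C U (Dom C f)" "b 1 \<in> hom C U (Dom C g)" "f \<cdot> b 0 = b 2" "g \<cdot> b 1 = b 2"
      using b cospan_is_cone[OF D(1-3)] by auto
    then have "\<exists>!h. h \<in> hom C U (Dom C p) \<and> p \<cdot> h = b 0 \<and> q \<cdot> h = b 1"
      using pb unfolding is_pullback_def by simp
    moreover have "(\<forall>j \<in> {0, 1, 2}. cospan_cone C f p q j \<cdot> h = b j) \<longleftrightarrow> p \<cdot> h = b 0 \<and> q \<cdot> h = b 1"
      if "h \<in> hom C U (Dom C p)" for h
    proof -
      have "(f \<cdot> p) \<cdot> h = f \<cdot> (p \<cdot> h)" using that D(1-8) by (simp add: hom_iff)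
      then show ?thesis using b'(3) by (auto simp: cospan_cone_def)
    qed
    ultimately show ?thesis by (metis (no_types, lifting))
  qed
  moreover have "is_cone cospan C (cospan_diagram C f g) (Dom C p) (cospan_cone C f p q)"
    using D cospan_is_cone[OF D(1-3)] by (auto simp: cospan_cone_def hom_iff)
  ultimately show ?thesis unfolding is_limit_def ob by blast
qed

end

context finite_limits
begin

lemma pullback_ex:
  assumes "f \<in> Arr C" "g \<in> Arr C" "Cod C f = Cod C g"
  obtains p q where "is_pullback C f g p q"
  using limit_ex[OF finite_cospan_diagram[OF assms]] limit_is_pullback[OF assms] by blast

end

lemma limit_preserving_pullback:
  assumes F: "is_functor C E F"
    and lim: "\<And>J D V c. finite_diagram J C D \<Longrightarrow> is_limit J C D V c \<Longrightarrow>
        is_limit J E (comp_ftr J F D) (FO F V) (\<lambda>j. FA F (c j))"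
    and pb: "is_pullback C f g p q"
  shows "is_pullback E (FA F f) (FA F g) (FA F p) (FA F q)"
proof -
  interpret C: category C using F by (rule is_functorD)
  interpret E: category E using F by (rule is_functorD)
  note D = C.is_pullbackD[OF pb] and F' = is_functorD[OF F]
  have "comp_ftr cospan F (cospan_diagram C f g) = cospan_diagram E (FA F f) (FA F g)"
    unfolding cospan_def cospan_diagram_def
    by (subst two_level_shape.comp_two_level_diagram[OF cospan_shape F])
      (use D F' in \<open>auto simp: two_level_diagram_def fun_eq_iff\<close>)
  then have "is_limit cospan E (cospan_diagram E (FA F f) (FA F g)) (FO F (Dom C p))
      (\<lambda>j. FA F (cospan_cone C f p q j))"
    using lim[OF C.finite_cospan_diagram[OF D(1-3)] C.pullback_is_limit[OF pb]] by simp
  then have "is_pullback E (FA F f) (FA F g) (FA F (cospan_cone C f p q 0))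
      (FA F (cospan_cone C f p q 1))"
    using D F' by (intro E.limit_is_pullback) auto
  then show ?thesis by (simp add: cospan_cone_def)
qed

text \<open>A limit of a finite diagram can be cut out of the product of its objects by one equation for
  each arrow.\<close>

lemma (in category_notation) finitely_completeI:
  assumes terminal: "\<exists>T. is_terminal C T"
    and product: "\<And>X Y. X \<in> Obj C \<Longrightarrow> Y \<in> Obj C \<Longrightarrow> \<exists>p q. is_product C X Y p q"
    and equalizer: "\<And>X Y f g. f \<in> hom C X Y \<Longrightarrow> g \<in> hom C X Y \<Longrightarrow>
      \<exists>E. \<exists>m \<in> hom C E X. f \<cdot> m = g \<cdot> m \<and>
        (\<forall>U. \<forall>a \<in> hom C U X. f \<cdot> a = g \<cdot> a \<longrightarrow> (\<exists>!h. h \<in> hom C U E \<and> m \<cdot> h = a))"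
  shows "finitely_complete C"
proof -
  have "\<exists>V c. is_limit J C D V c" if D: "finite_diagram J C D" for J D
  proof -
    have F: "is_functor J C D" and fin: "finite (Obj J)" "finite (Arr J)"
      using D by (auto simp: finite_diagram_def)
    interpret J: category J using F by (rule is_functorD)
    note F' = is_functorD(3-6)[OF F]
    \<comment> \<open>cones over the objects in \<open>S\<close> alone, compatible with the arrows in \<open>T\<close> alone\<close>
    define cone where "cone S T V c \<longleftrightarrow> V \<in> Obj C \<and> (\<forall>j \<in> S. c j \<in> hom C V (FO D j)) \<and>
      (\<forall>u \<in> T. FA D u \<cdot> c (Dom J u) = c (Cod J u))" for S T V c
    define lim where "lim S T V c \<longleftrightarrow> cone S T V c \<and>
      (\<forall>U b. cone S T U b \<longrightarrow> (\<exists>!h. h \<in> hom C U V \<and> (\<forall>j \<in> S. c j \<cdot> h = b j)))" for S T V c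
    have objects: "\<exists>V c. lim S {} V c" if "S \<subseteq> Obj J" for S
      using finite_subset[OF that fin(1)] that
    proof (induction S)
      case empty
      obtain T where "is_terminal C T" using terminal by blast
      then have "lim {} {} T undefined"
        by (auto simp: lim_def cone_def is_terminal_def)
      then show ?case by blast
    next
      case (insert j S)
      then obtain V c where V: "lim S {} V c" by auto
      obtain p q where pq: "is_product C V (FO D j) p q"
        using product[of V "FO D j"] V insert.prems F' by (auto simp: lim_def cone_def)
      define c' where "c' k = (if k = j then q else c k \<cdot> p)" for k
      have p: "p \<in> hom C (Dom C p) V" "q \<in> hom C (Dom C p) (FO D j)"
        using pq by (auto simp: is_product_def)
      have c: "c k \<in> hom C V (FO D k)" if "k \<in> S" for k
        using V that by (auto simp: lim_def cone_def)
      have "\<exists>!h. h \<in> hom C U (Dom C p) \<and> (\<forall>k \<in> insert j S. c' k \<cdot> h = b k)"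
        if b: "cone (insert j S) {} U b" for U b
      proof -
        have b': "cone S {} U b" "b j \<in> hom C U (FO D j)" using b by (auto simp: cone_def)
        then have ex1: "\<exists>!h. h \<in> hom C U V \<and> (\<forall>k \<in> S. c k \<cdot> h = b k)"
          using V by (auto simp: lim_def)
        then obtain h where h: "h \<in> hom C U V" "\<forall>k \<in> S. c k \<cdot> h = b k" by blast
        then have ex2: "\<exists>!h'. h' \<in> hom C U (Dom C p) \<and> p \<cdot> h' = h \<and> q \<cdot> h' = b j"
          using pq b' by (simp add: is_product_def)
        then obtain k where k: "k \<in> hom C U (Dom C p)" "p \<cdot> k = h" "q \<cdot> k = b j" by blast
        show ?thesis
        proof (rule ex1I[of _ k])
          show "k \<in> hom C U (Dom C p) \<and> (\<forall>i \<in> insert j S. c' i \<cdot> k = b i)"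
            using k h insert.hyps p c by (auto simp: c'_def hom_iff)
        next
          fix k' assume k': "k' \<in> hom C U (Dom C p) \<and> (\<forall>i \<in> insert j S. c' i \<cdot> k' = b i)"
          have "c i \<cdot> (p \<cdot> k') = b i" if "i \<in> S" for i
          proof -
            have "c' i \<cdot> k' = b i" using k' that by blast
            moreover have "c' i = c i \<cdot> p" using that insert.hyps by (auto simp: c'_def)
            moreover have "(c i \<cdot> p) \<cdot> k' = c i \<cdot> (p \<cdot> k')"
              using k'[THEN conjunct1] p c[OF that] by (simp add: hom_iff)
            ultimately show ?thesis by simp
          qed
          moreover have "p \<cdot> k' \<in> hom C U V" using k'[THEN conjunct1] p by (simp add: hom_iff)
          ultimately have "p \<cdot> k' = h" using ex1 h by blast
          moreover have "q \<cdot> k' = b j" using k' by (simp add: c'_def)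
          ultimately show "k' = k" using ex2 k k' by blast
        qed
      qed
      moreover have "cone (insert j S) {} (Dom C p) c'"
        using p c by (auto simp: cone_def c'_def hom_iff)
      ultimately have "lim (insert j S) {} (Dom C p) c'" by (simp add: lim_def)
      then show ?case by blast
    qed
    have arrows: "\<exists>V c. lim (Obj J) T V c" if "T \<subseteq> Arr J" for T
      using finite_subset[OF that fin(2)] that
    proof (induction T)
      case empty
      show ?case by (rule objects) simp
    next
      case (insert u T)
      then obtain V c where V: "lim (Obj J) T V c" by auto
      have c: "c k \<in> hom C V (FO D k)" if "k \<in> Obj J" for k
        using V that by (auto simp: lim_def cone_def)
      have cT: "FA D v \<cdot> c (Dom J v) = c (Cod J v)" if "v \<in> T" for v
        using V that by (auto simp: lim_def cone_def)
      have u: "u \<in> Arr J" using insert.prems by auto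
      have homs: "FA D u \<cdot> c (Dom J u) \<in> hom C V (FO D (Cod J u))"
        "c (Cod J u) \<in> hom C V (FO D (Cod J u))"
        using u c[of "Dom J u"] c[of "Cod J u"] F' by (auto simp: hom_iff)
      obtain E m where m: "m \<in> hom C E V"
        "(FA D u \<cdot> c (Dom J u)) \<cdot> m = c (Cod J u) \<cdot> m"
        and univ: "\<And>U a. a \<in> hom C U V \<Longrightarrow> (FA D u \<cdot> c (Dom J u)) \<cdot> a = c (Cod J u) \<cdot> a \<Longrightarrow>
          \<exists>!h. h \<in> hom C U E \<and> m \<cdot> h = a"
        using equalizer[OF homs] by blast
      have assoc: "FA D v \<cdot> (c (Dom J v) \<cdot> a) = (FA D v \<cdot> c (Dom J v)) \<cdot> a"
        if "a \<in> hom C U V" "v \<in> Arr J" for a U v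
        using that c[of "Dom J v"] F' by (auto simp: hom_iff)
      have "\<exists>!h. h \<in> hom C U E \<and> (\<forall>k \<in> Obj J. (c k \<cdot> m) \<cdot> h = b k)"
        if b: "cone (Obj J) (insert u T) U b" for U b
      proof -
        have b': "cone (Obj J) T U b" "FA D u \<cdot> b (Dom J u) = b (Cod J u)"
          using b by (auto simp: cone_def)
        then have ex1: "\<exists>!h. h \<in> hom C U V \<and> (\<forall>k \<in> Obj J. c k \<cdot> h = b k)"
          using V by (auto simp: lim_def)
        then obtain h where h: "h \<in> hom C U V" "\<forall>k \<in> Obj J. c k \<cdot> h = b k" by blast
        have "c (Dom J u) \<cdot> h = b (Dom J u)" "c (Cod J u) \<cdot> h = b (Cod J u)"
          using h(2) u by simp_all
        then have "(FA D u \<cdot> c (Dom J u)) \<cdot> h = c (Cod J u) \<cdot> h"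
          using assoc[OF h(1) u] b'(2) by simp
        then have ex2: "\<exists>!k. k \<in> hom C U E \<and> m \<cdot> k = h" using univ h by blast
        have eq: "(c k \<cdot> m) \<cdot> l = c k \<cdot> (m \<cdot> l)" if "k \<in> Obj J" "l \<in> hom C U E" for k l
          using that c[of k] m(1) by (simp add: hom_iff)
        have "l \<in> hom C U E \<Longrightarrow> (\<forall>k \<in> Obj J. (c k \<cdot> m) \<cdot> l = b k) \<longleftrightarrow> m \<cdot> l = h" for l
        proof -
          assume l: "l \<in> hom C U E"
          then have "m \<cdot> l \<in> hom C U V" using m(1) by (simp add: hom_iff)
          then have "(\<forall>k \<in> Obj J. c k \<cdot> (m \<cdot> l) = b k) \<longleftrightarrow> m \<cdot> l = h"
            using ex1 h by blast
          then show "(\<forall>k \<in> Obj J. (c k \<cdot> m) \<cdot> l = b k) \<longleftrightarrow> m \<cdot> l = h"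
            using eq[OF _ l] by simp
        qed
        then show ?thesis using ex2 by blast
      qed
      moreover have "cone (Obj J) (insert u T) E (\<lambda>k. c k \<cdot> m)"
      proof -
        have "FA D v \<cdot> (c (Dom J v) \<cdot> m) = c (Cod J v) \<cdot> m" if "v \<in> insert u T" for v
        proof -
          have v: "v \<in> Arr J" using that insert.prems by blast
          have "(FA D v \<cdot> c (Dom J v)) \<cdot> m = c (Cod J v) \<cdot> m"
            using that m(2) cT by (cases "v = u") simp_all
          then show ?thesis using assoc[OF m(1) v] by simp
        qed
        then show ?thesis using m(1) c hom_Obj[OF m(1)] by (simp add: cone_def hom_iff)
      qed
      ultimately have "lim (Obj J) (insert u T) E (\<lambda>k. c k \<cdot> m)" by (simp add: lim_def)
      then show ?case by blast
    qed
    obtain V c where "lim (Obj J) (Arr J) V c" using arrows by blast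
    moreover have "is_cone J C D U b \<longleftrightarrow> cone (Obj J) (Arr J) U b" for U b
      by (auto simp: is_cone_def cone_def)
    ultimately show ?thesis by (auto simp: lim_def is_limit_def)
  qed
  then show ?thesis using category_axioms by (simp add: finitely_complete_def)
qed


section \<open>Regular epimorphisms\<close>

context category_notation
begin

lemma coequalizer_cancel:
  assumes e: "is_coequalizer C a b e" and h: "h \<in> hom C (Cod C e) Z" "h' \<in> hom C (Cod C e) Z"
    and eq: "h \<cdot> e = h' \<cdot> e"
  shows "h = h'"
proof -
  have D: "a \<in> Arr C" "b \<in> Arr C" "e \<in> Arr C" "Cod C a = Dom C e" "Cod C b = Dom C e"
    "e \<cdot> a = e \<cdot> b"
    using e by (auto simp: is_coequalizer_def hom_iff)
  have "(h \<cdot> e) \<cdot> a = (h \<cdot> e) \<cdot> b" using D h by (simp add: hom_iff)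
  moreover have "h \<cdot> e \<in> hom C (Dom C e) Z" using D h by (simp add: hom_iff)
  ultimately have "\<exists>!k. k \<in> hom C (Cod C e) Z \<and> k \<cdot> e = h \<cdot> e"
    using e unfolding is_coequalizer_def by blast
  then show ?thesis using h eq by auto
qed

lemma coequalizer_factor:
  assumes "is_coequalizer C a b e" "f \<in> hom C (Dom C e) Z" "f \<cdot> a = f \<cdot> b"
  obtains h where "h \<in> hom C (Cod C e) Z" "h \<cdot> e = f"
  using assms unfolding is_coequalizer_def by metis

lemma regular_epi_Arr: "regular_epi C e \<Longrightarrow> e \<in> Arr C"
  by (auto simp: regular_epi_def is_coequalizer_def)

lemma regular_epi_cancel:
  assumes "regular_epi C e" "h \<cdot> e = h' \<cdot> e" "h \<in> hom C (Cod C e) Z" "h' \<in> hom C (Cod C e) Z"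
  shows "h = h'"
  using assms coequalizer_cancel unfolding regular_epi_def by blast

text \<open>Unlike the universal property of a coequalizer, this does not refer to a parallel pair: it is
  enough that \<open>f\<close> identifies all generalized elements that \<open>e\<close> identifies.\<close>

lemma regular_epi_descend:
  assumes e: "regular_epi C e" and f: "f \<in> hom C (Dom C e) Z"
    and eq: "\<And>U a b. \<lbrakk>a \<in> hom C U (Dom C e); b \<in> hom C U (Dom C e); e \<cdot> a = e \<cdot> b\<rbrakk>
      \<Longrightarrow> f \<cdot> a = f \<cdot> b"
  obtains h where "h \<in> hom C (Cod C e) Z" "h \<cdot> e = f"
proof -
  obtain a b where ab: "is_coequalizer C a b e" using e by (auto simp: regular_epi_def)
  then have "f \<cdot> a = f \<cdot> b" by (intro eq[of a "Dom C a"]) (auto simp: is_coequalizer_def)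
  then show ?thesis using that coequalizer_factor[OF ab f] by blast
qed

lemma regular_epi_Ide:
  assumes "X \<in> Obj C"
  shows "regular_epi C (Ide C X)"
  unfolding regular_epi_def
proof (intro exI)
  show "is_coequalizer C (Ide C X) (Ide C X) (Ide C X)"
    unfolding is_coequalizer_def using assms by (auto simp: hom_iff)
qed

lemma mono_regular_epi_is_iso:
  assumes m: "is_mono C m" and e: "regular_epi C m"
  shows "is_iso C m"
proof -
  have M: "m \<in> Arr C" using m by (simp add: is_mono_def)
  obtain h where h: "h \<in> hom C (Cod C m) (Dom C m)" "h \<cdot> m = Ide C (Dom C m)"
  proof (rule regular_epi_descend[OF e])
    show "Ide C (Dom C m) \<in> hom C (Dom C m) (Dom C m)" using M by (simp add: hom_iff)
    show "Ide C (Dom C m) \<cdot> a = Ide C (Dom C m) \<cdot> b"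
      if "a \<in> hom C U (Dom C m)" "b \<in> hom C U (Dom C m)" "m \<cdot> a = m \<cdot> b" for U a b
      using is_mono_cancel[OF m that(3,1,2)] by simp
  qed
  have "m \<cdot> h = Ide C (Cod C m)"
  proof (rule regular_epi_cancel[OF e])
    have "(m \<cdot> h) \<cdot> m = m \<cdot> (h \<cdot> m)"
      by (rule Comp_assoc) (use h M in \<open>auto simp: hom_iff\<close>)
    then show "(m \<cdot> h) \<cdot> m = Ide C (Cod C m) \<cdot> m" using h M by simp
  qed (use h M in \<open>auto simp: hom_iff\<close>)
  then show ?thesis using h M is_isoI[of m "Dom C m" "Cod C m" h] by (simp add: hom_iff)
qed

end

text \<open>Regular epimorphisms play the part of covers: what has to be shown of a generalized element
  \<open>x : U \<rightarrow> V\<close> may be shown after restricting \<open>x\<close> along a cover of \<open>U\<close>.\<close>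

definition is_cover :: "('o, 'a) cat \<Rightarrow> 'a \<Rightarrow> 'o \<Rightarrow> 'o \<Rightarrow> bool" where
  "is_cover C e V U \<longleftrightarrow> e \<in> hom C V U \<and> regular_epi C e"

context category_notation
begin

lemma is_coverD:
  assumes "is_cover C e V U"
  shows "e \<in> Arr C" "Dom C e = V" "Cod C e = U" "regular_epi C e" "e \<in> hom C V U"
  using assms by (auto simp: is_cover_def hom_iff)

lemma is_cover_Ide: "X \<in> Obj C \<Longrightarrow> is_cover C (Ide C X) X X"
  by (simp add: is_cover_def regular_epi_Ide Ide_in_hom)

lemma is_cover_cancel:
  assumes "is_cover C e V U" "h \<cdot> e = h' \<cdot> e" "h \<in> hom C U Z" "h' \<in> hom C U Z"
  shows "h = h'"
  using assms regular_epi_cancel[of e h h' Z] by (auto simp: is_cover_def hom_iff)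

lemma is_cover_descend:
  assumes e: "is_cover C e V U" and f: "f \<in> hom C V Z"
    and eq: "\<And>T a b. \<lbrakk>a \<in> hom C T V; b \<in> hom C T V; e \<cdot> a = e \<cdot> b\<rbrakk> \<Longrightarrow> f \<cdot> a = f \<cdot> b"
  obtains h where "h \<in> hom C U Z" "h \<cdot> e = f"
proof -
  note D = is_coverD[OF e]
  show ?thesis
    by (rule regular_epi_descend[OF D(4), unfolded D(2,3), OF f]) (erule (2) eq, erule (1) that)
qed

text \<open>Since \<open>m\<close> is monic, \<open>h\<close> identifies whatever \<open>e\<close> identifies, so \<open>h\<close> factors through \<open>e\<close>; the
  factor is inverse to \<open>m\<close>.\<close>

lemma regular_epi_extremal:
  assumes e: "is_cover C e X Y" and m: "is_mono C m" "m \<in> hom C I Y" and h: "h \<in> hom C X I"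
    and eq: "m \<cdot> h = e"
  shows "is_iso C m"
proof -
  have E: "e \<in> hom C X Y" using e by (simp add: is_cover_def)
  have eh: "e \<cdot> a = m \<cdot> (h \<cdot> a)" if "a \<in> hom C U X" for a U
    using Comp_assoc[OF that h m(2)] eq by simp
  have "h \<cdot> a = h \<cdot> b" if ab: "a \<in> hom C U X" "b \<in> hom C U X" "e \<cdot> a = e \<cdot> b" for U a b
    using is_mono_cancel[OF m(1), of "h \<cdot> a" "h \<cdot> b" U] ab eh m(2) h by (simp add: hom_iff)
  then obtain k where k: "k \<in> hom C Y I" "k \<cdot> e = h" using is_cover_descend[OF e h] by blast
  have "(m \<cdot> k) \<cdot> e = Ide C Y \<cdot> e"
    using Comp_assoc[OF E k(1) m(2)] k(2) eq E by (simp add: hom_iff)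
  then have mk: "m \<cdot> k = Ide C Y"
    by (rule is_cover_cancel[OF e]) (use k m E in \<open>auto simp: hom_iff\<close>)
  have "m \<cdot> (k \<cdot> m) = (m \<cdot> k) \<cdot> m" using Comp_assoc[OF m(2) k(1) m(2)] by simp
  also have "\<dots> = m \<cdot> Ide C I" using mk m(2) by (auto simp: hom_iff)
  finally have "k \<cdot> m = Ide C I"
    by (rule is_mono_cancel[OF m(1)]) (use k m in \<open>auto simp: hom_iff\<close>)
  then show ?thesis using is_isoI[OF m(2) k(1) _ mk] by simp
qed

lemma is_cover_iso_comp:
  assumes e: "is_cover C e X I" and m: "is_iso C m" "m \<in> hom C I Y"
  shows "is_cover C (m \<cdot> e) X Y"
proof -
  obtain a b where ab: "is_coequalizer C a b e" using e by (auto simp: is_cover_def regular_epi_def)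
  have E: "e \<in> Arr C" "Dom C e = X" "Cod C e = I" using e by (auto simp: is_cover_def hom_iff)
  have AB: "a \<in> hom C (Dom C a) X" "b \<in> hom C (Dom C a) X" "e \<cdot> a = e \<cdot> b"
    using ab E by (auto simp: is_coequalizer_def)
  have M: "m \<in> Arr C" "Dom C m = I" "Cod C m = Y" using m by (auto simp: hom_iff)
  obtain n where n: "n \<in> hom C Y I" "n \<cdot> m = Ide C I" "m \<cdot> n = Ide C Y"
    using is_isoE[OF m] .
  have "is_coequalizer C a b (m \<cdot> e)"
    unfolding is_coequalizer_def
  proof (intro conjI allI ballI impI)
    show "(m \<cdot> e) \<cdot> a = (m \<cdot> e) \<cdot> b" using AB E M by (simp add: hom_iff)
    fix Z f assume f: "f \<in> hom C (Dom C (m \<cdot> e)) Z" "f \<cdot> a = f \<cdot> b"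
    then have "\<exists>!h. h \<in> hom C I Z \<and> h \<cdot> e = f"
      using ab E M unfolding is_coequalizer_def by simp
    then obtain h where h: "h \<in> hom C I Z" "h \<cdot> e = f" and uniq: "\<And>k. k \<in> hom C I Z \<Longrightarrow> k \<cdot> e = f \<Longrightarrow> k = h"
      by auto
    have "(h \<cdot> n) \<cdot> (m \<cdot> e) = h \<cdot> ((n \<cdot> m) \<cdot> e)"
      using h(1) n(1) M E by (simp add: hom_iff)
    then have *: "(h \<cdot> n) \<cdot> (m \<cdot> e) = f" using n(2) h(2) E by simp
    have "k = h \<cdot> n" if k: "k \<in> hom C Y Z" "k \<cdot> (m \<cdot> e) = f" for k
    proof -
      have "k \<cdot> m = h" using k E M by (intro uniq) (simp_all add: hom_iff)
      then have "h \<cdot> n = k \<cdot> (m \<cdot> n)" using k(1) n(1) M by (auto simp: hom_iff)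
      then show ?thesis using n(3) k(1) by (simp add: hom_iff)
    qed
    then show "\<exists>!h. h \<in> hom C (Cod C (m \<cdot> e)) Z \<and> h \<cdot> (m \<cdot> e) = f"
      using * h(1) n(1) M E by (intro ex1I[of _ "h \<cdot> n"]) (simp_all add: hom_iff)
  qed (use AB E M in \<open>auto simp: hom_iff\<close>)
  then show ?thesis using E M by (auto simp: is_cover_def regular_epi_def hom_iff)
qed

end

locale regular_cat = category_notation C for C :: "('o, 'a) cat" (structure) +
  assumes regular: "regular_category C"
begin

sublocale finite_limits C
  by unfold_locales (use regular in \<open>simp add: regular_category_def\<close>)

lemma cover_pull:
  assumes e: "is_cover C e V W" and x: "x \<in> hom C U W"
  obtains U' e' x' where "is_cover C e' U' U" "x' \<in> hom C U' V" "e \<cdot> x' = x \<cdot> e'"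
proof -
  have D: "e \<in> Arr C" "x \<in> Arr C" "Cod C e = Cod C x" "Dom C e = V" "Dom C x = U"
    using e x by (auto simp: is_cover_def hom_iff)
  obtain p q where pq: "is_pullback C e x p q" using pullback_ex[OF D(1-3)] by blast
  then have "regular_epi C q"
    using regular e unfolding regular_category_def is_cover_def by blast
  then show ?thesis using that[of q "Dom C p" p] is_pullbackD[OF pq] D by (simp add: is_cover_def hom_iff)
qed

text \<open>Every arrow is a regular epimorphism, the coequalizer of its kernel pair, followed by a
  monomorphism: two elements of the image that become equal have local preimages, and these
  are related by the kernel pair.\<close>

lemma image_factorisation:
  assumes f: "f \<in> hom C X Y"
  obtains I e m where "is_cover C e X I" "m \<in> hom C I Y" "is_mono C m" "m \<cdot> e = f"
proof -
  have F: "f \<in> Arr C" "Dom C f = X" "Cod C f = Y" using f by (auto simp: hom_iff)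
  obtain p q where pq: "is_pullback C f f p q" using pullback_ex[OF F(1) F(1)] by blast
  note P = is_pullbackD[OF pq]
  obtain e where e: "is_coequalizer C p q e"
    using regular pq unfolding regular_category_def is_kernel_pair_def by blast
  then have re: "regular_epi C e" by (auto simp: regular_epi_def)
  have E: "e \<in> Arr C" "Dom C e = X" "e \<cdot> p = e \<cdot> q"
    using e P F by (auto simp: is_coequalizer_def hom_iff)
  define I where "I = Cod C e"
  have cov: "is_cover C e X I" using E re by (simp add: is_cover_def hom_iff I_def)
  have f': "f \<in> hom C (Dom C e) Y" using E f by simp
  obtain m where m: "m \<in> hom C I Y" "m \<cdot> e = f"
    using coequalizer_factor[OF e f' P(9)] by (auto simp: I_def)
  have "a = b" if ab: "a \<in> hom C U I" "b \<in> hom C U I" "m \<cdot> a = m \<cdot> b" for U a b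
  proof -
    obtain V c x where c: "is_cover C c V U" "x \<in> hom C V X" "e \<cdot> x = a \<cdot> c"
      using cover_pull[OF cov ab(1)] .
    have c': "c \<in> hom C V U" using c by (simp add: is_cover_def)
    have bc: "b \<cdot> c \<in> hom C V I" using ab(2) c' by (simp add: hom_iff)
    obtain T d y where d: "is_cover C d T V" "y \<in> hom C T X" "e \<cdot> y = (b \<cdot> c) \<cdot> d"
      using cover_pull[OF cov bc] .
    have d': "d \<in> hom C T V" using d by (simp add: is_cover_def)
    have eh: "e \<in> hom C X I" using cov by (simp add: is_cover_def)
    have xd: "x \<cdot> d \<in> hom C T X" using c d' by (simp add: hom_iff)
    have "e \<cdot> (x \<cdot> d) = (e \<cdot> x) \<cdot> d"
      using Comp_assoc[OF d' c(2) eh] by simp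
    also have "\<dots> = (a \<cdot> c) \<cdot> d" by (simp add: c(3))
    finally have ex: "e \<cdot> (x \<cdot> d) = (a \<cdot> c) \<cdot> d" .
    have fe: "f \<cdot> z = m \<cdot> (e \<cdot> z)" if "z \<in> hom C T X" for z
      using Comp_assoc[OF that eh m(1)] m(2) by simp
    have "m \<cdot> ((a \<cdot> c) \<cdot> d) = (m \<cdot> a) \<cdot> (c \<cdot> d)"
      "m \<cdot> ((b \<cdot> c) \<cdot> d) = (m \<cdot> b) \<cdot> (c \<cdot> d)"
      using m(1) ab(1,2) c' d' by (simp_all add: hom_iff)
    then have "f \<cdot> (x \<cdot> d) = f \<cdot> y"
      using fe[OF xd] fe[OF d(2)] ex d(3) ab(3) by simp
    then obtain h where h: "h \<in> hom C T (Dom C p)" "p \<cdot> h = x \<cdot> d" "q \<cdot> h = y"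
      using pullback_lift[OF pq, of "x \<cdot> d" T y] xd d(2) F by auto
    have "p \<in> hom C (Dom C p) X" "q \<in> hom C (Dom C p) X" using P F by (simp_all add: hom_iff)
    from Comp_assoc[OF h(1) this(1) eh] Comp_assoc[OF h(1) this(2) eh]
    have "e \<cdot> (x \<cdot> d) = e \<cdot> y" using E(3) h(2,3) by simp
    then have "(a \<cdot> c) \<cdot> d = (b \<cdot> c) \<cdot> d" using ex d(3) by simp
    then have "a \<cdot> c = b \<cdot> c"
      by (rule is_cover_cancel[OF d(1)]) (use ab c' in \<open>auto simp: hom_iff\<close>)
    then show "a = b" by (rule is_cover_cancel[OF c(1) _ ab(1,2)])
  qed
  then have "is_mono C m" using m by (auto simp: is_mono_def hom_iff)
  then show ?thesis using that cov m by blast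
qed

text \<open>With \<open>regular_epi_extremal\<close> this shows that regular and extremal epimorphisms coincide in a
  regular category. The closure properties below are immediate for extremal epimorphisms.\<close>

lemma extremal_is_cover:
  assumes f: "f \<in> hom C X Y"
    and ext: "\<And>I e m. \<lbrakk>e \<in> hom C X I; m \<in> hom C I Y; is_mono C m; m \<cdot> e = f\<rbrakk> \<Longrightarrow> is_iso C m"
  shows "is_cover C f X Y"
proof -
  obtain I e m where em: "is_cover C e X I" "m \<in> hom C I Y" "is_mono C m" "m \<cdot> e = f"
    using image_factorisation[OF f] .
  then have "is_iso C m" using ext by (auto simp: is_cover_def)
  then show ?thesis using is_cover_iso_comp[OF em(1) _ em(2)] em(4) by simp
qed

lemma is_cover_right_factor:
  assumes gf: "is_cover C (g \<cdot> f) X Z" and f: "f \<in> hom C X Y" and g: "g \<in> hom C Y Z"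
  shows "is_cover C g Y Z"
proof (rule extremal_is_cover[OF g])
  fix I e m assume em: "e \<in> hom C Y I" "m \<in> hom C I Z" "is_mono C m" "m \<cdot> e = g"
  then have "m \<cdot> (e \<cdot> f) = g \<cdot> f" using Comp_assoc[OF f em(1,2)] by simp
  moreover have "e \<cdot> f \<in> hom C X I" using em f by (simp add: hom_iff)
  ultimately show "is_iso C m" using regular_epi_extremal[OF gf em(3,2)] by blast
qed

lemma is_cover_comp:
  assumes f: "is_cover C f X Y" and g: "is_cover C g Y Z"
  shows "is_cover C (g \<cdot> f) X Z"
proof (rule extremal_is_cover)
  have F: "f \<in> hom C X Y" and G: "g \<in> hom C Y Z" using f g by (auto simp: is_cover_def)
  then show "g \<cdot> f \<in> hom C X Z" by (simp add: hom_iff)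
  fix I e m assume em: "e \<in> hom C X I" "m \<in> hom C I Z" "is_mono C m" "m \<cdot> e = g \<cdot> f"
  \<comment> \<open>\<open>e\<close> descends along the cover \<open>f\<close>, so that \<open>g\<close> factors through \<open>m\<close>\<close>
  have "e \<cdot> a = e \<cdot> b" if ab: "a \<in> hom C U X" "b \<in> hom C U X" "f \<cdot> a = f \<cdot> b" for U a b
  proof -
    have "m \<cdot> (e \<cdot> a) = g \<cdot> (f \<cdot> a)" "m \<cdot> (e \<cdot> b) = g \<cdot> (f \<cdot> b)"
      using Comp_assoc[OF ab(1) em(1,2)] Comp_assoc[OF ab(1) F G]
        Comp_assoc[OF ab(2) em(1,2)] Comp_assoc[OF ab(2) F G] em(4) by simp_all
    then show ?thesis using is_mono_cancel[OF em(3), of "e \<cdot> a" "e \<cdot> b" U] ab em(1,2)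
      by (simp add: hom_iff)
  qed
  then obtain h where h: "h \<in> hom C Y I" "h \<cdot> f = e" using is_cover_descend[OF f em(1)] by blast
  have "(m \<cdot> h) \<cdot> f = g \<cdot> f" using Comp_assoc[OF F h(1) em(2)] h(2) em(4) by simp
  then have "m \<cdot> h = g"
    by (rule is_cover_cancel[OF f]) (use em h G in \<open>auto simp: hom_iff\<close>)
  then show "is_iso C m" using regular_epi_extremal[OF g em(3,2) h(1)] by simp
qed

lemma common_cover:
  assumes e: "is_cover C e V U" and f: "is_cover C f W U"
  obtains T c d where "is_cover C (e \<cdot> c) T U" "c \<in> hom C T V" "d \<in> hom C T W" "f \<cdot> d = e \<cdot> c"
proof -
  have E: "e \<in> hom C V U" using e by (simp add: is_cover_def)
  obtain T c d where c: "is_cover C c T V" "d \<in> hom C T W" "f \<cdot> d = e \<cdot> c"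
    using cover_pull[OF f E] .
  then show ?thesis using that is_cover_comp[OF c(1) e] by (simp add: is_cover_def)
qed

text \<open>The image of a span is taken inside the product.\<close>

lemma span_image:
  assumes f: "f \<in> hom C R A" and g: "g \<in> hom C R B"
  obtains I c i j where "is_cover C c R I" "i \<in> hom C I A" "j \<in> hom C I B" "i \<cdot> c = f" "j \<cdot> c = g"
    "\<And>U a b. \<lbrakk>a \<in> hom C U I; b \<in> hom C U I; i \<cdot> a = i \<cdot> b; j \<cdot> a = j \<cdot> b\<rbrakk> \<Longrightarrow> a = b"
proof -
  obtain p q where pq: "is_product C A B p q"
    using product_ex[of A B] hom_Obj[OF f] hom_Obj[OF g] by blast
  define Q where "Q = Dom C p"
  have P: "p \<in> hom C Q A" "q \<in> hom C Q B" using pq by (auto simp: is_product_def Q_def)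
  have univ: "\<exists>!h. h \<in> hom C U Q \<and> p \<cdot> h = a \<and> q \<cdot> h = b"
    if "a \<in> hom C U A" "b \<in> hom C U B" for U a b
    using pq that by (simp add: is_product_def Q_def)
  obtain h where h: "h \<in> hom C R Q" "p \<cdot> h = f" "q \<cdot> h = g" using univ[OF f g] by blast
  obtain I c m where m: "is_cover C c R I" "m \<in> hom C I Q" "is_mono C m" "m \<cdot> c = h"
    using image_factorisation[OF h(1)] .
  have c: "c \<in> hom C R I" using m by (simp add: is_cover_def)
  show ?thesis
  proof (rule that[OF m(1), of "p \<cdot> m" "q \<cdot> m"])
    show "(p \<cdot> m) \<cdot> c = f" "(q \<cdot> m) \<cdot> c = g"
      using Comp_assoc[OF c m(2) P(1)] Comp_assoc[OF c m(2) P(2)] m(4) h by simp_all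
    fix U a b assume ab: "a \<in> hom C U I" "b \<in> hom C U I"
      and eq: "(p \<cdot> m) \<cdot> a = (p \<cdot> m) \<cdot> b" "(q \<cdot> m) \<cdot> a = (q \<cdot> m) \<cdot> b"
    have eq': "p \<cdot> (m \<cdot> a) = p \<cdot> (m \<cdot> b)" "q \<cdot> (m \<cdot> a) = q \<cdot> (m \<cdot> b)"
      using eq Comp_assoc[OF ab(1) m(2) P(1)] Comp_assoc[OF ab(1) m(2) P(2)]
        Comp_assoc[OF ab(2) m(2) P(1)] Comp_assoc[OF ab(2) m(2) P(2)] by simp_all
    have ma: "m \<cdot> a \<in> hom C U Q" "m \<cdot> b \<in> hom C U Q" using ab m(2) by (auto simp: hom_iff)
    then have "m \<cdot> a = m \<cdot> b"
      using univ[OF Comp_in_hom[OF ma(2) P(1)] Comp_in_hom[OF ma(2) P(2)]] eq' by blast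
    then show "a = b"
      by (rule is_mono_cancel[OF m(3)]) (use ab m(2) in \<open>auto simp: hom_iff\<close>)
  qed (use P m in \<open>auto simp: hom_iff\<close>)
qed

text \<open>Any two generalized elements identified by \<open>e\<close> come from one of the kernel pair.\<close>

lemma cover_coequalizes_kernel_pair:
  assumes e: "is_cover C e V U" and pq: "is_pullback C e e p q"
    and f: "f \<in> hom C V Z" "f \<cdot> p = f \<cdot> q"
  obtains h where "h \<in> hom C U Z" "h \<cdot> e = f"
proof (rule is_cover_descend[OF e f(1)])
  note P = is_pullbackD[OF pq]
  fix T a b assume ab: "a \<in> hom C T V" "b \<in> hom C T V" "e \<cdot> a = e \<cdot> b"
  then obtain k where k: "k \<in> hom C T (Dom C p)" "p \<cdot> k = a" "q \<cdot> k = b"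
    using pullback_lift[OF pq, of a T b] e by (auto simp: is_cover_def hom_iff)
  have V: "p \<in> hom C (Dom C p) V" "q \<in> hom C (Dom C p) V" using P e by (auto simp: is_cover_def hom_iff)
  show "f \<cdot> a = f \<cdot> b"
    using Comp_assoc[OF k(1) V(1) f(1)] Comp_assoc[OF k(1) V(2) f(1)] k f(2) by simp
qed (use that in blast)

end

locale exact_cat = category_notation C for C :: "('o, 'a) cat" (structure) +
  assumes exact: "exact_category C"
begin

sublocale regular_cat C
  by unfold_locales (use exact in \<open>simp add: exact_category_def\<close>)

text \<open>The relation is the kernel pair of some \<open>f\<close>. Its coequalizer \<open>q\<close> has the same kernel pair,
  because \<open>f\<close> factors through \<open>q\<close>.\<close>

lemma effective_quotient:
  assumes r: "is_equivalence_relation C X r s"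
  obtains Q q where "is_cover C q X Q"
    "\<And>U x y. \<lbrakk>x \<in> hom C U X; y \<in> hom C U X\<rbrakk> \<Longrightarrow>
       q \<cdot> x = q \<cdot> y \<longleftrightarrow> (\<exists>k \<in> hom C U (Dom C r). r \<cdot> k = x \<and> s \<cdot> k = y)"
proof -
  obtain f where f: "is_pullback C f f r s"
    using exact r unfolding exact_category_def is_kernel_pair_def by blast
  note P = is_pullbackD[OF f]
  have rs: "r \<in> hom C (Dom C r) X" "s \<in> hom C (Dom C r) X"
    using r by (auto simp: is_equivalence_relation_def Let_def)
  then have X: "Dom C f = X" using P by (simp add: hom_iff)
  obtain q where q: "is_coequalizer C r s q"
    using regular f unfolding regular_category_def is_kernel_pair_def by blast
  have "q \<in> Arr C" "r \<in> hom C (Dom C r) (Dom C q)" "q \<cdot> r = q \<cdot> s"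
    using q unfolding is_coequalizer_def by blast+
  then have q': "q \<in> hom C X (Cod C q)" "q \<cdot> r = q \<cdot> s"
    using rs(1) by (simp_all add: hom_iff)
  have "f \<in> hom C (Dom C q) (Cod C f)" using P X q' by (simp add: hom_iff)
  then obtain h where h: "h \<in> hom C (Cod C q) (Cod C f)" "h \<cdot> q = f"
    using coequalizer_factor[OF q _ P(9)] by blast
  show ?thesis
  proof (rule that[of q "Cod C q"])
    show "is_cover C q X (Cod C q)" using q q'(1) unfolding is_cover_def regular_epi_def by blast
    fix U x y assume xy: "x \<in> hom C U X" "y \<in> hom C U X"
    show "q \<cdot> x = q \<cdot> y \<longleftrightarrow> (\<exists>k \<in> hom C U (Dom C r). r \<cdot> k = x \<and> s \<cdot> k = y)"
    proof
      assume "q \<cdot> x = q \<cdot> y"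
      then have "f \<cdot> x = f \<cdot> y"
        using Comp_assoc[OF xy(1) q'(1) h(1)] Comp_assoc[OF xy(2) q'(1) h(1)] h(2) by simp
      then show "\<exists>k \<in> hom C U (Dom C r). r \<cdot> k = x \<and> s \<cdot> k = y"
        using pullback_lift[OF f, of x U y] xy X by metis
    next
      assume "\<exists>k \<in> hom C U (Dom C r). r \<cdot> k = x \<and> s \<cdot> k = y"
      then show "q \<cdot> x = q \<cdot> y"
        using Comp_assoc[OF _ rs(1) q'(1)] Comp_assoc[OF _ rs(2) q'(1)] q'(2) by metis
    qed
  qed
qed

end


section \<open>Functor categories and equivalences\<close>

lemma nat_transD:
  assumes "nat_trans A B F G \<theta>"
  shows "is_functor A B F" "is_functor A B G" "\<theta> \<in> extensional (Obj A)"
    "X \<in> Obj A \<Longrightarrow> \<theta> X \<in> hom B (FO F X) (FO G X)"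
    "f \<in> Arr A \<Longrightarrow> \<theta> (Cod A f) \<cdot>\<^bsub>B\<^esub> FA F f = FA G f \<cdot>\<^bsub>B\<^esub> \<theta> (Dom A f)"
  using assms unfolding nat_trans_def by blast+

lemma nat_transI:
  assumes "is_functor A B F" "is_functor A B G" "\<theta> \<in> extensional (Obj A)"
    "\<And>X. X \<in> Obj A \<Longrightarrow> \<theta> X \<in> hom B (FO F X) (FO G X)"
    "\<And>X Y f. f \<in> hom A X Y \<Longrightarrow> \<theta> Y \<cdot>\<^bsub>B\<^esub> FA F f = FA G f \<cdot>\<^bsub>B\<^esub> \<theta> X"
  shows "nat_trans A B F G \<theta>"
  using assms unfolding nat_trans_def by (auto simp: hom_def)

lemma nat_trans_Ide:
  assumes F: "is_functor A B F"
  shows "nat_trans A B F F (\<lambda>X \<in> Obj A. Ide B (FO F X))"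
proof -
  interpret A: category A using F by (rule is_functorD)
  interpret B: category B using F by (rule is_functorD)
  show ?thesis
    using is_functorD[OF F] by (intro nat_transI F) (auto simp: hom_iff)
qed

lemma nat_trans_comp:
  assumes t: "nat_trans A B F G \<theta>" and e: "nat_trans A B G H \<eta>"
  shows "nat_trans A B F H (\<lambda>X \<in> Obj A. \<eta> X \<cdot>\<^bsub>B\<^esub> \<theta> X)"
proof (rule nat_transI)
  note T = nat_transD[OF t] and E = nat_transD[OF e]
  show "is_functor A B F" "is_functor A B H" by fact+
  interpret A: category A using T(1) by (rule is_functorD)
  interpret B: category B using T(1) by (rule is_functorD)
  show "(\<lambda>X \<in> Obj A. \<eta> X \<cdot>\<^bsub>B\<^esub> \<theta> X) X \<in> hom B (FO F X) (FO H X)" if "X \<in> Obj A" for X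
    using that B.Comp_in_hom[OF T(4) E(4)] by simp
  fix X Y f assume f: "f \<in> hom A X Y"
  then have f': "f \<in> Arr A" "Dom A f = X" "Cod A f = Y" by (auto simp: hom_iff)
  have XY: "X \<in> Obj A" "Y \<in> Obj A" using f A.hom_Obj by blast+
  note m = T(4)[OF XY(1)] T(4)[OF XY(2)] E(4)[OF XY(1)] E(4)[OF XY(2)]
    is_functor_hom[OF T(1) f] is_functor_hom[OF T(2) f] is_functor_hom[OF E(2) f]
  have "(\<eta> Y \<cdot>\<^bsub>B\<^esub> \<theta> Y) \<cdot>\<^bsub>B\<^esub> FA F f = \<eta> Y \<cdot>\<^bsub>B\<^esub> (FA G f \<cdot>\<^bsub>B\<^esub> \<theta> X)"
    using B.Comp_assoc[OF m(5,2,4)] T(5)[OF f'(1)] f' by simp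
  also have "\<dots> = (FA H f \<cdot>\<^bsub>B\<^esub> \<eta> X) \<cdot>\<^bsub>B\<^esub> \<theta> X"
    using B.Comp_assoc[OF m(1,6,4)] E(5)[OF f'(1)] f' by simp
  also have "\<dots> = FA H f \<cdot>\<^bsub>B\<^esub> (\<eta> X \<cdot>\<^bsub>B\<^esub> \<theta> X)" using B.Comp_assoc[OF m(1,3,7)] .
  finally show "(\<lambda>X \<in> Obj A. \<eta> X \<cdot>\<^bsub>B\<^esub> \<theta> X) Y \<cdot>\<^bsub>B\<^esub> FA F f = FA H f \<cdot>\<^bsub>B\<^esub> (\<lambda>X \<in> Obj A. \<eta> X \<cdot>\<^bsub>B\<^esub> \<theta> X) X"
    using XY by simp
qed simp

lemma functor_cat_simps [simp]:
  "Obj (functor_cat A B P) = {F. is_functor A B F \<and> P F}"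
  "Dom (functor_cat A B P) (F, \<theta>, G) = F"
  "Cod (functor_cat A B P) (F, \<theta>, G) = G"
  "Ide (functor_cat A B P) F = (F, (\<lambda>X \<in> Obj A. Ide B (FO F X)), F)"
  "Comp (functor_cat A B P) (G', \<eta>, H) (F, \<theta>, G) = (F, (\<lambda>X \<in> Obj A. \<eta> X \<cdot>\<^bsub>B\<^esub> \<theta> X), H)"
  by (simp_all add: functor_cat_def)

lemma functor_cat_Arr: "\<phi> \<in> Arr (functor_cat A B P) \<longleftrightarrow>
    (\<exists>F \<theta> G. \<phi> = (F, \<theta>, G) \<and> P F \<and> P G \<and> nat_trans A B F G \<theta>)"
  by (auto simp: functor_cat_def)

lemma functor_cat_hom: "\<phi> \<in> hom (functor_cat A B P) F G \<longleftrightarrow>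
    (\<exists>\<theta>. \<phi> = (F, \<theta>, G) \<and> P F \<and> P G \<and> nat_trans A B F G \<theta>)"
  by (auto simp: hom_iff functor_cat_Arr)

lemma category_functor_cat: "category (functor_cat A B P)"
proof
  let ?S = "functor_cat A B P"
  show "Dom ?S \<phi> \<in> Obj ?S" "Cod ?S \<phi> \<in> Obj ?S" if "\<phi> \<in> Arr ?S" for \<phi>
    using that by (auto simp: functor_cat_Arr dest: nat_transD)
  show "Ide ?S F \<in> hom ?S F F" if "F \<in> Obj ?S" for F
    using that nat_trans_Ide by (auto simp: functor_cat_hom)
  show "\<psi> \<cdot>\<^bsub>?S\<^esub> \<phi> \<in> hom ?S F H" if "\<phi> \<in> hom ?S F G" "\<psi> \<in> hom ?S G H" for \<phi> \<psi> F G H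
    using that nat_trans_comp by (auto simp: functor_cat_hom)
  show "\<phi> \<cdot>\<^bsub>?S\<^esub> Ide ?S F = \<phi>" "Ide ?S G \<cdot>\<^bsub>?S\<^esub> \<phi> = \<phi>" if ph: "\<phi> \<in> hom ?S F G" for \<phi> F G
  proof -
    obtain \<theta> where t: "\<phi> = (F, \<theta>, G)" "nat_trans A B F G \<theta>" using ph by (auto simp: functor_cat_hom)
    note T = nat_transD[OF t(2)]
    interpret B: category B using T(1) by (rule is_functorD)
    have "(\<lambda>X \<in> Obj A. \<theta> X \<cdot>\<^bsub>B\<^esub> (\<lambda>X \<in> Obj A. Ide B (FO F X)) X) = \<theta>"
      "(\<lambda>X \<in> Obj A. (\<lambda>X \<in> Obj A. Ide B (FO G X)) X \<cdot>\<^bsub>B\<^esub> \<theta> X) = \<theta>"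
      using T(4) by (auto simp: hom_iff intro!: extensionalityI[OF _ T(3)])
    then show "\<phi> \<cdot>\<^bsub>?S\<^esub> Ide ?S F = \<phi>" "Ide ?S G \<cdot>\<^bsub>?S\<^esub> \<phi> = \<phi>" by (simp_all add: t(1))
  qed
  show "(\<chi> \<cdot>\<^bsub>?S\<^esub> \<psi>) \<cdot>\<^bsub>?S\<^esub> \<phi> = \<chi> \<cdot>\<^bsub>?S\<^esub> (\<psi> \<cdot>\<^bsub>?S\<^esub> \<phi>)"
    if hom: "\<phi> \<in> hom ?S F G" "\<psi> \<in> hom ?S G H" "\<chi> \<in> hom ?S H K" for \<phi> \<psi> \<chi> F G H K
  proof -
    obtain \<theta> where t: "\<phi> = (F, \<theta>, G)" "nat_trans A B F G \<theta>" using hom(1) by (auto simp: functor_cat_hom)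
    obtain \<eta> where e: "\<psi> = (G, \<eta>, H)" "nat_trans A B G H \<eta>" using hom(2) by (auto simp: functor_cat_hom)
    obtain \<zeta> where z: "\<chi> = (H, \<zeta>, K)" "nat_trans A B H K \<zeta>" using hom(3) by (auto simp: functor_cat_hom)
    interpret B: category B using nat_transD(1)[OF t(2)] by (rule is_functorD)
    have "(\<lambda>X \<in> Obj A. (\<lambda>X \<in> Obj A. \<zeta> X \<cdot>\<^bsub>B\<^esub> \<eta> X) X \<cdot>\<^bsub>B\<^esub> \<theta> X)
        = (\<lambda>X \<in> Obj A. \<zeta> X \<cdot>\<^bsub>B\<^esub> (\<lambda>X \<in> Obj A. \<eta> X \<cdot>\<^bsub>B\<^esub> \<theta> X) X)"
      using B.Comp_assoc[OF nat_transD(4)[OF t(2)] nat_transD(4)[OF e(2)] nat_transD(4)[OF z(2)]]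
      by (intro restrict_ext) simp
    then show ?thesis by (simp add: t(1) e(1) z(1))
  qed
qed

lemma functor_cat_isoI:
  assumes t: "nat_trans A B F G \<theta>" and P: "P F" "P G" and iso: "\<And>X. X \<in> Obj A \<Longrightarrow> is_iso B (\<theta> X)"
  shows "is_iso (functor_cat A B P) (F, \<theta>, G)"
proof -
  note T = nat_transD[OF t]
  interpret S: category "functor_cat A B P" by (rule category_functor_cat)
  interpret A: category A using T(1) by (rule is_functorD)
  interpret B: category B using T(1) by (rule is_functorD)
  have "\<exists>g. g \<in> hom B (FO G X) (FO F X) \<and> g \<cdot>\<^bsub>B\<^esub> \<theta> X = Ide B (FO F X) \<and> \<theta> X \<cdot>\<^bsub>B\<^esub> g = Ide B (FO G X)"
    if "X \<in> Obj A" for X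
    using B.is_isoE[OF iso[OF that] T(4)[OF that]] by metis
  then obtain i where i: "\<And>X. X \<in> Obj A \<Longrightarrow> i X \<in> hom B (FO G X) (FO F X)"
    "\<And>X. X \<in> Obj A \<Longrightarrow> i X \<cdot>\<^bsub>B\<^esub> \<theta> X = Ide B (FO F X)"
    "\<And>X. X \<in> Obj A \<Longrightarrow> \<theta> X \<cdot>\<^bsub>B\<^esub> i X = Ide B (FO G X)" by metis
  have "nat_trans A B G F (restrict i (Obj A))"
  proof (rule nat_transI)
    fix X Y f assume f: "f \<in> hom A X Y"
    then have f': "f \<in> Arr A" "Dom A f = X" "Cod A f = Y" by (auto simp: hom_iff)
    have X: "X \<in> Obj A" and Y: "Y \<in> Obj A" using f A.hom_Obj by blast+
    note Ff = is_functor_hom[OF T(1) f] and Gf = is_functor_hom[OF T(2) f]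
    have "i Y \<cdot>\<^bsub>B\<^esub> FA G f = i Y \<cdot>\<^bsub>B\<^esub> (FA G f \<cdot>\<^bsub>B\<^esub> (\<theta> X \<cdot>\<^bsub>B\<^esub> i X))"
      using i(3)[OF X] Gf by (simp add: hom_iff)
    also have "\<dots> = i Y \<cdot>\<^bsub>B\<^esub> ((FA G f \<cdot>\<^bsub>B\<^esub> \<theta> X) \<cdot>\<^bsub>B\<^esub> i X)"
      using B.Comp_assoc[OF i(1)[OF X] T(4)[OF X] Gf] by simp
    also have "\<dots> = i Y \<cdot>\<^bsub>B\<^esub> ((\<theta> Y \<cdot>\<^bsub>B\<^esub> FA F f) \<cdot>\<^bsub>B\<^esub> i X)" using T(5)[OF f'(1)] f' by simp
    also have "\<dots> = (i Y \<cdot>\<^bsub>B\<^esub> \<theta> Y) \<cdot>\<^bsub>B\<^esub> (FA F f \<cdot>\<^bsub>B\<^esub> i X)"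
      using i(1)[OF X] i(1)[OF Y] T(4)[OF Y] Ff by (simp add: hom_iff)
    also have "\<dots> = FA F f \<cdot>\<^bsub>B\<^esub> i X" using i(1)[OF X] i(2)[OF Y] Ff by (simp add: hom_iff)
    finally show "restrict i (Obj A) Y \<cdot>\<^bsub>B\<^esub> FA G f = FA F f \<cdot>\<^bsub>B\<^esub> restrict i (Obj A) X"
      using X Y by simp
  qed (use T i in auto)
  moreover have "(\<lambda>X \<in> Obj A. restrict i (Obj A) X \<cdot>\<^bsub>B\<^esub> \<theta> X) = (\<lambda>X \<in> Obj A. Ide B (FO F X))"
    "(\<lambda>X \<in> Obj A. \<theta> X \<cdot>\<^bsub>B\<^esub> restrict i (Obj A) X) = (\<lambda>X \<in> Obj A. Ide B (FO G X))"
    using i by (auto intro!: restrict_ext)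
  ultimately show ?thesis
    using t P by (intro S.is_isoI[of _ F G "(G, restrict i (Obj A), F)"]) (auto simp: functor_cat_hom)
qed

text \<open>Choose for every object of the target an object of the source whose image is isomorphic to it,
  and transport arrows along the chosen isomorphisms.\<close>

lemma is_equivalenceI:
  assumes K: "is_functor A B K"
    and full: "\<And>X Y g. \<lbrakk>X \<in> Obj A; Y \<in> Obj A; g \<in> hom B (FO K X) (FO K Y)\<rbrakk>
      \<Longrightarrow> \<exists>f \<in> hom A X Y. FA K f = g"
    and faithful: "\<And>X Y f g. \<lbrakk>f \<in> hom A X Y; g \<in> hom A X Y; FA K f = FA K g\<rbrakk> \<Longrightarrow> f = g"
    and surj: "\<And>Z. Z \<in> Obj B \<Longrightarrow> \<exists>X \<in> Obj A. \<exists>i \<in> hom B (FO K X) Z. is_iso B i"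
  shows "is_equivalence A B K"
proof -
  interpret A: category A using K by (rule is_functorD)
  interpret B: category B using K by (rule is_functorD)
  note K' = is_functorD[OF K]
  have "\<exists>X i j. X \<in> Obj A \<and> i \<in> hom B (FO K X) Z \<and> j \<in> hom B Z (FO K X) \<and>
      j \<cdot>\<^bsub>B\<^esub> i = Ide B (FO K X) \<and> i \<cdot>\<^bsub>B\<^esub> j = Ide B Z" if Z: "Z \<in> Obj B" for Z
  proof -
    obtain X i where X: "X \<in> Obj A" "i \<in> hom B (FO K X) Z" "is_iso B i" using surj[OF Z] by blast
    then show ?thesis using B.is_isoE[OF X(3,2)] by metis
  qed
  then obtain LO i j where LO: "\<And>Z. Z \<in> Obj B \<Longrightarrow> LO Z \<in> Obj A"
    and i: "\<And>Z. Z \<in> Obj B \<Longrightarrow> i Z \<in> hom B (FO K (LO Z)) Z"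
    and j: "\<And>Z. Z \<in> Obj B \<Longrightarrow> j Z \<in> hom B Z (FO K (LO Z))"
    and ji: "\<And>Z. Z \<in> Obj B \<Longrightarrow> j Z \<cdot>\<^bsub>B\<^esub> i Z = Ide B (FO K (LO Z))"
    and ij: "\<And>Z. Z \<in> Obj B \<Longrightarrow> i Z \<cdot>\<^bsub>B\<^esub> j Z = Ide B Z"
    by metis
  define lift where "lift X Y g = (SOME f. f \<in> hom A X Y \<and> FA K f = g)" for X Y g
  have lift: "lift X Y g \<in> hom A X Y" "FA K (lift X Y g) = g"
    if "X \<in> Obj A" "Y \<in> Obj A" "g \<in> hom B (FO K X) (FO K Y)" for X Y g
    using someI_ex[of "\<lambda>f. f \<in> hom A X Y \<and> FA K f = g"] full[OF that] unfolding lift_def by blast+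
  define conj where "conj g = j (Cod B g) \<cdot>\<^bsub>B\<^esub> (g \<cdot>\<^bsub>B\<^esub> i (Dom B g))" for g
  have conj: "conj g \<in> hom B (FO K (LO Y)) (FO K (LO Z))" if g: "g \<in> hom B Y Z" for g Y Z
    using g i[of Y] j[of Z] B.hom_Obj[OF g] by (simp add: conj_def hom_iff)
  define L where "L = \<lparr>FO = restrict LO (Obj B),
    FA = (\<lambda>g \<in> Arr B. lift (LO (Dom B g)) (LO (Cod B g)) (conj g))\<rparr>"
  have L: "FA L g \<in> hom A (LO Y) (LO Z)" "FA K (FA L g) = j Z \<cdot>\<^bsub>B\<^esub> (g \<cdot>\<^bsub>B\<^esub> i Y)"
    if g: "g \<in> hom B Y Z" for g Y Z
    using lift[OF LO LO conj[OF g]] B.hom_Obj[OF g] g by (simp_all add: L_def conj_def hom_iff)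
  have LO': "FO L Z = LO Z" if "Z \<in> Obj B" for Z using that by (simp add: L_def)
  have K_comp: "FA K (f \<cdot>\<^bsub>A\<^esub> g) = FA K f \<cdot>\<^bsub>B\<^esub> FA K g" if "g \<in> hom A X Y" "f \<in> hom A Y Z" for f g X Y Z
    using that K'(8) by (simp add: hom_iff)
  have functor_L: "is_functor B A L"
    unfolding is_functor_def
  proof (intro conjI ballI impI)
    show "FO L \<in> Obj B \<rightarrow>\<^sub>E Obj A" "FA L \<in> extensional (Arr B)" using LO by (auto simp: L_def)
    show "FA L f \<in> hom A (FO L (Dom B f)) (FO L (Cod B f))" if "f \<in> Arr B" for f
      using L(1)[of f "Dom B f" "Cod B f"] that by (simp add: LO' hom_iff)
    show "FA L (Ide B X) = Ide A (FO L X)" if X: "X \<in> Obj B" for X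
    proof (rule faithful)
      have I: "Ide B X \<in> hom B X X" using X by (rule B.Ide_in_hom)
      show "FA L (Ide B X) \<in> hom A (LO X) (LO X)" by (rule L(1)[OF I])
      show "Ide A (FO L X) \<in> hom A (LO X) (LO X)" using LO[OF X] LO'[OF X] A.Ide_in_hom by simp
      show "FA K (FA L (Ide B X)) = FA K (Ide A (FO L X))"
        using L(2)[OF I] i[OF X] ji[OF X] K'(7)[OF LO[OF X]] LO'[OF X] by (simp add: hom_iff)
    qed
    fix f g assume "f \<in> Arr B" "g \<in> Arr B" "Dom B g = Cod B f"
    then obtain X Y Z where f: "f \<in> hom B X Y" and g: "g \<in> hom B Y Z" by (auto simp: hom_iff)
    have ob: "X \<in> Obj B" "Y \<in> Obj B" "Z \<in> Obj B" using B.hom_Obj f g by blast+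
    have gf: "g \<cdot>\<^bsub>B\<^esub> f \<in> hom B X Z" using f g by (rule B.Comp_in_hom)
    show "FA L (g \<cdot>\<^bsub>B\<^esub> f) = FA L g \<cdot>\<^bsub>A\<^esub> FA L f"
    proof (rule faithful)
      show "FA L (g \<cdot>\<^bsub>B\<^esub> f) \<in> hom A (LO X) (LO Z)" by (rule L(1)[OF gf])
      show "FA L g \<cdot>\<^bsub>A\<^esub> FA L f \<in> hom A (LO X) (LO Z)"
        using L(1)[OF f] L(1)[OF g] by (rule A.Comp_in_hom)
      note t = i[OF ob(1)] i[OF ob(2)] j[OF ob(2)] j[OF ob(3)] f g
      have "FA K (FA L g \<cdot>\<^bsub>A\<^esub> FA L f) = (j Z \<cdot>\<^bsub>B\<^esub> (g \<cdot>\<^bsub>B\<^esub> i Y)) \<cdot>\<^bsub>B\<^esub> (j Y \<cdot>\<^bsub>B\<^esub> (f \<cdot>\<^bsub>B\<^esub> i X))"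
        using K_comp[OF L(1)[OF f] L(1)[OF g]] L(2)[OF f] L(2)[OF g] by simp
      also have "\<dots> = j Z \<cdot>\<^bsub>B\<^esub> (g \<cdot>\<^bsub>B\<^esub> ((i Y \<cdot>\<^bsub>B\<^esub> j Y) \<cdot>\<^bsub>B\<^esub> (f \<cdot>\<^bsub>B\<^esub> i X)))"
        using t by (simp add: hom_iff)
      also have "\<dots> = j Z \<cdot>\<^bsub>B\<^esub> ((g \<cdot>\<^bsub>B\<^esub> f) \<cdot>\<^bsub>B\<^esub> i X)"
        unfolding ij[OF ob(2)] using t by (simp add: hom_iff)
      finally show "FA K (FA L (g \<cdot>\<^bsub>B\<^esub> f)) = FA K (FA L g \<cdot>\<^bsub>A\<^esub> FA L f)" using L(2)[OF gf] by simp
    qed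
  qed (use A.category_axioms B.category_axioms in auto)
  have "nat_trans B B (comp_ftr B K L) (id_ftr B) (restrict i (Obj B))"
  proof (rule nat_transI)
    show "is_functor B B (comp_ftr B K L)" by (rule is_functor_comp[OF functor_L K])
    show "is_functor B B (id_ftr B)"
      using B.category_axioms by (auto simp: is_functor_def id_ftr_def hom_iff)
    show "restrict i (Obj B) X \<in> hom B (FO (comp_ftr B K L) X) (FO (id_ftr B) X)" if "X \<in> Obj B" for X
      using that i by (simp add: comp_ftr_def id_ftr_def LO')
    fix X Y f assume f: "f \<in> hom B X Y"
    have ob: "X \<in> Obj B" "Y \<in> Obj B" using B.hom_Obj[OF f] by auto
    have "i Y \<cdot>\<^bsub>B\<^esub> (j Y \<cdot>\<^bsub>B\<^esub> (f \<cdot>\<^bsub>B\<^esub> i X)) = (i Y \<cdot>\<^bsub>B\<^esub> j Y) \<cdot>\<^bsub>B\<^esub> (f \<cdot>\<^bsub>B\<^esub> i X)"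
      using f i[OF ob(1)] i[OF ob(2)] j[OF ob(2)] by (simp add: hom_iff)
    also have "\<dots> = f \<cdot>\<^bsub>B\<^esub> i X" unfolding ij[OF ob(2)] using f i[OF ob(1)] by (simp add: hom_iff)
    finally show "restrict i (Obj B) Y \<cdot>\<^bsub>B\<^esub> FA (comp_ftr B K L) f = FA (id_ftr B) f \<cdot>\<^bsub>B\<^esub> restrict i (Obj B) X"
      using L(2)[OF f] f ob by (simp add: comp_ftr_def id_ftr_def hom_iff)
  qed simp
  moreover have "is_iso B (restrict i (Obj B) X)" if "X \<in> Obj B" for X
    using B.is_isoI[OF i j ji ij] that by simp
  ultimately have counit: "naturally_iso B B (comp_ftr B K L) (id_ftr B)"
    unfolding naturally_iso_def by blast
  \<comment> \<open>preimages under \<open>K\<close> of the components of the counit and of its inverse give the unit\<close>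
  define u where "u X = lift (LO (FO K X)) X (i (FO K X))" for X
  define v where "v X = lift X (LO (FO K X)) (j (FO K X))" for X
  have u: "u X \<in> hom A (LO (FO K X)) X" "FA K (u X) = i (FO K X)" if "X \<in> Obj A" for X
    using lift[OF LO that i] K'(3)[OF that] by (simp_all add: u_def)
  have v: "v X \<in> hom A X (LO (FO K X))" "FA K (v X) = j (FO K X)" if "X \<in> Obj A" for X
    using lift[OF that LO j] K'(3)[OF that] by (simp_all add: v_def)
  have "nat_trans A A (comp_ftr A L K) (id_ftr A) (restrict u (Obj A))"
  proof (rule nat_transI)
    show "is_functor A A (comp_ftr A L K)" by (rule is_functor_comp[OF K functor_L])
    show "is_functor A A (id_ftr A)"
      using A.category_axioms by (auto simp: is_functor_def id_ftr_def hom_iff)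
    show "restrict u (Obj A) X \<in> hom A (FO (comp_ftr A L K) X) (FO (id_ftr A) X)" if "X \<in> Obj A" for X
      using that u K'(3) by (simp add: comp_ftr_def id_ftr_def LO')
    fix X Y f assume f: "f \<in> hom A X Y"
    have ob: "X \<in> Obj A" "Y \<in> Obj A" using A.hom_Obj[OF f] by auto
    note ob' = K'(3)[OF ob(1)] K'(3)[OF ob(2)]
    note Kf = is_functor_hom[OF K f]
    have "u Y \<cdot>\<^bsub>A\<^esub> FA L (FA K f) = f \<cdot>\<^bsub>A\<^esub> u X"
    proof (rule faithful)
      show "u Y \<cdot>\<^bsub>A\<^esub> FA L (FA K f) \<in> hom A (LO (FO K X)) Y"
        using L(1)[OF Kf] u(1)[OF ob(2)] by (rule A.Comp_in_hom)
      show "f \<cdot>\<^bsub>A\<^esub> u X \<in> hom A (LO (FO K X)) Y" using u(1)[OF ob(1)] f by (rule A.Comp_in_hom)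
      have "FA K (u Y \<cdot>\<^bsub>A\<^esub> FA L (FA K f)) = i (FO K Y) \<cdot>\<^bsub>B\<^esub> (j (FO K Y) \<cdot>\<^bsub>B\<^esub> (FA K f \<cdot>\<^bsub>B\<^esub> i (FO K X)))"
        using K_comp[OF L(1)[OF Kf] u(1)[OF ob(2)]] u(2)[OF ob(2)] L(2)[OF Kf] by simp
      also have "\<dots> = (i (FO K Y) \<cdot>\<^bsub>B\<^esub> j (FO K Y)) \<cdot>\<^bsub>B\<^esub> (FA K f \<cdot>\<^bsub>B\<^esub> i (FO K X))"
        using Kf i[OF ob'(1)] i[OF ob'(2)] j[OF ob'(2)] by (simp add: hom_iff)
      also have "\<dots> = FA K f \<cdot>\<^bsub>B\<^esub> i (FO K X)"
        unfolding ij[OF ob'(2)] using Kf i[OF ob'(1)] by (simp add: hom_iff)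
      also have "\<dots> = FA K (f \<cdot>\<^bsub>A\<^esub> u X)" using K_comp[OF u(1)[OF ob(1)] f] u(2)[OF ob(1)] by simp
      finally show "FA K (u Y \<cdot>\<^bsub>A\<^esub> FA L (FA K f)) = FA K (f \<cdot>\<^bsub>A\<^esub> u X)" .
    qed
    then show "restrict u (Obj A) Y \<cdot>\<^bsub>A\<^esub> FA (comp_ftr A L K) f = FA (id_ftr A) f \<cdot>\<^bsub>A\<^esub> restrict u (Obj A) X"
      using f ob by (simp add: comp_ftr_def id_ftr_def hom_iff)
  qed simp
  moreover have "is_iso A (restrict u (Obj A) X)" if X: "X \<in> Obj A" for X
  proof -
    have KX: "FO K X \<in> Obj B" using X by (rule K'(3))
    have "v X \<cdot>\<^bsub>A\<^esub> u X = Ide A (LO (FO K X))"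
    proof (rule faithful)
      show "v X \<cdot>\<^bsub>A\<^esub> u X \<in> hom A (LO (FO K X)) (LO (FO K X))" using u(1)[OF X] v(1)[OF X] by (rule A.Comp_in_hom)
      show "FA K (v X \<cdot>\<^bsub>A\<^esub> u X) = FA K (Ide A (LO (FO K X)))"
        using K_comp[OF u(1)[OF X] v(1)[OF X]] u(2)[OF X] v(2)[OF X] ji[OF KX] K'(7)[OF LO[OF KX]] by simp
    qed (rule A.Ide_in_hom[OF LO[OF KX]])
    moreover have "u X \<cdot>\<^bsub>A\<^esub> v X = Ide A X"
    proof (rule faithful)
      show "u X \<cdot>\<^bsub>A\<^esub> v X \<in> hom A X X" using v(1)[OF X] u(1)[OF X] by (rule A.Comp_in_hom)
      show "FA K (u X \<cdot>\<^bsub>A\<^esub> v X) = FA K (Ide A X)"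
        using K_comp[OF v(1)[OF X] u(1)[OF X]] u(2)[OF X] v(2)[OF X] ij[OF KX] K'(7)[OF X] by simp
    qed (rule A.Ide_in_hom[OF X])
    ultimately show ?thesis using A.is_isoI[OF u(1)[OF X] v(1)[OF X]] X by simp
  qed
  ultimately have "naturally_iso A A (comp_ftr A L K) (id_ftr A)"
    unfolding naturally_iso_def by blast
  then show ?thesis using K functor_L counit unfolding is_equivalence_def by blast
qed


section \<open>Full subcategories of projectives covering an exact category\<close>

lemma cone_image:
  assumes F: "is_functor W E F" and D: "is_functor J W D" and c: "is_cone J W D V c"
  shows "is_cone J E (comp_ftr J F D) (FO F V) (\<lambda>j. FA F (c j))"
proof -
  note D' = is_functorD[OF D] and F' = is_functorD[OF F]
  have C: "V \<in> Obj W" "\<And>j. j \<in> Obj J \<Longrightarrow> c j \<in> hom W V (FO D j)"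
    "\<And>u. u \<in> Arr J \<Longrightarrow> FA D u \<cdot>\<^bsub>W\<^esub> c (Dom J u) = c (Cod J u)"
    using c by (auto simp: is_cone_def)
  interpret J: category J by fact
  have "FA F (FA D u) \<cdot>\<^bsub>E\<^esub> FA F (c (Dom J u)) = FA F (c (Cod J u))" if u: "u \<in> Arr J" for u
  proof -
    have "c (Dom J u) \<in> hom W V (FO D (Dom J u))" using C(2) u by simp
    then have "FA F (FA D u \<cdot>\<^bsub>W\<^esub> c (Dom J u)) = FA F (FA D u) \<cdot>\<^bsub>E\<^esub> FA F (c (Dom J u))"
      using D' u by (intro F'(8)) (simp_all add: hom_iff)
    then show ?thesis using C(3)[OF u] by simp
  qed
  then show ?thesis
    using C F'(3) is_functor_hom[OF F] unfolding is_cone_def by (simp add: comp_ftr_def)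
qed

lemma finite_diagram_image:
  "\<lbrakk>is_functor W E F; finite_diagram J W D\<rbrakk> \<Longrightarrow> finite_diagram J E (comp_ftr J F D)"
  by (auto simp: finite_diagram_def intro: is_functor_comp)

lemma limit_factor:
  assumes "is_limit J C D L l" "is_cone J C D U b"
  obtains k where "k \<in> hom C U L" "\<And>j. j \<in> Obj J \<Longrightarrow> l j \<cdot>\<^bsub>C\<^esub> k = b j"
  using assms unfolding is_limit_def by metis

lemma (in category_notation) limit_unique:
  assumes lim: "is_limit J C D L l" and h: "h \<in> hom C U L" "h' \<in> hom C U L"
    and eq: "\<And>j. j \<in> Obj J \<Longrightarrow> l j \<cdot> h = l j \<cdot> h'"
    and D: "is_functor J C D"
  shows "h = h'"
proof -
  note D' = is_functorD[OF D]
  interpret J: category J by fact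
  have L: "\<And>j. j \<in> Obj J \<Longrightarrow> l j \<in> hom C L (FO D j)"
    "\<And>u. u \<in> Arr J \<Longrightarrow> FA D u \<cdot> l (Dom J u) = l (Cod J u)"
    using lim by (auto simp: is_limit_def is_cone_def)
  have "is_cone J C D U (\<lambda>j. l j \<cdot> h)"
    unfolding is_cone_def
  proof (intro conjI ballI)
    show "U \<in> Obj C" using hom_Obj[OF h(1)] by simp
    show "l j \<cdot> h \<in> hom C U (FO D j)" if "j \<in> Obj J" for j
      using Comp_in_hom[OF h(1) L(1)[OF that]] .
    fix u assume u: "u \<in> Arr J"
    have "FA D u \<in> hom C (FO D (Dom J u)) (FO D (Cod J u))" using D' u by (simp add: hom_iff)
    from Comp_assoc[OF h(1) L(1) this] show "FA D u \<cdot> (l (Dom J u) \<cdot> h) = l (Cod J u) \<cdot> h"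
      using L(2)[OF u] u by simp
  qed
  then have "\<exists>!k. k \<in> hom C U L \<and> (\<forall>j \<in> Obj J. l j \<cdot> k = l j \<cdot> h)"
    using lim unfolding is_limit_def by blast
  then show ?thesis using h eq by metis
qed

lemma exact_functor_cover:
  assumes F: "exact_functor X E F" and e: "is_cover X e A B"
  shows "is_cover E (FA F e) (FO F A) (FO F B)"
  using assms is_functor_hom[of X E F e A B] unfolding exact_functor_def is_cover_def by blast

lemma exact_functor_pullback:
  assumes "exact_functor X E F" "is_pullback X f g p q"
  shows "is_pullback E (FA F f) (FA F g) (FA F p) (FA F q)"
proof (rule limit_preserving_pullback[OF _ _ assms(2)])
  show "is_functor X E F" using assms(1) by (simp add: exact_functor_def)
qed (use assms(1) in \<open>simp add: exact_functor_def\<close>)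

text \<open>These properties of \<open>\<Gamma>\<close> characterise the exact completion of \<open>W\<close>, see the theorem
  \<open>exact_completion\<close> below: every object of \<open>X\<close> is then the coequalizer of a
  parallel pair coming from \<open>W\<close>, a weak kernel pair of a cover.\<close>

locale projective_presentation = W: category W + X: exact_cat X
  for W :: "('w, 'v) cat" and X :: "('o, 'a) cat" (structure) +
  fixes \<Gamma> :: "('w, 'v, 'o, 'a) ftr"
  assumes is_functor_\<Gamma>: "is_functor W X \<Gamma>"
    and full: "\<lbrakk>V \<in> Obj W; T \<in> Obj W; a \<in> hom X (FO \<Gamma> V) (FO \<Gamma> T)\<rbrakk> \<Longrightarrow> \<exists>g \<in> hom W V T. FA \<Gamma> g = a"
    and faithful: "\<lbrakk>f \<in> hom W V T; g \<in> hom W V T; FA \<Gamma> f = FA \<Gamma> g\<rbrakk> \<Longrightarrow> f = g"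
    and projective: "\<lbrakk>V \<in> Obj W; is_cover X e A B; a \<in> hom X (FO \<Gamma> V) B\<rbrakk>
      \<Longrightarrow> \<exists>b \<in> hom X (FO \<Gamma> V) A. e \<cdot> b = a"
    and covered: "A \<in> Obj X \<Longrightarrow> \<exists>V \<in> Obj W. \<exists>e. is_cover X e (FO \<Gamma> V) A"
begin

abbreviation "Go \<equiv> FO \<Gamma>"
abbreviation "Ga \<equiv> FA \<Gamma>"

lemma Ga_hom: "f \<in> hom W V T \<Longrightarrow> Ga f \<in> hom X (Go V) (Go T)"
  by (rule is_functor_hom[OF is_functor_\<Gamma>])

lemma Ga_Comp: "\<lbrakk>f \<in> hom W V T; g \<in> hom W T S\<rbrakk> \<Longrightarrow> Ga (g \<cdot>\<^bsub>W\<^esub> f) = Ga g \<cdot> Ga f"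
  using is_functorD(8)[OF is_functor_\<Gamma>] by (simp add: hom_iff)

lemma projective_lift:
  assumes "V \<in> Obj W" "T \<in> Obj W" "is_cover X e (Go T) B" "a \<in> hom X (Go V) B"
  obtains g where "g \<in> hom W V T" "e \<cdot> Ga g = a"
  using projective[OF assms(1,3,4)] full[OF assms(1,2)] by metis

text \<open>A weak limit in \<open>W\<close> is nothing but a cover of the limit taken in \<open>X\<close>.\<close>

lemma limit_cover:
  assumes D': "is_functor J W D" and lim: "is_limit J X (comp_ftr J \<Gamma> D) L l"
  obtains V e c where "V \<in> Obj W" "is_cover X e (Go V) L" "is_cone J W D V c"
    "\<forall>j \<in> Obj J. Ga (c j) = l j \<cdot> e"
proof -
  interpret J: category J using D' by (rule is_functorD)
  have L: "L \<in> Obj X" "\<And>j. j \<in> Obj J \<Longrightarrow> l j \<in> hom X L (Go (FO D j))"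
    "\<And>u. u \<in> Arr J \<Longrightarrow> Ga (FA D u) \<cdot> l (Dom J u) = l (Cod J u)"
    using lim by (auto simp: is_limit_def is_cone_def comp_ftr_def)
  obtain V e where V: "V \<in> Obj W" "is_cover X e (Go V) L" using covered[OF L(1)] by blast
  have e: "e \<in> hom X (Go V) L" using V(2) by (simp add: is_cover_def)
  have "\<exists>c. c \<in> hom W V (FO D j) \<and> Ga c = l j \<cdot> e" if j: "j \<in> Obj J" for j
    using full[OF V(1) is_functorD(3)[OF D' j] X.Comp_in_hom[OF e L(2)[OF j]]] by blast
  then obtain c where c: "\<And>j. j \<in> Obj J \<Longrightarrow> c j \<in> hom W V (FO D j)"
    "\<And>j. j \<in> Obj J \<Longrightarrow> Ga (c j) = l j \<cdot> e" by metis
  have "is_cone J W D V c"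
    unfolding is_cone_def
  proof (intro conjI ballI)
    fix u assume u: "u \<in> Arr J"
    have Du: "FA D u \<in> hom W (FO D (Dom J u)) (FO D (Cod J u))"
      using is_functorD[OF D'] u by (simp add: hom_iff)
    have ob: "Dom J u \<in> Obj J" "Cod J u \<in> Obj J" using u by auto
    show "FA D u \<cdot>\<^bsub>W\<^esub> c (Dom J u) = c (Cod J u)"
    proof (rule faithful)
      show "FA D u \<cdot>\<^bsub>W\<^esub> c (Dom J u) \<in> hom W V (FO D (Cod J u))"
        using c(1)[OF ob(1)] Du by (rule W.Comp_in_hom)
      show "c (Cod J u) \<in> hom W V (FO D (Cod J u))" by (rule c(1)[OF ob(2)])
      have "Ga (FA D u \<cdot>\<^bsub>W\<^esub> c (Dom J u)) = (Ga (FA D u) \<cdot> l (Dom J u)) \<cdot> e"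
        using Ga_Comp[OF c(1)[OF ob(1)] Du] c(2)[OF ob(1)] X.Comp_assoc[OF e L(2)[OF ob(1)] Ga_hom[OF Du]]
        by simp
      then show "Ga (FA D u \<cdot>\<^bsub>W\<^esub> c (Dom J u)) = Ga (c (Cod J u))"
        using L(3)[OF u] c(2)[OF ob(2)] by simp
    qed
  qed (use V c in auto)
  then show ?thesis using that V c(2) by blast
qed

lemma weakly_lex_W: "weakly_lex W"
  unfolding weakly_lex_def
proof (intro conjI allI impI)
  fix J D assume D: "finite_diagram J W D"
  have D': "is_functor J W D" using D by (simp add: finite_diagram_def)
  obtain L l where lim: "is_limit J X (comp_ftr J \<Gamma> D) L l"
    using X.limit_ex[OF finite_diagram_image[OF is_functor_\<Gamma> D]] by blast
  have l: "l j \<in> hom X L (Go (FO D j))" if "j \<in> Obj J" for j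
    using lim that by (simp add: is_limit_def is_cone_def comp_ftr_def)
  obtain V e c where V: "V \<in> Obj W" "is_cover X e (Go V) L" and c: "is_cone J W D V c"
    "\<forall>j \<in> Obj J. Ga (c j) = l j \<cdot> e"
    using limit_cover[OF D' lim] .
  have e: "e \<in> hom X (Go V) L" using V(2) by (simp add: is_cover_def)
  have "\<exists>h. h \<in> hom W U V \<and> (\<forall>j \<in> Obj J. c j \<cdot>\<^bsub>W\<^esub> h = b j)" if b: "is_cone J W D U b" for U b
  proof -
    have B: "U \<in> Obj W" "\<And>j. j \<in> Obj J \<Longrightarrow> b j \<in> hom W U (FO D j)"
      using b by (auto simp: is_cone_def)
    obtain k where k: "k \<in> hom X (Go U) L" "\<And>j. j \<in> Obj J \<Longrightarrow> l j \<cdot> k = Ga (b j)"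
      using limit_factor[OF lim cone_image[OF is_functor_\<Gamma> D' b]] by blast
    obtain h where h: "h \<in> hom W U V" "e \<cdot> Ga h = k"
      using projective_lift[OF B(1) V k(1)] .
    have "c j \<cdot>\<^bsub>W\<^esub> h = b j" if j: "j \<in> Obj J" for j
    proof (rule faithful)
      have cj: "c j \<in> hom W V (FO D j)" using c(1) j by (simp add: is_cone_def)
      show "c j \<cdot>\<^bsub>W\<^esub> h \<in> hom W U (FO D j)" using h(1) cj by (rule W.Comp_in_hom)
      show "b j \<in> hom W U (FO D j)" by (rule B(2)[OF j])
      show "Ga (c j \<cdot>\<^bsub>W\<^esub> h) = Ga (b j)"
        using Ga_Comp[OF h(1) cj] c(2) j X.Comp_assoc[OF Ga_hom[OF h(1)] e l[OF j]] h(2) k(2)[OF j]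
        by simp
    qed
    then show ?thesis using h(1) by blast
  qed
  then show "\<exists>V c. is_weak_limit J W D V c" using c(1) unfolding is_weak_limit_def by blast
qed (rule W.category_axioms)

lemma left_covering_\<Gamma>: "left_covering W X \<Gamma>"
  unfolding left_covering_def
proof (intro conjI allI impI)
  show "is_functor W X \<Gamma>" by (rule is_functor_\<Gamma>)
  fix J D V c L l h
  assume "finite_diagram J W D \<and> is_weak_limit J W D V c \<and> is_limit J X (comp_ftr J \<Gamma> D) L l \<and>
    h \<in> hom X (Go V) L \<and> (\<forall>j \<in> Obj J. l j \<cdot> h = Ga (c j))"
  then have D': "is_functor J W D" and wl: "is_weak_limit J W D V c"
    and lim: "is_limit J X (comp_ftr J \<Gamma> D) L l" and h: "h \<in> hom X (Go V) L"
    "\<And>j. j \<in> Obj J \<Longrightarrow> l j \<cdot> h = Ga (c j)" by (auto simp: finite_diagram_def)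
  have l: "l j \<in> hom X L (Go (FO D j))" "c j \<in> hom W V (FO D j)" if "j \<in> Obj J" for j
    using lim wl that by (simp_all add: is_limit_def is_weak_limit_def is_cone_def comp_ftr_def)
  obtain U e b where "U \<in> Obj W" and U: "is_cover X e (Go U) L" and b: "is_cone J W D U b"
    "\<forall>j \<in> Obj J. Ga (b j) = l j \<cdot> e"
    using limit_cover[OF D' lim] .
  have e: "e \<in> hom X (Go U) L" using U by (simp add: is_cover_def)
  obtain k where k: "k \<in> hom W U V" "\<And>j. j \<in> Obj J \<Longrightarrow> c j \<cdot>\<^bsub>W\<^esub> k = b j"
    using wl b(1) unfolding is_weak_limit_def by blast
  \<comment> \<open>the cover \<open>e\<close> factors through \<open>h\<close>\<close>
  have "h \<cdot> Ga k = e"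
  proof (rule X.limit_unique[OF lim _ e _ is_functor_comp[OF D' is_functor_\<Gamma>]])
    show "h \<cdot> Ga k \<in> hom X (Go U) L" using Ga_hom[OF k(1)] h(1) by (rule X.Comp_in_hom)
    show "l j \<cdot> (h \<cdot> Ga k) = l j \<cdot> e" if j: "j \<in> Obj J" for j
      using X.Comp_assoc[OF Ga_hom[OF k(1)] h(1) l(1)[OF j]] h(2)[OF j]
        Ga_Comp[OF k(1) l(2)[OF j]] k(2)[OF j] b(2) j by simp
  qed
  then show "regular_epi X h"
    using X.is_cover_right_factor[OF _ Ga_hom[OF k(1)] h(1)] U by (simp add: is_cover_def)
qed

text \<open>The cover \<open>c\<close> of the kernel pair of \<open>a\<close> turns the kernel pair into a pair of arrows of \<open>W\<close>,
  a weak kernel pair of \<open>a\<close>.\<close>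

lemma weak_kernel_pair:
  assumes a: "a \<in> hom X (Go V) A" and V: "V \<in> Obj W"
  obtains p q c R r s where "is_pullback X a a p q" "R \<in> Obj W" "is_cover X c (Go R) (Dom X p)"
    "r \<in> hom W R V" "s \<in> hom W R V" "Ga r = p \<cdot> c" "Ga s = q \<cdot> c"
    "a \<cdot> Ga r = a \<cdot> Ga s"
    "\<And>T u v. \<lbrakk>u \<in> hom W T V; v \<in> hom W T V; a \<cdot> Ga u = a \<cdot> Ga v\<rbrakk>
      \<Longrightarrow> \<exists>k \<in> hom W T R. r \<cdot>\<^bsub>W\<^esub> k = u \<and> s \<cdot>\<^bsub>W\<^esub> k = v"
proof -
  have A: "a \<in> Arr X" "Dom X a = Go V" "Cod X a = A" using a by (auto simp: hom_iff)
  obtain p q where pq: "is_pullback X a a p q" using X.pullback_ex[OF A(1) A(1)] by blast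
  define K where "K = Dom X p"
  have P: "p \<in> hom X K (Go V)" "q \<in> hom X K (Go V)"
    using X.is_pullbackD[OF pq] A by (simp_all add: hom_iff K_def)
  obtain R c where R: "R \<in> Obj W" "is_cover X c (Go R) K"
    using covered[of K] X.hom_Obj[OF P(1)] by blast
  have c: "c \<in> hom X (Go R) K" using R(2) by (simp add: is_cover_def)
  obtain r where r: "r \<in> hom W R V" "Ga r = p \<cdot> c"
    using full[OF R(1) V X.Comp_in_hom[OF c P(1)]] by blast
  obtain s where s: "s \<in> hom W R V" "Ga s = q \<cdot> c"
    using full[OF R(1) V X.Comp_in_hom[OF c P(2)]] by blast
  show ?thesis
  proof (rule that[OF pq R(1) _ r(1) s(1) r(2) s(2)])
    show "is_cover X c (Go R) (Dom X p)" using R by (simp add: K_def)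
    show "a \<cdot> Ga r = a \<cdot> Ga s"
      using X.Comp_assoc[OF c P(1) a] X.Comp_assoc[OF c P(2) a] r(2) s(2) X.is_pullbackD(9)[OF pq] by simp
    fix T u v assume uv: "u \<in> hom W T V" "v \<in> hom W T V" "a \<cdot> Ga u = a \<cdot> Ga v"
    obtain h where h: "h \<in> hom X (Go T) K" "p \<cdot> h = Ga u" "q \<cdot> h = Ga v"
      using X.pullback_lift[OF pq, of "Ga u" "Go T" "Ga v"] Ga_hom[OF uv(1)] Ga_hom[OF uv(2)] uv(3) A(2)
      by (auto simp: K_def)
    obtain k where k: "k \<in> hom W T R" "c \<cdot> Ga k = h"
      using projective_lift[OF _ R h(1)] W.hom_Obj[OF uv(1)] by blast
    have "r \<cdot>\<^bsub>W\<^esub> k = u"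
    proof (rule faithful)
      show "r \<cdot>\<^bsub>W\<^esub> k \<in> hom W T V" using k(1) r(1) by (rule W.Comp_in_hom)
      show "Ga (r \<cdot>\<^bsub>W\<^esub> k) = Ga u"
        using Ga_Comp[OF k(1) r(1)] r(2) X.Comp_assoc[OF Ga_hom[OF k(1)] c P(1)] k(2) h(2) by simp
    qed (rule uv)
    moreover have "s \<cdot>\<^bsub>W\<^esub> k = v"
    proof (rule faithful)
      show "s \<cdot>\<^bsub>W\<^esub> k \<in> hom W T V" using k(1) s(1) by (rule W.Comp_in_hom)
      show "Ga (s \<cdot>\<^bsub>W\<^esub> k) = Ga v"
        using Ga_Comp[OF k(1) s(1)] s(2) X.Comp_assoc[OF Ga_hom[OF k(1)] c P(2)] k(2) h(3) by simp
    qed (rule uv)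
    ultimately show "\<exists>k \<in> hom W T R. r \<cdot>\<^bsub>W\<^esub> k = u \<and> s \<cdot>\<^bsub>W\<^esub> k = v" using k(1) by blast
  qed
qed

end


section \<open>Restriction of exact functors along the presentation\<close>

locale exact_restriction = projective_presentation W X \<Gamma> + E: exact_cat E
  for W :: "('w, 'v) cat" and X :: "('o, 'a) cat" and \<Gamma> :: "('w, 'v, 'o, 'a) ftr"
    and E :: "('p, 'b) cat" (structure)
begin

text \<open>The arrow from \<open>F (Go V)\<close> to the limit in \<open>E\<close> is, up to the isomorphism of two limits, the image
  of the arrow from \<open>Go V\<close> to the limit in \<open>X\<close>; the latter is a cover and \<open>F\<close> preserves covers.\<close>

lemma left_covering_restriction:
  assumes F: "exact_functor X E F"
  shows "left_covering W E (comp_ftr W F \<Gamma>)"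
  unfolding left_covering_def
proof (intro conjI allI impI)
  have fF: "is_functor X E F" using F by (simp add: exact_functor_def)
  show "is_functor W E (comp_ftr W F \<Gamma>)" by (rule is_functor_comp[OF is_functor_\<Gamma> fF])
  fix J D V c L l h
  assume "finite_diagram J W D \<and> is_weak_limit J W D V c \<and>
    is_limit J E (comp_ftr J (comp_ftr W F \<Gamma>) D) L l \<and>
    h \<in> hom E (FO (comp_ftr W F \<Gamma>) V) L \<and> (\<forall>j \<in> Obj J. l j \<cdot> h = FA (comp_ftr W F \<Gamma>) (c j))"
  then have D: "finite_diagram J W D" and wl: "is_weak_limit J W D V c"
    and lim: "is_limit J E (comp_ftr J (comp_ftr W F \<Gamma>) D) L l"
    and h: "h \<in> hom E (FO (comp_ftr W F \<Gamma>) V) L"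
    "\<And>j. j \<in> Obj J \<Longrightarrow> l j \<cdot> h = FA (comp_ftr W F \<Gamma>) (c j)" by auto
  have D': "is_functor J W D" using D by (simp add: finite_diagram_def)
  interpret J: category J using D' by (rule is_functorD)
  note GD = is_functor_comp[OF D' is_functor_\<Gamma>]
  note FGD = is_functor_comp[OF GD fF]
  have eq: "comp_ftr J (comp_ftr W F \<Gamma>) D = comp_ftr J F (comp_ftr J \<Gamma> D)"
    using is_functorD(3,4)[OF D'] by (auto simp: comp_ftr_def fun_eq_iff)
  have c: "V \<in> Obj W" "\<And>j. j \<in> Obj J \<Longrightarrow> c j \<in> hom W V (FO D j)" "is_cone J W D V c"
    using wl by (auto simp: is_weak_limit_def is_cone_def)
  obtain K m where K: "is_limit J X (comp_ftr J \<Gamma> D) K m"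
    using X.limit_ex[OF finite_diagram_image[OF is_functor_\<Gamma> D]] by blast
  obtain k where k: "k \<in> hom X (Go V) K" "\<And>j. j \<in> Obj J \<Longrightarrow> m j \<cdot>\<^bsub>X\<^esub> k = Ga (c j)"
    using limit_factor[OF K cone_image[OF is_functor_\<Gamma> D' c(3)]] by blast
  have "regular_epi X k"
    using left_covering_\<Gamma> D wl K k unfolding left_covering_def by blast
  then have "is_cover E (FA F k) (FO F (Go V)) (FO F K)"
    using exact_functor_cover[OF F] k(1) by (simp add: is_cover_def)
  moreover have FK: "is_limit J E (comp_ftr J F (comp_ftr J \<Gamma> D)) (FO F K) (\<lambda>j. FA F (m j))"
    using F K finite_diagram_image[OF is_functor_\<Gamma> D] unfolding exact_functor_def by blast
  \<comment> \<open>\<open>L\<close> and \<open>F K\<close> are limits of the same diagram in \<open>E\<close>\<close>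
  have coneL: "is_cone J E (comp_ftr J F (comp_ftr J \<Gamma> D)) L l"
    using lim unfolding is_limit_def eq by blast
  obtain n where n: "n \<in> hom E L (FO F K)" "\<And>j. j \<in> Obj J \<Longrightarrow> FA F (m j) \<cdot> n = l j"
    using limit_factor[OF FK coneL] by blast
  have coneK: "is_cone J E (comp_ftr J (comp_ftr W F \<Gamma>) D) (FO F K) (\<lambda>j. FA F (m j))"
    using FK unfolding is_limit_def eq by blast
  obtain n' where n': "n' \<in> hom E (FO F K) L" "\<And>j. j \<in> Obj J \<Longrightarrow> l j \<cdot> n' = FA F (m j)"
    using limit_factor[OF lim coneK] by blast
  have l: "\<And>j. j \<in> Obj J \<Longrightarrow> l j \<in> hom E L (FO F (Go (FO D j)))"
    "\<And>j. j \<in> Obj J \<Longrightarrow> FA F (m j) \<in> hom E (FO F K) (FO F (Go (FO D j)))"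
    "\<And>j. j \<in> Obj J \<Longrightarrow> m j \<in> hom X K (Go (FO D j))"
    using coneL FK K unfolding is_limit_def is_cone_def by (simp_all add: comp_ftr_def)
  have "n' \<cdot> n = Ide E L"
  proof (rule E.limit_unique[OF lim])
    show "n' \<cdot> n \<in> hom E L L" using n(1) n'(1) by (rule E.Comp_in_hom)
    show I: "Ide E L \<in> hom E L L" using E.hom_Obj[OF n(1)] by (simp add: E.Ide_in_hom)
    show "l j \<cdot> (n' \<cdot> n) = l j \<cdot> Ide E L" if j: "j \<in> Obj J" for j
      using E.Comp_assoc[OF n(1) n'(1) l(1)[OF j]] n(2)[OF j] n'(2)[OF j]
        E.Comp_Ide_right[OF l(1)[OF j]] by simp
  qed (simp add: eq FGD)
  moreover have "n \<cdot> n' = Ide E (FO F K)"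
  proof (rule E.limit_unique[OF FK])
    show "n \<cdot> n' \<in> hom E (FO F K) (FO F K)" using n'(1) n(1) by (rule E.Comp_in_hom)
    show I: "Ide E (FO F K) \<in> hom E (FO F K) (FO F K)"
      using E.hom_Obj[OF n(1)] by (simp add: E.Ide_in_hom)
    show "FA F (m j) \<cdot> (n \<cdot> n') = FA F (m j) \<cdot> Ide E (FO F K)" if j: "j \<in> Obj J" for j
      using E.Comp_assoc[OF n'(1) n(1) l(2)[OF j]] n(2)[OF j] n'(2)[OF j]
        E.Comp_Ide_right[OF l(2)[OF j]] by simp
  qed (rule FGD)
  ultimately have n'_iso: "is_iso E n'" and cov: "is_cover E (FA F k) (FO F (Go V)) (FO F K)"
    using E.is_isoI[OF n'(1) n(1)] by auto
  have Fk: "FA F k \<in> hom E (FO F (Go V)) (FO F K)" using cov by (simp add: is_cover_def)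
  have h': "h \<in> hom E (FO F (Go V)) L" using h(1) c(1) by (simp add: comp_ftr_def)
  have "n' \<cdot> FA F k = h"
  proof (rule E.limit_unique[OF lim _ h'])
    show "n' \<cdot> FA F k \<in> hom E (FO F (Go V)) L" using Fk n'(1) by (rule E.Comp_in_hom)
    show "l j \<cdot> (n' \<cdot> FA F k) = l j \<cdot> h" if j: "j \<in> Obj J" for j
    proof -
      have "c j \<in> Arr W" using c(2)[OF j] by (simp add: hom_iff)
      then have "l j \<cdot> h = FA F (m j \<cdot>\<^bsub>X\<^esub> k)" using h(2)[OF j] k(2)[OF j] by (simp add: comp_ftr_def)
      also have "\<dots> = FA F (m j) \<cdot> FA F k"
        using is_functorD(8)[OF fF] l(3)[OF j] k(1) by (simp add: hom_iff)
      finally show ?thesis using E.Comp_assoc[OF Fk n'(1) l(1)[OF j]] n'(2)[OF j] by simp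
    qed
  qed (simp add: eq FGD)
  then show "regular_epi E h"
    using E.is_cover_iso_comp[OF cov n'_iso n'(1)] by (simp add: is_cover_def)
qed

text \<open>The component at \<open>A\<close> is determined by the one at an object of \<open>W\<close> that covers \<open>A\<close>, since \<open>F\<close>
  preserves the cover.\<close>

lemma restriction_faithful:
  assumes F: "exact_functor X E F" and n: "nat_trans X E F G \<eta>" "nat_trans X E F G \<eta>'"
    and eq: "\<And>V. V \<in> Obj W \<Longrightarrow> \<eta> (Go V) = \<eta>' (Go V)"
  shows "\<eta> = \<eta>'"
proof (rule extensionalityI)
  note N = nat_transD[OF n(1)] and N' = nat_transD[OF n(2)]
  show "\<eta> \<in> extensional (Obj X)" "\<eta>' \<in> extensional (Obj X)" by fact+
  fix A assume A: "A \<in> Obj X"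
  obtain V e where V: "V \<in> Obj W" "is_cover X e (Go V) A" using covered[OF A] by blast
  have e: "e \<in> Arr X" "Dom X e = Go V" "Cod X e = A" using X.is_coverD[OF V(2)] by auto
  have "\<eta> A \<cdot> FA F e = \<eta>' A \<cdot> FA F e"
    using N(5)[OF e(1)] N'(5)[OF e(1)] eq[OF V(1)] e(2,3) by simp
  then show "\<eta> A = \<eta>' A"
    by (rule E.is_cover_cancel[OF exact_functor_cover[OF F V(2)]]) (use N(4) N'(4) A in auto)
qed

text \<open>A transformation given on \<open>W\<close> extends along covers: an exact functor sends a cover of \<open>A\<close>
  to a coequalizer of the image of its weak kernel pair.\<close>

lemma restriction_full:
  assumes F: "exact_functor X E F" and G: "exact_functor X E G"
    and t: "nat_trans W E (comp_ftr W F \<Gamma>) (comp_ftr W G \<Gamma>) \<theta>"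
  obtains \<eta> where "nat_trans X E F G \<eta>" "\<And>V. V \<in> Obj W \<Longrightarrow> \<eta> (Go V) = \<theta> V"
proof -
  have fF: "is_functor X E F" and fG: "is_functor X E G" using F G by (simp_all add: exact_functor_def)
  note F' = is_functorD[OF fF] and G' = is_functorD[OF fG] and T = nat_transD[OF t]
  note Fh = is_functor_hom[OF fF] and Gh = is_functor_hom[OF fG]
  have Fc: "FA F (g \<cdot>\<^bsub>X\<^esub> f) = FA F g \<cdot> FA F f" if "f \<in> hom X A B" "g \<in> hom X B D" for f g A B D
    using that F'(8) by (simp add: hom_iff)
  have Gc: "FA G (g \<cdot>\<^bsub>X\<^esub> f) = FA G g \<cdot> FA G f" if "f \<in> hom X A B" "g \<in> hom X B D" for f g A B D
    using that G'(8) by (simp add: hom_iff)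
  have th: "\<theta> V \<in> hom E (FO F (Go V)) (FO G (Go V))" if "V \<in> Obj W" for V
    using T(4)[OF that] that by (simp add: comp_ftr_def)
  have tn: "\<theta> S \<cdot> FA F (Ga f) = FA G (Ga f) \<cdot> \<theta> V" if "f \<in> hom W V S" for f V S
    using T(5)[of f] that by (simp add: comp_ftr_def hom_iff)
  have step: "\<exists>m \<in> hom E (FO F A) (FO G A). m \<cdot> FA F a = FA G a \<cdot> \<theta> V"
    if V: "V \<in> Obj W" and cov: "is_cover X a (Go V) A" for A V a
  proof -
    have a: "a \<in> hom X (Go V) A" using cov by (simp add: is_cover_def)
    obtain p q c R r s where pq: "is_pullback X a a p q" and R: "R \<in> Obj W" "is_cover X c (Go R) (Dom X p)"
      and r: "r \<in> hom W R V" "Ga r = p \<cdot>\<^bsub>X\<^esub> c" and s: "s \<in> hom W R V" "Ga s = q \<cdot>\<^bsub>X\<^esub> c"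
      and rs: "a \<cdot>\<^bsub>X\<^esub> Ga r = a \<cdot>\<^bsub>X\<^esub> Ga s"
      using weak_kernel_pair[OF a V] by metis
    have c: "c \<in> hom X (Go R) (Dom X p)" using R(2) by (simp add: is_cover_def)
    have P: "p \<in> hom X (Dom X p) (Go V)" "q \<in> hom X (Dom X p) (Go V)"
      using X.is_pullbackD[OF pq] a by (simp_all add: hom_iff)
    define f where "f = FA G a \<cdot> \<theta> V"
    have f: "f \<in> hom E (FO F (Go V)) (FO G A)"
      unfolding f_def using th[OF V] Gh[OF a] by (rule E.Comp_in_hom)
    have fu: "f \<cdot> FA F (Ga u) = FA G (a \<cdot>\<^bsub>X\<^esub> Ga u) \<cdot> \<theta> R" if u: "u \<in> hom W R V" for u
    proof -
      have "f \<cdot> FA F (Ga u) = FA G a \<cdot> (FA G (Ga u) \<cdot> \<theta> R)"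
        unfolding f_def using E.Comp_assoc[OF Fh[OF Ga_hom[OF u]] th[OF V] Gh[OF a]] tn[OF u] by simp
      also have "\<dots> = FA G (a \<cdot>\<^bsub>X\<^esub> Ga u) \<cdot> \<theta> R"
        using E.Comp_assoc[OF th[OF R(1)] Gh[OF Ga_hom[OF u]] Gh[OF a]] Gc[OF Ga_hom[OF u] a] by simp
      finally show ?thesis .
    qed
    have "f \<cdot> FA F (Ga r) = f \<cdot> FA F (Ga s)" using fu[OF r(1)] fu[OF s(1)] rs by simp
    then have "(f \<cdot> FA F p) \<cdot> FA F c = (f \<cdot> FA F q) \<cdot> FA F c"
      using r(2) s(2) Fc[OF c P(1)] Fc[OF c P(2)] E.Comp_assoc[OF Fh[OF c] Fh[OF P(1)] f]
        E.Comp_assoc[OF Fh[OF c] Fh[OF P(2)] f] by simp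
    then have "f \<cdot> FA F p = f \<cdot> FA F q"
      by (rule E.is_cover_cancel[OF exact_functor_cover[OF F R(2)]])
        (rule E.Comp_in_hom[OF Fh[OF P(1)] f] E.Comp_in_hom[OF Fh[OF P(2)] f])+
    then obtain m where "m \<in> hom E (FO F A) (FO G A)" "m \<cdot> FA F a = f"
      using E.cover_coequalizes_kernel_pair[OF exact_functor_cover[OF F cov]
        exact_functor_pullback[OF F pq] f] by blast
    then show ?thesis by (auto simp: f_def)
  qed
  have "\<exists>V a m. V \<in> Obj W \<and> is_cover X a (Go V) A \<and> m \<in> hom E (FO F A) (FO G A) \<and>
      m \<cdot> FA F a = FA G a \<cdot> \<theta> V" if "A \<in> Obj X" for A
    using covered[OF that] step by metis
  then obtain cV ca m where V: "\<And>A. A \<in> Obj X \<Longrightarrow> cV A \<in> Obj W"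
    and ca: "\<And>A. A \<in> Obj X \<Longrightarrow> is_cover X (ca A) (Go (cV A)) A"
    and m: "\<And>A. A \<in> Obj X \<Longrightarrow> m A \<in> hom E (FO F A) (FO G A)"
    and eq: "\<And>A. A \<in> Obj X \<Longrightarrow> m A \<cdot> FA F (ca A) = FA G (ca A) \<cdot> \<theta> (cV A)"
    by metis
  \<comment> \<open>the equation that defines \<open>m A\<close> extends from the chosen cover to all arrows out of \<open>W\<close>\<close>
  have all: "m A \<cdot> FA F a = FA G a \<cdot> \<theta> T" if T: "T \<in> Obj W" and a: "a \<in> hom X (Go T) A" for T a A
  proof -
    have A: "A \<in> Obj X" using X.hom_Obj[OF a] by simp
    have c: "ca A \<in> hom X (Go (cV A)) A" using ca[OF A] by (simp add: is_cover_def)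
    obtain g where g: "g \<in> hom W T (cV A)" "ca A \<cdot>\<^bsub>X\<^esub> Ga g = a"
      using projective_lift[OF T V[OF A] ca[OF A] a] .
    note g' = Ga_hom[OF g(1)]
    have "m A \<cdot> FA F a = (m A \<cdot> FA F (ca A)) \<cdot> FA F (Ga g)"
      using Fc[OF g' c] g(2) E.Comp_assoc[OF Fh[OF g'] Fh[OF c] m[OF A]] by simp
    also have "\<dots> = FA G (ca A) \<cdot> (FA G (Ga g) \<cdot> \<theta> T)"
      using eq[OF A] E.Comp_assoc[OF Fh[OF g'] th[OF V[OF A]] Gh[OF c]] tn[OF g(1)] by simp
    also have "\<dots> = FA G a \<cdot> \<theta> T"
      using Gc[OF g' c] g(2) E.Comp_assoc[OF th[OF T] Gh[OF g'] Gh[OF c]] by simp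
    finally show ?thesis .
  qed
  have "nat_trans X E F G (restrict m (Obj X))"
  proof (rule nat_transI[OF fF fG])
    fix A B f assume f: "f \<in> hom X A B"
    have A: "A \<in> Obj X" and B: "B \<in> Obj X" using X.hom_Obj[OF f] by auto
    have c: "ca A \<in> hom X (Go (cV A)) A" using ca[OF A] by (simp add: is_cover_def)
    have "m B \<cdot> FA F f = FA G f \<cdot> m A"
    proof (rule E.is_cover_cancel[OF exact_functor_cover[OF F ca[OF A]]])
      show "m B \<cdot> FA F f \<in> hom E (FO F A) (FO G B)" using Fh[OF f] m[OF B] by (rule E.Comp_in_hom)
      show "FA G f \<cdot> m A \<in> hom E (FO F A) (FO G B)" using m[OF A] Gh[OF f] by (rule E.Comp_in_hom)
      have "(m B \<cdot> FA F f) \<cdot> FA F (ca A) = m B \<cdot> FA F (f \<cdot>\<^bsub>X\<^esub> ca A)"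
        using Fc[OF c f] E.Comp_assoc[OF Fh[OF c] Fh[OF f] m[OF B]] by simp
      also have "\<dots> = FA G (f \<cdot>\<^bsub>X\<^esub> ca A) \<cdot> \<theta> (cV A)"
        by (rule all[OF V[OF A] X.Comp_in_hom[OF c f]])
      also have "\<dots> = FA G f \<cdot> (m A \<cdot> FA F (ca A))"
        using Gc[OF c f] eq[OF A] E.Comp_assoc[OF th[OF V[OF A]] Gh[OF c] Gh[OF f]] by simp
      also have "\<dots> = (FA G f \<cdot> m A) \<cdot> FA F (ca A)"
        using E.Comp_assoc[OF Fh[OF c] m[OF A] Gh[OF f]] by simp
      finally show "(m B \<cdot> FA F f) \<cdot> FA F (ca A) = (FA G f \<cdot> m A) \<cdot> FA F (ca A)" .
    qed
    then show "restrict m (Obj X) B \<cdot> FA F f = FA G f \<cdot> restrict m (Obj X) A"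
      using A B by simp
  qed (use m in auto)
  moreover have "restrict m (Obj X) (Go V) = \<theta> V" if V: "V \<in> Obj W" for V
  proof -
    have GV: "Go V \<in> Obj X" using V by (rule is_functorD(3)[OF is_functor_\<Gamma>])
    have "m (Go V) \<cdot> FA F (Ide X (Go V)) = FA G (Ide X (Go V)) \<cdot> \<theta> V"
      by (rule all[OF V X.Ide_in_hom[OF GV]])
    then have "m (Go V) = \<theta> V"
      using F'(7)[OF GV] G'(7)[OF GV] E.Comp_Ide_right[OF m[OF GV]] E.Comp_Ide_left[OF th[OF V]] by simp
    then show ?thesis using GV by simp
  qed
  ultimately show ?thesis by (rule that)
qed

end


section \<open>Extension of a left covering functor\<close>

locale left_covering_extension = projective_presentation W X \<Gamma> + E: exact_cat E
  for W :: "('w, 'v) cat" and X :: "('o, 'a) cat" and \<Gamma> :: "('w, 'v, 'o, 'a) ftr"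
    and E :: "('p, 'b) cat" (structure) +
  fixes F :: "('w, 'v, 'p, 'b) ftr"
  assumes left_covering_F: "left_covering W E F"
begin

abbreviation "Fo \<equiv> FO F"
abbreviation "Fa \<equiv> FA F"

lemma is_functor_F: "is_functor W E F"
  using left_covering_F by (simp add: left_covering_def)

lemma Fa_hom: "f \<in> hom W V T \<Longrightarrow> Fa f \<in> hom E (Fo V) (Fo T)"
  by (rule is_functor_hom[OF is_functor_F])

lemma Fa_Comp: "\<lbrakk>f \<in> hom W V T; g \<in> hom W T S\<rbrakk> \<Longrightarrow> Fa (g \<cdot>\<^bsub>W\<^esub> f) = Fa g \<cdot> Fa f"
  using is_functorD(8)[OF is_functor_F] by (simp add: hom_iff)

lemma Fa_Comp_apply:
  "\<lbrakk>f \<in> hom W V T; g \<in> hom W T S; z \<in> hom E U (Fo V)\<rbrakk> \<Longrightarrow> Fa (g \<cdot>\<^bsub>W\<^esub> f) \<cdot> z = Fa g \<cdot> (Fa f \<cdot> z)"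
  using Fa_Comp E.Comp_assoc[OF _ Fa_hom Fa_hom] by metis

text \<open>Left covering means flat with respect to covers: a cone over the image of a finite diagram
  is locally the image of a cone in \<open>W\<close>, because the weak limit covers the limit. The three
  instances that follow are the form in which the hypothesis on \<open>F\<close> enters below.\<close>

lemma local_cone:
  assumes D: "finite_diagram J W D" and b: "is_cone J E (comp_ftr J F D) U b"
  obtains e U' V c z where "is_cover E e U' U" "is_cone J W D V c" "z \<in> hom E U' (Fo V)"
    "\<And>j. j \<in> Obj J \<Longrightarrow> Fa (c j) \<cdot> z = b j \<cdot> e"
proof -
  have D': "is_functor J W D" using D by (simp add: finite_diagram_def)
  obtain V c where V: "is_weak_limit J W D V c" using weakly_lex_W D unfolding weakly_lex_def by blast
  then have c: "is_cone J W D V c" by (simp add: is_weak_limit_def)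
  obtain L l where L: "is_limit J E (comp_ftr J F D) L l"
    using E.limit_ex[OF finite_diagram_image[OF is_functor_F D]] by blast
  obtain h where h: "h \<in> hom E (Fo V) L" "\<And>j. j \<in> Obj J \<Longrightarrow> l j \<cdot> h = Fa (c j)"
    using limit_factor[OF L cone_image[OF is_functor_F D' c]] by blast
  have "regular_epi E h" using left_covering_F D V L h unfolding left_covering_def by blast
  then have cov: "is_cover E h (Fo V) L" using h(1) by (simp add: is_cover_def)
  obtain k where k: "k \<in> hom E U L" "\<And>j. j \<in> Obj J \<Longrightarrow> l j \<cdot> k = b j"
    using limit_factor[OF L b] by blast
  obtain U' e z where e: "is_cover E e U' U" "z \<in> hom E U' (Fo V)" "h \<cdot> z = k \<cdot> e"
    using E.cover_pull[OF cov k(1)] .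
  have e': "e \<in> hom E U' U" using e(1) by (simp add: is_cover_def)
  have "Fa (c j) \<cdot> z = b j \<cdot> e" if j: "j \<in> Obj J" for j
  proof -
    have l: "l j \<in> hom E L (Fo (FO D j))"
      using L j by (simp add: is_limit_def is_cone_def comp_ftr_def)
    have "Fa (c j) \<cdot> z = l j \<cdot> (h \<cdot> z)"
      using h(2)[OF j] E.Comp_assoc[OF e(2) h(1) l] by simp
    then show ?thesis using e(3) E.Comp_assoc[OF e' k(1) l] k(2)[OF j] by simp
  qed
  then show ?thesis using that e c by blast
qed

lemma local_object:
  assumes "U \<in> Obj E"
  obtains e U' V z where "is_cover E e U' U" "V \<in> Obj W" "z \<in> hom E U' (Fo V)"
proof -
  interpret S: two_level_shape "{}" "{}" id id by unfold_locales auto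
  let ?D = "two_level_diagram W {} {} undefined undefined undefined"
  have D: "finite_diagram S.J W ?D" by (rule S.finite_diagram_J) (auto simp: W.category_axioms)
  have "is_cone S.J E (comp_ftr S.J F ?D) U undefined"
    using assms by (simp add: is_cone_def two_level_def)
  from local_cone[OF D this] show ?thesis using that unfolding is_cone_def by metis
qed

lemma local_pair:
  assumes x: "x \<in> hom E U (Fo A)" and y: "y \<in> hom E U (Fo B)" and AB: "A \<in> Obj W" "B \<in> Obj W"
  obtains e U' V p q z where "is_cover E e U' U" "p \<in> hom W V A" "q \<in> hom W V B"
    "z \<in> hom E U' (Fo V)" "Fa p \<cdot> z = x \<cdot> e" "Fa q \<cdot> z = y \<cdot> e"
proof -
  interpret S: two_level_shape "{}" "{0, 1}" id id by unfold_locales auto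
  let ?O = "\<lambda>n. if n = (0::nat) then A else B"
  let ?D = "two_level_diagram W {} {0, 1} ?O undefined undefined"
  have O: "?O n \<in> Obj W" for n using AB by simp
  have D: "finite_diagram S.J W ?D"
    by (rule S.finite_diagram_J[OF W.category_axioms O]) auto
  have U: "U \<in> Obj E" using E.hom_Obj[OF x] by simp
  have FoO: "Fo (?O n) \<in> Obj E" for n by (rule is_functorD(3)[OF is_functor_F O])
  have "is_cone S.J E (comp_ftr S.J F ?D) U (\<lambda>n. if n = 0 then x else y)"
    unfolding S.comp_two_level_diagram[OF is_functor_F O]
    by (subst S.two_level_cone[OF E.category_axioms FoO]) (use x y U in auto)
  from local_cone[OF D this] obtain e U' V c z where e: "is_cover E e U' U" "is_cone S.J W ?D V c"
    "z \<in> hom E U' (Fo V)" "\<And>j. j \<in> Obj S.J \<Longrightarrow> Fa (c j) \<cdot> z = (if j = 0 then x else y) \<cdot> e"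
    by blast
  have "Fa (c 0) \<cdot> z = x \<cdot> e" "Fa (c 1) \<cdot> z = y \<cdot> e"
    using e(4)[of 0] e(4)[of 1] by (simp_all add: two_level_def)
  moreover have "c 0 \<in> hom W V A" "c 1 \<in> hom W V B"
    using e(2) unfolding S.two_level_cone[OF W.category_axioms O] by simp_all
  ultimately show ?thesis using that[OF e(1) _ _ e(3)] by blast
qed

lemma local_equalizer:
  assumes fg: "f \<in> hom W A B" "g \<in> hom W A B"
    and x: "x \<in> hom E U (Fo A)" and eq: "Fa f \<cdot> x = Fa g \<cdot> x"
  obtains e U' V h z where "is_cover E e U' U" "h \<in> hom W V A" "f \<cdot>\<^bsub>W\<^esub> h = g \<cdot>\<^bsub>W\<^esub> h"
    "z \<in> hom E U' (Fo V)" "Fa h \<cdot> z = x \<cdot> e"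
proof -
  interpret S: two_level_shape "{0}" "{1}" "\<lambda>_. 1" "\<lambda>_. 1" by unfold_locales auto
  let ?O = "\<lambda>n. if n = (0::nat) then A else B"
  let ?D = "two_level_diagram W {0} {1} ?O (\<lambda>_. f) (\<lambda>_. g)"
  have O: "?O n \<in> Obj W" for n using W.hom_Obj[OF fg(1)] by simp
  have D: "finite_diagram S.J W ?D"
    by (rule S.finite_diagram_J[OF W.category_axioms O]) (use fg in auto)
  have U: "U \<in> Obj E" using E.hom_Obj[OF x] by simp
  have FoO: "Fo (?O n) \<in> Obj E" for n by (rule is_functorD(3)[OF is_functor_F O])
  have "is_cone S.J E (comp_ftr S.J F ?D) U (\<lambda>n. if n = 0 then x else Fa f \<cdot> x)"
    unfolding S.comp_two_level_diagram[OF is_functor_F O]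
    by (subst S.two_level_cone[OF E.category_axioms FoO])
      (use x U eq E.Comp_in_hom[OF x Fa_hom[OF fg(1)]] in auto)
  from local_cone[OF D this] obtain e U' V c z where e: "is_cover E e U' U" "is_cone S.J W ?D V c"
    "z \<in> hom E U' (Fo V)" "\<And>j. j \<in> Obj S.J \<Longrightarrow> Fa (c j) \<cdot> z = (if j = 0 then x else Fa f \<cdot> x) \<cdot> e"
    by blast
  have "Fa (c 0) \<cdot> z = x \<cdot> e" using e(4)[of 0] by (simp add: two_level_def)
  moreover have "c 0 \<in> hom W V A" "f \<cdot>\<^bsub>W\<^esub> c 0 = g \<cdot>\<^bsub>W\<^esub> c 0"
    using e(2) unfolding S.two_level_cone[OF W.category_axioms O] by simp_all
  ultimately show ?thesis using that[OF e(1) _ _ e(3)] by blast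
qed

text \<open>The value at \<open>A\<close> of the extension is the quotient of \<open>Fo V\<close>, for a cover \<open>a\<close> of \<open>A\<close> by the
  image of \<open>V\<close>, by the following relation: two elements of \<open>Fo V\<close> are identified if locally they
  are the images of one element under two arrows that \<open>a\<close> makes equal.\<close>

definition same :: "'w \<Rightarrow> 'a \<Rightarrow> 'p \<Rightarrow> 'b \<Rightarrow> 'b \<Rightarrow> bool" where
  "same V a U x y \<longleftrightarrow> (\<exists>e U' T z s t. is_cover E e U' U \<and> s \<in> hom W T V \<and> t \<in> hom W T V \<and>
     z \<in> hom E U' (Fo T) \<and> Fa s \<cdot> z = x \<cdot> e \<and> Fa t \<cdot> z = y \<cdot> e \<and> a \<cdot>\<^bsub>X\<^esub> Ga s = a \<cdot>\<^bsub>X\<^esub> Ga t)"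

lemma same_refl:
  assumes V: "V \<in> Obj W" and x: "x \<in> hom E U (Fo V)"
  shows "same V a U x x"
proof -
  have "Fa (Ide W V) \<cdot> x = x \<cdot> Ide E U"
    using is_functorD(7)[OF is_functor_F V] E.Comp_Ide_left[OF x] E.Comp_Ide_right[OF x] by simp
  then show ?thesis unfolding same_def
    using E.is_cover_Ide[of U] E.hom_Obj[OF x] W.Ide_in_hom[OF V] x by blast
qed

lemma same_sym: "same V a U x y \<Longrightarrow> same V a U y x"
  unfolding same_def by metis

text \<open>The element \<open>y\<close> is reached from \<open>z1\<close> along \<open>t1\<close> and from \<open>z2\<close> along \<open>s2\<close>. Locally \<open>z1\<close> and \<open>z2\<close> come
  from one element \<open>z4\<close>, by \<open>local_pair\<close>, and the two routes from \<open>z4\<close> to \<open>y\<close> can be made equal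
  already in \<open>W\<close>, by \<open>local_equalizer\<close>.\<close>

lemma same_trans:
  assumes a: "a \<in> hom X (Go V) A"
    and xyw: "x \<in> hom E U (Fo V)" "y \<in> hom E U (Fo V)" "w \<in> hom E U (Fo V)"
    and xy: "same V a U x y" and yw: "same V a U y w"
  shows "same V a U x w"
proof -
  obtain e1 U1 T1 z1 s1 t1 where 1: "is_cover E e1 U1 U" "s1 \<in> hom W T1 V" "t1 \<in> hom W T1 V"
    "z1 \<in> hom E U1 (Fo T1)" "Fa s1 \<cdot> z1 = x \<cdot> e1" "Fa t1 \<cdot> z1 = y \<cdot> e1"
    "a \<cdot>\<^bsub>X\<^esub> Ga s1 = a \<cdot>\<^bsub>X\<^esub> Ga t1"
    using xy unfolding same_def by blast
  obtain e2 U2 T2 z2 s2 t2 where 2: "is_cover E e2 U2 U" "s2 \<in> hom W T2 V" "t2 \<in> hom W T2 V"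
    "z2 \<in> hom E U2 (Fo T2)" "Fa s2 \<cdot> z2 = y \<cdot> e2" "Fa t2 \<cdot> z2 = w \<cdot> e2"
    "a \<cdot>\<^bsub>X\<^esub> Ga s2 = a \<cdot>\<^bsub>X\<^esub> Ga t2"
    using yw unfolding same_def by blast
  have e: "e1 \<in> hom E U1 U" "e2 \<in> hom E U2 U" using 1(1) 2(1) by (simp_all add: is_cover_def)
  obtain U3 c d where 3: "is_cover E (e1 \<cdot> c) U3 U" "c \<in> hom E U3 U1" "d \<in> hom E U3 U2"
    "e2 \<cdot> d = e1 \<cdot> c"
    using E.common_cover[OF 1(1) 2(1)] .
  have zc: "z1 \<cdot> c \<in> hom E U3 (Fo T1)" and zd: "z2 \<cdot> d \<in> hom E U3 (Fo T2)"
    using E.Comp_in_hom 3(2,3) 1(4) 2(4) by blast+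
  obtain e4 U4 T4 p q z4 where 4: "is_cover E e4 U4 U3" "p \<in> hom W T4 T1" "q \<in> hom W T4 T2"
    "z4 \<in> hom E U4 (Fo T4)" "Fa p \<cdot> z4 = (z1 \<cdot> c) \<cdot> e4" "Fa q \<cdot> z4 = (z2 \<cdot> d) \<cdot> e4"
    using local_pair[OF zc zd W.hom_Obj(1)[OF 1(2)] W.hom_Obj(1)[OF 2(2)]] .
  have e4: "e4 \<in> hom E U4 U3" using 4(1) by (simp add: is_cover_def)
  have push1: "Fa (f \<cdot>\<^bsub>W\<^esub> p) \<cdot> z4 = v \<cdot> ((e1 \<cdot> c) \<cdot> e4)"
    if "f \<in> hom W T1 V" "Fa f \<cdot> z1 = v \<cdot> e1" "v \<in> hom E U (Fo V)" for f v
  proof -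
    have "Fa (f \<cdot>\<^bsub>W\<^esub> p) \<cdot> z4 = Fa f \<cdot> ((z1 \<cdot> c) \<cdot> e4)"
      using Fa_Comp_apply[OF 4(2) that(1) 4(4)] 4(5) by simp
    also have "\<dots> = ((Fa f \<cdot> z1) \<cdot> c) \<cdot> e4"
      using Fa_hom[OF that(1)] 1(4) 3(2) e4 by (simp add: hom_iff)
    also have "\<dots> = v \<cdot> ((e1 \<cdot> c) \<cdot> e4)"
      unfolding that(2) using that(3) e 3(2) e4 by (simp add: hom_iff)
    finally show ?thesis .
  qed
  have push2: "Fa (f \<cdot>\<^bsub>W\<^esub> q) \<cdot> z4 = v \<cdot> ((e1 \<cdot> c) \<cdot> e4)"
    if "f \<in> hom W T2 V" "Fa f \<cdot> z2 = v \<cdot> e2" "v \<in> hom E U (Fo V)" for f v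
  proof -
    have "Fa (f \<cdot>\<^bsub>W\<^esub> q) \<cdot> z4 = Fa f \<cdot> ((z2 \<cdot> d) \<cdot> e4)"
      using Fa_Comp_apply[OF 4(3) that(1) 4(4)] 4(6) by simp
    also have "\<dots> = ((Fa f \<cdot> z2) \<cdot> d) \<cdot> e4"
      using Fa_hom[OF that(1)] 2(4) 3(3) e4 by (simp add: hom_iff)
    also have "\<dots> = v \<cdot> ((e2 \<cdot> d) \<cdot> e4)"
      unfolding that(2) using that(3) e 3(3) e4 by (simp add: hom_iff)
    finally show ?thesis using 3(4) by simp
  qed
  have tp: "t1 \<cdot>\<^bsub>W\<^esub> p \<in> hom W T4 V" "s2 \<cdot>\<^bsub>W\<^esub> q \<in> hom W T4 V" "s1 \<cdot>\<^bsub>W\<^esub> p \<in> hom W T4 V" "t2 \<cdot>\<^bsub>W\<^esub> q \<in> hom W T4 V"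
    using W.Comp_in_hom 4(2,3) 1(2,3) 2(2,3) by blast+
  have t1s2: "Fa (t1 \<cdot>\<^bsub>W\<^esub> p) \<cdot> z4 = Fa (s2 \<cdot>\<^bsub>W\<^esub> q) \<cdot> z4"
    using push1[OF 1(3,6) xyw(2)] push2[OF 2(2,5) xyw(2)] by simp
  obtain e5 U5 T5 h z5 where 5: "is_cover E e5 U5 U4" "h \<in> hom W T5 T4"
    "(t1 \<cdot>\<^bsub>W\<^esub> p) \<cdot>\<^bsub>W\<^esub> h = (s2 \<cdot>\<^bsub>W\<^esub> q) \<cdot>\<^bsub>W\<^esub> h" "z5 \<in> hom E U5 (Fo T5)" "Fa h \<cdot> z5 = z4 \<cdot> e5"
    using local_equalizer[OF tp(1,2) 4(4) t1s2] .
  have e5: "e5 \<in> hom E U5 U4" using 5(1) by (simp add: is_cover_def)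
  define ec where "ec = ((e1 \<cdot> c) \<cdot> e4) \<cdot> e5"
  have cov: "is_cover E ec U5 U"
    unfolding ec_def by (rule E.is_cover_comp[OF 5(1) E.is_cover_comp[OF 4(1) 3(1)]])
  have push: "Fa (f \<cdot>\<^bsub>W\<^esub> h) \<cdot> z5 = v \<cdot> ec"
    if "f \<in> hom W T4 V" "Fa f \<cdot> z4 = v \<cdot> ((e1 \<cdot> c) \<cdot> e4)" "v \<in> hom E U (Fo V)" for f v
  proof -
    have "Fa (f \<cdot>\<^bsub>W\<^esub> h) \<cdot> z5 = (Fa f \<cdot> z4) \<cdot> e5"
      using Fa_Comp_apply[OF 5(2) that(1) 5(4)] 5(5) E.Comp_assoc[OF e5 4(4) Fa_hom[OF that(1)]] by simp
    then show ?thesis unfolding that(2) ec_def using that(3) e 3(2) e4 e5 by (simp add: hom_iff)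
  qed
  have G: "a \<cdot>\<^bsub>X\<^esub> Ga (f \<cdot>\<^bsub>W\<^esub> h) = (a \<cdot>\<^bsub>X\<^esub> Ga f) \<cdot>\<^bsub>X\<^esub> Ga h" if "f \<in> hom W T4 V" for f
    using Ga_Comp[OF 5(2) that] X.Comp_assoc[OF Ga_hom[OF 5(2)] Ga_hom[OF that] a] by simp
  have Gp: "a \<cdot>\<^bsub>X\<^esub> Ga (f \<cdot>\<^bsub>W\<^esub> p) = (a \<cdot>\<^bsub>X\<^esub> Ga f) \<cdot>\<^bsub>X\<^esub> Ga p" if "f \<in> hom W T1 V" for f
    using Ga_Comp[OF 4(2) that] X.Comp_assoc[OF Ga_hom[OF 4(2)] Ga_hom[OF that] a] by simp
  have Gq: "a \<cdot>\<^bsub>X\<^esub> Ga (f \<cdot>\<^bsub>W\<^esub> q) = (a \<cdot>\<^bsub>X\<^esub> Ga f) \<cdot>\<^bsub>X\<^esub> Ga q" if "f \<in> hom W T2 V" for f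
    using Ga_Comp[OF 4(3) that] X.Comp_assoc[OF Ga_hom[OF 4(3)] Ga_hom[OF that] a] by simp
  have "a \<cdot>\<^bsub>X\<^esub> Ga ((s1 \<cdot>\<^bsub>W\<^esub> p) \<cdot>\<^bsub>W\<^esub> h) = a \<cdot>\<^bsub>X\<^esub> Ga ((t1 \<cdot>\<^bsub>W\<^esub> p) \<cdot>\<^bsub>W\<^esub> h)"
    using G[OF tp(3)] G[OF tp(1)] Gp[OF 1(2)] Gp[OF 1(3)] 1(7) by simp
  also have "\<dots> = a \<cdot>\<^bsub>X\<^esub> Ga ((s2 \<cdot>\<^bsub>W\<^esub> q) \<cdot>\<^bsub>W\<^esub> h)" using 5(3) by simp
  also have "\<dots> = a \<cdot>\<^bsub>X\<^esub> Ga ((t2 \<cdot>\<^bsub>W\<^esub> q) \<cdot>\<^bsub>W\<^esub> h)"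
    using G[OF tp(2)] G[OF tp(4)] Gq[OF 2(2)] Gq[OF 2(3)] 2(7) by simp
  finally have "a \<cdot>\<^bsub>X\<^esub> Ga ((s1 \<cdot>\<^bsub>W\<^esub> p) \<cdot>\<^bsub>W\<^esub> h) = a \<cdot>\<^bsub>X\<^esub> Ga ((t2 \<cdot>\<^bsub>W\<^esub> q) \<cdot>\<^bsub>W\<^esub> h)" .
  moreover have "Fa ((s1 \<cdot>\<^bsub>W\<^esub> p) \<cdot>\<^bsub>W\<^esub> h) \<cdot> z5 = x \<cdot> ec"
    by (rule push[OF tp(3) push1[OF 1(2,5) xyw(1)] xyw(1)])
  moreover have "Fa ((t2 \<cdot>\<^bsub>W\<^esub> q) \<cdot>\<^bsub>W\<^esub> h) \<cdot> z5 = w \<cdot> ec"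
    by (rule push[OF tp(4) push2[OF 2(3,6) xyw(3)] xyw(3)])
  ultimately show ?thesis unfolding same_def
    using cov 5(4) W.Comp_in_hom[OF 5(2) tp(3)] W.Comp_in_hom[OF 5(2) tp(4)] by blast
qed

text \<open>The relation is represented by the image of a weak kernel pair of \<open>a\<close>.\<close>

lemma same_representable:
  assumes a: "a \<in> hom X (Go V) A" and V: "V \<in> Obj W"
  obtains I i j where "i \<in> hom E I (Fo V)" "j \<in> hom E I (Fo V)"
    "\<forall>U. \<forall>h \<in> hom E U I. \<forall>k \<in> hom E U I. i \<cdot> h = i \<cdot> k \<and> j \<cdot> h = j \<cdot> k \<longrightarrow> h = k"
    "\<forall>U. \<forall>x \<in> hom E U (Fo V). \<forall>y \<in> hom E U (Fo V).
      same V a U x y \<longleftrightarrow> (\<exists>k \<in> hom E U I. i \<cdot> k = x \<and> j \<cdot> k = y)"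
proof -
  obtain R r s where r: "r \<in> hom W R V" "s \<in> hom W R V" "a \<cdot>\<^bsub>X\<^esub> Ga r = a \<cdot>\<^bsub>X\<^esub> Ga s"
    and univ: "\<And>T u v. \<lbrakk>u \<in> hom W T V; v \<in> hom W T V; a \<cdot>\<^bsub>X\<^esub> Ga u = a \<cdot>\<^bsub>X\<^esub> Ga v\<rbrakk>
      \<Longrightarrow> \<exists>k \<in> hom W T R. r \<cdot>\<^bsub>W\<^esub> k = u \<and> s \<cdot>\<^bsub>W\<^esub> k = v"
    using weak_kernel_pair[OF a V] by metis
  obtain I c i j where I: "is_cover E c (Fo R) I" "i \<in> hom E I (Fo V)" "j \<in> hom E I (Fo V)"
    "i \<cdot> c = Fa r" "j \<cdot> c = Fa s"
    and monic: "\<And>U h k. \<lbrakk>h \<in> hom E U I; k \<in> hom E U I; i \<cdot> h = i \<cdot> k; j \<cdot> h = j \<cdot> k\<rbrakk> \<Longrightarrow> h = k"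
    using E.span_image[OF Fa_hom[OF r(1)] Fa_hom[OF r(2)]] by metis
  have c: "c \<in> hom E (Fo R) I" using I(1) by (simp add: is_cover_def)
  show ?thesis
  proof (rule that[OF I(2,3)]; intro allI ballI impI)
    show "h = k" if "h \<in> hom E U I" "k \<in> hom E U I" "i \<cdot> h = i \<cdot> k \<and> j \<cdot> h = j \<cdot> k" for U h k
      using monic that by blast
    fix U x y assume xy: "x \<in> hom E U (Fo V)" "y \<in> hom E U (Fo V)"
    show "same V a U x y \<longleftrightarrow> (\<exists>k \<in> hom E U I. i \<cdot> k = x \<and> j \<cdot> k = y)"
    proof
      assume "same V a U x y"
      then obtain e U' T z u v where e: "is_cover E e U' U" and uv: "u \<in> hom W T V" "v \<in> hom W T V"
        and z: "z \<in> hom E U' (Fo T)" "Fa u \<cdot> z = x \<cdot> e" "Fa v \<cdot> z = y \<cdot> e"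
        and auv: "a \<cdot>\<^bsub>X\<^esub> Ga u = a \<cdot>\<^bsub>X\<^esub> Ga v"
        unfolding same_def by blast
      obtain k where k: "k \<in> hom W T R" "r \<cdot>\<^bsub>W\<^esub> k = u" "s \<cdot>\<^bsub>W\<^esub> k = v" using univ[OF uv auv] by blast
      have e': "e \<in> hom E U' U" using e by (simp add: is_cover_def)
      define l where "l = c \<cdot> (Fa k \<cdot> z)"
      have kz: "Fa k \<cdot> z \<in> hom E U' (Fo R)" using z(1) Fa_hom[OF k(1)] by (rule E.Comp_in_hom)
      have l: "l \<in> hom E U' I" unfolding l_def using kz c by (rule E.Comp_in_hom)
      have il: "i \<cdot> l = x \<cdot> e"
        unfolding l_def using E.Comp_assoc[OF kz c I(2)] I(4) Fa_Comp_apply[OF k(1) r(1) z(1)] k(2) z(2) by simp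
      have jl: "j \<cdot> l = y \<cdot> e"
        unfolding l_def using E.Comp_assoc[OF kz c I(3)] I(5) Fa_Comp_apply[OF k(1) r(2) z(1)] k(3) z(3) by simp
      obtain m where m: "m \<in> hom E U I" "m \<cdot> e = l"
      proof (rule E.is_cover_descend[OF e l])
        fix S p q assume pq: "p \<in> hom E S U'" "q \<in> hom E S U'" "e \<cdot> p = e \<cdot> q"
        show "l \<cdot> p = l \<cdot> q"
        proof (rule monic)
          show "l \<cdot> p \<in> hom E S I" "l \<cdot> q \<in> hom E S I" using E.Comp_in_hom l pq by blast+
          show "i \<cdot> (l \<cdot> p) = i \<cdot> (l \<cdot> q)"
            using E.Comp_assoc[OF pq(1) l I(2)] E.Comp_assoc[OF pq(2) l I(2)] il
              E.Comp_assoc[OF pq(1) e' xy(1)] E.Comp_assoc[OF pq(2) e' xy(1)] pq(3) by simp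
          show "j \<cdot> (l \<cdot> p) = j \<cdot> (l \<cdot> q)"
            using E.Comp_assoc[OF pq(1) l I(3)] E.Comp_assoc[OF pq(2) l I(3)] jl
              E.Comp_assoc[OF pq(1) e' xy(2)] E.Comp_assoc[OF pq(2) e' xy(2)] pq(3) by simp
        qed
      qed
      have "i \<cdot> m = x"
        by (rule E.is_cover_cancel[OF e _ E.Comp_in_hom[OF m(1) I(2)] xy(1)])
          (use E.Comp_assoc[OF e' m(1) I(2)] m(2) il in simp)
      moreover have "j \<cdot> m = y"
        by (rule E.is_cover_cancel[OF e _ E.Comp_in_hom[OF m(1) I(3)] xy(2)])
          (use E.Comp_assoc[OF e' m(1) I(3)] m(2) jl in simp)
      ultimately show "\<exists>k \<in> hom E U I. i \<cdot> k = x \<and> j \<cdot> k = y" using m(1) by blast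
    next
      assume "\<exists>k \<in> hom E U I. i \<cdot> k = x \<and> j \<cdot> k = y"
      then obtain k where k: "k \<in> hom E U I" "i \<cdot> k = x" "j \<cdot> k = y" by blast
      obtain U' e z where e: "is_cover E e U' U" "z \<in> hom E U' (Fo R)" "c \<cdot> z = k \<cdot> e"
        using E.cover_pull[OF I(1) k(1)] .
      have e': "e \<in> hom E U' U" using e by (simp add: is_cover_def)
      have "Fa r \<cdot> z = x \<cdot> e"
        using E.Comp_assoc[OF e(2) c I(2)] I(4) e(3) E.Comp_assoc[OF e' k(1) I(2)] k(2) by simp
      moreover have "Fa s \<cdot> z = y \<cdot> e"
        using E.Comp_assoc[OF e(2) c I(3)] I(5) e(3) E.Comp_assoc[OF e' k(1) I(3)] k(3) by simp
      ultimately show "same V a U x y" unfolding same_def using e r by blast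
    qed
  qed
qed

lemma quotient_ex:
  assumes a: "a \<in> hom X (Go V) A" and V: "V \<in> Obj W"
  obtains Q q where "is_cover E q (Fo V) Q"
    "\<And>U x y. \<lbrakk>x \<in> hom E U (Fo V); y \<in> hom E U (Fo V)\<rbrakk> \<Longrightarrow> q \<cdot> x = q \<cdot> y \<longleftrightarrow> same V a U x y"
proof -
  obtain I i j where ij: "i \<in> hom E I (Fo V)" "j \<in> hom E I (Fo V)"
    and monic: "\<forall>U. \<forall>h \<in> hom E U I. \<forall>k \<in> hom E U I. i \<cdot> h = i \<cdot> k \<and> j \<cdot> h = j \<cdot> k \<longrightarrow> h = k"
    and rep': "\<forall>U. \<forall>x \<in> hom E U (Fo V). \<forall>y \<in> hom E U (Fo V).
      same V a U x y \<longleftrightarrow> (\<exists>k \<in> hom E U I. i \<cdot> k = x \<and> j \<cdot> k = y)"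
    using same_representable[OF a V] .
  note rep = rep'[rule_format]
  have I: "Dom E i = I" using ij by (simp add: hom_iff)
  have FV: "Fo V \<in> Obj E" using V by (rule is_functorD(3)[OF is_functor_F])
  have "i \<in> Arr E" "j \<in> Arr E" "Cod E j = Cod E i" using ij by (simp_all add: hom_iff)
  then obtain q1 q2 where q: "is_pullback E j i q1 q2" using E.pullback_ex by blast
  define K where "K = Dom E q1"
  have q': "q1 \<in> hom E K I" "q2 \<in> hom E K I" "j \<cdot> q1 = i \<cdot> q2"
    using E.is_pullbackD[OF q] ij by (simp_all add: K_def hom_iff)
  have same_ij: "same V a S (i \<cdot> k) (j \<cdot> k)" if "k \<in> hom E S I" for k S
    using rep[OF E.Comp_in_hom[OF that ij(1)] E.Comp_in_hom[OF that ij(2)]] that by blast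
  note iq = E.Comp_in_hom[OF q'(1) ij(1)] E.Comp_in_hom[OF q'(1) ij(2)] E.Comp_in_hom[OF q'(2) ij(2)]
  have "is_equivalence_relation E (Fo V) i j"
    unfolding is_equivalence_relation_def Let_def I
  proof (intro conjI ballI allI impI ij)
    show "\<And>U h k. \<lbrakk>h \<in> hom E U I; k \<in> hom E U I; i \<cdot> h = i \<cdot> k \<and> j \<cdot> h = j \<cdot> k\<rbrakk> \<Longrightarrow> h = k"
      using monic by blast
    note id = E.Ide_in_hom[OF FV]
    show "\<exists>\<rho> \<in> hom E (Fo V) I. i \<cdot> \<rho> = Ide E (Fo V) \<and> j \<cdot> \<rho> = Ide E (Fo V)"
      using rep[OF id id] same_refl[OF V id] by blast
    have "same V a I i j"
      using same_ij[of "Ide E I" I] ij E.Ide_in_hom[of I] E.hom_Obj[OF ij(1)] by (simp add: hom_iff)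
    then show "\<exists>\<sigma> \<in> hom E I I. i \<cdot> \<sigma> = j \<and> j \<cdot> \<sigma> = i"
      using rep[OF ij(2,1)] same_sym by blast
    have "same V a K (i \<cdot> q1) (j \<cdot> q2)"
      using same_trans[OF a iq(1,2,3) same_ij[OF q'(1)]] same_ij[OF q'(2)] q'(3) by simp
    then show "\<exists>q1 q2. is_pullback E j i q1 q2 \<and>
        (\<exists>\<tau> \<in> hom E (Dom E q1) I. i \<cdot> \<tau> = i \<cdot> q1 \<and> j \<cdot> \<tau> = j \<cdot> q2)"
      using rep[OF iq(1,3)] q by (auto simp: K_def)
  qed
  then show ?thesis
  proof (rule E.effective_quotient)
    fix Q q
    assume q: "is_cover E q (Fo V) Q"
      and eq: "\<And>U x y. \<lbrakk>x \<in> hom E U (Fo V); y \<in> hom E U (Fo V)\<rbrakk> \<Longrightarrow>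
        q \<cdot> x = q \<cdot> y \<longleftrightarrow> (\<exists>k \<in> hom E U (Dom E i). i \<cdot> k = x \<and> j \<cdot> k = y)"
    show ?thesis by (rule that[OF q]) (simp add: eq rep I)
  qed
qed

definition base :: "'o \<Rightarrow> 'w" where
  "base A = (SOME V. V \<in> Obj W \<and> (\<exists>a. is_cover X a (Go V) A))"

definition cov :: "'o \<Rightarrow> 'a" where
  "cov A = (SOME a. is_cover X a (Go (base A)) A)"

definition quo :: "'o \<Rightarrow> 'b" where
  "quo A = (SOME q. regular_epi E q \<and> Dom E q = Fo (base A) \<and>
     (\<forall>U. \<forall>x \<in> hom E U (Fo (base A)). \<forall>y \<in> hom E U (Fo (base A)).
        q \<cdot> x = q \<cdot> y \<longleftrightarrow> same (base A) (cov A) U x y))"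

definition Fhat :: "'o \<Rightarrow> 'p" where
  "Fhat A = Cod E (quo A)"

lemma base_cov:
  assumes "A \<in> Obj X"
  shows "base A \<in> Obj W" "is_cover X (cov A) (Go (base A)) A" "cov A \<in> hom X (Go (base A)) A"
proof -
  have "base A \<in> Obj W \<and> (\<exists>a. is_cover X a (Go (base A)) A)"
    unfolding base_def by (rule someI_ex) (use covered[OF assms] in blast)
  then show "base A \<in> Obj W" "is_cover X (cov A) (Go (base A)) A"
    unfolding cov_def by (auto intro: someI_ex)
  then show "cov A \<in> hom X (Go (base A)) A" by (simp add: is_cover_def)
qed

lemma quo:
  assumes A: "A \<in> Obj X"
  shows "is_cover E (quo A) (Fo (base A)) (Fhat A)" "quo A \<in> hom E (Fo (base A)) (Fhat A)"
    "\<lbrakk>x \<in> hom E U (Fo (base A)); y \<in> hom E U (Fo (base A))\<rbrakk>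
      \<Longrightarrow> quo A \<cdot> x = quo A \<cdot> y \<longleftrightarrow> same (base A) (cov A) U x y"
proof -
  have "\<exists>q. regular_epi E q \<and> Dom E q = Fo (base A) \<and>
     (\<forall>U. \<forall>x \<in> hom E U (Fo (base A)). \<forall>y \<in> hom E U (Fo (base A)).
        q \<cdot> x = q \<cdot> y \<longleftrightarrow> same (base A) (cov A) U x y)"
      proof (rule quotient_ex[OF base_cov(3)[OF A] base_cov(1)[OF A]])
    fix Q q
    assume "is_cover E q (Fo (base A)) Q" and "\<And>U x y. \<lbrakk>x \<in> hom E U (Fo (base A)); y \<in> hom E U (Fo (base A))\<rbrakk>
      \<Longrightarrow> q \<cdot> x = q \<cdot> y \<longleftrightarrow> same (base A) (cov A) U x y"
    then show ?thesis using E.is_coverD[of q] by blast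
  qed
  then have *: "regular_epi E (quo A) \<and> Dom E (quo A) = Fo (base A) \<and>
     (\<forall>U. \<forall>x \<in> hom E U (Fo (base A)). \<forall>y \<in> hom E U (Fo (base A)).
        quo A \<cdot> x = quo A \<cdot> y \<longleftrightarrow> same (base A) (cov A) U x y)"
    unfolding quo_def by (rule someI_ex)
  then show "is_cover E (quo A) (Fo (base A)) (Fhat A)"
    using E.regular_epi_Arr by (simp add: is_cover_def hom_iff Fhat_def)
  then show "quo A \<in> hom E (Fo (base A)) (Fhat A)" by (simp add: is_cover_def)
  show "\<lbrakk>x \<in> hom E U (Fo (base A)); y \<in> hom E U (Fo (base A))\<rbrakk>
      \<Longrightarrow> quo A \<cdot> x = quo A \<cdot> y \<longleftrightarrow> same (base A) (cov A) U x y"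
    using * by blast
qed

text \<open>Every arrow \<open>a : Go V \<rightarrow> A\<close> induces \<open>kap V a : Fo V \<rightarrow> Fhat A\<close>. Elements of \<open>Fhat A\<close> are thus
  locally represented by an arrow \<open>a : Go V \<rightarrow> A\<close> and an element of \<open>Fo V\<close>: this presents \<open>Fhat A\<close> as the
  colimit of \<open>Fo V\<close> over all arrows \<open>Go V \<rightarrow> A\<close>. In the definition, \<open>g\<close> lifts \<open>a\<close> along the chosen
  cover of \<open>A\<close>; by \<open>quo_eqI\<close> the choice of the lift is immaterial.\<close>

definition kap :: "'w \<Rightarrow> 'a \<Rightarrow> 'b" where
  "kap V a = quo (Cod X a) \<cdot> Fa (SOME g. g \<in> hom W V (base (Cod X a)) \<and> cov (Cod X a) \<cdot>\<^bsub>X\<^esub> Ga g = a)"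

lemma lift_cov:
  assumes "a \<in> hom X (Go V) A" "V \<in> Obj W"
  obtains g where "g \<in> hom W V (base A)" "cov A \<cdot>\<^bsub>X\<^esub> Ga g = a"
  using projective_lift[OF assms(2) base_cov(1,2) assms(1)] X.hom_Obj[OF assms(1)] by metis

lemma quo_eqI:
  assumes A: "A \<in> Obj X" and g: "g \<in> hom W V (base A)" "g' \<in> hom W V (base A)"
    and eq: "cov A \<cdot>\<^bsub>X\<^esub> Ga g = cov A \<cdot>\<^bsub>X\<^esub> Ga g'" and z: "z \<in> hom E U (Fo V)"
  shows "quo A \<cdot> (Fa g \<cdot> z) = quo A \<cdot> (Fa g' \<cdot> z)"
proof -
  have gz: "Fa g \<cdot> z \<in> hom E U (Fo (base A))" "Fa g' \<cdot> z \<in> hom E U (Fo (base A))"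
    using E.Comp_in_hom[OF z] Fa_hom g by blast+
  have "is_cover E (Ide E U) U U" using E.is_cover_Ide E.hom_Obj[OF z] by blast
  moreover have "Fa g \<cdot> z = (Fa g \<cdot> z) \<cdot> Ide E U" "Fa g' \<cdot> z = (Fa g' \<cdot> z) \<cdot> Ide E U"
    using E.Comp_Ide_right[OF gz(1)] E.Comp_Ide_right[OF gz(2)] by simp_all
  ultimately have "same (base A) (cov A) U (Fa g \<cdot> z) (Fa g' \<cdot> z)"
    unfolding same_def using g eq z by blast
  then show ?thesis using quo(3)[OF A gz] by simp
qed

lemma kap_eq:
  assumes A: "A \<in> Obj X" and g: "g \<in> hom W V (base A)" "cov A \<cdot>\<^bsub>X\<^esub> Ga g = a"
  shows "kap V a = quo A \<cdot> Fa g"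
proof -
  have cA: "Cod X a = A" using Ga_hom[OF g(1)] base_cov(3)[OF A] g(2) by (auto simp: hom_iff)
  define g' where "g' = (SOME g. g \<in> hom W V (base A) \<and> cov A \<cdot>\<^bsub>X\<^esub> Ga g = a)"
  have g': "g' \<in> hom W V (base A) \<and> cov A \<cdot>\<^bsub>X\<^esub> Ga g' = a"
    unfolding g'_def by (rule someI_ex) (use g in blast)
  have "kap V a = quo A \<cdot> Fa g'" by (simp add: kap_def cA g'_def)
  moreover have "quo A \<cdot> (Fa g' \<cdot> Ide E (Fo V)) = quo A \<cdot> (Fa g \<cdot> Ide E (Fo V))"
    using g' g W.hom_Obj[OF g(1)] is_functorD(3)[OF is_functor_F]
    by (intro quo_eqI[OF A]) (auto intro: E.Ide_in_hom)
  ultimately show ?thesis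
    using E.Comp_Ide_right[OF Fa_hom[OF g(1)]] E.Comp_Ide_right[OF Fa_hom[OF conjunct1[OF g']]] by simp
qed

lemma kap_hom:
  assumes a: "a \<in> hom X (Go V) A" and V: "V \<in> Obj W"
  shows "kap V a \<in> hom E (Fo V) (Fhat A)"
proof -
  have A: "A \<in> Obj X" using X.hom_Obj[OF a] by simp
  obtain g where g: "g \<in> hom W V (base A)" "cov A \<cdot>\<^bsub>X\<^esub> Ga g = a" using lift_cov[OF assms] .
  show ?thesis unfolding kap_eq[OF A g] using Fa_hom[OF g(1)] quo(2)[OF A] by (rule E.Comp_in_hom)
qed

lemma kap_Comp:
  assumes a: "a \<in> hom X (Go V) A" and h: "h \<in> hom W T V"
  shows "kap T (a \<cdot>\<^bsub>X\<^esub> Ga h) = kap V a \<cdot> Fa h"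
proof -
  have A: "A \<in> Obj X" using X.hom_Obj[OF a] by simp
  obtain g where g: "g \<in> hom W V (base A)" "cov A \<cdot>\<^bsub>X\<^esub> Ga g = a"
    using lift_cov[OF a] W.hom_Obj[OF h] by blast
  have "cov A \<cdot>\<^bsub>X\<^esub> Ga (g \<cdot>\<^bsub>W\<^esub> h) = a \<cdot>\<^bsub>X\<^esub> Ga h"
    using Ga_Comp[OF h g(1)] g(2) X.Comp_assoc[OF Ga_hom[OF h] Ga_hom[OF g(1)] base_cov(3)[OF A]] by simp
  then have "kap T (a \<cdot>\<^bsub>X\<^esub> Ga h) = quo A \<cdot> Fa (g \<cdot>\<^bsub>W\<^esub> h)"
    by (rule kap_eq[OF A W.Comp_in_hom[OF h g(1)]])
  then show ?thesis
    using kap_eq[OF A g] Fa_Comp[OF h g(1)] E.Comp_assoc[OF Fa_hom[OF h] Fa_hom[OF g(1)] quo(2)[OF A]] by simp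
qed

lemma kap_Comp_apply:
  assumes "a \<in> hom X (Go V) A" "h \<in> hom W T V" "z \<in> hom E U (Fo T)"
  shows "kap T (a \<cdot>\<^bsub>X\<^esub> Ga h) \<cdot> z = kap V a \<cdot> (Fa h \<cdot> z)"
  using kap_Comp[OF assms(1,2)] E.Comp_assoc[OF assms(3) Fa_hom[OF assms(2)] kap_hom[OF assms(1)]]
    W.hom_Obj[OF assms(2)] by simp

lemma kap_cov:
  assumes A: "A \<in> Obj X"
  shows "kap (base A) (cov A) = quo A"
proof -
  note b = base_cov[OF A]
  have "cov A \<cdot>\<^bsub>X\<^esub> Ga (Ide W (base A)) = cov A"
    using is_functorD(7)[OF is_functor_\<Gamma> b(1)] X.Comp_Ide_right[OF b(3)] by simp
  then have "kap (base A) (cov A) = quo A \<cdot> Fa (Ide W (base A))"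
    by (rule kap_eq[OF A W.Ide_in_hom[OF b(1)]])
  then show ?thesis using is_functorD(7)[OF is_functor_F b(1)] E.Comp_Ide_right[OF quo(2)[OF A]] by simp
qed

lemma kap_local:
  assumes A: "A \<in> Obj X" and y: "y \<in> hom E U (Fhat A)"
  obtains e U' V a x where "is_cover E e U' U" "V \<in> Obj W" "a \<in> hom X (Go V) A"
    "x \<in> hom E U' (Fo V)" "kap V a \<cdot> x = y \<cdot> e"
  using E.cover_pull[OF quo(1)[OF A] y] that[OF _ base_cov(1)[OF A] base_cov(3)[OF A]] kap_cov[OF A] by metis

text \<open>The relation \<open>same\<close> gives arrows \<open>s\<close>, \<open>t\<close> that \<open>cov A\<close> makes equal, together with an element whose
  images under them are the images of \<open>z\<close> under the lifts \<open>g\<close>, \<open>g'\<close> of \<open>a\<close>, \<open>b\<close>. Refining \<open>z\<close> once more for each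
  of these two coincidences turns them into equations in \<open>W\<close>, and \<open>a\<close> and \<open>b\<close> become equal in \<open>X\<close>.\<close>

lemma kap_eqD:
  assumes a: "a \<in> hom X (Go V) A" "b \<in> hom X (Go V) A" and V: "V \<in> Obj W"
    and z: "z \<in> hom E U (Fo V)" and eq: "kap V a \<cdot> z = kap V b \<cdot> z"
  obtains e U' T h z' where "is_cover E e U' U" "h \<in> hom W T V" "z' \<in> hom E U' (Fo T)"
    "Fa h \<cdot> z' = z \<cdot> e" "a \<cdot>\<^bsub>X\<^esub> Ga h = b \<cdot>\<^bsub>X\<^esub> Ga h"
proof -
  have A: "A \<in> Obj X" using X.hom_Obj[OF a(1)] by simp
  note cA = base_cov(3)[OF A]
  obtain g where g: "g \<in> hom W V (base A)" "cov A \<cdot>\<^bsub>X\<^esub> Ga g = a" using lift_cov[OF a(1) V] .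
  obtain g' where g': "g' \<in> hom W V (base A)" "cov A \<cdot>\<^bsub>X\<^esub> Ga g' = b" using lift_cov[OF a(2) V] .
  note gz = E.Comp_in_hom[OF z Fa_hom[OF g(1)]] and gz' = E.Comp_in_hom[OF z Fa_hom[OF g'(1)]]
  have "quo A \<cdot> (Fa g \<cdot> z) = quo A \<cdot> (Fa g' \<cdot> z)"
    using eq kap_eq[OF A g] kap_eq[OF A g'] E.Comp_assoc[OF z Fa_hom[OF g(1)] quo(2)[OF A]]
      E.Comp_assoc[OF z Fa_hom[OF g'(1)] quo(2)[OF A]] by simp
  then obtain e1 U1 T1 z1 s t where 1: "is_cover E e1 U1 U" "s \<in> hom W T1 (base A)" "t \<in> hom W T1 (base A)"
    "z1 \<in> hom E U1 (Fo T1)" "Fa s \<cdot> z1 = (Fa g \<cdot> z) \<cdot> e1" "Fa t \<cdot> z1 = (Fa g' \<cdot> z) \<cdot> e1"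
    "cov A \<cdot>\<^bsub>X\<^esub> Ga s = cov A \<cdot>\<^bsub>X\<^esub> Ga t"
    using quo(3)[OF A gz gz'] unfolding same_def by blast
  have e1: "e1 \<in> hom E U1 U" using 1(1) by (simp add: is_cover_def)
  note ze = E.Comp_in_hom[OF e1 z]
  obtain e2 U2 T2 p r z2 where 2: "is_cover E e2 U2 U1" "p \<in> hom W T2 V" "r \<in> hom W T2 T1"
    "z2 \<in> hom E U2 (Fo T2)" "Fa p \<cdot> z2 = (z \<cdot> e1) \<cdot> e2" "Fa r \<cdot> z2 = z1 \<cdot> e2"
    using local_pair[OF ze 1(4) V W.hom_Obj(1)[OF 1(2)]] .
  have e2: "e2 \<in> hom E U2 U1" using 2(1) by (simp add: is_cover_def)
  have step: "Fa (u \<cdot>\<^bsub>W\<^esub> r) \<cdot> z2 = Fa (k \<cdot>\<^bsub>W\<^esub> p) \<cdot> z2"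
    if "u \<in> hom W T1 (base A)" "k \<in> hom W V (base A)" "Fa u \<cdot> z1 = (Fa k \<cdot> z) \<cdot> e1" for u k
  proof -
    have "Fa (u \<cdot>\<^bsub>W\<^esub> r) \<cdot> z2 = ((Fa k \<cdot> z) \<cdot> e1) \<cdot> e2"
      using Fa_Comp_apply[OF 2(3) that(1) 2(4)] 2(6) E.Comp_assoc[OF e2 1(4) Fa_hom[OF that(1)]] that(3) by simp
    also have "\<dots> = Fa k \<cdot> ((z \<cdot> e1) \<cdot> e2)"
      using Fa_hom[OF that(2)] z e1 e2 by (simp add: hom_iff)
    finally show ?thesis using Fa_Comp_apply[OF 2(2) that(2) 2(4)] 2(5) by simp
  qed
  note c1 = W.Comp_in_hom[OF 2(3) 1(2)] W.Comp_in_hom[OF 2(2) g(1)]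
  obtain e3 U3 T3 h z3 where 3: "is_cover E e3 U3 U2" "h \<in> hom W T3 T2" "(s \<cdot>\<^bsub>W\<^esub> r) \<cdot>\<^bsub>W\<^esub> h = (g \<cdot>\<^bsub>W\<^esub> p) \<cdot>\<^bsub>W\<^esub> h"
    "z3 \<in> hom E U3 (Fo T3)" "Fa h \<cdot> z3 = z2 \<cdot> e3"
    using local_equalizer[OF c1 2(4) step[OF 1(2) g(1) 1(5)]] .
  have e3: "e3 \<in> hom E U3 U2" using 3(1) by (simp add: is_cover_def)
  note c2 = W.Comp_in_hom[OF 2(3) 1(3)] W.Comp_in_hom[OF 2(2) g'(1)]
  note c3 = W.Comp_in_hom[OF 3(2) c2(1)] W.Comp_in_hom[OF 3(2) c2(2)]
  have "Fa ((t \<cdot>\<^bsub>W\<^esub> r) \<cdot>\<^bsub>W\<^esub> h) \<cdot> z3 = Fa ((g' \<cdot>\<^bsub>W\<^esub> p) \<cdot>\<^bsub>W\<^esub> h) \<cdot> z3"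
    using Fa_Comp_apply[OF 3(2) c2(1) 3(4)] Fa_Comp_apply[OF 3(2) c2(2) 3(4)] 3(5)
      E.Comp_assoc[OF e3 2(4) Fa_hom[OF c2(1)]] E.Comp_assoc[OF e3 2(4) Fa_hom[OF c2(2)]]
      step[OF 1(3) g'(1) 1(6)] by simp
  note eq4 = this
  obtain e4 U4 T4 k z4 where 4: "is_cover E e4 U4 U3" "k \<in> hom W T4 T3"
    "((t \<cdot>\<^bsub>W\<^esub> r) \<cdot>\<^bsub>W\<^esub> h) \<cdot>\<^bsub>W\<^esub> k = ((g' \<cdot>\<^bsub>W\<^esub> p) \<cdot>\<^bsub>W\<^esub> h) \<cdot>\<^bsub>W\<^esub> k"
    "z4 \<in> hom E U4 (Fo T4)" "Fa k \<cdot> z4 = z3 \<cdot> e4"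
    using local_equalizer[OF c3 3(4) eq4] .
  have e4: "e4 \<in> hom E U4 U3" using 4(1) by (simp add: is_cover_def)
  define m where "m = p \<cdot>\<^bsub>W\<^esub> (h \<cdot>\<^bsub>W\<^esub> k)"
  have hk: "h \<cdot>\<^bsub>W\<^esub> k \<in> hom W T4 T2" using 4(2) 3(2) by (rule W.Comp_in_hom)
  have m: "m \<in> hom W T4 V" unfolding m_def using hk 2(2) by (rule W.Comp_in_hom)
  define ec where "ec = e1 \<cdot> (e2 \<cdot> (e3 \<cdot> e4))"
  have "is_cover E ec U4 U" unfolding ec_def
    by (rule E.is_cover_comp[OF E.is_cover_comp[OF E.is_cover_comp[OF 4(1) 3(1)] 2(1)] 1(1)])
  moreover have "Fa m \<cdot> z4 = z \<cdot> ec"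
  proof -
    have "Fa m \<cdot> z4 = Fa p \<cdot> (Fa h \<cdot> (Fa k \<cdot> z4))"
      unfolding m_def using Fa_Comp_apply[OF hk 2(2) 4(4)] Fa_Comp_apply[OF 4(2) 3(2) 4(4)] by simp
    also have "\<dots> = ((Fa p \<cdot> z2) \<cdot> e3) \<cdot> e4"
      using 4(5) 3(5) E.Comp_assoc[OF e4 3(4) Fa_hom[OF 3(2)]] Fa_hom[OF 2(2)] 2(4) e3 e4
      by (simp add: hom_iff)
    also have "\<dots> = z \<cdot> ec" unfolding 2(5) ec_def using z e1 e2 e3 e4 by (simp add: hom_iff)
    finally show ?thesis .
  qed
  moreover have "a \<cdot>\<^bsub>X\<^esub> Ga m = b \<cdot>\<^bsub>X\<^esub> Ga m"
  proof -
    have assoc: "u \<cdot>\<^bsub>W\<^esub> m = ((u \<cdot>\<^bsub>W\<^esub> p) \<cdot>\<^bsub>W\<^esub> h) \<cdot>\<^bsub>W\<^esub> k" if "u \<in> hom W V (base A)" for u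
      unfolding m_def using that 2(2) 3(2) 4(2) by (simp add: hom_iff)
    have assoc': "((u \<cdot>\<^bsub>W\<^esub> r) \<cdot>\<^bsub>W\<^esub> h) \<cdot>\<^bsub>W\<^esub> k = u \<cdot>\<^bsub>W\<^esub> (r \<cdot>\<^bsub>W\<^esub> (h \<cdot>\<^bsub>W\<^esub> k))" if "u \<in> hom W T1 (base A)" for u
      using that 2(3) 3(2) 4(2) by (simp add: hom_iff)
    have rhk: "r \<cdot>\<^bsub>W\<^esub> (h \<cdot>\<^bsub>W\<^esub> k) \<in> hom W T4 T1" using hk 2(3) by (rule W.Comp_in_hom)
    have comp: "cov A \<cdot>\<^bsub>X\<^esub> Ga (u \<cdot>\<^bsub>W\<^esub> v) = (cov A \<cdot>\<^bsub>X\<^esub> Ga u) \<cdot>\<^bsub>X\<^esub> Ga v"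
      if "u \<in> hom W S (base A)" "v \<in> hom W T4 S" for u v S
      using Ga_Comp[OF that(2,1)] X.Comp_assoc[OF Ga_hom[OF that(2)] Ga_hom[OF that(1)] cA] by simp
    have "a \<cdot>\<^bsub>X\<^esub> Ga m = cov A \<cdot>\<^bsub>X\<^esub> Ga (s \<cdot>\<^bsub>W\<^esub> (r \<cdot>\<^bsub>W\<^esub> (h \<cdot>\<^bsub>W\<^esub> k)))"
      using comp[OF g(1) m] g(2) assoc[OF g(1)] 3(3) assoc'[OF 1(2)] by simp
    also have "\<dots> = cov A \<cdot>\<^bsub>X\<^esub> Ga (t \<cdot>\<^bsub>W\<^esub> (r \<cdot>\<^bsub>W\<^esub> (h \<cdot>\<^bsub>W\<^esub> k)))"
      using comp[OF 1(2) rhk] comp[OF 1(3) rhk] 1(7) by simp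
    also have "\<dots> = b \<cdot>\<^bsub>X\<^esub> Ga m"
      using comp[OF g'(1) m] g'(2) assoc[OF g'(1)] 4(3) assoc'[OF 1(3)] by simp
    finally show ?thesis .
  qed
  ultimately show ?thesis using that m 4(4) by blast
qed

lemma kap_eqD_finite:
  assumes "finite S" and V: "V \<in> Obj W" and z: "z \<in> hom E U (Fo V)"
    and ab: "\<And>i. i \<in> S \<Longrightarrow> a i \<in> hom X (Go V) (A i)" "\<And>i. i \<in> S \<Longrightarrow> b i \<in> hom X (Go V) (A i)"
    and eq: "\<And>i. i \<in> S \<Longrightarrow> kap V (a i) \<cdot> z = kap V (b i) \<cdot> z"
  shows "\<exists>e U' T h z'. is_cover E e U' U \<and> h \<in> hom W T V \<and> z' \<in> hom E U' (Fo T) \<and>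
    Fa h \<cdot> z' = z \<cdot> e \<and> (\<forall>i \<in> S. a i \<cdot>\<^bsub>X\<^esub> Ga h = b i \<cdot>\<^bsub>X\<^esub> Ga h)"
  using assms(1) ab eq
proof (induction S)
  case empty
  have "is_cover E (Ide E U) U U" using E.is_cover_Ide E.hom_Obj[OF z] by blast
  moreover have "Fa (Ide W V) \<cdot> z = z \<cdot> Ide E U"
    using is_functorD(7)[OF is_functor_F V] E.Comp_Ide_left[OF z] E.Comp_Ide_right[OF z] by simp
  ultimately show ?case using W.Ide_in_hom[OF V] z by blast
next
  case (insert i S)
  obtain e U' T h z' where 1: "is_cover E e U' U" "h \<in> hom W T V" "z' \<in> hom E U' (Fo T)"
    "Fa h \<cdot> z' = z \<cdot> e" "\<forall>i \<in> S. a i \<cdot>\<^bsub>X\<^esub> Ga h = b i \<cdot>\<^bsub>X\<^esub> Ga h"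
    using insert.IH insert.prems by (metis insertCI)
  have e: "e \<in> hom E U' U" using 1(1) by (simp add: is_cover_def)
  have i: "a i \<in> hom X (Go V) (A i)" "b i \<in> hom X (Go V) (A i)" using insert.prems by blast+
  have T: "T \<in> Obj W" using W.hom_Obj[OF 1(2)] by simp
  have "kap T (a i \<cdot>\<^bsub>X\<^esub> Ga h) \<cdot> z' = kap T (b i \<cdot>\<^bsub>X\<^esub> Ga h) \<cdot> z'"
    using kap_Comp_apply[OF i(1) 1(2,3)] kap_Comp_apply[OF i(2) 1(2,3)] 1(4)
      E.Comp_assoc[OF e z kap_hom[OF i(1) V]] E.Comp_assoc[OF e z kap_hom[OF i(2) V]]
      insert.prems(3)[of i] by simp
  note eqi = this
  obtain e' U'' T' h' z'' where 2: "is_cover E e' U'' U'" "h' \<in> hom W T' T" "z'' \<in> hom E U'' (Fo T')"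
    "Fa h' \<cdot> z'' = z' \<cdot> e'" "(a i \<cdot>\<^bsub>X\<^esub> Ga h) \<cdot>\<^bsub>X\<^esub> Ga h' = (b i \<cdot>\<^bsub>X\<^esub> Ga h) \<cdot>\<^bsub>X\<^esub> Ga h'"
    using kap_eqD[OF X.Comp_in_hom[OF Ga_hom[OF 1(2)] i(1)] X.Comp_in_hom[OF Ga_hom[OF 1(2)] i(2)] T 1(3) eqi] .
  have e': "e' \<in> hom E U'' U'" using 2(1) by (simp add: is_cover_def)
  have "Fa (h \<cdot>\<^bsub>W\<^esub> h') \<cdot> z'' = z \<cdot> (e \<cdot> e')"
    using Fa_Comp_apply[OF 2(2) 1(2) 2(3)] 2(4) E.Comp_assoc[OF e' 1(3) Fa_hom[OF 1(2)]] 1(4)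
      E.Comp_assoc[OF e' e z] by simp
  moreover have "a k \<cdot>\<^bsub>X\<^esub> Ga (h \<cdot>\<^bsub>W\<^esub> h') = b k \<cdot>\<^bsub>X\<^esub> Ga (h \<cdot>\<^bsub>W\<^esub> h')" if k: "k \<in> insert i S" for k
  proof -
    have ab: "a k \<in> hom X (Go V) (A k)" "b k \<in> hom X (Go V) (A k)" using insert.prems k by blast+
    have "(a k \<cdot>\<^bsub>X\<^esub> Ga h) \<cdot>\<^bsub>X\<^esub> Ga h' = (b k \<cdot>\<^bsub>X\<^esub> Ga h) \<cdot>\<^bsub>X\<^esub> Ga h'" using k 1(5) 2(5) by auto
    then show ?thesis using Ga_Comp[OF 2(2) 1(2)] X.Comp_assoc[OF Ga_hom[OF 2(2)] Ga_hom[OF 1(2)] ab(1)]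
        X.Comp_assoc[OF Ga_hom[OF 2(2)] Ga_hom[OF 1(2)] ab(2)] by simp
  qed
  ultimately show ?case
    using E.is_cover_comp[OF 2(1) 1(1)] W.Comp_in_hom[OF 2(2) 1(2)] 2(3) by blast
qed

end


context left_covering_extension
begin

definition fhat :: "'a \<Rightarrow> 'b" where
  "fhat f = (THE m. m \<in> hom E (Fhat (Dom X f)) (Fhat (Cod X f)) \<and>
     m \<cdot> quo (Dom X f) = kap (base (Dom X f)) (f \<cdot>\<^bsub>X\<^esub> cov (Dom X f)))"

lemma fhat_quo:
  assumes f: "f \<in> hom X A B"
  shows "fhat f \<in> hom E (Fhat A) (Fhat B)" "fhat f \<cdot> quo A = kap (base A) (f \<cdot>\<^bsub>X\<^esub> cov A)"
proof -
  have A: "A \<in> Obj X" using X.hom_Obj[OF f] by simp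
  note b = base_cov[OF A]
  define d where "d = f \<cdot>\<^bsub>X\<^esub> cov A"
  have d: "d \<in> hom X (Go (base A)) B" unfolding d_def using b(3) f by (rule X.Comp_in_hom)
  have k: "kap (base A) d \<in> hom E (Fo (base A)) (Fhat B)" by (rule kap_hom[OF d b(1)])
  obtain m where m: "m \<in> hom E (Fhat A) (Fhat B)" "m \<cdot> quo A = kap (base A) d"
  proof (rule E.is_cover_descend[OF quo(1)[OF A] k])
    fix U p q assume pq: "p \<in> hom E U (Fo (base A))" "q \<in> hom E U (Fo (base A))" "quo A \<cdot> p = quo A \<cdot> q"
    then obtain e U' T z s t where e: "is_cover E e U' U" and st: "s \<in> hom W T (base A)" "t \<in> hom W T (base A)"
      and z: "z \<in> hom E U' (Fo T)" "Fa s \<cdot> z = p \<cdot> e" "Fa t \<cdot> z = q \<cdot> e"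
      and eq: "cov A \<cdot>\<^bsub>X\<^esub> Ga s = cov A \<cdot>\<^bsub>X\<^esub> Ga t"
      using quo(3)[OF A pq(1,2)] unfolding same_def by blast
    have e': "e \<in> hom E U' U" using e by (simp add: is_cover_def)
    have "d \<cdot>\<^bsub>X\<^esub> Ga s = d \<cdot>\<^bsub>X\<^esub> Ga t"
      unfolding d_def using X.Comp_assoc[OF Ga_hom[OF st(1)] b(3) f]
        X.Comp_assoc[OF Ga_hom[OF st(2)] b(3) f] eq by simp
    then have "kap (base A) d \<cdot> (Fa s \<cdot> z) = kap (base A) d \<cdot> (Fa t \<cdot> z)"
      using kap_Comp_apply[OF d st(1) z(1)] kap_Comp_apply[OF d st(2) z(1)] by simp
    then have "(kap (base A) d \<cdot> p) \<cdot> e = (kap (base A) d \<cdot> q) \<cdot> e"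
      using z(2,3) E.Comp_assoc[OF e' pq(1) k] E.Comp_assoc[OF e' pq(2) k] by simp
    then show "kap (base A) d \<cdot> p = kap (base A) d \<cdot> q"
      by (rule E.is_cover_cancel[OF e _ E.Comp_in_hom[OF pq(1) k] E.Comp_in_hom[OF pq(2) k]])
  qed
  have AB: "Dom X f = A" "Cod X f = B" using f by (auto simp: hom_iff)
  have "fhat f = m"
    unfolding fhat_def AB
  proof (rule the_equality)
    show "m \<in> hom E (Fhat A) (Fhat B) \<and> m \<cdot> quo A = kap (base A) (f \<cdot>\<^bsub>X\<^esub> cov A)"
      using m by (simp add: d_def)
    fix m' assume "m' \<in> hom E (Fhat A) (Fhat B) \<and> m' \<cdot> quo A = kap (base A) (f \<cdot>\<^bsub>X\<^esub> cov A)"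
    then show "m' = m" using E.is_cover_cancel[OF quo(1)[OF A] _ _ m(1), of m'] m(2) by (simp add: d_def)
  qed
  then show "fhat f \<in> hom E (Fhat A) (Fhat B)" "fhat f \<cdot> quo A = kap (base A) (f \<cdot>\<^bsub>X\<^esub> cov A)"
    using m by (simp_all add: d_def)
qed

lemma fhat_kap:
  assumes f: "f \<in> hom X A B" and a: "a \<in> hom X (Go V) A" and V: "V \<in> Obj W"
  shows "fhat f \<cdot> kap V a = kap V (f \<cdot>\<^bsub>X\<^esub> a)"
proof -
  have A: "A \<in> Obj X" using X.hom_Obj[OF f] by simp
  note c = base_cov(3)[OF A]
  obtain g where g: "g \<in> hom W V (base A)" "cov A \<cdot>\<^bsub>X\<^esub> Ga g = a" using lift_cov[OF a V] .
  have "fhat f \<cdot> kap V a = (fhat f \<cdot> quo A) \<cdot> Fa g"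
    unfolding kap_eq[OF A g] using E.Comp_assoc[OF Fa_hom[OF g(1)] quo(2)[OF A] fhat_quo(1)[OF f]] by simp
  also have "\<dots> = kap V ((f \<cdot>\<^bsub>X\<^esub> cov A) \<cdot>\<^bsub>X\<^esub> Ga g)"
    unfolding fhat_quo(2)[OF f] using kap_Comp[OF X.Comp_in_hom[OF c f] g(1)] by simp
  also have "\<dots> = kap V (f \<cdot>\<^bsub>X\<^esub> a)" using X.Comp_assoc[OF Ga_hom[OF g(1)] c f] g(2) by simp
  finally show ?thesis .
qed

lemma fhat_kap_apply:
  assumes "f \<in> hom X A B" "a \<in> hom X (Go V) A" "V \<in> Obj W" "z \<in> hom E U (Fo V)"
  shows "fhat f \<cdot> (kap V a \<cdot> z) = kap V (f \<cdot>\<^bsub>X\<^esub> a) \<cdot> z"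
  using fhat_kap[OF assms(1-3)] E.Comp_assoc[OF assms(4) kap_hom[OF assms(2,3)] fhat_quo(1)[OF assms(1)]] by simp

text \<open>The extension of \<open>F\<close>, the left Kan extension along \<open>\<Gamma>\<close>.\<close>

definition Ext :: "('o, 'a, 'p, 'b) ftr" where
  "Ext = \<lparr>FO = restrict Fhat (Obj X), FA = restrict fhat (Arr X)\<rparr>"

lemma Ext_simps [simp]:
  "A \<in> Obj X \<Longrightarrow> FO Ext A = Fhat A"
  "f \<in> Arr X \<Longrightarrow> FA Ext f = fhat f"
  by (simp_all add: Ext_def)

lemma is_functor_Ext: "is_functor X E Ext"
  unfolding is_functor_def
proof (intro conjI ballI impI X.category_axioms E.category_axioms)
  have "Fhat A \<in> Obj E" if "A \<in> Obj X" for A using E.hom_Obj[OF quo(2)[OF that]] by simp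
  then show "FO Ext \<in> Obj X \<rightarrow>\<^sub>E Obj E" by (auto simp: Ext_def)
  show "FA Ext \<in> extensional (Arr X)" by (simp add: Ext_def)
  show "FA Ext f \<in> hom E (FO Ext (Dom X f)) (FO Ext (Cod X f))" if "f \<in> Arr X" for f
    using that fhat_quo(1)[of f "Dom X f" "Cod X f"] by (simp add: hom_def)
  show "FA Ext (Ide X A) = Ide E (FO Ext A)" if A: "A \<in> Obj X" for A
  proof -
    have I: "Ide X A \<in> hom X A A" using A by (rule X.Ide_in_hom)
    have FA: "Fhat A \<in> Obj E" using E.hom_Obj[OF quo(2)[OF A]] by simp
    have "fhat (Ide X A) \<cdot> quo A = Ide E (Fhat A) \<cdot> quo A"
      using fhat_quo(2)[OF I] X.Comp_Ide_left[OF base_cov(3)[OF A]] kap_cov[OF A]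
        E.Comp_Ide_left[OF quo(2)[OF A]] by simp
    then have "fhat (Ide X A) = Ide E (Fhat A)"
      by (rule E.is_cover_cancel[OF quo(1)[OF A] _ fhat_quo(1)[OF I] E.Ide_in_hom[OF FA]])
    then show ?thesis using A by simp
  qed
  fix f g assume "f \<in> Arr X" "g \<in> Arr X" "Dom X g = Cod X f"
  then obtain A B D where f: "f \<in> hom X A B" and g: "g \<in> hom X B D" by (auto simp: hom_iff)
  have A: "A \<in> Obj X" using X.hom_Obj[OF f] by simp
  have gf: "g \<cdot>\<^bsub>X\<^esub> f \<in> hom X A D" using f g by (rule X.Comp_in_hom)
  note b = base_cov[OF A] and fc = X.Comp_in_hom[OF base_cov(3)[OF A] f]
  have "(fhat g \<cdot> fhat f) \<cdot> quo A = fhat g \<cdot> kap (base A) (f \<cdot>\<^bsub>X\<^esub> cov A)"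
    using E.Comp_assoc[OF quo(2)[OF A] fhat_quo(1)[OF f] fhat_quo(1)[OF g]] fhat_quo(2)[OF f] by simp
  also have "\<dots> = fhat (g \<cdot>\<^bsub>X\<^esub> f) \<cdot> quo A"
    using fhat_kap[OF g fc b(1)] fhat_quo(2)[OF gf] X.Comp_assoc[OF b(3) f g] by simp
  finally have "fhat g \<cdot> fhat f = fhat (g \<cdot>\<^bsub>X\<^esub> f)"
    by (rule E.is_cover_cancel[OF quo(1)[OF A] _ E.Comp_in_hom[OF fhat_quo(1)[OF f] fhat_quo(1)[OF g]] fhat_quo(1)[OF gf]])
  then show "FA Ext (g \<cdot>\<^bsub>X\<^esub> f) = FA Ext g \<cdot> FA Ext f"
    using f g gf by (simp add: hom_def)
qed

text \<open>On an object \<open>Go V\<close>, the identity represents everything: its \<open>kap V\<close> is a cover because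
  \<open>quo (Go V)\<close> factors through it, and a monomorphism because \<open>\<Gamma>\<close> is faithful.\<close>

lemma kap_Ide_iso:
  assumes V: "V \<in> Obj W"
  shows "is_iso E (kap V (Ide X (Go V)))" "kap V (Ide X (Go V)) \<in> hom E (Fo V) (Fhat (Go V))"
proof -
  have GV: "Go V \<in> Obj X" using V by (rule is_functorD(3)[OF is_functor_\<Gamma>])
  have I: "Ide X (Go V) \<in> hom X (Go V) (Go V)" using GV by (rule X.Ide_in_hom)
  let ?k = "kap V (Ide X (Go V))"
  show k: "?k \<in> hom E (Fo V) (Fhat (Go V))" by (rule kap_hom[OF I V])
  note b = base_cov[OF GV]
  obtain g where g: "g \<in> hom W (base (Go V)) V" "Ga g = cov (Go V)" using full[OF b(1) V b(3)] by blast
  have "?k \<cdot> Fa g = quo (Go V)"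
    using kap_Comp[OF I g(1)] g(2) X.Comp_Ide_left[OF b(3)] kap_cov[OF GV] by simp
  then have cover: "is_cover E ?k (Fo V) (Fhat (Go V))"
    using E.is_cover_right_factor[OF _ Fa_hom[OF g(1)] k] quo(1)[OF GV] by simp
  have "z = z'" if z: "z \<in> hom E U (Fo V)" "z' \<in> hom E U (Fo V)" "?k \<cdot> z = ?k \<cdot> z'" for U z z'
  proof -
    obtain e U' T p q y where 1: "is_cover E e U' U" "p \<in> hom W T V" "q \<in> hom W T V"
      "y \<in> hom E U' (Fo T)" "Fa p \<cdot> y = z \<cdot> e" "Fa q \<cdot> y = z' \<cdot> e"
      using local_pair[OF z(1,2) V V] .
    have e: "e \<in> hom E U' U" using 1(1) by (simp add: is_cover_def)
    have T: "T \<in> Obj W" using W.hom_Obj[OF 1(2)] by simp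
    have "?k \<cdot> (Fa p \<cdot> y) = ?k \<cdot> (Fa q \<cdot> y)"
      using 1(5,6) E.Comp_assoc[OF e z(1) k] E.Comp_assoc[OF e z(2) k] z(3) by simp
    then have "kap T (Ide X (Go V) \<cdot>\<^bsub>X\<^esub> Ga p) \<cdot> y = kap T (Ide X (Go V) \<cdot>\<^bsub>X\<^esub> Ga q) \<cdot> y"
      using kap_Comp_apply[OF I 1(2,4)] kap_Comp_apply[OF I 1(3,4)] by simp
    then have eq: "kap T (Ga p) \<cdot> y = kap T (Ga q) \<cdot> y"
      using X.Comp_Ide_left[OF Ga_hom[OF 1(2)]] X.Comp_Ide_left[OF Ga_hom[OF 1(3)]] by simp
    obtain e' U'' S h w where 2: "is_cover E e' U'' U'" "h \<in> hom W S T" "w \<in> hom E U'' (Fo S)"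
      "Fa h \<cdot> w = y \<cdot> e'" "Ga p \<cdot>\<^bsub>X\<^esub> Ga h = Ga q \<cdot>\<^bsub>X\<^esub> Ga h"
      using kap_eqD[OF Ga_hom[OF 1(2)] Ga_hom[OF 1(3)] T 1(4) eq] .
    have e': "e' \<in> hom E U'' U'" using 2(1) by (simp add: is_cover_def)
    have "p \<cdot>\<^bsub>W\<^esub> h = q \<cdot>\<^bsub>W\<^esub> h"
      using faithful[OF W.Comp_in_hom[OF 2(2) 1(2)] W.Comp_in_hom[OF 2(2) 1(3)]] 2(5)
        Ga_Comp[OF 2(2) 1(2)] Ga_Comp[OF 2(2) 1(3)] by simp
    then have "Fa p \<cdot> (y \<cdot> e') = Fa q \<cdot> (y \<cdot> e')"
      using Fa_Comp_apply[OF 2(2) 1(2) 2(3)] Fa_Comp_apply[OF 2(2) 1(3) 2(3)] 2(4) by simp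
    then have "(z \<cdot> e) \<cdot> e' = (z' \<cdot> e) \<cdot> e'"
      using E.Comp_assoc[OF e' 1(4) Fa_hom[OF 1(2)]] E.Comp_assoc[OF e' 1(4) Fa_hom[OF 1(3)]] 1(5,6) by simp
    then have "z \<cdot> e = z' \<cdot> e"
      by (rule E.is_cover_cancel[OF 2(1) _ E.Comp_in_hom[OF e z(1)] E.Comp_in_hom[OF e z(2)]])
    then show "z = z'" by (rule E.is_cover_cancel[OF 1(1) _ z(1,2)])
  qed
  then have "is_mono E ?k" using k by (simp add: is_mono_def hom_iff)
  then show "is_iso E ?k" using E.mono_regular_epi_is_iso cover by (simp add: is_cover_def)
qed

lemma Ext_restricts: "nat_trans W E F (comp_ftr W Ext \<Gamma>) (\<lambda>V \<in> Obj W. kap V (Ide X (Go V)))"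
proof (rule nat_transI[OF is_functor_F is_functor_comp[OF is_functor_\<Gamma> is_functor_Ext]])
  note G = is_functorD(3)[OF is_functor_\<Gamma>]
  show "(\<lambda>V \<in> Obj W. kap V (Ide X (Go V))) V \<in> hom E (Fo V) (FO (comp_ftr W Ext \<Gamma>) V)"
    if "V \<in> Obj W" for V
    using that kap_Ide_iso(2)[OF that] G[OF that] by (simp add: comp_ftr_def)
  fix V T f assume f: "f \<in> hom W V T"
  have VT: "V \<in> Obj W" "T \<in> Obj W" using W.hom_Obj[OF f] by auto
  have I: "Ide X (Go V) \<in> hom X (Go V) (Go V)" "Ide X (Go T) \<in> hom X (Go T) (Go T)"
    using VT G X.Ide_in_hom by blast+
  have "kap T (Ide X (Go T)) \<cdot> Fa f = kap V (Ga f)"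
    using kap_Comp[OF I(2) f] X.Comp_Ide_left[OF Ga_hom[OF f]] by simp
  also have "\<dots> = fhat (Ga f) \<cdot> kap V (Ide X (Go V))"
    using fhat_kap[OF Ga_hom[OF f] I(1) VT(1)] X.Comp_Ide_right[OF Ga_hom[OF f]] by simp
  finally show "(\<lambda>V \<in> Obj W. kap V (Ide X (Go V))) T \<cdot> Fa f
      = FA (comp_ftr W Ext \<Gamma>) f \<cdot> (\<lambda>V \<in> Obj W. kap V (Ide X (Go V))) V"
    using VT f Ga_hom[OF f] by (simp add: comp_ftr_def hom_def)
qed simp

text \<open>The chosen cover of \<open>B\<close> lifts along \<open>e\<close>, so \<open>quo B\<close> factors through \<open>fhat e\<close>.\<close>

lemma Ext_cover:
  assumes e: "is_cover X e A B"
  shows "is_cover E (fhat e) (Fhat A) (Fhat B)"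
proof -
  have e': "e \<in> hom X A B" using e by (simp add: is_cover_def)
  have B: "B \<in> Obj X" using X.hom_Obj[OF e'] by simp
  note b = base_cov[OF B]
  obtain a where a: "a \<in> hom X (Go (base B)) A" "e \<cdot>\<^bsub>X\<^esub> a = cov B" using projective[OF b(1) e b(3)] by blast
  have "fhat e \<cdot> kap (base B) a = quo B"
    using fhat_kap[OF e' a(1) b(1)] a(2) kap_cov[OF B] by simp
  then show ?thesis
    using E.is_cover_right_factor[OF _ kap_hom[OF a(1) b(1)] fhat_quo(1)[OF e']] quo(1)[OF B] by simp
qed

text \<open>Two factorisations have local representatives \<open>a\<close>, \<open>a'\<close> at the same element \<open>z\<close>. Their
  composites with the limit cone represent the same elements, hence become equal in \<open>X\<close> on a
  refinement of \<open>z\<close>; then so do \<open>a\<close> and \<open>a'\<close>, by the uniqueness in \<open>X\<close>.\<close>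

lemma Ext_limit_unique:
  assumes D: "finite_diagram J X D" and lim: "is_limit J X D L l"
    and h: "h \<in> hom E U (Fhat L)" "h' \<in> hom E U (Fhat L)"
    and eq: "\<And>j. j \<in> Obj J \<Longrightarrow> fhat (l j) \<cdot> h = fhat (l j) \<cdot> h'"
  shows "h = h'"
proof -
  have D': "is_functor J X D" and fin: "finite (Obj J)" using D by (simp_all add: finite_diagram_def)
  have L: "L \<in> Obj X" "\<And>j. j \<in> Obj J \<Longrightarrow> l j \<in> hom X L (FO D j)"
    using lim by (auto simp: is_limit_def is_cone_def)
  note b = base_cov[OF L(1)] and q = quo(2)[OF L(1)]
  obtain e1 U1 V1 a1 x1 where 1: "is_cover E e1 U1 U" "V1 \<in> Obj W" "a1 \<in> hom X (Go V1) L"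
    "x1 \<in> hom E U1 (Fo V1)" "kap V1 a1 \<cdot> x1 = h \<cdot> e1"
    using kap_local[OF L(1) h(1)] .
  have e1: "e1 \<in> hom E U1 U" using 1(1) by (simp add: is_cover_def)
  obtain e2 U2 V2 a2 x2 where 2: "is_cover E e2 U2 U1" "V2 \<in> Obj W" "a2 \<in> hom X (Go V2) L"
    "x2 \<in> hom E U2 (Fo V2)" "kap V2 a2 \<cdot> x2 = (h' \<cdot> e1) \<cdot> e2"
    using kap_local[OF L(1) E.Comp_in_hom[OF e1 h(2)]] .
  have e2: "e2 \<in> hom E U2 U1" using 2(1) by (simp add: is_cover_def)
  obtain e3 U3 V p q z where 3: "is_cover E e3 U3 U2" "p \<in> hom W V V1" "q \<in> hom W V V2"
    "z \<in> hom E U3 (Fo V)" "Fa p \<cdot> z = (x1 \<cdot> e2) \<cdot> e3" "Fa q \<cdot> z = x2 \<cdot> e3"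
    using local_pair[OF E.Comp_in_hom[OF e2 1(4)] 2(4) 1(2) 2(2)] .
  have e3: "e3 \<in> hom E U3 U2" using 3(1) by (simp add: is_cover_def)
  have V: "V \<in> Obj W" using W.hom_Obj[OF 3(2)] by simp
  define ec where "ec = e1 \<cdot> (e2 \<cdot> e3)"
  have cover: "is_cover E ec U3 U"
    unfolding ec_def by (rule E.is_cover_comp[OF E.is_cover_comp[OF 3(1) 2(1)] 1(1)])
  have ec: "ec \<in> hom E U3 U" using cover by (simp add: is_cover_def)
  define a where "a = a1 \<cdot>\<^bsub>X\<^esub> Ga p"
  define a' where "a' = a2 \<cdot>\<^bsub>X\<^esub> Ga q"
  have a: "a \<in> hom X (Go V) L" "a' \<in> hom X (Go V) L"
    unfolding a_def a'_def using X.Comp_in_hom Ga_hom 3(2,3) 1(3) 2(3) by blast+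
  have az: "kap V a \<cdot> z = h \<cdot> ec"
  proof -
    have "kap V a \<cdot> z = ((kap V1 a1 \<cdot> x1) \<cdot> e2) \<cdot> e3"
      unfolding a_def kap_Comp_apply[OF 1(3) 3(2,4)] 3(5)
      using kap_hom[OF 1(3,2)] 1(4) e2 e3 by (simp add: hom_iff)
    then show ?thesis unfolding 1(5) ec_def using h(1) e1 e2 e3 by (simp add: hom_iff)
  qed
  have az': "kap V a' \<cdot> z = h' \<cdot> ec"
  proof -
    have "kap V a' \<cdot> z = (kap V2 a2 \<cdot> x2) \<cdot> e3"
      unfolding a'_def kap_Comp_apply[OF 2(3) 3(3,4)] 3(6)
      using kap_hom[OF 2(3,2)] 2(4) e3 by (simp add: hom_iff)
    then show ?thesis unfolding 2(5) ec_def using h(2) e1 e2 e3 by (simp add: hom_iff)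
  qed
  have "kap V (l j \<cdot>\<^bsub>X\<^esub> a) \<cdot> z = kap V (l j \<cdot>\<^bsub>X\<^esub> a') \<cdot> z" if j: "j \<in> Obj J" for j
    using fhat_kap_apply[OF L(2)[OF j] a(1) V 3(4)] fhat_kap_apply[OF L(2)[OF j] a(2) V 3(4)] az az'
      E.Comp_assoc[OF ec h(1) fhat_quo(1)[OF L(2)[OF j]]]
      E.Comp_assoc[OF ec h(2) fhat_quo(1)[OF L(2)[OF j]]] eq[OF j] by simp
  then obtain e4 U4 T k w where 4: "is_cover E e4 U4 U3" "k \<in> hom W T V" "w \<in> hom E U4 (Fo T)"
    "Fa k \<cdot> w = z \<cdot> e4" "\<forall>j \<in> Obj J. (l j \<cdot>\<^bsub>X\<^esub> a) \<cdot>\<^bsub>X\<^esub> Ga k = (l j \<cdot>\<^bsub>X\<^esub> a') \<cdot>\<^bsub>X\<^esub> Ga k"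
    using kap_eqD_finite[OF fin V 3(4), of "\<lambda>j. l j \<cdot>\<^bsub>X\<^esub> a" "FO D" "\<lambda>j. l j \<cdot>\<^bsub>X\<^esub> a'"]
      X.Comp_in_hom[OF a(1) L(2)] X.Comp_in_hom[OF a(2) L(2)] by blast
  have e4: "e4 \<in> hom E U4 U3" using 4(1) by (simp add: is_cover_def)
  note Gk = Ga_hom[OF 4(2)]
  have "a \<cdot>\<^bsub>X\<^esub> Ga k = a' \<cdot>\<^bsub>X\<^esub> Ga k"
  proof (rule X.limit_unique[OF lim X.Comp_in_hom[OF Gk a(1)] X.Comp_in_hom[OF Gk a(2)] _ D'])
    show "l j \<cdot>\<^bsub>X\<^esub> (a \<cdot>\<^bsub>X\<^esub> Ga k) = l j \<cdot>\<^bsub>X\<^esub> (a' \<cdot>\<^bsub>X\<^esub> Ga k)" if j: "j \<in> Obj J" for j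
      using X.Comp_assoc[OF Gk a(1) L(2)[OF j]] X.Comp_assoc[OF Gk a(2) L(2)[OF j]] 4(5) j by simp
  qed
  then have "kap V a \<cdot> (z \<cdot> e4) = kap V a' \<cdot> (z \<cdot> e4)"
    using kap_Comp_apply[OF a(1) 4(2,3)] kap_Comp_apply[OF a(2) 4(2,3)] 4(4) by simp
  then have "(h \<cdot> ec) \<cdot> e4 = (h' \<cdot> ec) \<cdot> e4"
    using E.Comp_assoc[OF e4 3(4) kap_hom[OF a(1) V]] E.Comp_assoc[OF e4 3(4) kap_hom[OF a(2) V]] az az' by simp
  then have "h \<cdot> ec = h' \<cdot> ec"
    by (rule E.is_cover_cancel[OF 4(1) _ E.Comp_in_hom[OF ec h(1)] E.Comp_in_hom[OF ec h(2)]])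
  then show ?thesis by (rule E.is_cover_cancel[OF cover _ h])
qed

text \<open>By induction on the set: \<open>local_pair\<close> makes the element at which the previous representatives
  live and an element representing the next \<open>y i\<close> images of a common element.\<close>

lemma local_representatives:
  assumes "finite S" and U: "U \<in> Obj E"
    and A: "\<And>i. i \<in> S \<Longrightarrow> A i \<in> Obj X" and y: "\<And>i. i \<in> S \<Longrightarrow> y i \<in> hom E U (Fhat (A i))"
  shows "\<exists>e U' V z v. is_cover E e U' U \<and> V \<in> Obj W \<and> z \<in> hom E U' (Fo V) \<and>
    (\<forall>i \<in> S. v i \<in> hom X (Go V) (A i) \<and> kap V (v i) \<cdot> z = y i \<cdot> e)"
  using assms(1) A y
proof (induction S)
  case empty
  show ?case using local_object[OF U] by (metis empty_iff)
next
  case (insert i S)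
  obtain e U' V z v where 1: "is_cover E e U' U" "V \<in> Obj W" "z \<in> hom E U' (Fo V)"
    "\<forall>i \<in> S. v i \<in> hom X (Go V) (A i) \<and> kap V (v i) \<cdot> z = y i \<cdot> e"
    using insert.IH insert.prems by (metis insertCI)
  have e: "e \<in> hom E U' U" using 1(1) by (simp add: is_cover_def)
  have i: "A i \<in> Obj X" "y i \<in> hom E U (Fhat (A i))" using insert.prems by blast+
  obtain e1 U1 V1 a x where 2: "is_cover E e1 U1 U'" "V1 \<in> Obj W" "a \<in> hom X (Go V1) (A i)"
    "x \<in> hom E U1 (Fo V1)" "kap V1 a \<cdot> x = (y i \<cdot> e) \<cdot> e1"
    using kap_local[OF i(1) E.Comp_in_hom[OF e i(2)]] .
  have e1: "e1 \<in> hom E U1 U'" using 2(1) by (simp add: is_cover_def)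
  obtain e2 U2 T p q w where 3: "is_cover E e2 U2 U1" "p \<in> hom W T V" "q \<in> hom W T V1"
    "w \<in> hom E U2 (Fo T)" "Fa p \<cdot> w = (z \<cdot> e1) \<cdot> e2" "Fa q \<cdot> w = x \<cdot> e2"
    using local_pair[OF E.Comp_in_hom[OF e1 1(3)] 2(4) 1(2) 2(2)] .
  have e2: "e2 \<in> hom E U2 U1" using 3(1) by (simp add: is_cover_def)
  define v' where "v' k = (if k = i then a \<cdot>\<^bsub>X\<^esub> Ga q else v k \<cdot>\<^bsub>X\<^esub> Ga p)" for k
  have "v' k \<in> hom X (Go T) (A k) \<and> kap T (v' k) \<cdot> w = y k \<cdot> (e \<cdot> (e1 \<cdot> e2))" if k: "k \<in> insert i S" for k
  proof (cases "k = i")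
    case True
    have "kap T (a \<cdot>\<^bsub>X\<^esub> Ga q) \<cdot> w = (kap V1 a \<cdot> x) \<cdot> e2"
      unfolding kap_Comp_apply[OF 2(3) 3(3,4)] 3(6) using kap_hom[OF 2(3,2)] 2(4) e2 by (simp add: hom_iff)
    also have "\<dots> = y i \<cdot> (e \<cdot> (e1 \<cdot> e2))" unfolding 2(5) using i e e1 e2 by (simp add: hom_iff)
    finally show ?thesis using True X.Comp_in_hom[OF Ga_hom[OF 3(3)] 2(3)] by (simp add: v'_def)
  next
    case False
    then have vk: "v k \<in> hom X (Go V) (A k)" "kap V (v k) \<cdot> z = y k \<cdot> e" using 1(4) k by auto
    have yk: "y k \<in> hom E U (Fhat (A k))" using insert.prems k by blast
    have "kap T (v k \<cdot>\<^bsub>X\<^esub> Ga p) \<cdot> w = ((kap V (v k) \<cdot> z) \<cdot> e1) \<cdot> e2"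
      unfolding kap_Comp_apply[OF vk(1) 3(2,4)] 3(5) using kap_hom[OF vk(1) 1(2)] 1(3) e1 e2 by (simp add: hom_iff)
    also have "\<dots> = y k \<cdot> (e \<cdot> (e1 \<cdot> e2))" unfolding vk(2) using yk e e1 e2 by (simp add: hom_iff)
    finally show ?thesis using False X.Comp_in_hom[OF Ga_hom[OF 3(2)] vk(1)] by (simp add: v'_def)
  qed
  moreover have "is_cover E (e \<cdot> (e1 \<cdot> e2)) U2 U"
    by (rule E.is_cover_comp[OF E.is_cover_comp[OF 3(1) 2(1)] 1(1)])
  moreover have "T \<in> Obj W" using W.hom_Obj[OF 3(2)] by simp
  ultimately show ?case using 3(4) by blast
qed

text \<open>Represent the legs of the cone by arrows \<open>v j\<close> at one element \<open>z\<close>. That the cone commutes means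
  that certain composites represent the same elements; after finitely many refinements of \<open>z\<close> the
  \<open>v j\<close> form a cone in \<open>X\<close>, which factors through the limit.\<close>

lemma Ext_limit_local:
  assumes D: "finite_diagram J X D" and lim: "is_limit J X D L l"
    and y: "is_cone J E (comp_ftr J Ext D) U y"
  obtains e U' h where "is_cover E e U' U" "h \<in> hom E U' (Fhat L)"
    "\<forall>j \<in> Obj J. fhat (l j) \<cdot> h = y j \<cdot> e"
proof -
  have D': "is_functor J X D" and fin: "finite (Obj J)" "finite (Arr J)"
    using D by (simp_all add: finite_diagram_def)
  interpret J: category J using D' by (rule is_functorD)
  note F = is_functorD[OF D']
  have L: "L \<in> Obj X" "\<And>j. j \<in> Obj J \<Longrightarrow> l j \<in> hom X L (FO D j)"
    using lim by (auto simp: is_limit_def is_cone_def)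
  have Y: "U \<in> Obj E" "\<And>j. j \<in> Obj J \<Longrightarrow> y j \<in> hom E U (Fhat (FO D j))"
    "\<And>u. u \<in> Arr J \<Longrightarrow> fhat (FA D u) \<cdot> y (Dom J u) = y (Cod J u)"
    using y F by (auto simp: is_cone_def comp_ftr_def)
  obtain e U' V z v where 1: "is_cover E e U' U" "V \<in> Obj W" "z \<in> hom E U' (Fo V)"
    "\<forall>j \<in> Obj J. v j \<in> hom X (Go V) (FO D j) \<and> kap V (v j) \<cdot> z = y j \<cdot> e"
    using local_representatives[OF fin(1) Y(1), of "FO D" y] F(3) Y(2) by blast
  have v: "\<And>j. j \<in> Obj J \<Longrightarrow> v j \<in> hom X (Go V) (FO D j)"
    "\<And>j. j \<in> Obj J \<Longrightarrow> kap V (v j) \<cdot> z = y j \<cdot> e" using 1(4) by blast+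
  have e: "e \<in> hom E U' U" using 1(1) by (simp add: is_cover_def)
  have Du: "FA D u \<in> hom X (FO D (Dom J u)) (FO D (Cod J u))" if "u \<in> Arr J" for u
    using F that by (simp add: hom_iff)
  have "kap V (FA D u \<cdot>\<^bsub>X\<^esub> v (Dom J u)) \<cdot> z = kap V (v (Cod J u)) \<cdot> z" if u: "u \<in> Arr J" for u
  proof -
    have ob: "Dom J u \<in> Obj J" "Cod J u \<in> Obj J" using u by auto
    have "kap V (FA D u \<cdot>\<^bsub>X\<^esub> v (Dom J u)) \<cdot> z = fhat (FA D u) \<cdot> (y (Dom J u) \<cdot> e)"
      using fhat_kap_apply[OF Du[OF u] v(1)[OF ob(1)] 1(2,3)] v(2)[OF ob(1)] by simp
    also have "\<dots> = y (Cod J u) \<cdot> e"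
      using E.Comp_assoc[OF e Y(2)[OF ob(1)] fhat_quo(1)[OF Du[OF u]]] Y(3)[OF u] by simp
    finally show ?thesis using v(2)[OF ob(2)] by simp
  qed
  moreover have "v (Cod J u) \<in> hom X (Go V) (FO D (Cod J u))"
    "FA D u \<cdot>\<^bsub>X\<^esub> v (Dom J u) \<in> hom X (Go V) (FO D (Cod J u))" if u: "u \<in> Arr J" for u
    using v(1)[of "Dom J u"] v(1)[of "Cod J u"] u X.Comp_in_hom[OF _ Du[OF u]] by simp_all
  ultimately obtain e' U'' T k w where 2: "is_cover E e' U'' U'" "k \<in> hom W T V" "w \<in> hom E U'' (Fo T)"
    "Fa k \<cdot> w = z \<cdot> e'" "\<forall>u \<in> Arr J. (FA D u \<cdot>\<^bsub>X\<^esub> v (Dom J u)) \<cdot>\<^bsub>X\<^esub> Ga k = v (Cod J u) \<cdot>\<^bsub>X\<^esub> Ga k"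
    using kap_eqD_finite[OF fin(2) 1(2,3), of "\<lambda>u. FA D u \<cdot>\<^bsub>X\<^esub> v (Dom J u)" "\<lambda>u. FO D (Cod J u)" "\<lambda>u. v (Cod J u)"]
    by blast
  have e': "e' \<in> hom E U'' U'" using 2(1) by (simp add: is_cover_def)
  note Gk = Ga_hom[OF 2(2)]
  have T: "T \<in> Obj W" using W.hom_Obj[OF 2(2)] by simp
  have "is_cone J X D (Go T) (\<lambda>j. v j \<cdot>\<^bsub>X\<^esub> Ga k)"
    unfolding is_cone_def
  proof (intro conjI ballI)
    show "Go T \<in> Obj X" using X.hom_Obj[OF Gk] by simp
    show "v j \<cdot>\<^bsub>X\<^esub> Ga k \<in> hom X (Go T) (FO D j)" if "j \<in> Obj J" for j
      using Gk v(1)[OF that] by (rule X.Comp_in_hom)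
    show "FA D u \<cdot>\<^bsub>X\<^esub> (v (Dom J u) \<cdot>\<^bsub>X\<^esub> Ga k) = v (Cod J u) \<cdot>\<^bsub>X\<^esub> Ga k" if u: "u \<in> Arr J" for u
      using X.Comp_assoc[OF Gk v(1) Du[OF u]] 2(5) u by simp
  qed
  then obtain a where a: "a \<in> hom X (Go T) L" "\<And>j. j \<in> Obj J \<Longrightarrow> l j \<cdot>\<^bsub>X\<^esub> a = v j \<cdot>\<^bsub>X\<^esub> Ga k"
    using limit_factor[OF lim] by blast
  have "fhat (l j) \<cdot> (kap T a \<cdot> w) = y j \<cdot> (e \<cdot> e')" if j: "j \<in> Obj J" for j
  proof -
    have "fhat (l j) \<cdot> (kap T a \<cdot> w) = kap V (v j) \<cdot> (z \<cdot> e')"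
      using fhat_kap_apply[OF L(2)[OF j] a(1) T 2(3)] a(2)[OF j] kap_Comp_apply[OF v(1)[OF j] 2(2,3)] 2(4)
      by simp
    also have "\<dots> = (y j \<cdot> e) \<cdot> e'"
      using E.Comp_assoc[OF e' 1(3) kap_hom[OF v(1)[OF j] 1(2)]] v(2)[OF j] by simp
    finally show ?thesis using E.Comp_assoc[OF e' e Y(2)[OF j]] by simp
  qed
  then show ?thesis
    using that[OF E.is_cover_comp[OF 2(1) 1(1)] E.Comp_in_hom[OF 2(3) kap_hom[OF a(1) T]]] by blast
qed

text \<open>Local factorisations descend along the cover because they are unique.\<close>

lemma Ext_limit:
  assumes D: "finite_diagram J X D" and lim: "is_limit J X D L l"
  shows "is_limit J E (comp_ftr J Ext D) (FO Ext L) (\<lambda>j. FA Ext (l j))"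
proof -
  have D': "is_functor J X D" using D by (simp add: finite_diagram_def)
  have L: "L \<in> Obj X" "\<And>j. j \<in> Obj J \<Longrightarrow> l j \<in> hom X L (FO D j)" "is_cone J X D L l"
    using lim by (auto simp: is_limit_def is_cone_def)
  have El: "FA Ext (l j) = fhat (l j)" if "j \<in> Obj J" for j using L(2)[OF that] by (simp add: hom_def)
  have "\<exists>!h. h \<in> hom E U (Fhat L) \<and> (\<forall>j \<in> Obj J. fhat (l j) \<cdot> h = y j)"
    if y: "is_cone J E (comp_ftr J Ext D) U y" for U y
  proof -
    have Y: "\<And>j. j \<in> Obj J \<Longrightarrow> y j \<in> hom E U (Fhat (FO D j))"
      using y is_functorD(3)[OF D'] by (auto simp: is_cone_def comp_ftr_def)
    obtain e U' h where h: "is_cover E e U' U" "h \<in> hom E U' (Fhat L)"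
      "\<forall>j \<in> Obj J. fhat (l j) \<cdot> h = y j \<cdot> e"
      using Ext_limit_local[OF D lim y] .
    have e: "e \<in> hom E U' U" using h(1) by (simp add: is_cover_def)
    obtain m where m: "m \<in> hom E U (Fhat L)" "m \<cdot> e = h"
    proof (rule E.is_cover_descend[OF h(1,2)])
      fix T p q assume pq: "p \<in> hom E T U'" "q \<in> hom E T U'" "e \<cdot> p = e \<cdot> q"
      show "h \<cdot> p = h \<cdot> q"
      proof (rule Ext_limit_unique[OF D lim E.Comp_in_hom[OF pq(1) h(2)] E.Comp_in_hom[OF pq(2) h(2)]])
        fix j assume j: "j \<in> Obj J"
        show "fhat (l j) \<cdot> (h \<cdot> p) = fhat (l j) \<cdot> (h \<cdot> q)"
          using E.Comp_assoc[OF pq(1) h(2) fhat_quo(1)[OF L(2)[OF j]]] h(3) j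
            E.Comp_assoc[OF pq(2) h(2) fhat_quo(1)[OF L(2)[OF j]]]
            E.Comp_assoc[OF pq(1) e Y[OF j]] E.Comp_assoc[OF pq(2) e Y[OF j]] pq(3) by simp
      qed
    qed
    have mj: "fhat (l j) \<cdot> m = y j" if j: "j \<in> Obj J" for j
    proof (rule E.is_cover_cancel[OF h(1) _ E.Comp_in_hom[OF m(1) fhat_quo(1)[OF L(2)[OF j]]] Y[OF j]])
      show "(fhat (l j) \<cdot> m) \<cdot> e = y j \<cdot> e"
        using E.Comp_assoc[OF e m(1) fhat_quo(1)[OF L(2)[OF j]]] m(2) h(3) j by simp
    qed
    show ?thesis
    proof (rule ex1I[of _ m])
      show "m \<in> hom E U (Fhat L) \<and> (\<forall>j \<in> Obj J. fhat (l j) \<cdot> m = y j)" using m(1) mj by blast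
      fix m' assume m': "m' \<in> hom E U (Fhat L) \<and> (\<forall>j \<in> Obj J. fhat (l j) \<cdot> m' = y j)"
      show "m' = m" by (rule Ext_limit_unique[OF D lim]) (use m' m(1) mj in auto)
    qed
  qed
  moreover have "is_cone J E (comp_ftr J Ext D) (FO Ext L) (\<lambda>j. FA Ext (l j))"
    by (rule cone_image[OF is_functor_Ext D' L(3)])
  ultimately show ?thesis using L(1) El by (simp add: is_limit_def)
qed

lemma exact_functor_Ext: "exact_functor X E Ext"
proof -
  have "regular_epi E (FA Ext e)" if e: "regular_epi X e" for e
  proof -
    have E: "e \<in> Arr X" using X.regular_epi_Arr[OF e] .
    then have "is_cover X e (Dom X e) (Cod X e)" using e by (simp add: is_cover_def hom_def)
    from Ext_cover[OF this] show ?thesis using E by (simp add: is_cover_def)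
  qed
  then show ?thesis using is_functor_Ext Ext_limit unfolding exact_functor_def by blast
qed

end

lemma precomp_simps:
  "G \<in> Obj S \<Longrightarrow> FO (precomp_ftr W \<Gamma> S) G = comp_ftr W G \<Gamma>"
  "(F, \<theta>, G) \<in> Arr S \<Longrightarrow> FA (precomp_ftr W \<Gamma> S) (F, \<theta>, G)
     = (comp_ftr W F \<Gamma>, (\<lambda>X \<in> Obj W. \<theta> (FO \<Gamma> X)), comp_ftr W G \<Gamma>)"
  by (simp_all add: precomp_ftr_def)

context exact_restriction
begin

lemma restrict_nat_trans:
  assumes t: "nat_trans X E F G \<theta>"
  shows "nat_trans W E (comp_ftr W F \<Gamma>) (comp_ftr W G \<Gamma>) (\<lambda>V \<in> Obj W. \<theta> (Go V))"
proof (rule nat_transI)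
  note T = nat_transD[OF t]
  show "is_functor W E (comp_ftr W F \<Gamma>)" "is_functor W E (comp_ftr W G \<Gamma>)"
    using is_functor_comp[OF is_functor_\<Gamma>] T(1,2) by blast+
  show "(\<lambda>V \<in> Obj W. \<theta> (Go V)) V \<in> hom E (FO (comp_ftr W F \<Gamma>) V) (FO (comp_ftr W G \<Gamma>) V)" if "V \<in> Obj W" for V
    using that T(4) is_functorD(3)[OF is_functor_\<Gamma>] by (simp add: comp_ftr_def)
  fix V S f assume f: "f \<in> hom W V S"
  have "V \<in> Obj W" "S \<in> Obj W" using W.hom_Obj[OF f] by auto
  then show "(\<lambda>V \<in> Obj W. \<theta> (Go V)) S \<cdot> FA (comp_ftr W F \<Gamma>) f
      = FA (comp_ftr W G \<Gamma>) f \<cdot> (\<lambda>V \<in> Obj W. \<theta> (Go V)) V"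
    using T(5)[of "Ga f"] Ga_hom[OF f] f by (simp add: comp_ftr_def hom_iff)
qed simp

lemma precomp_is_functor:
  "is_functor (functor_cat X E (exact_functor X E)) (functor_cat W E (left_covering W E))
     (precomp_ftr W \<Gamma> (functor_cat X E (exact_functor X E)))" (is "is_functor ?S ?T ?K")
proof -
  have lc: "left_covering W E (comp_ftr W F \<Gamma>)" if "exact_functor X E F" for F
    using left_covering_restriction[OF that] .
  have fn: "is_functor W E (comp_ftr W F \<Gamma>)" if "exact_functor X E F" for F
    using left_covering_restriction[OF that] by (simp add: left_covering_def)
  have Go: "Go V \<in> Obj X" if "V \<in> Obj W" for V using is_functorD(3)[OF is_functor_\<Gamma> that] .
  show ?thesis
    unfolding is_functor_def
  proof (intro conjI ballI impI category_functor_cat)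
    show "FO ?K \<in> Obj ?S \<rightarrow>\<^sub>E Obj ?T" using lc fn by (auto simp: precomp_ftr_def)
    show "FA ?K \<in> extensional (Arr ?S)" by (simp add: precomp_ftr_def)
    show "FA ?K \<phi> \<in> hom ?T (FO ?K (Dom ?S \<phi>)) (FO ?K (Cod ?S \<phi>))" if ph: "\<phi> \<in> Arr ?S" for \<phi>
    proof -
      obtain F \<theta> G where t: "\<phi> = (F, \<theta>, G)" "exact_functor X E F" "exact_functor X E G" "nat_trans X E F G \<theta>"
        using ph by (auto simp: functor_cat_Arr)
      have "F \<in> Obj ?S" "G \<in> Obj ?S" using t nat_transD[OF t(4)] by simp_all
      then show ?thesis
        using ph t lc restrict_nat_trans[OF t(4)] by (simp add: precomp_simps functor_cat_hom)
    qed
    show "FA ?K (Ide ?S F) = Ide ?T (FO ?K F)" if F: "F \<in> Obj ?S" for F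
    proof -
      have "Ide ?S F \<in> Arr ?S" using category.Ide_in_hom[OF category_functor_cat F] by (simp add: hom_def)
      moreover have "(\<lambda>V \<in> Obj W. (\<lambda>A \<in> Obj X. Ide E (FO F A)) (Go V))
          = (\<lambda>V \<in> Obj W. Ide E (FO (comp_ftr W F \<Gamma>) V))"
        using Go by (auto simp: comp_ftr_def intro!: restrict_ext)
      ultimately show ?thesis using F by (simp add: precomp_simps)
    qed
    fix \<phi> \<psi> assume ph: "\<phi> \<in> Arr ?S" and ps: "\<psi> \<in> Arr ?S" and eq: "Dom ?S \<psi> = Cod ?S \<phi>"
    obtain F \<theta> G where t: "\<phi> = (F, \<theta>, G)" "exact_functor X E F" "exact_functor X E G" "nat_trans X E F G \<theta>"
      using ph by (auto simp: functor_cat_Arr)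
    obtain \<eta> H where u: "\<psi> = (G, \<eta>, H)" using ps eq t(1) by (auto simp: functor_cat_Arr)
    interpret S: category ?S by (rule category_functor_cat)
    have "\<psi> \<cdot>\<^bsub>?S\<^esub> \<phi> \<in> Arr ?S" using S.Comp_closed(1)[OF ph ps eq] .
    moreover have "(\<lambda>V \<in> Obj W. (\<lambda>A \<in> Obj X. \<eta> A \<cdot> \<theta> A) (Go V))
        = (\<lambda>V \<in> Obj W. (\<lambda>V \<in> Obj W. \<eta> (Go V)) V \<cdot> (\<lambda>V \<in> Obj W. \<theta> (Go V)) V)"
      using Go by (auto intro!: restrict_ext)
    ultimately show "FA ?K (\<psi> \<cdot>\<^bsub>?S\<^esub> \<phi>) = FA ?K \<psi> \<cdot>\<^bsub>?T\<^esub> FA ?K \<phi>"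
      using ph ps by (simp add: t(1) u precomp_simps)
  qed
qed

lemma precomp_is_equivalence:
  "is_equivalence (functor_cat X E (exact_functor X E)) (functor_cat W E (left_covering W E))
     (precomp_ftr W \<Gamma> (functor_cat X E (exact_functor X E)))" (is "is_equivalence ?S ?T ?K")
proof (rule is_equivalenceI[OF precomp_is_functor])
  fix F G \<phi> assume F: "F \<in> Obj ?S" and G: "G \<in> Obj ?S" and ph: "\<phi> \<in> hom ?T (FO ?K F) (FO ?K G)"
  then obtain \<theta> where t: "\<phi> = (comp_ftr W F \<Gamma>, \<theta>, comp_ftr W G \<Gamma>)"
    "nat_trans W E (comp_ftr W F \<Gamma>) (comp_ftr W G \<Gamma>) \<theta>"
    by (auto simp: functor_cat_hom precomp_simps)
  have FG: "exact_functor X E F" "exact_functor X E G" using F G by simp_all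
  obtain \<eta> where h: "nat_trans X E F G \<eta>" "\<And>V. V \<in> Obj W \<Longrightarrow> \<eta> (Go V) = \<theta> V"
    using restriction_full[OF FG t(2)] by blast
  have "(\<lambda>V \<in> Obj W. \<eta> (Go V)) = \<theta>"
    using h(2) by (intro extensionalityI[OF restrict_extensional nat_transD(3)[OF t(2)]]) simp
  moreover have hom: "(F, \<eta>, G) \<in> hom ?S F G" using FG h(1) by (simp add: functor_cat_hom)
  ultimately have "FA ?K (F, \<eta>, G) = \<phi>" by (simp add: t(1) precomp_simps hom_def)
  then show "\<exists>f \<in> hom ?S F G. FA ?K f = \<phi>" using hom by blast
next
  fix F G \<phi> \<psi> assume ph: "\<phi> \<in> hom ?S F G" and ps: "\<psi> \<in> hom ?S F G" and eq: "FA ?K \<phi> = FA ?K \<psi>"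
  obtain \<theta> where t: "\<phi> = (F, \<theta>, G)" "exact_functor X E F" "nat_trans X E F G \<theta>"
    using ph by (auto simp: functor_cat_hom)
  obtain \<eta> where u: "\<psi> = (F, \<eta>, G)" "nat_trans X E F G \<eta>"
    using ps by (auto simp: functor_cat_hom)
  have "(\<lambda>V \<in> Obj W. \<theta> (Go V)) = (\<lambda>V \<in> Obj W. \<eta> (Go V))"
    using eq ph ps by (simp add: t(1) u(1) precomp_simps hom_def)
  then have "\<theta> (Go V) = \<eta> (Go V)" if "V \<in> Obj W" for V using that by (metis restrict_apply')
  then show "\<phi> = \<psi>" using restriction_faithful[OF t(2,3) u(2)] t(1) u(1) by simp
next
  fix F assume F: "F \<in> Obj ?T"
  interpret L: left_covering_extension W X \<Gamma> E F by unfold_locales (use F in simp)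
  interpret T: category ?T by (rule category_functor_cat)
  let ?k = "\<lambda>V \<in> Obj W. L.kap V (Ide X (Go V))"
  have Ext: "L.Ext \<in> Obj ?S" using L.exact_functor_Ext L.is_functor_Ext by simp
  have lc: "left_covering W E F" "left_covering W E (comp_ftr W L.Ext \<Gamma>)"
    using F left_covering_restriction[OF L.exact_functor_Ext] by simp_all
  have iso: "is_iso ?T (F, ?k, comp_ftr W L.Ext \<Gamma>)"
    by (rule functor_cat_isoI[OF L.Ext_restricts lc]) (simp add: L.kap_Ide_iso(1))
  have hom: "(F, ?k, comp_ftr W L.Ext \<Gamma>) \<in> hom ?T F (comp_ftr W L.Ext \<Gamma>)"
    using lc L.Ext_restricts by (simp add: functor_cat_hom)
  obtain i where i: "i \<in> hom ?T (comp_ftr W L.Ext \<Gamma>) F" "is_iso ?T i"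
  proof (rule T.is_isoE[OF iso hom])
    fix i assume i: "i \<in> hom ?T (comp_ftr W L.Ext \<Gamma>) F"
      and inv: "i \<cdot>\<^bsub>?T\<^esub> (F, ?k, comp_ftr W L.Ext \<Gamma>) = Ide ?T F"
        "(F, ?k, comp_ftr W L.Ext \<Gamma>) \<cdot>\<^bsub>?T\<^esub> i = Ide ?T (comp_ftr W L.Ext \<Gamma>)"
    show ?thesis by (rule that[OF i T.is_isoI[OF i hom inv(2,1)]])
  qed
  then show "\<exists>G \<in> Obj ?S. \<exists>i \<in> hom ?T (FO ?K G) F. is_iso ?T i"
    using Ext by (intro bexI[of _ L.Ext]) (auto simp: precomp_simps)
qed

end

text \<open>By this criterion the homotopy exact completion is recognised below.\<close>

theorem (in projective_presentation) exact_completion: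
  "exact_completion TYPE(('p, 'b) cat) W X \<Gamma>"
proof -
  have "is_equivalence (functor_cat X E (exact_functor X E)) (functor_cat W E (left_covering W E))
      (precomp_ftr W \<Gamma> (functor_cat X E (exact_functor X E)))" if "exact_category E" for E :: "('p, 'b) cat"
  proof -
    have "category E"
      using that by (simp add: exact_category_def regular_category_def finitely_complete_def)
    then interpret E: category E .
    interpret exact_restriction W X \<Gamma> E by unfold_locales (rule that)
    show ?thesis by (rule precomp_is_equivalence)
  qed
  then show ?thesis
    unfolding exact_completion_def using weakly_lex_W X.exact left_covering_\<Gamma> by blast
qed


section \<open>Fibrations and homotopy in a path category\<close>

lemma (in category_notation) pullback_sym:
  assumes "is_pullback C f g p q"
  shows "is_pullback C g f q p"
proof -
  note P = is_pullbackD[OF assms]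
  show ?thesis
  proof (rule is_pullbackI)
    show "g \<in> hom C (Dom C g) (Cod C f)" "f \<in> hom C (Dom C f) (Cod C f)" using P(1-3) by (simp_all add: hom_iff)
    show "q \<in> hom C (Dom C p) (Dom C g)" "p \<in> hom C (Dom C p) (Dom C f)" using P(4-8) by (simp_all add: hom_iff)
    show "g \<cdot> q = f \<cdot> p" using P(9) by simp
    show "\<exists>h \<in> hom C U (Dom C p). q \<cdot> h = a \<and> p \<cdot> h = b"
      if ab: "a \<in> hom C U (Dom C g)" "b \<in> hom C U (Dom C f)" "g \<cdot> a = f \<cdot> b" for U a b
      using pullback_lift[OF assms ab(2,1) ab(3)[symmetric]] by metis
    show "h = h'" if "h \<in> hom C U (Dom C p)" "h' \<in> hom C U (Dom C p)" "q \<cdot> h = q \<cdot> h'" "p \<cdot> h = p \<cdot> h'"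
      for U h h'
      using pullback_unique[OF assms that(1,2,4,3)] .
  qed
qed

locale path_category_notation = path_category C Fib Weq
  for C :: "('o, 'a) cat" (structure) and Fib Weq :: "'a set"
begin

lemma fibration_Arr: "f \<in> Fib \<Longrightarrow> f \<in> Arr C"
  using Fib_Arr by blast

lemma product_over_terminal:
  assumes T: "is_terminal C T" and f: "f \<in> hom C X T" and g: "g \<in> hom C Y T" and P: "p \<in> hom C Q X" "q \<in> hom C Q Y"
  shows "is_product C X Y p q \<longleftrightarrow> is_pullback C f g p q"
proof -
  have D: "Dom C f = X" "Cod C f = T" "Dom C g = Y" "Cod C g = T" "f \<in> Arr C" "g \<in> Arr C" "Dom C p = Q"
    using f g P by (simp_all add: hom_iff)
  have eq: "f \<cdot> a = g \<cdot> b" if ab: "a \<in> hom C U X" "b \<in> hom C U Y" for U a b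
    using T Comp_in_hom[OF ab(1) f] Comp_in_hom[OF ab(2) g] hom_Obj[OF ab(1)] unfolding is_terminal_def by blast
  have all: "(\<forall>U. \<forall>a \<in> hom C U X. \<forall>b \<in> hom C U Y. f \<cdot> a = g \<cdot> b \<longrightarrow> S U a b)
      \<longleftrightarrow> (\<forall>U. \<forall>a \<in> hom C U X. \<forall>b \<in> hom C U Y. S U a b)" for S using eq by blast
  show ?thesis
    unfolding is_product_def is_pullback_def D all by (simp only: D(5,6) P eq[OF P] simp_thms)
qed

lemma product_ex:
  assumes "X \<in> Obj C" "Y \<in> Obj C"
  shows "\<exists>p q. is_product C X Y p q"
proof -
  obtain T where T: "is_terminal C T" and fib: "\<forall>f \<in> Arr C. Cod C f = T \<longrightarrow> f \<in> Fib"
    using terminal_exists by blast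
  obtain f g where fg: "f \<in> hom C X T" "g \<in> hom C Y T" using T assms unfolding is_terminal_def by blast
  then have "f \<in> Fib" "g \<in> Arr C" "Cod C g = Cod C f" using fib by (simp_all add: hom_iff)
  then obtain p q where pq: "is_pullback C f g p q" using Fib_pullback_exists by blast
  note P = is_pullbackD[OF pq]
  have "p \<in> hom C (Dom C p) X" "q \<in> hom C (Dom C p) Y" using P fg by (simp_all add: hom_iff)
  then show ?thesis using product_over_terminal[OF T fg] pq by blast
qed

lemma chosen_product:
  assumes "X \<in> Obj C" "Y \<in> Obj C"
  shows "is_product C X Y (proj\<^sub>1 C X Y) (proj\<^sub>2 C X Y)"
proof -
  obtain p q where "is_product C X Y p q" using product_ex[OF assms] by blast
  then have "case chosen_product C X Y of (p, q) \<Rightarrow> is_product C X Y p q"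
    using someI[of "\<lambda>(x, y). is_product C X Y x y" "(p, q)"] unfolding chosen_product_def by simp
  then show ?thesis by (simp add: proj\<^sub>1_def proj\<^sub>2_def split_beta)
qed

lemma proj_hom [simp]:
  assumes "X \<in> Obj C" "Y \<in> Obj C"
  shows "proj\<^sub>1 C X Y \<in> hom C (prod_obj C X Y) X" "proj\<^sub>2 C X Y \<in> hom C (prod_obj C X Y) Y"
  using chosen_product[OF assms] by (simp_all add: is_product_def prod_obj_def)

lemma prod_obj_Obj [simp]: "\<lbrakk>X \<in> Obj C; Y \<in> Obj C\<rbrakk> \<Longrightarrow> prod_obj C X Y \<in> Obj C"
  using hom_Obj[OF proj_hom(1)] by blast

lemma proj_Fib:
  assumes "X \<in> Obj C" "Y \<in> Obj C"
  shows "proj\<^sub>1 C X Y \<in> Fib" "proj\<^sub>2 C X Y \<in> Fib"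
proof -
  obtain T where T: "is_terminal C T" and fib: "\<forall>f \<in> Arr C. Cod C f = T \<longrightarrow> f \<in> Fib"
    using terminal_exists by blast
  obtain f g where fg: "f \<in> hom C X T" "g \<in> hom C Y T" using T assms unfolding is_terminal_def by blast
  have "is_pullback C f g (proj\<^sub>1 C X Y) (proj\<^sub>2 C X Y)"
    using product_over_terminal[OF T fg proj_hom[OF assms]] chosen_product[OF assms] by blast
  moreover have "f \<in> Fib" "g \<in> Fib" using fib fg by (simp_all add: hom_iff)
  ultimately show "proj\<^sub>1 C X Y \<in> Fib" "proj\<^sub>2 C X Y \<in> Fib"
    using Fib_pullback pullback_sym by blast+
qed

lemma prod_eqI:
  assumes "X \<in> Obj C" "Y \<in> Obj C" and h: "h \<in> hom C U (prod_obj C X Y)" "h' \<in> hom C U (prod_obj C X Y)"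
    and eq: "proj\<^sub>1 C X Y \<cdot> h = proj\<^sub>1 C X Y \<cdot> h'" "proj\<^sub>2 C X Y \<cdot> h = proj\<^sub>2 C X Y \<cdot> h'"
  shows "h = h'"
proof -
  note p = proj_hom[OF assms(1,2)]
  have "\<exists>!k. k \<in> hom C U (prod_obj C X Y) \<and> proj\<^sub>1 C X Y \<cdot> k = proj\<^sub>1 C X Y \<cdot> h \<and>
      proj\<^sub>2 C X Y \<cdot> k = proj\<^sub>2 C X Y \<cdot> h"
    using chosen_product[OF assms(1,2)] Comp_in_hom[OF h(1) p(1)] Comp_in_hom[OF h(1) p(2)]
    unfolding is_product_def prod_obj_def by blast
  then show ?thesis using h eq by metis
qed

lemma pairing:
  assumes f: "f \<in> hom C U X" and g: "g \<in> hom C U Y"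
  shows "pairing C f g \<in> hom C U (prod_obj C X Y)" "proj\<^sub>1 C X Y \<cdot> pairing C f g = f"
    "proj\<^sub>2 C X Y \<cdot> pairing C f g = g"
proof -
  have D: "Dom C f = U" "Cod C f = X" "Cod C g = Y" using f g by (simp_all add: hom_iff)
  have "\<exists>!k. k \<in> hom C U (prod_obj C X Y) \<and> proj\<^sub>1 C X Y \<cdot> k = f \<and> proj\<^sub>2 C X Y \<cdot> k = g"
    using chosen_product[of X Y] hom_Obj[OF f] hom_Obj[OF g] f g
    unfolding is_product_def prod_obj_def by blast
  from theI'[OF this]
  show "pairing C f g \<in> hom C U (prod_obj C X Y)" "proj\<^sub>1 C X Y \<cdot> pairing C f g = f"
    "proj\<^sub>2 C X Y \<cdot> pairing C f g = g"
    unfolding pairing_def D by blast+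
qed

lemma pairing_unique:
  assumes "h \<in> hom C U (prod_obj C X Y)" "proj\<^sub>1 C X Y \<cdot> h = f" "proj\<^sub>2 C X Y \<cdot> h = g"
    "X \<in> Obj C" "Y \<in> Obj C"
  shows "h = pairing C f g"
proof (rule prod_eqI[OF assms(4,5,1)])
  have "f \<in> hom C U X" "g \<in> hom C U Y"
    using assms(2,3) Comp_in_hom[OF assms(1) proj_hom(1)[OF assms(4,5)]]
      Comp_in_hom[OF assms(1) proj_hom(2)[OF assms(4,5)]] by simp_all
  from pairing[OF this] show "pairing C f g \<in> hom C U (prod_obj C X Y)"
    "proj\<^sub>1 C X Y \<cdot> h = proj\<^sub>1 C X Y \<cdot> pairing C f g"
    "proj\<^sub>2 C X Y \<cdot> h = proj\<^sub>2 C X Y \<cdot> pairing C f g" using assms(2,3) by simp_all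
qed

lemma pairing_Comp:
  assumes f: "f \<in> hom C U X" and g: "g \<in> hom C U Y" and k: "k \<in> hom C V U"
  shows "pairing C f g \<cdot> k = pairing C (f \<cdot> k) (g \<cdot> k)"
proof (rule pairing_unique)
  have ob: "X \<in> Obj C" "Y \<in> Obj C" using hom_Obj[OF f] hom_Obj[OF g] by auto
  then show "X \<in> Obj C" "Y \<in> Obj C" .
  note p = pairing[OF f g]
  show "pairing C f g \<cdot> k \<in> hom C V (prod_obj C X Y)" using k p(1) by (rule Comp_in_hom)
  show "proj\<^sub>1 C X Y \<cdot> (pairing C f g \<cdot> k) = f \<cdot> k" "proj\<^sub>2 C X Y \<cdot> (pairing C f g \<cdot> k) = g \<cdot> k"
    using Comp_assoc[OF k p(1) proj_hom(1)[OF ob]] Comp_assoc[OF k p(1) proj_hom(2)[OF ob]] p(2,3) by simp_all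
qed

lemma prod_map:
  assumes f: "f \<in> hom C X X'" and g: "g \<in> hom C Y Y'"
  shows "prod_map C f g \<in> hom C (prod_obj C X Y) (prod_obj C X' Y')"
    "h \<in> hom C U (prod_obj C X Y) \<Longrightarrow> prod_map C f g \<cdot> h
      = pairing C (f \<cdot> (proj\<^sub>1 C X Y \<cdot> h)) (g \<cdot> (proj\<^sub>2 C X Y \<cdot> h))"
proof -
  have D: "Dom C f = X" "Dom C g = Y" using f g by (simp_all add: hom_iff)
  have ob: "X \<in> Obj C" "Y \<in> Obj C" using hom_Obj[OF f] hom_Obj[OF g] by auto
  note p = proj_hom[OF ob]
  note fp = Comp_in_hom[OF p(1) f] and gp = Comp_in_hom[OF p(2) g]
  show "prod_map C f g \<in> hom C (prod_obj C X Y) (prod_obj C X' Y')"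
    unfolding prod_map_def D using pairing(1)[OF fp gp] .
  show "h \<in> hom C U (prod_obj C X Y) \<Longrightarrow> prod_map C f g \<cdot> h
      = pairing C (f \<cdot> (proj\<^sub>1 C X Y \<cdot> h)) (g \<cdot> (proj\<^sub>2 C X Y \<cdot> h))"
    unfolding prod_map_def D using pairing_Comp[OF fp gp] Comp_assoc[OF _ p(1) f] Comp_assoc[OF _ p(2) g] by simp
qed

lemma prod_map_pairing:
  assumes f: "f \<in> hom C X X'" and g: "g \<in> hom C Y Y'" and a: "a \<in> hom C U X" and b: "b \<in> hom C U Y"
  shows "prod_map C f g \<cdot> pairing C a b = pairing C (f \<cdot> a) (g \<cdot> b)"
  using prod_map(2)[OF f g pairing(1)[OF a b]] pairing(2,3)[OF a b] by simp

lemma diagonal_Comp: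
  assumes "a \<in> hom C U X"
  shows "diagonal C X \<cdot> a = pairing C a a"
proof -
  have I: "Ide C X \<in> hom C X X" using hom_Obj[OF assms] by (simp add: Ide_in_hom)
  show ?thesis unfolding diagonal_def pairing_Comp[OF I I assms] using Comp_Ide_left[OF assms] by simp
qed

lemma Ide_Weq: "X \<in> Obj C \<Longrightarrow> Ide C X \<in> Weq"
  using iso_acyclic[OF is_isoI[OF Ide_in_hom Ide_in_hom]] by (simp add: Ide_in_hom)

lemma Weq_right_cancel:
  assumes f: "f \<in> hom C X Y" and g: "g \<in> hom C Y Z" and w: "g \<cdot> f \<in> Weq" "f \<in> Weq"
  shows "g \<in> Weq"
proof -
  have "Ide C X \<in> hom C X X" using hom_Obj[OF f] by (simp add: Ide_in_hom)
  from two_out_of_six[OF this f g] show ?thesis using w Comp_Ide_right[OF f] by simp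
qed

lemma Weq_left_cancel:
  assumes f: "f \<in> hom C X Y" and g: "g \<in> hom C Y Z" and w: "g \<cdot> f \<in> Weq" "g \<in> Weq"
  shows "f \<in> Weq"
proof -
  have "Ide C Z \<in> hom C Z Z" using hom_Obj[OF g] by (simp add: Ide_in_hom)
  from two_out_of_six[OF f g this] show ?thesis using w Comp_Ide_left[OF g] by simp
qed

lemma path_objectD:
  assumes e: "is_path_object C Fib Weq B r e" and B: "B \<in> Obj C"
  defines "s \<equiv> proj\<^sub>1 C B B \<cdot> e" and "t \<equiv> proj\<^sub>2 C B B \<cdot> e"
  shows "r \<in> Weq" "e \<in> Fib" "r \<in> hom C B (Dom C e)" "e \<in> hom C (Dom C e) (prod_obj C B B)"
    "e \<cdot> r = pairing C (Ide C B) (Ide C B)"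
    "s \<in> hom C (Dom C e) B" "t \<in> hom C (Dom C e) B" "s \<cdot> r = Ide C B" "t \<cdot> r = Ide C B"
    "s \<in> Fib \<inter> Weq" "t \<in> Fib \<inter> Weq"
proof -
  show *: "r \<in> Weq" "e \<in> Fib" and r: "r \<in> hom C B (Dom C e)" and e': "e \<in> hom C (Dom C e) (prod_obj C B B)"
    and er: "e \<cdot> r = pairing C (Ide C B) (Ide C B)"
    using e by (simp_all add: is_path_object_def diagonal_def)
  note p = proj_hom[OF B B] and I = Ide_in_hom[OF B]
  show s: "s \<in> hom C (Dom C e) B" and t: "t \<in> hom C (Dom C e) B"
    unfolding s_def t_def using Comp_in_hom[OF e'] p by blast+
  show sr: "s \<cdot> r = Ide C B" and tr: "t \<cdot> r = Ide C B"
    unfolding s_def t_def Comp_assoc[OF r e' p(1)] Comp_assoc[OF r e' p(2)] er using pairing[OF I I] by simp_all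
  have "s \<in> Fib" "t \<in> Fib"
    unfolding s_def t_def using Fib_Comp[OF *(2)] proj_Fib[OF B B] p e' by (simp_all add: hom_iff)
  moreover have "s \<in> Weq" "t \<in> Weq"
    using Weq_right_cancel[OF r s] Weq_right_cancel[OF r t] sr tr Ide_Weq[OF B] *(1) by simp_all
  ultimately show "s \<in> Fib \<inter> Weq" "t \<in> Fib \<inter> Weq" by auto
qed

text \<open>The object \<open>P\<close> is the mapping path space of \<open>f\<close>, whose elements are an element \<open>a\<close> of \<open>A\<close> and a path
  from \<open>f a\<close>; \<open>p\<close> takes the endpoint of the path, and \<open>w\<close> adds the constant path.\<close>

lemma factorisation:
  assumes f: "f \<in> hom C A Q"
  obtains P w p where "w \<in> hom C A P" "w \<in> Weq" "p \<in> hom C P Q" "p \<in> Fib" "p \<cdot> w = f"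
proof -
  have A: "A \<in> Obj C" and Q: "Q \<in> Obj C" using hom_Obj[OF f] by auto
  obtain r e where re: "is_path_object C Fib Weq Q r e" using path_object_exists[OF Q] by blast
  define s where "s = proj\<^sub>1 C Q Q \<cdot> e"
  define t where "t = proj\<^sub>2 C Q Q \<cdot> e"
  note po = path_objectD[OF re Q, folded s_def t_def]
  note pQ = proj_hom[OF Q Q] and pA = proj_hom[OF A Q]
  define k where "k = prod_map C f (Ide C Q)"
  have I: "Ide C Q \<in> hom C Q Q" by (rule Ide_in_hom[OF Q])
  have k: "k \<in> hom C (prod_obj C A Q) (prod_obj C Q Q)" unfolding k_def by (rule prod_map(1)[OF f I])
  have "k \<in> Arr C" "Cod C k = Cod C e" using k po(4) by (simp_all add: hom_iff)
  then obtain x y where pb: "is_pullback C e k x y" using Fib_pullback_exists[OF po(2)] by blast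
  define P where "P = Dom C x"
  have x: "x \<in> hom C P (Dom C e)" and y: "y \<in> hom C P (prod_obj C A Q)"
    using is_pullbackD[OF pb] k by (simp_all add: P_def hom_iff)
  have exky: "e \<cdot> x = k \<cdot> y" by (rule is_pullbackD(9)[OF pb])
  have yF: "y \<in> Fib" by (rule Fib_pullback[OF po(2) pb])
  define u where "u = proj\<^sub>1 C A Q \<cdot> y"
  define p where "p = proj\<^sub>2 C A Q \<cdot> y"
  have u: "u \<in> hom C P A" and p: "p \<in> hom C P Q" unfolding u_def p_def using Comp_in_hom[OF y] pA by blast+
  have pF: "p \<in> Fib" unfolding p_def using Fib_Comp[OF yF proj_Fib(2)[OF A Q]] y pA by (simp add: hom_iff)
  have ky: "k \<cdot> y = pairing C (f \<cdot> u) p"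
    unfolding k_def prod_map(2)[OF f I y] using Comp_Ide_left[OF p] by (simp add: u_def p_def)
  have fu: "f \<cdot> u \<in> hom C P Q" using u f by (rule Comp_in_hom)
  have sx: "s \<cdot> x = f \<cdot> u" and tx: "t \<cdot> x = p"
    unfolding s_def t_def Comp_assoc[OF x po(4) pQ(1)] Comp_assoc[OF x po(4) pQ(2)] exky ky
    using pairing[OF fu p] by simp_all
  \<comment> \<open>\<open>u\<close> is a pullback of the acyclic fibration \<open>s\<close>, and \<open>w\<close> will be a section of \<open>u\<close>\<close>
  have "is_pullback C s f x u"
  proof (rule is_pullbackI[OF po(6) f x u sx])
    fix U a b assume ab: "a \<in> hom C U (Dom C e)" "b \<in> hom C U A" "s \<cdot> a = f \<cdot> b"
    have ta: "t \<cdot> a \<in> hom C U Q" using ab(1) po(7) by (rule Comp_in_hom)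
    note bt = pairing[OF ab(2) ta]
    have "k \<cdot> pairing C b (t \<cdot> a) = pairing C (f \<cdot> b) (t \<cdot> a)"
      unfolding k_def prod_map_pairing[OF f I ab(2) ta] using Comp_Ide_left[OF ta] by simp
    also have "\<dots> = e \<cdot> a"
      using pairing_unique[OF Comp_in_hom[OF ab(1) po(4)] _ _ Q Q] Comp_assoc[OF ab(1) po(4) pQ(1)]
        Comp_assoc[OF ab(1) po(4) pQ(2)] ab(3) by (simp add: s_def t_def)
    finally have eq: "e \<cdot> a = k \<cdot> pairing C b (t \<cdot> a)" by simp
    have bt': "pairing C b (t \<cdot> a) \<in> hom C U (Dom C k)" using bt(1) k by (simp add: hom_iff)
    obtain h where h: "h \<in> hom C U P" "x \<cdot> h = a" "y \<cdot> h = pairing C b (t \<cdot> a)"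
      using pullback_lift[OF pb ab(1) bt' eq] P_def by blast
    have "u \<cdot> h = b" unfolding u_def Comp_assoc[OF h(1) y pA(1)] h(3) by (rule bt(2))
    then show "\<exists>h \<in> hom C U P. x \<cdot> h = a \<and> u \<cdot> h = b" using h by blast
  next
    fix U h h' assume h: "h \<in> hom C U P" "h' \<in> hom C U P" "x \<cdot> h = x \<cdot> h'" "u \<cdot> h = u \<cdot> h'"
    have "p \<cdot> h = p \<cdot> h'"
      using Comp_assoc[OF h(1) x po(7)] Comp_assoc[OF h(2) x po(7)] tx h(3) by simp
    then have "y \<cdot> h = y \<cdot> h'"
      using prod_eqI[OF A Q Comp_in_hom[OF h(1) y] Comp_in_hom[OF h(2) y]] h(4)
        Comp_assoc[OF h(1) y pA(1)] Comp_assoc[OF h(2) y pA(1)]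
        Comp_assoc[OF h(1) y pA(2)] Comp_assoc[OF h(2) y pA(2)] by (simp add: u_def p_def)
    then show "h = h'" using pullback_unique[OF pb _ _ h(3)] h(1,2) P_def by simp
  qed
  then have uW: "u \<in> Weq" using acyclic_pullback[OF po(10)] by blast
  have IA: "Ide C A \<in> hom C A A" by (rule Ide_in_hom[OF A])
  have rf: "r \<cdot> f \<in> hom C A (Dom C e)" using f po(3) by (rule Comp_in_hom)
  have "e \<cdot> (r \<cdot> f) = pairing C f f"
    unfolding Comp_assoc[OF f po(3,4), symmetric] po(5) pairing_Comp[OF I I f] using Comp_Ide_left[OF f] by simp
  also have "\<dots> = k \<cdot> pairing C (Ide C A) f"
    unfolding k_def prod_map_pairing[OF f I IA f] using Comp_Ide_left[OF f] Comp_Ide_right[OF f] by simp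
  finally have eq: "e \<cdot> (r \<cdot> f) = k \<cdot> pairing C (Ide C A) f" .
  have "pairing C (Ide C A) f \<in> hom C A (Dom C k)" using pairing(1)[OF IA f] k by (simp add: hom_iff)
  then obtain w where w: "w \<in> hom C A P" "x \<cdot> w = r \<cdot> f" "y \<cdot> w = pairing C (Ide C A) f"
    using pullback_lift[OF pb rf _ eq] P_def by blast
  have "u \<cdot> w = Ide C A" "p \<cdot> w = f"
    unfolding u_def p_def Comp_assoc[OF w(1) y pA(1)] Comp_assoc[OF w(1) y pA(2)] w(3)
    using pairing[OF IA f] by simp_all
  then show ?thesis using that[OF w(1) _ p pF] Weq_left_cancel[OF w(1) u _ uW] Ide_Weq[OF A] by simp
qed

text \<open>Fibrations lift against weak equivalences, as far as the lower triangle is concerned: the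
  pullback \<open>Q \<rightarrow> B\<close> of \<open>p\<close> receives a map from \<open>A\<close>; replace this map by a fibration \<open>P \<rightarrow> Q\<close>,
  and the composite \<open>P \<rightarrow> B\<close> is an acyclic fibration, which has a section.\<close>

lemma weak_lifting:
  assumes w: "w \<in> hom C A B" "w \<in> Weq" and p: "p \<in> hom C R D" "p \<in> Fib"
    and l: "l \<in> hom C A R" and k: "k \<in> hom C B D" and eq: "p \<cdot> l = k \<cdot> w"
  obtains d where "d \<in> hom C B R" "p \<cdot> d = k"
proof -
  have "k \<in> Arr C" "Cod C k = Cod C p" "Dom C k = B" "Dom C p = R" using k p(1) by (simp_all add: hom_iff)
  then obtain x y where pb: "is_pullback C p k x y" and D: "Dom C k = B" "Dom C p = R"
    using Fib_pullback_exists[OF p(2)] by blast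
  define Q where "Q = Dom C x"
  have x: "x \<in> hom C Q R" and y: "y \<in> hom C Q B"
    using is_pullbackD[OF pb] k p by (simp_all add: Q_def hom_iff)
  have pxky: "p \<cdot> x = k \<cdot> y" by (rule is_pullbackD(9)[OF pb])
  obtain m where m: "m \<in> hom C A Q" "x \<cdot> m = l" "y \<cdot> m = w"
    using pullback_lift[OF pb, unfolded D, OF l w(1) eq] Q_def by blast
  obtain P v q where v: "v \<in> hom C A P" "v \<in> Weq" "q \<in> hom C P Q" "q \<in> Fib" "q \<cdot> v = m"
    using factorisation[OF m(1)] .
  have yq: "y \<cdot> q \<in> hom C P B" using v(3) y by (rule Comp_in_hom)
  have "y \<cdot> q \<in> Fib" using Fib_Comp[OF v(4) Fib_pullback[OF p(2) pb]] v(3) y by (simp add: hom_iff)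
  moreover have "(y \<cdot> q) \<cdot> v = w" using Comp_assoc[OF v(1,3) y] v(5) m(3) by simp
  then have "y \<cdot> q \<in> Weq" using Weq_right_cancel[OF v(1) yq] w(2) v(2) by simp
  ultimately have "\<exists>s \<in> hom C (Cod C (y \<cdot> q)) (Dom C (y \<cdot> q)). (y \<cdot> q) \<cdot> s = Ide C (Cod C (y \<cdot> q))"
    using acyclic_section by blast
  then obtain s where s: "s \<in> hom C B P" "(y \<cdot> q) \<cdot> s = Ide C B" using yq by (auto simp: hom_iff)
  have qs: "q \<cdot> s \<in> hom C B Q" using s(1) v(3) by (rule Comp_in_hom)
  have "p \<cdot> (x \<cdot> (q \<cdot> s)) = k \<cdot> (y \<cdot> (q \<cdot> s))"
    using Comp_assoc[OF qs x p(1)] Comp_assoc[OF qs y k] pxky by simp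
  also have "\<dots> = k" using Comp_assoc[OF s(1) v(3) y] s(2) Comp_Ide_right[OF k] by simp
  finally show ?thesis using that Comp_in_hom[OF qs x] by blast
qed


section \<open>Homotopy equivalence relations on generalized elements\<close>

text \<open>A fibration \<open>p\<close> into \<open>X \<times> X\<close> relates the generalized elements \<open>a, b : U \<rightarrow> X\<close> for which \<open>(a, b)\<close>
  lifts along \<open>p\<close>. It is a homotopy equivalence relation iff this is an equivalence relation
  for all \<open>U\<close>.\<close>

definition lifts :: "'a \<Rightarrow> 'a \<Rightarrow> bool" where
  "lifts p a \<longleftrightarrow> (\<exists>h \<in> hom C (Dom C a) (Dom C p). p \<cdot> h = a)"

definition rel :: "'a \<Rightarrow> 'a \<Rightarrow> 'a \<Rightarrow> bool" where
  "rel p a b \<longleftrightarrow> lifts p (pairing C a b)"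

abbreviation "her \<equiv> homotopy_equivalence_relation C Fib"

lemma lifts_hom: "a \<in> hom C U D \<Longrightarrow> lifts p a \<longleftrightarrow> (\<exists>h \<in> hom C U (Dom C p). p \<cdot> h = a)"
  by (simp add: lifts_def hom_def)

lemma rel_iff: "\<lbrakk>a \<in> hom C U X; b \<in> hom C U X\<rbrakk>
    \<Longrightarrow> rel p a b \<longleftrightarrow> (\<exists>h \<in> hom C U (Dom C p). p \<cdot> h = pairing C a b)"
  unfolding rel_def by (rule lifts_hom[OF pairing(1)])

lemma rel_projI:
  assumes p: "p \<in> hom C (Dom C p) (prod_obj C X X)" and X: "X \<in> Obj C" and h: "h \<in> hom C U (Dom C p)"
  shows "rel p ((proj\<^sub>1 C X X \<cdot> p) \<cdot> h) ((proj\<^sub>2 C X X \<cdot> p) \<cdot> h)"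
proof -
  note pr = proj_hom[OF X X] and ph = Comp_in_hom[OF h p]
  have "p \<cdot> h = pairing C ((proj\<^sub>1 C X X \<cdot> p) \<cdot> h) ((proj\<^sub>2 C X X \<cdot> p) \<cdot> h)"
    by (rule pairing_unique[OF ph _ _ X X])
      (simp_all only: Comp_assoc[OF h p pr(1)] Comp_assoc[OF h p pr(2)])
  moreover have "(proj\<^sub>1 C X X \<cdot> p) \<cdot> h \<in> hom C U X" "(proj\<^sub>2 C X X \<cdot> p) \<cdot> h \<in> hom C U X"
    using Comp_in_hom[OF h] Comp_in_hom[OF p] pr by blast+
  ultimately show ?thesis using rel_iff h by metis
qed

lemma relE:
  assumes p: "p \<in> hom C (Dom C p) (prod_obj C X X)" and ab: "a \<in> hom C U X" "b \<in> hom C U X" and r: "rel p a b"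
  obtains h where "h \<in> hom C U (Dom C p)" "(proj\<^sub>1 C X X \<cdot> p) \<cdot> h = a" "(proj\<^sub>2 C X X \<cdot> p) \<cdot> h = b"
    "p \<cdot> h = pairing C a b"
proof -
  have X: "X \<in> Obj C" using hom_Obj[OF ab(1)] by simp
  note pr = proj_hom[OF X X]
  obtain h where h: "h \<in> hom C U (Dom C p)" "p \<cdot> h = pairing C a b" using r rel_iff[OF ab] by blast
  then show ?thesis
    using that Comp_assoc[OF h(1) p pr(1)] Comp_assoc[OF h(1) p pr(2)] pairing[OF ab] by simp
qed

lemma rel_Comp:
  assumes p: "p \<in> hom C (Dom C p) (prod_obj C X X)" and ab: "a \<in> hom C U X" "b \<in> hom C U X" and r: "rel p a b"
    and c: "c \<in> hom C V U"
  shows "rel p (a \<cdot> c) (b \<cdot> c)"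
proof -
  obtain h where h: "h \<in> hom C U (Dom C p)" "p \<cdot> h = pairing C a b" using r rel_iff[OF ab] by blast
  have "p \<cdot> (h \<cdot> c) = pairing C (a \<cdot> c) (b \<cdot> c)"
    using Comp_assoc[OF c h(1) p] h(2) pairing_Comp[OF ab c] by simp
  then show ?thesis
    using rel_iff[OF Comp_in_hom[OF c ab(1)] Comp_in_hom[OF c ab(2)]] Comp_in_hom[OF c h(1)] by blast
qed

lemma herD:
  assumes her: "her X p"
  shows "X \<in> Obj C" "p \<in> Fib" "p \<in> hom C (Dom C p) (prod_obj C X X)"
    and her_refl: "a \<in> hom C U X \<Longrightarrow> rel p a a"
    and her_sym: "\<lbrakk>rel p a b; a \<in> hom C U X; b \<in> hom C U X\<rbrakk> \<Longrightarrow> rel p b a"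
    and her_trans: "\<lbrakk>rel p a b; rel p b c; a \<in> hom C U X; b \<in> hom C U X; c \<in> hom C U X\<rbrakk> \<Longrightarrow> rel p a c"
proof -
  show X: "X \<in> Obj C" and "p \<in> Fib" and p: "p \<in> hom C (Dom C p) (prod_obj C X X)"
    using her by (simp_all add: homotopy_equivalence_relation_def Let_def)
  define p1 where "p1 = proj\<^sub>1 C X X \<cdot> p"
  define p2 where "p2 = proj\<^sub>2 C X X \<cdot> p"
  have p12: "p1 \<in> hom C (Dom C p) X" "p2 \<in> hom C (Dom C p) X"
    unfolding p1_def p2_def using Comp_in_hom[OF p] proj_hom[OF X X] by blast+
  obtain \<rho> where \<rho>: "\<rho> \<in> hom C X (Dom C p)" "p \<cdot> \<rho> = diagonal C X"
    using her by (auto simp: homotopy_equivalence_relation_def Let_def)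
  obtain \<sigma> where \<sigma>: "\<sigma> \<in> hom C (Dom C p) (Dom C p)" "p1 \<cdot> \<sigma> = p2" "p2 \<cdot> \<sigma> = p1"
    using her by (auto simp: homotopy_equivalence_relation_def Let_def p1_def p2_def)
  obtain q1 q2 \<tau> where q: "is_pullback C p2 p1 q1 q2" and \<tau>: "\<tau> \<in> hom C (Dom C q1) (Dom C p)"
      "p1 \<cdot> \<tau> = p1 \<cdot> q1" "p2 \<cdot> \<tau> = p2 \<cdot> q2"
    using her by (auto simp: homotopy_equivalence_relation_def Let_def p1_def p2_def)
  show "rel p a a" if a: "a \<in> hom C U X"
    unfolding rel_iff[OF a a]
    using Comp_in_hom[OF a \<rho>(1)] Comp_assoc[OF a \<rho>(1) p] \<rho>(2) diagonal_Comp[OF a] by force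
  note relI = rel_projI[OF p X, folded p1_def p2_def]
  show "rel p b a" if r: "rel p a b" and ab: "a \<in> hom C U X" "b \<in> hom C U X"
  proof -
    obtain h where h: "h \<in> hom C U (Dom C p)" "p1 \<cdot> h = a" "p2 \<cdot> h = b"
      using relE[OF p ab r] unfolding p1_def p2_def .
    have "p1 \<cdot> (\<sigma> \<cdot> h) = b" "p2 \<cdot> (\<sigma> \<cdot> h) = a"
      using Comp_assoc[OF h(1) \<sigma>(1) p12(1)] Comp_assoc[OF h(1) \<sigma>(1) p12(2)] \<sigma>(2,3) h(2,3) by simp_all
    then show ?thesis using relI[OF Comp_in_hom[OF h(1) \<sigma>(1)]] by simp
  qed
  show "rel p a c" if r: "rel p a b" "rel p b c" and abc: "a \<in> hom C U X" "b \<in> hom C U X" "c \<in> hom C U X"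
  proof -
    obtain h where h: "h \<in> hom C U (Dom C p)" "p1 \<cdot> h = a" "p2 \<cdot> h = b"
      using relE[OF p abc(1,2) r(1)] unfolding p1_def p2_def .
    obtain k where k: "k \<in> hom C U (Dom C p)" "p1 \<cdot> k = b" "p2 \<cdot> k = c"
      using relE[OF p abc(2,3) r(2)] unfolding p1_def p2_def .
    have D: "Dom C p1 = Dom C p" "Dom C p2 = Dom C p" using p12 by (simp_all add: hom_iff)
    have eq: "p2 \<cdot> h = p1 \<cdot> k" using h k by simp
    obtain l where l: "l \<in> hom C U (Dom C q1)" "q1 \<cdot> l = h" "q2 \<cdot> l = k"
      using pullback_lift[OF q, unfolded D, OF h(1) k(1) eq] .
    have q12: "q1 \<in> hom C (Dom C q1) (Dom C p)" "q2 \<in> hom C (Dom C q1) (Dom C p)"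
      using is_pullbackD[OF q] D by (simp_all add: hom_iff)
    have "p1 \<cdot> (\<tau> \<cdot> l) = a" "p2 \<cdot> (\<tau> \<cdot> l) = c"
      using Comp_assoc[OF l(1) \<tau>(1) p12(1)] Comp_assoc[OF l(1) \<tau>(1) p12(2)] \<tau>(2,3) l(2,3)
        Comp_assoc[OF l(1) q12(1) p12(1)] Comp_assoc[OF l(1) q12(2) p12(2)] h k by simp_all
    then show ?thesis using relI[OF Comp_in_hom[OF l(1) \<tau>(1)]] by simp
  qed
qed

lemma herI:
  assumes X: "X \<in> Obj C" and F: "p \<in> Fib" and cod: "Cod C p = prod_obj C X X"
    and refl: "\<And>U a. a \<in> hom C U X \<Longrightarrow> rel p a a"
    and sym: "\<And>U a b. \<lbrakk>a \<in> hom C U X; b \<in> hom C U X; rel p a b\<rbrakk> \<Longrightarrow> rel p b a"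
    and trans: "\<And>U a b c. \<lbrakk>a \<in> hom C U X; b \<in> hom C U X; c \<in> hom C U X; rel p a b; rel p b c\<rbrakk> \<Longrightarrow> rel p a c"
  shows "her X p"
proof -
  have p: "p \<in> hom C (Dom C p) (prod_obj C X X)" using fibration_Arr[OF F] cod by (simp add: hom_iff)
  define p1 where "p1 = proj\<^sub>1 C X X \<cdot> p"
  define p2 where "p2 = proj\<^sub>2 C X X \<cdot> p"
  have p12: "p1 \<in> hom C (Dom C p) X" "p2 \<in> hom C (Dom C p) X"
    unfolding p1_def p2_def using Comp_in_hom[OF p] proj_hom[OF X X] by blast+
  note relI = rel_projI[OF p X, folded p1_def p2_def] and E = relE[OF p, folded p1_def p2_def]
  have I: "Ide C X \<in> hom C X X" by (rule Ide_in_hom[OF X])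
  have "\<exists>\<rho> \<in> hom C X (Dom C p). p \<cdot> \<rho> = diagonal C X"
    using refl[OF I] rel_iff[OF I I] by (simp add: diagonal_def)
  moreover have "\<exists>\<sigma> \<in> hom C (Dom C p) (Dom C p). p1 \<cdot> \<sigma> = p2 \<and> p2 \<cdot> \<sigma> = p1"
  proof -
    have "Ide C (Dom C p) \<in> hom C (Dom C p) (Dom C p)" using hom_Obj[OF p] by (simp add: Ide_in_hom)
    from relI[OF this] have "rel p p1 p2" using Comp_Ide_right[OF p12(1)] Comp_Ide_right[OF p12(2)] by simp
    from E[OF p12(2,1) sym[OF p12 this]] show ?thesis by metis
  qed
  moreover have "\<exists>q1 q2. is_pullback C p2 p1 q1 q2 \<and>
     (\<exists>\<tau> \<in> hom C (Dom C q1) (Dom C p). p1 \<cdot> \<tau> = p1 \<cdot> q1 \<and> p2 \<cdot> \<tau> = p2 \<cdot> q2)"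
  proof -
    have "p2 \<in> Fib"
      unfolding p2_def using Fib_Comp[OF F proj_Fib(2)[OF X X]] proj_hom[OF X X] cod by (simp add: hom_iff)
    moreover have "p1 \<in> Arr C" "Cod C p1 = Cod C p2" and D: "Dom C p1 = Dom C p" "Dom C p2 = Dom C p"
      using p12 by (simp_all add: hom_iff)
    ultimately obtain q1 q2 where q: "is_pullback C p2 p1 q1 q2" using Fib_pullback_exists by blast
    have q12: "q1 \<in> hom C (Dom C q1) (Dom C p)" "q2 \<in> hom C (Dom C q1) (Dom C p)"
      using is_pullbackD[OF q] D by (simp_all add: hom_iff)
    have "rel p (p1 \<cdot> q1) (p2 \<cdot> q2)"
      using trans[OF Comp_in_hom[OF q12(1) p12(1)] Comp_in_hom[OF q12(1) p12(2)] Comp_in_hom[OF q12(2) p12(2)]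
        relI[OF q12(1)]] relI[OF q12(2)] is_pullbackD(9)[OF q] by simp
    from E[OF Comp_in_hom[OF q12(1) p12(1)] Comp_in_hom[OF q12(2) p12(2)] this] show ?thesis using q by metis
  qed
  ultimately show ?thesis
    using X F p unfolding homotopy_equivalence_relation_def Let_def p1_def p2_def by blast
qed

text \<open>Symmetry and transitivity are weak liftings along \<open>e\<close>. For symmetry, reversal of paths is lifted
  against \<open>r\<close>; for transitivity, concatenation is lifted against the inclusion \<open>u\<close> of the constant
  paths into the composable pairs, a weak equivalence because the projection \<open>q2\<close> is one.\<close>

lemma path_object_her:
  assumes e: "is_path_object C Fib Weq B r e" and B: "B \<in> Obj C"
  shows "her B e"
proof -
  define s where "s = proj\<^sub>1 C B B \<cdot> e"
  define t where "t = proj\<^sub>2 C B B \<cdot> e"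
  note po = path_objectD[OF e B, folded s_def t_def]
  note relI = rel_projI[OF po(4) B, folded s_def t_def] and E = relE[OF po(4), folded s_def t_def]
  have I: "Ide C B \<in> hom C B B" by (rule Ide_in_hom[OF B])
  show ?thesis
  proof (rule herI[OF B po(2)])
    show "Cod C e = prod_obj C B B" using po(4) by (simp add: hom_iff)
    show "rel e a a" if a: "a \<in> hom C U B" for U a
      using relI[OF Comp_in_hom[OF a po(3)]] Comp_assoc[OF a po(3,6)] Comp_assoc[OF a po(3,7)] po(8,9)
        Comp_Ide_left[OF a] by simp
    have "e \<cdot> r = pairing C t s \<cdot> r"
      unfolding po(5) pairing_Comp[OF po(7,6,3)] po(8,9) ..
    then obtain d where d: "d \<in> hom C (Dom C e) (Dom C e)" "e \<cdot> d = pairing C t s"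
      using weak_lifting[OF po(3,1,4,2,3) pairing(1)[OF po(7,6)]] by blast
    show "rel e b a" if ab: "a \<in> hom C U B" "b \<in> hom C U B" "rel e a b" for U a b
    proof -
      obtain h where h: "h \<in> hom C U (Dom C e)" "s \<cdot> h = a" "t \<cdot> h = b" using E[OF ab] .
      have "e \<cdot> (d \<cdot> h) = pairing C b a"
        using Comp_assoc[OF h(1) d(1) po(4)] d(2) pairing_Comp[OF po(7,6) h(1)] h(2,3) by simp
      then show ?thesis using rel_iff[OF ab(2,1)] Comp_in_hom[OF h(1) d(1)] by blast
    qed
    have D: "Dom C s = Dom C e" "Dom C t = Dom C e" "Cod C s = B" "Cod C t = B" "s \<in> Arr C"
      using po(6,7) by (simp_all add: hom_iff)
    obtain q1 q2 where q: "is_pullback C t s q1 q2"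
      using Fib_pullback_exists[of t s] po(11) D by auto
    have q12: "q1 \<in> hom C (Dom C q1) (Dom C e)" "q2 \<in> hom C (Dom C q1) (Dom C e)"
      using is_pullbackD[OF q] D by (simp_all add: hom_iff)
    have qW: "q2 \<in> Weq" using acyclic_pullback[OF po(11) q] by simp
    have "t \<cdot> r = s \<cdot> r" using po(8,9) by simp
    then obtain u where u: "u \<in> hom C B (Dom C q1)" "q1 \<cdot> u = r" "q2 \<cdot> u = r"
      using pullback_lift[OF q, unfolded D, OF po(3,3)] by blast
    have uW: "u \<in> Weq" using Weq_left_cancel[OF u(1) q12(2)] u(3) po(1) qW by simp
    note st = Comp_in_hom[OF q12(1) po(6)] Comp_in_hom[OF q12(2) po(7)]
    have "e \<cdot> r = pairing C (s \<cdot> q1) (t \<cdot> q2) \<cdot> u"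
      unfolding po(5) pairing_Comp[OF st u(1)] Comp_assoc[OF u(1) q12(1) po(6)] Comp_assoc[OF u(1) q12(2) po(7)]
        u(2,3) po(8,9) ..
    then obtain m where m: "m \<in> hom C (Dom C q1) (Dom C e)" "e \<cdot> m = pairing C (s \<cdot> q1) (t \<cdot> q2)"
      using weak_lifting[OF u(1) uW po(4,2,3) pairing(1)[OF st]] by blast
    show "rel e a c" if abc: "a \<in> hom C U B" "b \<in> hom C U B" "c \<in> hom C U B" "rel e a b" "rel e b c" for U a b c
    proof -
      obtain h where h: "h \<in> hom C U (Dom C e)" "s \<cdot> h = a" "t \<cdot> h = b" using E[OF abc(1,2,4)] .
      obtain k where k: "k \<in> hom C U (Dom C e)" "s \<cdot> k = b" "t \<cdot> k = c" using E[OF abc(2,3,5)] .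
      have eq: "t \<cdot> h = s \<cdot> k" using h k by simp
      obtain l where l: "l \<in> hom C U (Dom C q1)" "q1 \<cdot> l = h" "q2 \<cdot> l = k"
        using pullback_lift[OF q, unfolded D, OF h(1) k(1) eq] .
      have "e \<cdot> (m \<cdot> l) = pairing C a c"
        using Comp_assoc[OF l(1) m(1) po(4)] m(2) pairing_Comp[OF st l(1)]
          Comp_assoc[OF l(1) q12(1) po(6)] Comp_assoc[OF l(1) q12(2) po(7)] l(2,3) h k by simp
      then show ?thesis using rel_iff[OF abc(1,3)] Comp_in_hom[OF l(1) m(1)] by blast
    qed
  qed
qed

text \<open>A path object is the least homotopy equivalence relation on \<open>X\<close>: reflexivity of \<open>p\<close> is a map \<open>X \<rightarrow> R\<close>, and
  \<open>weak_lifting\<close> extends it along the weak equivalence \<open>r\<close>, over \<open>X \<times> X\<close>.\<close>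

lemma path_object_rel:
  assumes e: "is_path_object C Fib Weq X r e" and p: "her X p"
    and ab: "a \<in> hom C U X" "b \<in> hom C U X" and r: "rel e a b"
  shows "rel p a b"
proof -
  note H = herD[OF p] and po = path_objectD[OF e H(1)]
  have I: "Ide C X \<in> hom C X X" by (rule Ide_in_hom[OF H(1)])
  obtain l where l: "l \<in> hom C X (Dom C p)" "p \<cdot> l = pairing C (Ide C X) (Ide C X)"
    using H(4)[OF I] rel_iff[OF I I] by blast
  have "p \<cdot> l = e \<cdot> r" using l(2) po(5) by simp
  then obtain d where d: "d \<in> hom C (Dom C e) (Dom C p)" "p \<cdot> d = e"
    using weak_lifting[OF po(3,1) H(3,2) l(1) po(4)] by blast
  obtain h where h: "h \<in> hom C U (Dom C e)" "e \<cdot> h = pairing C a b" using r rel_iff[OF ab] by blast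
  have "p \<cdot> (d \<cdot> h) = pairing C a b" using Comp_assoc[OF h(1) d(1) H(3)] d(2) h(2) by simp
  then show ?thesis using rel_iff[OF ab] Comp_in_hom[OF h(1) d(1)] by blast
qed

text \<open>Fibrations over \<open>U\<close> as predicates on the generalized elements of \<open>U\<close>: substitution, conjunction and
  existential quantification.\<close>

lemma fibration_substitution:
  assumes p: "p \<in> Fib" and k: "k \<in> hom C U (Cod C p)"
  obtains e where "e \<in> Fib" "Cod C e = U" "\<And>V a. a \<in> hom C V U \<Longrightarrow> lifts e a \<longleftrightarrow> lifts p (k \<cdot> a)"
proof -
  have D: "k \<in> Arr C" "Cod C k = Cod C p" "Dom C k = U" using k by (simp_all add: hom_iff)
  obtain x e where pb: "is_pullback C p k x e" using Fib_pullback_exists[OF p D(1,2)] by blast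
  note P = is_pullbackD[OF pb]
  have p': "p \<in> hom C (Dom C p) (Cod C p)" using P(1) by (simp add: hom_iff)
  have x: "x \<in> hom C (Dom C x) (Dom C p)" and e: "e \<in> hom C (Dom C x) U" using P D by (simp_all add: hom_iff)
  have De: "Dom C e = Dom C x" using P by simp
  show ?thesis
  proof (rule that[OF Fib_pullback[OF p pb]])
    show "Cod C e = U" using e by (simp add: hom_iff)
    fix V a assume a: "a \<in> hom C V U"
    have ka: "k \<cdot> a \<in> hom C V (Cod C p)" using a k by (rule Comp_in_hom)
    show "lifts e a \<longleftrightarrow> lifts p (k \<cdot> a)"
      unfolding lifts_hom[OF a] lifts_hom[OF ka] De
    proof
      assume "\<exists>h \<in> hom C V (Dom C x). e \<cdot> h = a"
      then obtain h where h: "h \<in> hom C V (Dom C x)" "e \<cdot> h = a" by blast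
      then have "p \<cdot> (x \<cdot> h) = k \<cdot> a"
        using Comp_assoc[OF h(1) x p'] Comp_assoc[OF h(1) e k] P(9) by simp
      then show "\<exists>h \<in> hom C V (Dom C p). p \<cdot> h = k \<cdot> a" using Comp_in_hom[OF h(1) x] by blast
    next
      assume "\<exists>h \<in> hom C V (Dom C p). p \<cdot> h = k \<cdot> a"
      then obtain h where h: "h \<in> hom C V (Dom C p)" "p \<cdot> h = k \<cdot> a" by blast
      obtain l where "l \<in> hom C V (Dom C x)" "e \<cdot> l = a"
        using pullback_lift[OF pb h(1) _ h(2)] a D(3) by blast
      then show "\<exists>h \<in> hom C V (Dom C x). e \<cdot> h = a" by blast
    qed
  qed
qed

lemma lifts_composite:
  assumes f: "f \<in> hom C X Y" and g: "g \<in> hom C Y Z" and a: "a \<in> hom C U Z"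
  shows "lifts (g \<cdot> f) a \<longleftrightarrow> (\<exists>b \<in> hom C U Y. g \<cdot> b = a \<and> lifts f b)"
proof -
  have D: "Dom C (g \<cdot> f) = X" "Dom C f = X" using f g by (simp_all add: hom_iff)
  show ?thesis
  proof
    assume "lifts (g \<cdot> f) a"
    then obtain h where h: "h \<in> hom C U X" "(g \<cdot> f) \<cdot> h = a" using lifts_hom[OF a] D by auto
    have fh: "f \<cdot> h \<in> hom C U Y" using h(1) f by (rule Comp_in_hom)
    moreover have "g \<cdot> (f \<cdot> h) = a" using Comp_assoc[OF h(1) f g] h(2) by simp
    moreover have "lifts f (f \<cdot> h)" using lifts_hom[OF fh] D(2) h(1) by blast
    ultimately show "\<exists>b \<in> hom C U Y. g \<cdot> b = a \<and> lifts f b" by blast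
  next
    assume "\<exists>b \<in> hom C U Y. g \<cdot> b = a \<and> lifts f b"
    then obtain b where b: "b \<in> hom C U Y" "g \<cdot> b = a" "lifts f b" by blast
    then obtain h where h: "h \<in> hom C U X" "f \<cdot> h = b" using lifts_hom[OF b(1)] D(2) by auto
    then have "(g \<cdot> f) \<cdot> h = a" using Comp_assoc[OF h(1) f g] b(2) by simp
    then show "lifts (g \<cdot> f) a" using lifts_hom[OF a] D(1) h(1) by auto
  qed
qed

lemma fibration_conjunction:
  assumes e: "e \<in> Fib" "Cod C e = U" and e': "e' \<in> Fib" "Cod C e' = U"
  obtains d where "d \<in> Fib" "Cod C d = U" "\<And>V a. a \<in> hom C V U \<Longrightarrow> lifts d a \<longleftrightarrow> lifts e a \<and> lifts e' a"
proof -
  have E': "e' \<in> hom C (Dom C e') U" using e' fibration_Arr by (simp add: hom_iff)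
  obtain x where x: "x \<in> Fib" "Cod C x = Dom C e'"
    "\<And>V a. a \<in> hom C V (Dom C e') \<Longrightarrow> lifts x a \<longleftrightarrow> lifts e (e' \<cdot> a)"
    using fibration_substitution[OF e(1)] E' e(2) by metis
  have X: "x \<in> hom C (Dom C x) (Dom C e')" using x fibration_Arr by (simp add: hom_iff)
  show ?thesis
  proof (rule that)
    show "e' \<cdot> x \<in> Fib" using Fib_Comp[OF x(1) e'(1)] x(2) by simp
    show "Cod C (e' \<cdot> x) = U" using X E' by (simp add: hom_iff)
    fix V a assume a: "a \<in> hom C V U"
    show "lifts (e' \<cdot> x) a \<longleftrightarrow> lifts e a \<and> lifts e' a"
      unfolding lifts_composite[OF X E' a] using x(3) lifts_hom[OF a, of e'] by metis
  qed
qed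

lemma fibration_projection:
  assumes e: "e \<in> Fib" "Cod C e = prod_obj C U Z" and ob: "U \<in> Obj C" "Z \<in> Obj C"
  obtains d where "d \<in> Fib" "Cod C d = U"
    "\<And>V a. a \<in> hom C V U \<Longrightarrow> lifts d a \<longleftrightarrow> (\<exists>z \<in> hom C V Z. lifts e (pairing C a z))"
proof (rule that)
  note p = proj_hom[OF ob]
  have E: "e \<in> hom C (Dom C e) (prod_obj C U Z)" using e fibration_Arr by (simp add: hom_iff)
  show "proj\<^sub>1 C U Z \<cdot> e \<in> Fib" using Fib_Comp[OF e(1) proj_Fib(1)[OF ob]] p e by (simp add: hom_iff)
  show "Cod C (proj\<^sub>1 C U Z \<cdot> e) = U" using E p by (simp add: hom_iff)
  fix V a assume a: "a \<in> hom C V U"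
  show "lifts (proj\<^sub>1 C U Z \<cdot> e) a \<longleftrightarrow> (\<exists>z \<in> hom C V Z. lifts e (pairing C a z))"
    unfolding lifts_composite[OF E p(1) a]
  proof
    assume "\<exists>b \<in> hom C V (prod_obj C U Z). proj\<^sub>1 C U Z \<cdot> b = a \<and> lifts e b"
    then obtain b where b: "b \<in> hom C V (prod_obj C U Z)" "proj\<^sub>1 C U Z \<cdot> b = a" "lifts e b" by blast
    have "b = pairing C a (proj\<^sub>2 C U Z \<cdot> b)" using pairing_unique[OF b(1,2) refl ob] .
    then show "\<exists>z \<in> hom C V Z. lifts e (pairing C a z)" using b(3) Comp_in_hom[OF b(1) p(2)] by metis
  next
    assume "\<exists>z \<in> hom C V Z. lifts e (pairing C a z)"
    then show "\<exists>b \<in> hom C V (prod_obj C U Z). proj\<^sub>1 C U Z \<cdot> b = a \<and> lifts e b"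
      using pairing[OF a] by metis
  qed
qed

lemma rel_fibration:
  assumes p: "her X p" and f: "f \<in> hom C U X" and g: "g \<in> hom C U X"
  obtains e where "e \<in> Fib" "Cod C e = U"
    "\<And>V a. a \<in> hom C V U \<Longrightarrow> lifts e a \<longleftrightarrow> rel p (f \<cdot> a) (g \<cdot> a)"
proof -
  note H = herD[OF p]
  have "pairing C f g \<in> hom C U (Cod C p)" using pairing(1)[OF f g] H(3) by (simp add: hom_iff)
  from fibration_substitution[OF H(2) this]
  show ?thesis using that pairing_Comp[OF f g] unfolding rel_def by metis
qed

lemma rel_pullback:
  assumes p: "her Y p" and f: "f \<in> hom C X Y"
  obtains q where "her X q"
    "\<And>U a b. \<lbrakk>a \<in> hom C U X; b \<in> hom C U X\<rbrakk> \<Longrightarrow> rel q a b \<longleftrightarrow> rel p (f \<cdot> a) (f \<cdot> b)"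
proof -
  have X: "X \<in> Obj C" using hom_Obj[OF f] by simp
  note pr = proj_hom[OF X X]
  note H = herD[OF p]
  obtain q where q: "q \<in> Fib" "Cod C q = prod_obj C X X"
    "\<And>V a. a \<in> hom C V (prod_obj C X X) \<Longrightarrow>
       lifts q a \<longleftrightarrow> rel p ((f \<cdot> proj\<^sub>1 C X X) \<cdot> a) ((f \<cdot> proj\<^sub>2 C X X) \<cdot> a)"
    using rel_fibration[OF p Comp_in_hom[OF pr(1) f] Comp_in_hom[OF pr(2) f]] by metis
  have rel: "rel q a b \<longleftrightarrow> rel p (f \<cdot> a) (f \<cdot> b)" if ab: "a \<in> hom C U X" "b \<in> hom C U X" for U a b
    unfolding rel_def[of q] q(3)[OF pairing(1)[OF ab]]
    using Comp_assoc[OF pairing(1)[OF ab] pr(1) f] Comp_assoc[OF pairing(1)[OF ab] pr(2) f]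
      pairing(2,3)[OF ab] by simp
  have fh: "f \<cdot> a \<in> hom C U Y" if "a \<in> hom C U X" for a U using that f by (rule Comp_in_hom)
  have "her X q"
  proof (rule herI[OF X q(1,2)])
    show "rel q a a" if "a \<in> hom C U X" for U a
      using rel[OF that that] H(4)[OF fh[OF that]] by simp
    show "rel q b a" if "a \<in> hom C U X" "b \<in> hom C U X" "rel q a b" for U a b
      using rel[OF that(1,2)] rel[OF that(2,1)] H(5)[OF _ fh[OF that(1)] fh[OF that(2)]] that(3) by simp
    show "rel q a c" if "a \<in> hom C U X" "b \<in> hom C U X" "c \<in> hom C U X" "rel q a b" "rel q b c" for U a b c
      using rel[OF that(1,2)] rel[OF that(2,3)] rel[OF that(1,3)]
        H(6)[OF _ _ fh[OF that(1)] fh[OF that(2)] fh[OF that(3)]] that(4,5) by simp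
  qed
  then show ?thesis using that rel by blast
qed

text \<open>Maps preserve homotopy, because homotopy is the least relation on its domain.\<close>

lemma path_object_rel_image:
  assumes e: "is_path_object C Fib Weq X r e" and p: "her Y p" and f: "f \<in> hom C X Y"
    and ab: "a \<in> hom C U X" "b \<in> hom C U X" and r: "rel e a b"
  shows "rel p (f \<cdot> a) (f \<cdot> b)"
proof -
  obtain q where q: "her X q" "\<And>U a b. \<lbrakk>a \<in> hom C U X; b \<in> hom C U X\<rbrakk> \<Longrightarrow> rel q a b \<longleftrightarrow> rel p (f \<cdot> a) (f \<cdot> b)"
    using rel_pullback[OF p f] by metis
  show ?thesis using path_object_rel[OF e q(1) ab r] q(2)[OF ab] by simp
qed

text \<open>Homotopy does not depend on the path object because any two path objects on \<open>X\<close> contain each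
  other, both being least.\<close>

lemma homotopic_iff:
  assumes f: "f \<in> hom C U X" and g: "g \<in> hom C U X" and e: "is_path_object C Fib Weq X r e"
  shows "homotopic C Fib Weq f g \<longleftrightarrow> rel e f g"
proof -
  have X: "X \<in> Obj C" using hom_Obj[OF f] by simp
  have D: "f \<in> Arr C" "Dom C f = U" "Cod C f = X" using f by (simp_all add: hom_iff)
  have "rel e f g" if re: "is_path_object C Fib Weq X r' e'" and h: "h \<in> hom C U (Dom C e')"
      "(proj\<^sub>1 C X X \<cdot> e') \<cdot> h = f" "(proj\<^sub>2 C X X \<cdot> e') \<cdot> h = g" for r' e' h
    using path_object_rel[OF re path_object_her[OF e X] f g] rel_projI[OF path_objectD(4)[OF re X] X h(1)] h(2,3)
    by simp
  moreover have "\<exists>h \<in> hom C U (Dom C e). (proj\<^sub>1 C X X \<cdot> e) \<cdot> h = f \<and> (proj\<^sub>2 C X X \<cdot> e) \<cdot> h = g"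
    if "rel e f g"
    using relE[OF path_objectD(4)[OF e X] f g that] by metis
  ultimately show ?thesis unfolding homotopic_def D using D(1) g e by blast
qed

end


section \<open>The homotopy exact completion as a category\<close>

context path_category_notation
begin

abbreviation "Hx \<equiv> Hex C Fib"

definition hx :: "'o \<times> 'a \<Rightarrow> 'o \<times> 'a \<Rightarrow> 'a \<Rightarrow> ('o \<times> 'a) \<times> ('o \<times> 'a) \<times> 'a set" where
  "hx A B f = (A, B, hex_class C A B f)"

lemma Hex_simps [simp]:
  "Obj Hx = {(X, p). her X p}"
  "Dom Hx (hx A B f) = A"
  "Cod Hx (hx A B f) = B"
  "Ide Hx A = hx A A (Ide C (fst A))"
  by (simp_all add: Hex_def Let_def hx_def)

lemma Hex_Arr: "\<phi> \<in> Arr Hx \<longleftrightarrow> (\<exists>A B f. \<phi> = hx A B f \<and> A \<in> Obj Hx \<and> B \<in> Obj Hx \<and> f \<in> hex_map C A B)"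
  by (auto simp: Hex_def Let_def hx_def)

lemma hex_map_hom: "f \<in> hex_map C (X, p) (Y, q) \<Longrightarrow> f \<in> hom C X Y"
  by (simp add: hex_map_def)

text \<open>The two components of \<open>p\<close> are the generic pair of related elements.\<close>

lemma hex_map_iff:
  assumes p: "her X p" and q: "her Y q"
  shows "f \<in> hex_map C (X, p) (Y, q) \<longleftrightarrow> f \<in> hom C X Y \<and>
    (\<forall>U. \<forall>a \<in> hom C U X. \<forall>b \<in> hom C U X. rel p a b \<longrightarrow> rel q (f \<cdot> a) (f \<cdot> b))"
proof
  note P = herD[OF p] and Q = herD[OF q]
  assume f: "f \<in> hex_map C (X, p) (Y, q)"
  have fh: "f \<in> hom C X Y" using f by (rule hex_map_hom)
  obtain \<phi> where \<phi>: "\<phi> \<in> hom C (Dom C p) (Dom C q)" "q \<cdot> \<phi> = prod_map C f f \<cdot> p"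
    using f by (auto simp: hex_map_def)
  have "rel q (f \<cdot> a) (f \<cdot> b)" if ab: "a \<in> hom C U X" "b \<in> hom C U X" "rel p a b" for U a b
  proof -
    obtain h where h: "h \<in> hom C U (Dom C p)" "p \<cdot> h = pairing C a b" using rel_iff[OF ab(1,2)] ab(3) by blast
    have "q \<cdot> (\<phi> \<cdot> h) = prod_map C f f \<cdot> pairing C a b"
      using Comp_assoc[OF h(1) \<phi>(1) Q(3)] \<phi>(2) Comp_assoc[OF h(1) P(3) prod_map(1)[OF fh fh]] h(2) by simp
    then show ?thesis
      using rel_iff[OF Comp_in_hom[OF ab(1) fh] Comp_in_hom[OF ab(2) fh]] Comp_in_hom[OF h(1) \<phi>(1)]
        prod_map_pairing[OF fh fh ab(1,2)] by metis
  qed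
  then show "f \<in> hom C X Y \<and>
    (\<forall>U. \<forall>a \<in> hom C U X. \<forall>b \<in> hom C U X. rel p a b \<longrightarrow> rel q (f \<cdot> a) (f \<cdot> b))" using fh by blast
next
  note P = herD[OF p] and Q = herD[OF q]
  assume f: "f \<in> hom C X Y \<and>
    (\<forall>U. \<forall>a \<in> hom C U X. \<forall>b \<in> hom C U X. rel p a b \<longrightarrow> rel q (f \<cdot> a) (f \<cdot> b))"
  then have fh: "f \<in> hom C X Y" by blast
  note pr = proj_hom[OF P(1) P(1)]
  define p1 where "p1 = proj\<^sub>1 C X X \<cdot> p"
  define p2 where "p2 = proj\<^sub>2 C X X \<cdot> p"
  have p12: "p1 \<in> hom C (Dom C p) X" "p2 \<in> hom C (Dom C p) X"
    unfolding p1_def p2_def using Comp_in_hom[OF P(3)] pr by blast+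
  have "Ide C (Dom C p) \<in> hom C (Dom C p) (Dom C p)" using hom_Obj[OF P(3)] by (simp add: Ide_in_hom)
  from rel_projI[OF P(3,1) this, folded p1_def p2_def] have "rel p p1 p2"
    using Comp_Ide_right[OF p12(1)] Comp_Ide_right[OF p12(2)] by simp
  then have "rel q (f \<cdot> p1) (f \<cdot> p2)" using f p12 by blast
  then obtain h where "h \<in> hom C (Dom C p) (Dom C q)" "q \<cdot> h = pairing C (f \<cdot> p1) (f \<cdot> p2)"
    using rel_iff[OF Comp_in_hom[OF p12(1) fh] Comp_in_hom[OF p12(2) fh]] by blast
  then show "f \<in> hex_map C (X, p) (Y, q)"
    using fh prod_map(2)[OF fh fh P(3)] by (auto simp: hex_map_def p1_def p2_def)
qed

lemma hex_mapI:
  assumes "her X p" "her Y q" "f \<in> hom C X Y"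
    and "\<And>U a b. \<lbrakk>a \<in> hom C U X; b \<in> hom C U X; rel p a b\<rbrakk> \<Longrightarrow> rel q (f \<cdot> a) (f \<cdot> b)"
  shows "f \<in> hex_map C (X, p) (Y, q)"
  using hex_map_iff[OF assms(1,2)] assms(3,4) by blast

lemma hex_map_rel:
  assumes "her X p" "her Y q" "f \<in> hex_map C (X, p) (Y, q)" "rel p a b" "a \<in> hom C U X" "b \<in> hom C U X"
  shows "rel q (f \<cdot> a) (f \<cdot> b)"
  using hex_map_iff[OF assms(1,2)] assms(3-6) by blast

lemma hex_map_Comp:
  assumes p: "her X p" and q: "her Y q" and r: "her Z r"
    and f: "f \<in> hex_map C (X, p) (Y, q)" and g: "g \<in> hex_map C (Y, q) (Z, r)"
  shows "g \<cdot> f \<in> hex_map C (X, p) (Z, r)"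
proof (rule hex_mapI[OF p r])
  note fh = hex_map_hom[OF f] and gh = hex_map_hom[OF g]
  show "g \<cdot> f \<in> hom C X Z" using fh gh by (rule Comp_in_hom)
  fix U a b assume ab: "a \<in> hom C U X" "b \<in> hom C U X" "rel p a b"
  have "rel r (g \<cdot> (f \<cdot> a)) (g \<cdot> (f \<cdot> b))"
    by (rule hex_map_rel[OF q r g hex_map_rel[OF p q f ab(3,1,2)] Comp_in_hom[OF ab(1) fh] Comp_in_hom[OF ab(2) fh]])
  then show "rel r ((g \<cdot> f) \<cdot> a) ((g \<cdot> f) \<cdot> b)"
    using Comp_assoc[OF ab(1) fh gh] Comp_assoc[OF ab(2) fh gh] by simp
qed

lemma hex_map_Ide:
  assumes p: "her X p"
  shows "Ide C X \<in> hex_map C (X, p) (X, p)"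
  using herD(1)[OF p] Comp_Ide_left by (intro hex_mapI[OF p p]) (auto simp: Ide_in_hom)

lemma hex_class_iff:
  assumes "f \<in> hom C X Y"
  shows "g \<in> hex_class C (X, p) (Y, q) f \<longleftrightarrow> g \<in> hex_map C (X, p) (Y, q) \<and> rel q f g"
proof -
  have "rel q f g \<longleftrightarrow> (\<exists>H \<in> hom C X (Dom C q). q \<cdot> H = pairing C f g)" if "g \<in> hex_map C (X, p) (Y, q)"
    using rel_iff[OF assms hex_map_hom[OF that]] .
  then show ?thesis by (auto simp: hex_class_def)
qed

lemma hex_class_eq_iff:
  assumes p: "her X p" and q: "her Y q"
    and f: "f \<in> hex_map C (X, p) (Y, q)" and g: "g \<in> hex_map C (X, p) (Y, q)"
  shows "hex_class C (X, p) (Y, q) f = hex_class C (X, p) (Y, q) g \<longleftrightarrow> rel q f g"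
proof -
  note Q = herD[OF q]
  note fh = hex_map_hom[OF f] and gh = hex_map_hom[OF g]
  have "hex_class C (X, p) (Y, q) f \<subseteq> hex_class C (X, p) (Y, q) g"
    if gf: "rel q g f" "g \<in> hom C X Y" "f \<in> hom C X Y" for f g
  proof
    fix h assume "h \<in> hex_class C (X, p) (Y, q) f"
    then have h: "h \<in> hex_map C (X, p) (Y, q)" "rel q f h" using hex_class_iff[OF gf(3)] by blast+
    then show "h \<in> hex_class C (X, p) (Y, q) g"
      using Q(6)[OF gf(1) h(2) gf(2,3) hex_map_hom[OF h(1)]] hex_class_iff[OF gf(2)] by blast
  qed
  moreover have "rel q f g" if "hex_class C (X, p) (Y, q) f = hex_class C (X, p) (Y, q) g"
    using hex_class_iff[OF gh, of g p q] hex_class_iff[OF fh, of g p q] g Q(4)[OF gh] that by blast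
  ultimately show ?thesis using Q(5)[OF _ fh gh] fh gh by blast
qed

lemma hx_eq_iff:
  assumes "her X p" "her Y q" "f \<in> hex_map C (X, p) (Y, q)" "g \<in> hex_map C (X, p) (Y, q)"
  shows "hx (X, p) (Y, q) f = hx (X, p) (Y, q) g \<longleftrightarrow> rel q f g"
  using hex_class_eq_iff[OF assms] by (simp add: hx_def)

lemma hx_hom:
  assumes "her X p" "her Y q" "f \<in> hex_map C (X, p) (Y, q)"
  shows "hx (X, p) (Y, q) f \<in> hom Hx (X, p) (Y, q)"
proof -
  have "hx (X, p) (Y, q) f \<in> Arr Hx"
    unfolding Hex_Arr
    by (rule exI[of _ "(X, p)"], rule exI[of _ "(Y, q)"], rule exI[of _ f]) (simp add: assms)
  then show ?thesis by (simp add: hom_iff)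
qed

lemma Hex_homE:
  assumes "\<phi> \<in> hom Hx (X, p) (Y, q)"
  obtains f where "f \<in> hex_map C (X, p) (Y, q)" "\<phi> = hx (X, p) (Y, q) f" "her X p" "her Y q"
  using assms by (auto simp: hom_iff Hex_Arr)

text \<open>Representatives may be changed one at a time: \<open>f\<close> because \<open>g\<close> preserves the relations, and \<open>g\<close>
  because relations are stable under precomposition.\<close>

lemma hex_class_Comp:
  assumes p: "her X p" and q: "her Y q" and r: "her Z r"
    and f: "f \<in> hex_map C (X, p) (Y, q)" and g: "g \<in> hex_map C (Y, q) (Z, r)"
  shows "(\<Union>g' \<in> hex_class C (Y, q) (Z, r) g. \<Union>f' \<in> hex_class C (X, p) (Y, q) f.
      hex_class C (X, p) (Z, r) (g' \<cdot> f')) = hex_class C (X, p) (Z, r) (g \<cdot> f)"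
proof -
  note fh = hex_map_hom[OF f] and gh = hex_map_hom[OF g]
  have eq: "hex_class C (X, p) (Z, r) (g' \<cdot> f') = hex_class C (X, p) (Z, r) (g \<cdot> f)"
    if g': "g' \<in> hex_class C (Y, q) (Z, r) g" and f': "f' \<in> hex_class C (X, p) (Y, q) f" for f' g'
  proof -
    have g'm: "g' \<in> hex_map C (Y, q) (Z, r)" "rel r g g'" using g' hex_class_iff[OF gh] by blast+
    have f'm: "f' \<in> hex_map C (X, p) (Y, q)" "rel q f f'" using f' hex_class_iff[OF fh] by blast+
    note f'h = hex_map_hom[OF f'm(1)] and g'h = hex_map_hom[OF g'm(1)]
    have "rel r (g \<cdot> f) (g \<cdot> f')" by (rule hex_map_rel[OF q r g f'm(2) fh f'h])
    moreover have "rel r (g \<cdot> f') (g' \<cdot> f')" by (rule rel_Comp[OF herD(3)[OF r] gh g'h g'm(2) f'h])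
    ultimately have "rel r (g \<cdot> f) (g' \<cdot> f')"
      using herD(6)[OF r] Comp_in_hom[OF fh gh] Comp_in_hom[OF f'h gh] Comp_in_hom[OF f'h g'h] by blast
    then show ?thesis
      using hex_class_eq_iff[OF p r hex_map_Comp[OF p q r f g] hex_map_Comp[OF p q r f'm(1) g'm(1)]] by simp
  qed
  moreover have "f \<in> hex_class C (X, p) (Y, q) f" "g \<in> hex_class C (Y, q) (Z, r) g"
    using hex_class_iff[OF fh] hex_class_iff[OF gh] f g herD(4)[OF q fh] herD(4)[OF r gh] by blast+
  ultimately show ?thesis by blast
qed

lemma Hex_Comp:
  assumes "her X p" "her Y q" "her Z r" "f \<in> hex_map C (X, p) (Y, q)" "g \<in> hex_map C (Y, q) (Z, r)"
  shows "hx (Y, q) (Z, r) g \<cdot>\<^bsub>Hx\<^esub> hx (X, p) (Y, q) f = hx (X, p) (Z, r) (g \<cdot> f)"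
  using hex_class_Comp[OF assms] by (simp add: hx_def Hex_def Let_def)

lemma category_Hex: "category Hx"
proof
  show "Dom Hx \<phi> \<in> Obj Hx" "Cod Hx \<phi> \<in> Obj Hx" if "\<phi> \<in> Arr Hx" for \<phi>
    using that unfolding Hex_Arr by auto
  show "Ide Hx A \<in> hom Hx A A" if "A \<in> Obj Hx" for A
    using that hx_hom hex_map_Ide by auto
  fix \<phi> A B assume \<phi>: "\<phi> \<in> hom Hx A B"
  obtain X p Y q where AB: "A = (X, p)" "B = (Y, q)" by (cases A, cases B)
  obtain f where f: "f \<in> hex_map C (X, p) (Y, q)" "\<phi> = hx (X, p) (Y, q) f" and pq: "her X p" "her Y q"
    using \<phi> unfolding AB by (rule Hex_homE)
  note fh = hex_map_hom[OF f(1)]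
  show "\<phi> \<cdot>\<^bsub>Hx\<^esub> Ide Hx A = \<phi>" "Ide Hx B \<cdot>\<^bsub>Hx\<^esub> \<phi> = \<phi>"
    using Hex_Comp[OF pq(1,1,2) hex_map_Ide[OF pq(1)] f(1)] Hex_Comp[OF pq(1,2,2) f(1) hex_map_Ide[OF pq(2)]]
      Comp_Ide_left[OF fh] Comp_Ide_right[OF fh] by (simp_all add: AB f(2))
  fix \<psi> D assume \<psi>: "\<psi> \<in> hom Hx B D"
  obtain Z r where D: "D = (Z, r)" by (cases D)
  obtain g where g: "g \<in> hex_map C (Y, q) (Z, r)" "\<psi> = hx (Y, q) (Z, r) g" and r: "her Z r"
    using \<psi> unfolding AB D by (rule Hex_homE)
  show "\<psi> \<cdot>\<^bsub>Hx\<^esub> \<phi> \<in> hom Hx A D"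
    unfolding AB D f(2) g(2) Hex_Comp[OF pq r f(1) g(1)] by (rule hx_hom[OF pq(1) r hex_map_Comp[OF pq r f(1) g(1)]])
  fix \<chi> K assume \<chi>: "\<chi> \<in> hom Hx D K"
  obtain V s where K: "K = (V, s)" by (cases K)
  obtain h where h: "h \<in> hex_map C (Z, r) (V, s)" "\<chi> = hx (Z, r) (V, s) h" and s: "her V s"
    using \<chi> unfolding D K by (rule Hex_homE)
  show "(\<chi> \<cdot>\<^bsub>Hx\<^esub> \<psi>) \<cdot>\<^bsub>Hx\<^esub> \<phi> = \<chi> \<cdot>\<^bsub>Hx\<^esub> (\<psi> \<cdot>\<^bsub>Hx\<^esub> \<phi>)"
    unfolding f(2) g(2) h(2) Hex_Comp[OF pq r f(1) g(1)] Hex_Comp[OF pq(2) r s g(1) h(1)]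
      Hex_Comp[OF pq(1) r s hex_map_Comp[OF pq r f(1) g(1)] h(1)]
      Hex_Comp[OF pq s f(1) hex_map_Comp[OF pq(2) r s g(1) h(1)]]
      Comp_assoc[OF fh hex_map_hom[OF g(1)] hex_map_hom[OF h(1)]] ..
qed

end

sublocale path_category_notation \<subseteq> Hex: category "Hex C Fib"
  by (rule category_Hex)


section \<open>Exactness of the homotopy exact completion\<close>

context path_category_notation
begin

lemma rel_conjunction:
  assumes p: "her X p" and q: "her X q"
  obtains r where "her X r" "\<And>U a b. \<lbrakk>a \<in> hom C U X; b \<in> hom C U X\<rbrakk> \<Longrightarrow> rel r a b \<longleftrightarrow> rel p a b \<and> rel q a b"
proof -
  note P = herD[OF p] and Q = herD[OF q]
  have cod: "Cod C p = prod_obj C X X" "Cod C q = prod_obj C X X" using P(3) Q(3) by (simp_all add: hom_iff)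
  obtain r where r: "r \<in> Fib" "Cod C r = prod_obj C X X"
    "\<And>V a. a \<in> hom C V (prod_obj C X X) \<Longrightarrow> lifts r a \<longleftrightarrow> lifts p a \<and> lifts q a"
    using fibration_conjunction[OF P(2) cod(1) Q(2) cod(2)] by metis
  have rel: "rel r a b \<longleftrightarrow> rel p a b \<and> rel q a b" if "a \<in> hom C U X" "b \<in> hom C U X" for U a b
    unfolding rel_def using r(3)[OF pairing(1)[OF that]] .
  have "her X r"
  proof (rule herI[OF P(1) r(1,2)])
    show "rel r a a" if "a \<in> hom C U X" for U a using rel[OF that that] P(4)[OF that] Q(4)[OF that] by blast
    show "rel r b a" if "a \<in> hom C U X" "b \<in> hom C U X" "rel r a b" for U a b
      using rel[OF that(1,2)] rel[OF that(2,1)] P(5)[OF _ that(1,2)] Q(5)[OF _ that(1,2)] that(3) by blast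
    show "rel r a c" if "a \<in> hom C U X" "b \<in> hom C U X" "c \<in> hom C U X" "rel r a b" "rel r b c" for U a b c
      using rel[OF that(1,2)] rel[OF that(2,3)] rel[OF that(1,3)] P(6)[OF _ _ that(1-3)] Q(6)[OF _ _ that(1-3)]
        that(4,5) by blast
  qed
  then show ?thesis using that rel by blast
qed

text \<open>Elements of the product are related if both their components are.\<close>

lemma Hex_product:
  assumes A: "A \<in> Obj Hx" and B: "B \<in> Obj Hx"
  shows "\<exists>\<phi> \<psi>. is_product Hx A B \<phi> \<psi>"
proof -
  obtain X p Y q where AB: "A = (X, p)" "B = (Y, q)" and p: "her X p" and q: "her Y q"
    using A B by auto
  have XY: "X \<in> Obj C" "Y \<in> Obj C" using herD(1) p q by blast+
  define Z where "Z = prod_obj C X Y"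
  define \<pi>1 where "\<pi>1 = proj\<^sub>1 C X Y"
  define \<pi>2 where "\<pi>2 = proj\<^sub>2 C X Y"
  have \<pi>: "\<pi>1 \<in> hom C Z X" "\<pi>2 \<in> hom C Z Y" unfolding \<pi>1_def \<pi>2_def Z_def using proj_hom[OF XY] by blast+
  obtain p' where p': "her Z p'"
    "\<And>U a b. \<lbrakk>a \<in> hom C U Z; b \<in> hom C U Z\<rbrakk> \<Longrightarrow> rel p' a b \<longleftrightarrow> rel p (\<pi>1 \<cdot> a) (\<pi>1 \<cdot> b)"
    using rel_pullback[OF p \<pi>(1)] by metis
  obtain q' where q': "her Z q'"
    "\<And>U a b. \<lbrakk>a \<in> hom C U Z; b \<in> hom C U Z\<rbrakk> \<Longrightarrow> rel q' a b \<longleftrightarrow> rel q (\<pi>2 \<cdot> a) (\<pi>2 \<cdot> b)"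
    using rel_pullback[OF q \<pi>(2)] by metis
  obtain r where r: "her Z r"
    "\<And>U a b. \<lbrakk>a \<in> hom C U Z; b \<in> hom C U Z\<rbrakk> \<Longrightarrow> rel r a b \<longleftrightarrow> rel p' a b \<and> rel q' a b"
    using rel_conjunction[OF p'(1) q'(1)] by metis
  have rel: "rel r a b \<longleftrightarrow> rel p (\<pi>1 \<cdot> a) (\<pi>1 \<cdot> b) \<and> rel q (\<pi>2 \<cdot> a) (\<pi>2 \<cdot> b)"
    if "a \<in> hom C U Z" "b \<in> hom C U Z" for U a b
    using r(2)[OF that] p'(2)[OF that] q'(2)[OF that] by simp
  have m: "\<pi>1 \<in> hex_map C (Z, r) (X, p)" "\<pi>2 \<in> hex_map C (Z, r) (Y, q)"
    using hex_mapI[OF r(1) p \<pi>(1)] hex_mapI[OF r(1) q \<pi>(2)] rel by blast+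
  have "is_product Hx (X, p) (Y, q) (hx (Z, r) (X, p) \<pi>1) (hx (Z, r) (Y, q) \<pi>2)"
    unfolding is_product_def Hex_simps
  proof (intro conjI allI ballI hx_hom r(1) p q m)
    fix W' \<phi> \<psi> assume \<phi>: "\<phi> \<in> hom Hx W' (X, p)" and \<psi>: "\<psi> \<in> hom Hx W' (Y, q)"
    obtain W w where W': "W' = (W, w)" by (cases W')
    obtain f where f: "f \<in> hex_map C (W, w) (X, p)" "\<phi> = hx (W, w) (X, p) f" and w: "her W w"
      using \<phi> unfolding W' by (rule Hex_homE)
    obtain g where g: "g \<in> hex_map C (W, w) (Y, q)" "\<psi> = hx (W, w) (Y, q) g"
      using \<psi> unfolding W' by (rule Hex_homE)
    note fh = hex_map_hom[OF f(1)] and gh = hex_map_hom[OF g(1)]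
    define h where "h = pairing C f g"
    have h: "h \<in> hom C W Z" "\<pi>1 \<cdot> h = f" "\<pi>2 \<cdot> h = g"
      unfolding h_def Z_def \<pi>1_def \<pi>2_def by (rule pairing[OF fh gh])+
    have hm: "h \<in> hex_map C (W, w) (Z, r)"
    proof (rule hex_mapI[OF w r(1) h(1)])
      fix U a b assume ab: "a \<in> hom C U W" "b \<in> hom C U W" "rel w a b"
      have "rel p (f \<cdot> a) (f \<cdot> b)" "rel q (g \<cdot> a) (g \<cdot> b)"
        using hex_map_rel[OF w p f(1) ab(3,1,2)] hex_map_rel[OF w q g(1) ab(3,1,2)] .
      then show "rel r (h \<cdot> a) (h \<cdot> b)"
        using rel[OF Comp_in_hom[OF ab(1) h(1)] Comp_in_hom[OF ab(2) h(1)]] h(2,3)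
          Comp_assoc[OF ab(1) h(1) \<pi>(1)] Comp_assoc[OF ab(2) h(1) \<pi>(1)]
          Comp_assoc[OF ab(1) h(1) \<pi>(2)] Comp_assoc[OF ab(2) h(1) \<pi>(2)] by simp
    qed
    show "\<exists>!\<chi>. \<chi> \<in> hom Hx W' (Z, r) \<and> hx (Z, r) (X, p) \<pi>1 \<cdot>\<^bsub>Hx\<^esub> \<chi> = \<phi> \<and> hx (Z, r) (Y, q) \<pi>2 \<cdot>\<^bsub>Hx\<^esub> \<chi> = \<psi>"
    proof (rule ex1I[of _ "hx (W, w) (Z, r) h"])
      show "hx (W, w) (Z, r) h \<in> hom Hx W' (Z, r) \<and> hx (Z, r) (X, p) \<pi>1 \<cdot>\<^bsub>Hx\<^esub> hx (W, w) (Z, r) h = \<phi> \<and>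
        hx (Z, r) (Y, q) \<pi>2 \<cdot>\<^bsub>Hx\<^esub> hx (W, w) (Z, r) h = \<psi>"
        using hx_hom[OF w r(1) hm] Hex_Comp[OF w r(1) p hm m(1)] Hex_Comp[OF w r(1) q hm m(2)] h(2,3)
        by (simp add: W' f(2) g(2))
      fix \<chi> assume \<chi>: "\<chi> \<in> hom Hx W' (Z, r) \<and> hx (Z, r) (X, p) \<pi>1 \<cdot>\<^bsub>Hx\<^esub> \<chi> = \<phi> \<and> hx (Z, r) (Y, q) \<pi>2 \<cdot>\<^bsub>Hx\<^esub> \<chi> = \<psi>"
      then obtain k where k: "k \<in> hex_map C (W, w) (Z, r)" "\<chi> = hx (W, w) (Z, r) k"
        unfolding W' by (auto elim: Hex_homE)
      have "rel p (\<pi>1 \<cdot> k) f" "rel q (\<pi>2 \<cdot> k) g"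
        using \<chi> Hex_Comp[OF w r(1) p k(1) m(1)] Hex_Comp[OF w r(1) q k(1) m(2)]
          hx_eq_iff[OF w p hex_map_Comp[OF w r(1) p k(1) m(1)] f(1)]
          hx_eq_iff[OF w q hex_map_Comp[OF w r(1) q k(1) m(2)] g(1)] by (simp_all add: k(2) f(2) g(2))
      then have "rel r k h" using rel[OF hex_map_hom[OF k(1)] h(1)] h(2,3) by simp
      then show "\<chi> = hx (W, w) (Z, r) h" using hx_eq_iff[OF w r(1) k(1) hm] k(2) by simp
    qed
  qed
  then show ?thesis unfolding AB by blast
qed

text \<open>The elements that \<open>f\<close> and \<open>g\<close> send to related elements form a fibration \<open>e\<close> over \<open>X\<close>, and their
  relation is that of \<open>X\<close>.\<close>

lemma Hex_equalizer:
  assumes \<phi>: "\<phi> \<in> hom Hx A B" and \<psi>: "\<psi> \<in> hom Hx A B"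
  shows "\<exists>E. \<exists>\<mu> \<in> hom Hx E A. \<phi> \<cdot>\<^bsub>Hx\<^esub> \<mu> = \<psi> \<cdot>\<^bsub>Hx\<^esub> \<mu> \<and>
    (\<forall>U. \<forall>\<alpha> \<in> hom Hx U A. \<phi> \<cdot>\<^bsub>Hx\<^esub> \<alpha> = \<psi> \<cdot>\<^bsub>Hx\<^esub> \<alpha> \<longrightarrow> (\<exists>!\<eta>. \<eta> \<in> hom Hx U E \<and> \<mu> \<cdot>\<^bsub>Hx\<^esub> \<eta> = \<alpha>))"
proof -
  obtain X p Y q where AB: "A = (X, p)" "B = (Y, q)" by (cases A, cases B)
  obtain f where f: "f \<in> hex_map C (X, p) (Y, q)" "\<phi> = hx (X, p) (Y, q) f" and p: "her X p" and q: "her Y q"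
    using \<phi> unfolding AB by (rule Hex_homE)
  obtain g where g: "g \<in> hex_map C (X, p) (Y, q)" "\<psi> = hx (X, p) (Y, q) g"
    using \<psi> unfolding AB by (rule Hex_homE)
  note fh = hex_map_hom[OF f(1)] and gh = hex_map_hom[OF g(1)]
  obtain e where e: "e \<in> Fib" "Cod C e = X"
    "\<And>V a. a \<in> hom C V X \<Longrightarrow> lifts e a \<longleftrightarrow> rel q (f \<cdot> a) (g \<cdot> a)"
    using rel_fibration[OF q fh gh] by metis
  define E where "E = Dom C e"
  have eh: "e \<in> hom C E X" using e(1,2) fibration_Arr by (simp add: hom_iff E_def)
  obtain r where r: "her E r" "\<And>U a b. \<lbrakk>a \<in> hom C U E; b \<in> hom C U E\<rbrakk> \<Longrightarrow> rel r a b \<longleftrightarrow> rel p (e \<cdot> a) (e \<cdot> b)"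
    using rel_pullback[OF p eh] by metis
  have em: "e \<in> hex_map C (E, r) (X, p)" using hex_mapI[OF r(1) p eh] r(2) by blast
  have "lifts e e" using lifts_hom[OF eh] Comp_Ide_right[OF eh] hom_Obj[OF eh] Ide_in_hom[of E] E_def by metis
  then have "rel q (f \<cdot> e) (g \<cdot> e)" using e(3)[OF eh] by simp
  then have comm: "\<phi> \<cdot>\<^bsub>Hx\<^esub> hx (E, r) (X, p) e = \<psi> \<cdot>\<^bsub>Hx\<^esub> hx (E, r) (X, p) e"
    unfolding f(2) g(2) Hex_Comp[OF r(1) p q em f(1)] Hex_Comp[OF r(1) p q em g(1)]
    using hx_eq_iff[OF r(1) q hex_map_Comp[OF r(1) p q em f(1)] hex_map_Comp[OF r(1) p q em g(1)]] by simp
  have univ: "\<exists>!\<eta>. \<eta> \<in> hom Hx U (E, r) \<and> hx (E, r) (X, p) e \<cdot>\<^bsub>Hx\<^esub> \<eta> = \<alpha>"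
    if \<alpha>: "\<alpha> \<in> hom Hx U (X, p)" and eq: "\<phi> \<cdot>\<^bsub>Hx\<^esub> \<alpha> = \<psi> \<cdot>\<^bsub>Hx\<^esub> \<alpha>" for U \<alpha>
  proof -
    obtain W w where U: "U = (W, w)" by (cases U)
    obtain a where a: "a \<in> hex_map C (W, w) (X, p)" "\<alpha> = hx (W, w) (X, p) a" and w: "her W w"
      using \<alpha> unfolding U by (rule Hex_homE)
    note ah = hex_map_hom[OF a(1)]
    have "rel q (f \<cdot> a) (g \<cdot> a)"
      using eq hx_eq_iff[OF w q hex_map_Comp[OF w p q a(1) f(1)] hex_map_Comp[OF w p q a(1) g(1)]]
      unfolding f(2) g(2) a(2) Hex_Comp[OF w p q a(1) f(1)] Hex_Comp[OF w p q a(1) g(1)] by simp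
    then obtain h where h: "h \<in> hom C W E" "e \<cdot> h = a"
      using e(3)[OF ah] lifts_hom[OF ah] E_def by auto
    have hm: "h \<in> hex_map C (W, w) (E, r)"
    proof (rule hex_mapI[OF w r(1) h(1)])
      fix V x y assume xy: "x \<in> hom C V W" "y \<in> hom C V W" "rel w x y"
      have "rel p (a \<cdot> x) (a \<cdot> y)" by (rule hex_map_rel[OF w p a(1) xy(3,1,2)])
      then show "rel r (h \<cdot> x) (h \<cdot> y)"
        using r(2)[OF Comp_in_hom[OF xy(1) h(1)] Comp_in_hom[OF xy(2) h(1)]] h(2)
          Comp_assoc[OF xy(1) h(1) eh] Comp_assoc[OF xy(2) h(1) eh] by simp
    qed
    show ?thesis
    proof (rule ex1I[of _ "hx (W, w) (E, r) h"])
      show "hx (W, w) (E, r) h \<in> hom Hx U (E, r) \<and> hx (E, r) (X, p) e \<cdot>\<^bsub>Hx\<^esub> hx (W, w) (E, r) h = \<alpha>"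
        using hx_hom[OF w r(1) hm] Hex_Comp[OF w r(1) p hm em] h(2) by (simp add: U a(2))
      fix \<eta> assume \<eta>: "\<eta> \<in> hom Hx U (E, r) \<and> hx (E, r) (X, p) e \<cdot>\<^bsub>Hx\<^esub> \<eta> = \<alpha>"
      then obtain k where k: "k \<in> hex_map C (W, w) (E, r)" "\<eta> = hx (W, w) (E, r) k"
        unfolding U by (auto elim: Hex_homE)
      have "rel p (e \<cdot> k) a"
        using \<eta> Hex_Comp[OF w r(1) p k(1) em] hx_eq_iff[OF w p hex_map_Comp[OF w r(1) p k(1) em] a(1)]
        by (simp add: k(2) a(2))
      then have "rel r k h" using r(2)[OF hex_map_hom[OF k(1)] h(1)] h(2) by simp
      then show "\<eta> = hx (W, w) (E, r) h" using hx_eq_iff[OF w r(1) k(1) hm] k(2) by simp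
    qed
  qed
  show ?thesis unfolding AB using hx_hom[OF r(1) p em] comm univ by blast
qed

text \<open>The image of \<open>f : (X, p) \<rightarrow> (Y, q)\<close> is \<open>X\<close> with the relation pulled back from \<open>q\<close>.\<close>

lemma Hex_image_mono:
  assumes q: "her Y q" and k: "her X k" "\<And>U a b. \<lbrakk>a \<in> hom C U X; b \<in> hom C U X\<rbrakk> \<Longrightarrow> rel k a b \<longleftrightarrow> rel q (f \<cdot> a) (f \<cdot> b)"
    and f: "f \<in> hom C X Y"
  shows "f \<in> hex_map C (X, k) (Y, q)" "is_mono Hx (hx (X, k) (Y, q) f)"
proof -
  show m: "f \<in> hex_map C (X, k) (Y, q)" using hex_mapI[OF k(1) q f] k(2) by blast
  have "\<alpha> = \<beta>" if \<alpha>: "\<alpha> \<in> hom Hx U (X, k)" and \<beta>: "\<beta> \<in> hom Hx U (X, k)"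
      and eq: "hx (X, k) (Y, q) f \<cdot>\<^bsub>Hx\<^esub> \<alpha> = hx (X, k) (Y, q) f \<cdot>\<^bsub>Hx\<^esub> \<beta>" for U \<alpha> \<beta>
  proof -
    obtain W w where U: "U = (W, w)" by (cases U)
    obtain a where a: "a \<in> hex_map C (W, w) (X, k)" "\<alpha> = hx (W, w) (X, k) a" and w: "her W w"
      using \<alpha> unfolding U by (rule Hex_homE)
    obtain b where b: "b \<in> hex_map C (W, w) (X, k)" "\<beta> = hx (W, w) (X, k) b"
      using \<beta> unfolding U by (rule Hex_homE)
    have "rel q (f \<cdot> a) (f \<cdot> b)"
      using eq hx_eq_iff[OF w q hex_map_Comp[OF w k(1) q a(1) m] hex_map_Comp[OF w k(1) q b(1) m]]
      unfolding a(2) b(2) Hex_Comp[OF w k(1) q a(1) m] Hex_Comp[OF w k(1) q b(1) m] by simp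
    then have "rel k a b" using k(2)[OF hex_map_hom[OF a(1)] hex_map_hom[OF b(1)]] by simp
    then show ?thesis using hx_eq_iff[OF w k(1) a(1) b(1)] a(2) b(2) by simp
  qed
  moreover have "hx (X, k) (Y, q) f \<in> Arr Hx" using hx_hom[OF k(1) q m] by (simp add: hom_iff)
  ultimately show "is_mono Hx (hx (X, k) (Y, q) f)" unfolding is_mono_def Hex_simps by blast
qed

text \<open>Hypothesis \<open>gen\<close> says that \<open>(u, v)\<close> is weakly universal, up to \<open>p\<close>, among the pairs that \<open>f\<close>
  identifies. Thus an arrow that identifies \<open>u\<close> and \<open>v\<close> preserves the relation \<open>k\<close> on \<open>X\<close>.\<close>

lemma Hex_image_coequalizer:
  assumes p: "her X p" and q: "her Y q" and f: "f \<in> hex_map C (X, p) (Y, q)"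
    and k: "her X k" "\<And>U a b. \<lbrakk>a \<in> hom C U X; b \<in> hom C U X\<rbrakk> \<Longrightarrow> rel k a b \<longleftrightarrow> rel q (f \<cdot> a) (f \<cdot> b)"
    and z: "her Z z" and u: "u \<in> hex_map C (Z, z) (X, p)" and v: "v \<in> hex_map C (Z, z) (X, p)"
    and uv: "rel q (f \<cdot> u) (f \<cdot> v)"
    and gen: "\<And>U a b. \<lbrakk>a \<in> hom C U X; b \<in> hom C U X; rel q (f \<cdot> a) (f \<cdot> b)\<rbrakk>
      \<Longrightarrow> \<exists>c \<in> hom C U Z. rel p (u \<cdot> c) a \<and> rel p (v \<cdot> c) b"
  shows "Ide C X \<in> hex_map C (X, p) (X, k)"
    "is_coequalizer Hx (hx (Z, z) (X, p) u) (hx (Z, z) (X, p) v) (hx (X, p) (X, k) (Ide C X))"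
proof -
  have I: "Ide C X \<in> hom C X X" using herD(1)[OF p] by (rule Ide_in_hom)
  note uh = hex_map_hom[OF u] and vh = hex_map_hom[OF v]
  show Im: "Ide C X \<in> hex_map C (X, p) (X, k)"
    using hex_mapI[OF p k(1) I] k(2) hex_map_rel[OF p q f] Comp_Ide_left by simp
  let ?e = "hx (X, p) (X, k) (Ide C X)"
  have "rel k u v" using uv k(2)[OF uh vh] by simp
  then have "rel k (Ide C X \<cdot> u) (Ide C X \<cdot> v)" using Comp_Ide_left[OF uh] Comp_Ide_left[OF vh] by simp
  then have comm: "?e \<cdot>\<^bsub>Hx\<^esub> hx (Z, z) (X, p) u = ?e \<cdot>\<^bsub>Hx\<^esub> hx (Z, z) (X, p) v"
    unfolding Hex_Comp[OF z p k(1) u Im] Hex_Comp[OF z p k(1) v Im]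
    using hx_eq_iff[OF z k(1) hex_map_Comp[OF z p k(1) u Im] hex_map_Comp[OF z p k(1) v Im]] by simp
  have univ: "\<exists>!\<eta>. \<eta> \<in> hom Hx (X, k) T \<and> \<eta> \<cdot>\<^bsub>Hx\<^esub> ?e = \<gamma>"
    if \<gamma>: "\<gamma> \<in> hom Hx (X, p) T" and eq: "\<gamma> \<cdot>\<^bsub>Hx\<^esub> hx (Z, z) (X, p) u = \<gamma> \<cdot>\<^bsub>Hx\<^esub> hx (Z, z) (X, p) v" for \<gamma> T
  proof -
    obtain S s where T: "T = (S, s)" by (cases T)
    obtain g where g: "g \<in> hex_map C (X, p) (S, s)" "\<gamma> = hx (X, p) (S, s) g" and s: "her S s"
      using \<gamma> unfolding T by (rule Hex_homE)
    note gh = hex_map_hom[OF g(1)]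
    have guv: "rel s (g \<cdot> u) (g \<cdot> v)"
      using eq hx_eq_iff[OF z s hex_map_Comp[OF z p s u g(1)] hex_map_Comp[OF z p s v g(1)]]
      unfolding g(2) Hex_Comp[OF z p s u g(1)] Hex_Comp[OF z p s v g(1)] by simp
    have gm: "g \<in> hex_map C (X, k) (S, s)"
    proof (rule hex_mapI[OF k(1) s gh])
      fix U a b assume ab: "a \<in> hom C U X" "b \<in> hom C U X" "rel k a b"
      then have "rel q (f \<cdot> a) (f \<cdot> b)" using k(2) by blast
      then obtain c where c: "c \<in> hom C U Z" "rel p (u \<cdot> c) a" "rel p (v \<cdot> c) b"
        using gen[OF ab(1,2)] by blast
      note uc = Comp_in_hom[OF c(1) uh] and vc = Comp_in_hom[OF c(1) vh]
      note S = herD[OF s]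
      have 1: "rel s (g \<cdot> (u \<cdot> c)) (g \<cdot> a)" by (rule hex_map_rel[OF p s g(1) c(2) uc ab(1)])
      have 2: "rel s (g \<cdot> (v \<cdot> c)) (g \<cdot> b)" by (rule hex_map_rel[OF p s g(1) c(3) vc ab(2)])
      have 3: "rel s (g \<cdot> (u \<cdot> c)) (g \<cdot> (v \<cdot> c))"
        using rel_Comp[OF S(3) Comp_in_hom[OF uh gh] Comp_in_hom[OF vh gh] guv c(1)]
          Comp_assoc[OF c(1) uh gh] Comp_assoc[OF c(1) vh gh] by simp
      note h = Comp_in_hom[OF ab(1) gh] Comp_in_hom[OF ab(2) gh] Comp_in_hom[OF uc gh] Comp_in_hom[OF vc gh]
      show "rel s (g \<cdot> a) (g \<cdot> b)"
        using S(6)[OF S(5)[OF 1 h(3,1)] S(6)[OF 3 2 h(3,4,2)] h(1,3,2)] .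
    qed
    show ?thesis
    proof (rule ex1I[of _ "hx (X, k) (S, s) g"])
      show "hx (X, k) (S, s) g \<in> hom Hx (X, k) T \<and> hx (X, k) (S, s) g \<cdot>\<^bsub>Hx\<^esub> ?e = \<gamma>"
        using hx_hom[OF k(1) s gm] Hex_Comp[OF p k(1) s Im gm] Comp_Ide_right[OF gh] by (simp add: T g(2))
      fix \<eta> assume \<eta>: "\<eta> \<in> hom Hx (X, k) T \<and> \<eta> \<cdot>\<^bsub>Hx\<^esub> ?e = \<gamma>"
      then obtain h where h: "h \<in> hex_map C (X, k) (S, s)" "\<eta> = hx (X, k) (S, s) h"
        unfolding T by (auto elim: Hex_homE)
      have "rel s (h \<cdot> Ide C X) g"
        using \<eta> Hex_Comp[OF p k(1) s Im h(1)] hx_eq_iff[OF p s hex_map_Comp[OF p k(1) s Im h(1)] g(1)]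
        by (simp add: h(2) g(2))
      then show "\<eta> = hx (X, k) (S, s) g"
        using hx_eq_iff[OF k(1) s h(1) gm] h(2) Comp_Ide_right[OF hex_map_hom[OF h(1)]] by simp
    qed
  qed
  show "is_coequalizer Hx (hx (Z, z) (X, p) u) (hx (Z, z) (X, p) v) ?e"
    unfolding is_coequalizer_def Hex_simps
    using hx_hom[OF z p u] hx_hom[OF z p v] hx_hom[OF p k(1) Im, unfolded hom_iff] comm univ by blast
qed

end

text \<open>Path objects make \<open>(U, P U)\<close> the free object on \<open>U\<close>: every \<open>a : U \<rightarrow> X\<close> is a map \<open>(U, P U) \<rightarrow> (X, p)\<close>.
  Generalized elements in \<open>C\<close> therefore are elements in the homotopy exact completion, and facts
  about limits there apply to them.\<close>

locale chosen_path_objects = path_category_notation C Fib Weq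
  for C :: "('o, 'a) cat" (structure) and Fib Weq :: "'a set" +
  fixes P :: "'o \<Rightarrow> 'a"
  assumes path_object: "X \<in> Obj C \<Longrightarrow> \<exists>r. is_path_object C Fib Weq X r (P X)"
begin

lemma her_P: "X \<in> Obj C \<Longrightarrow> her X (P X)"
  using path_object path_object_her by blast

lemma hex_map_P:
  assumes p: "her X p"
  shows "hex_map C (U, P U) (X, p) = hom C U X"
proof
  show "hex_map C (U, P U) (X, p) \<subseteq> hom C U X" using hex_map_hom by blast
  show "hom C U X \<subseteq> hex_map C (U, P U) (X, p)"
  proof
    fix a assume a: "a \<in> hom C U X"
    have U: "U \<in> Obj C" using hom_Obj[OF a] by simp
    then obtain r where "is_path_object C Fib Weq U r (P U)" using path_object by blast
    from path_object_rel_image[OF this p a] show "a \<in> hex_map C (U, P U) (X, p)"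
      by (intro hex_mapI[OF her_P[OF U] p a])
  qed
qed

lemma Hex_terminal: "\<exists>T. is_terminal Hx T"
proof -
  obtain T where T: "is_terminal C T" using terminal_exists by blast
  then have TO: "T \<in> Obj C" by (simp add: is_terminal_def)
  note PT = her_P[OF TO]
  have eq: "f = g" if "f \<in> hom C X T" "g \<in> hom C X T" for f g X
    using T that hom_Obj[OF that(1)] unfolding is_terminal_def by blast
  have "\<exists>!\<phi>. \<phi> \<in> hom Hx A (T, P T)" if "A \<in> Obj Hx" for A
  proof -
    obtain X p where A: "A = (X, p)" by (cases A)
    have p: "her X p" using that A by simp
    obtain f where f: "f \<in> hom C X T" using T herD(1)[OF p] unfolding is_terminal_def by blast
    have fm: "f \<in> hex_map C (X, p) (T, P T)"
    proof (rule hex_mapI[OF p PT f])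
      fix U a b assume ab: "a \<in> hom C U X" "b \<in> hom C U X"
      show "rel (P T) (f \<cdot> a) (f \<cdot> b)"
        using eq[OF Comp_in_hom[OF ab(1) f] Comp_in_hom[OF ab(2) f]] herD(4)[OF PT Comp_in_hom[OF ab(1) f]] by simp
    qed
    show ?thesis
    proof (rule ex1I[of _ "hx (X, p) (T, P T) f"])
      show "hx (X, p) (T, P T) f \<in> hom Hx A (T, P T)" unfolding A by (rule hx_hom[OF p PT fm])
      fix \<phi> assume "\<phi> \<in> hom Hx A (T, P T)"
      then obtain g where "g \<in> hex_map C (X, p) (T, P T)" "\<phi> = hx (X, p) (T, P T) g"
        unfolding A by (rule Hex_homE)
      then show "\<phi> = hx (X, p) (T, P T) f" using eq[OF hex_map_hom f] by simp
    qed
  qed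
  then show ?thesis using PT unfolding is_terminal_def by auto
qed

lemma finitely_complete_Hex: "finitely_complete Hx"
  by (rule Hex.finitely_completeI[OF Hex_terminal Hex_product Hex_equalizer])

text \<open>Generalized elements are arrows out of \<open>(U, P U)\<close>, so the universal property of the pullback
  applies to them.\<close>

lemma Hex_pullback_element:
  assumes pb: "is_pullback Hx (hx (X, p) (Z, r) f) (hx (Y, q) (Z, r) g) (hx (W, w) (X, p) u) (hx (W, w) (Y, q) v)"
    and her: "her X p" "her Y q" "her Z r" "her W w"
    and maps: "f \<in> hex_map C (X, p) (Z, r)" "g \<in> hex_map C (Y, q) (Z, r)"
      "u \<in> hex_map C (W, w) (X, p)" "v \<in> hex_map C (W, w) (Y, q)"
    and ab: "a \<in> hom C U X" "b \<in> hom C U Y" "rel r (f \<cdot> a) (g \<cdot> b)"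
  shows "\<exists>c \<in> hom C U W. rel p (u \<cdot> c) a \<and> rel q (v \<cdot> c) b"
proof -
  have U: "U \<in> Obj C" using hom_Obj[OF ab(1)] by simp
  note PU = her_P[OF U]
  have am: "a \<in> hex_map C (U, P U) (X, p)" and bm: "b \<in> hex_map C (U, P U) (Y, q)"
    using ab hex_map_P her by simp_all
  have eq: "hx (X, p) (Z, r) f \<cdot>\<^bsub>Hx\<^esub> hx (U, P U) (X, p) a = hx (Y, q) (Z, r) g \<cdot>\<^bsub>Hx\<^esub> hx (U, P U) (Y, q) b"
    unfolding Hex_Comp[OF PU her(1,3) am maps(1)] Hex_Comp[OF PU her(2,3) bm maps(2)]
    using hx_eq_iff[OF PU her(3) hex_map_Comp[OF PU her(1,3) am maps(1)] hex_map_Comp[OF PU her(2,3) bm maps(2)]]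
      ab(3) by simp
  obtain \<eta> where \<eta>: "\<eta> \<in> hom Hx (U, P U) (W, w)" "hx (W, w) (X, p) u \<cdot>\<^bsub>Hx\<^esub> \<eta> = hx (U, P U) (X, p) a"
    "hx (W, w) (Y, q) v \<cdot>\<^bsub>Hx\<^esub> \<eta> = hx (U, P U) (Y, q) b"
    using Hex.pullback_lift[OF pb, unfolded Hex_simps, OF hx_hom[OF PU her(1) am] hx_hom[OF PU her(2) bm] eq] .
  obtain c where c: "c \<in> hex_map C (U, P U) (W, w)" "\<eta> = hx (U, P U) (W, w) c" using \<eta>(1) by (rule Hex_homE)
  have "rel p (u \<cdot> c) a" "rel q (v \<cdot> c) b"
    using \<eta>(2,3) hx_eq_iff[OF PU her(1) hex_map_Comp[OF PU her(4,1) c(1) maps(3)] am]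
      hx_eq_iff[OF PU her(2) hex_map_Comp[OF PU her(4,2) c(1) maps(4)] bm]
    unfolding c(2) Hex_Comp[OF PU her(4,1) c(1) maps(3)] Hex_Comp[OF PU her(4,2) c(1) maps(4)] by simp_all
  then show ?thesis using hex_map_hom[OF c(1)] by blast
qed

lemma Hex_kernel_pair_coequalizer:
  assumes pb: "is_pullback Hx (hx (X, p) (Y, q) f) (hx (X, p) (Y, q) f) \<phi> \<psi>"
    and p: "her X p" and q: "her Y q" and f: "f \<in> hex_map C (X, p) (Y, q)"
    and k: "her X k" "\<And>U a b. \<lbrakk>a \<in> hom C U X; b \<in> hom C U X\<rbrakk> \<Longrightarrow> rel k a b \<longleftrightarrow> rel q (f \<cdot> a) (f \<cdot> b)"
  shows "is_coequalizer Hx \<phi> \<psi> (hx (X, p) (X, k) (Ide C X))"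
proof -
  note D = Hex.is_pullbackD[OF pb]
  obtain Z z where Z: "Dom Hx \<phi> = (Z, z)" by (cases "Dom Hx \<phi>")
  have "\<phi> \<in> hom Hx (Z, z) (X, p)" "\<psi> \<in> hom Hx (Z, z) (X, p)" using D Z by (simp_all add: hom_iff)
  then obtain u v where u: "u \<in> hex_map C (Z, z) (X, p)" "\<phi> = hx (Z, z) (X, p) u" and z: "her Z z"
    and v: "v \<in> hex_map C (Z, z) (X, p)" "\<psi> = hx (Z, z) (X, p) v"
    by (metis Hex_homE)
  have "rel q (f \<cdot> u) (f \<cdot> v)"
    using D(9) hx_eq_iff[OF z q hex_map_Comp[OF z p q u(1) f] hex_map_Comp[OF z p q v(1) f]]
    unfolding u(2) v(2) Hex_Comp[OF z p q u(1) f] Hex_Comp[OF z p q v(1) f] by simp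
  then show ?thesis
    unfolding u(2) v(2)
    using Hex_pullback_element[OF pb[unfolded u(2) v(2)] p p q z f f u(1) v(1)]
    by (intro Hex_image_coequalizer(2)[OF p q f k z u(1) v(1)])
qed

text \<open>Factor \<open>f\<close> as the coequalizer \<open>(X, p) \<rightarrow> (X, k)\<close> of its kernel pair and the monomorphism \<open>(X, k) \<rightarrow> (Y, q)\<close>,
  where \<open>k\<close> is the relation pulled back along \<open>f\<close>. Then \<open>f\<close> is a regular epimorphism iff the latter is
  invertible. An inverse is the same as a section \<open>s\<close> up to \<open>q\<close>: by the choice of \<open>k\<close>, any such \<open>s\<close>
  sends \<open>q\<close>-related elements to \<open>k\<close>-related ones, although it may fail to respect \<open>p\<close>.\<close>

lemma Hex_cover_iff:
  assumes p: "her X p" and q: "her Y q" and f: "f \<in> hex_map C (X, p) (Y, q)"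
  shows "is_cover Hx (hx (X, p) (Y, q) f) (X, p) (Y, q) \<longleftrightarrow> (\<exists>s \<in> hom C Y X. rel q (f \<cdot> s) (Ide C Y))"
proof -
  note fh = hex_map_hom[OF f]
  obtain k where k: "her X k" "\<And>U a b. \<lbrakk>a \<in> hom C U X; b \<in> hom C U X\<rbrakk> \<Longrightarrow> rel k a b \<longleftrightarrow> rel q (f \<cdot> a) (f \<cdot> b)"
    using rel_pullback[OF q fh] by metis
  have I: "Ide C X \<in> hom C X X" "Ide C Y \<in> hom C Y Y" using herD(1) p q Ide_in_hom by blast+
  interpret fl: finite_limits Hx by unfold_locales (rule finitely_complete_Hex)
  have F: "hx (X, p) (Y, q) f \<in> Arr Hx" using hx_hom[OF p q f] by (simp add: hom_def)
  obtain \<phi> \<psi> where pb: "is_pullback Hx (hx (X, p) (Y, q) f) (hx (X, p) (Y, q) f) \<phi> \<psi>"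
    using fl.pullback_ex[OF F F refl] .
  let ?e = "hx (X, p) (X, k) (Ide C X)"
  let ?m = "hx (X, k) (Y, q) f"
  have m: "f \<in> hex_map C (X, k) (Y, q)" "is_mono Hx ?m"
    by (rule Hex_image_mono[OF q k(1) k(2) fh]; assumption)+
  have Im: "Ide C X \<in> hex_map C (X, p) (X, k)"
    using hex_mapI[OF p k(1) I(1)] k(2) hex_map_rel[OF p q f] Comp_Ide_left by simp
  have "is_coequalizer Hx \<phi> \<psi> ?e" by (rule Hex_kernel_pair_coequalizer[OF pb p q f k])
  then have e: "is_cover Hx ?e (X, p) (X, k)"
    using hx_hom[OF p k(1) Im] unfolding is_cover_def regular_epi_def by blast
  have me: "?m \<cdot>\<^bsub>Hx\<^esub> ?e = hx (X, p) (Y, q) f"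
    using Hex_Comp[OF p k(1) q Im m(1)] Comp_Ide_right[OF fh] by simp
  note mh = hx_hom[OF k(1) q m(1)]
  show ?thesis
  proof
    assume "is_cover Hx (hx (X, p) (Y, q) f) (X, p) (Y, q)"
    then have "is_iso Hx ?m"
      by (rule Hex.regular_epi_extremal[OF _ m(2) mh hx_hom[OF p k(1) Im] me])
    then obtain \<nu> where \<nu>: "\<nu> \<in> hom Hx (Y, q) (X, k)" "?m \<cdot>\<^bsub>Hx\<^esub> \<nu> = Ide Hx (Y, q)"
      using mh by (rule Hex.is_isoE)
    obtain s where s: "s \<in> hex_map C (Y, q) (X, k)" "\<nu> = hx (Y, q) (X, k) s" using \<nu>(1) by (rule Hex_homE)
    have "rel q (f \<cdot> s) (Ide C Y)"
      using \<nu>(2) hx_eq_iff[OF q q hex_map_Comp[OF q k(1) q s(1) m(1)] hex_map_Ide[OF q]]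
      unfolding s(2) Hex_Comp[OF q k(1) q s(1) m(1)] by simp
    then show "\<exists>s \<in> hom C Y X. rel q (f \<cdot> s) (Ide C Y)" using hex_map_hom[OF s(1)] by blast
  next
    assume "\<exists>s \<in> hom C Y X. rel q (f \<cdot> s) (Ide C Y)"
    then obtain s where s: "s \<in> hom C Y X" "rel q (f \<cdot> s) (Ide C Y)" by blast
    note Q = herD[OF q]
    have fs: "f \<cdot> s \<in> hom C Y Y" using s(1) fh by (rule Comp_in_hom)
    have fsa: "rel q (f \<cdot> (s \<cdot> a)) a" if a: "a \<in> hom C U Y" for a U
      using rel_Comp[OF Q(3) fs I(2) s(2) a] Comp_assoc[OF a s(1) fh] Comp_Ide_left[OF a] by simp
    have sm: "s \<in> hex_map C (Y, q) (X, k)"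
    proof (rule hex_mapI[OF q k(1) s(1)])
      fix U a b assume ab: "a \<in> hom C U Y" "b \<in> hom C U Y" "rel q a b"
      note sa = Comp_in_hom[OF ab(1) s(1)] and sb = Comp_in_hom[OF ab(2) s(1)]
      note h = Comp_in_hom[OF sa fh] Comp_in_hom[OF sb fh]
      have "rel q (f \<cdot> (s \<cdot> a)) (f \<cdot> (s \<cdot> b))"
        using Q(6)[OF fsa[OF ab(1)] Q(6)[OF ab(3) Q(5)[OF fsa[OF ab(2)] h(2) ab(2)] ab(1,2) h(2)] h(1) ab(1) h(2)] .
      then show "rel k (s \<cdot> a) (s \<cdot> b)" using k(2)[OF sa sb] by simp
    qed
    have "?m \<cdot>\<^bsub>Hx\<^esub> hx (Y, q) (X, k) s = Ide Hx (Y, q)"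
      unfolding Hex_Comp[OF q k(1) q sm m(1)]
      using hx_eq_iff[OF q q hex_map_Comp[OF q k(1) q sm m(1)] hex_map_Ide[OF q]] s(2) by simp
    moreover have "hx (Y, q) (X, k) s \<cdot>\<^bsub>Hx\<^esub> ?m = Ide Hx (X, k)"
    proof -
      have "rel k (s \<cdot> f) (Ide C X)"
        using k(2)[OF Comp_in_hom[OF fh s(1)] I(1)] fsa[OF fh] Comp_Ide_right[OF fh] by simp
      then show ?thesis
        unfolding Hex_Comp[OF k(1) q k(1) m(1) sm]
        using hx_eq_iff[OF k(1) k(1) hex_map_Comp[OF k(1) q k(1) m(1) sm] hex_map_Ide[OF k(1)]] by simp
    qed
    ultimately have "is_iso Hx ?m" using Hex.is_isoI[OF mh hx_hom[OF q k(1) sm]] by blast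
    then show "is_cover Hx (hx (X, p) (Y, q) f) (X, p) (Y, q)"
      using Hex.is_cover_iso_comp[OF e _ mh] me by simp
  qed
qed

lemma regular_Hex: "regular_category Hx"
  unfolding regular_category_def
proof (intro conjI allI impI finitely_complete_Hex)
  fix \<chi> \<phi> \<psi> assume pb: "is_kernel_pair Hx \<chi> \<phi> \<psi>"
  then have "\<chi> \<in> Arr Hx" by (simp add: is_kernel_pair_def is_pullback_def)
  then obtain X p Y q f where f: "\<chi> = hx (X, p) (Y, q) f" "her X p" "her Y q" "f \<in> hex_map C (X, p) (Y, q)"
    by (auto simp: Hex_Arr)
  obtain k where k: "her X k" "\<And>U a b. \<lbrakk>a \<in> hom C U X; b \<in> hom C U X\<rbrakk> \<Longrightarrow> rel k a b \<longleftrightarrow> rel q (f \<cdot> a) (f \<cdot> b)"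
    using rel_pullback[OF f(3) hex_map_hom[OF f(4)]] by metis
  then show "\<exists>\<epsilon>. is_coequalizer Hx \<phi> \<psi> \<epsilon>"
    using Hex_kernel_pair_coequalizer[OF pb[unfolded is_kernel_pair_def f(1)] f(2-4)] by blast
next
  fix \<alpha> \<beta> \<phi> \<psi> assume pb: "is_pullback Hx \<alpha> \<beta> \<phi> \<psi>" and re: "regular_epi Hx \<alpha>"
  note D = Hex.is_pullbackD[OF pb]
  obtain X p Z r f where f: "\<alpha> = hx (X, p) (Z, r) f" "her X p" "her Z r" "f \<in> hex_map C (X, p) (Z, r)"
    using D(1) by (auto simp: Hex_Arr)
  have "Cod Hx \<beta> = (Z, r)" using D(3) f(1) by simp
  then obtain Y q g where g: "\<beta> = hx (Y, q) (Z, r) g" "her Y q" "g \<in> hex_map C (Y, q) (Z, r)"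
    using D(2) by (auto simp: Hex_Arr)
  obtain W w where W: "Dom Hx \<phi> = (W, w)" by (cases "Dom Hx \<phi>")
  have "\<phi> \<in> hom Hx (W, w) (X, p)" "\<psi> \<in> hom Hx (W, w) (Y, q)"
    using D(4-8) W f(1) g(1) by (simp_all add: hom_iff)
  then obtain u v where u: "u \<in> hex_map C (W, w) (X, p)" "\<phi> = hx (W, w) (X, p) u" and w: "her W w"
    and v: "v \<in> hex_map C (W, w) (Y, q)" "\<psi> = hx (W, w) (Y, q) v"
    by (metis Hex_homE)
  note R = herD[OF f(3)]
  have "is_cover Hx (hx (X, p) (Z, r) f) (X, p) (Z, r)"
    using re hx_hom[OF f(2-4)] f(1) by (simp add: is_cover_def)
  then obtain s where s: "s \<in> hom C Z X" "rel r (f \<cdot> s) (Ide C Z)" using Hex_cover_iff[OF f(2-4)] by blast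
  note fh = hex_map_hom[OF f(4)] and gh = hex_map_hom[OF g(3)]
  have I: "Ide C Z \<in> hom C Z Z" "Ide C Y \<in> hom C Y Y" using R(1) herD(1)[OF g(2)] Ide_in_hom by blast+
  \<comment> \<open>\<open>s g\<close> and the identity form an element of the pullback, a section of \<open>v\<close> up to \<open>q\<close>\<close>
  have sg: "s \<cdot> g \<in> hom C Y X" using gh s(1) by (rule Comp_in_hom)
  have "rel r (f \<cdot> (s \<cdot> g)) (g \<cdot> Ide C Y)"
    using rel_Comp[OF R(3) Comp_in_hom[OF s(1) fh] I(1) s(2) gh] Comp_assoc[OF gh s(1) fh]
      Comp_Ide_left[OF gh] Comp_Ide_right[OF gh] by simp
  then obtain c where "c \<in> hom C Y W" "rel q (v \<cdot> c) (Ide C Y)"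
    using Hex_pullback_element[OF pb[unfolded f(1) g(1) u(2) v(2)] f(2) g(2) f(3) w f(4) g(3) u(1) v(1) sg I(2)] by blast
  then show "regular_epi Hx \<psi>"
    using Hex_cover_iff[OF w g(2) v(1)] v(2) by (auto simp: is_cover_def)
qed

text \<open>An internal equivalence relation \<open>R\<close> on \<open>(X, p)\<close> is the kernel pair of the quotient of \<open>X\<close> by the
  relation "there is an element of \<open>R\<close> between elements related to \<open>a\<close> and to \<open>b\<close>". The
  projection that quantifies over \<open>R\<close> is a fibration because every object is fibrant.\<close>

lemma exact_Hex: "exact_category Hx"
  unfolding exact_category_def
proof (intro conjI allI impI regular_Hex)
  fix A \<phi> \<psi> assume er: "is_equivalence_relation Hx A \<phi> \<psi>"
  have hom0: "\<phi> \<in> hom Hx (Dom Hx \<phi>) A" "\<psi> \<in> hom Hx (Dom Hx \<phi>) A"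
    and monic0: "\<And>U \<alpha> \<beta>. \<lbrakk>\<alpha> \<in> hom Hx U (Dom Hx \<phi>); \<beta> \<in> hom Hx U (Dom Hx \<phi>); \<phi> \<cdot>\<^bsub>Hx\<^esub> \<alpha> = \<phi> \<cdot>\<^bsub>Hx\<^esub> \<beta>; \<psi> \<cdot>\<^bsub>Hx\<^esub> \<alpha> = \<psi> \<cdot>\<^bsub>Hx\<^esub> \<beta>\<rbrakk> \<Longrightarrow> \<alpha> = \<beta>"
    and refl0: "\<exists>\<rho> \<in> hom Hx A (Dom Hx \<phi>). \<phi> \<cdot>\<^bsub>Hx\<^esub> \<rho> = Ide Hx A \<and> \<psi> \<cdot>\<^bsub>Hx\<^esub> \<rho> = Ide Hx A"
    and sym0: "\<exists>\<sigma> \<in> hom Hx (Dom Hx \<phi>) (Dom Hx \<phi>). \<phi> \<cdot>\<^bsub>Hx\<^esub> \<sigma> = \<psi> \<and> \<psi> \<cdot>\<^bsub>Hx\<^esub> \<sigma> = \<phi>"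
    and trans0: "\<exists>\<kappa>1 \<kappa>2. is_pullback Hx \<psi> \<phi> \<kappa>1 \<kappa>2 \<and> (\<exists>\<tau> \<in> hom Hx (Dom Hx \<kappa>1) (Dom Hx \<phi>).
      \<phi> \<cdot>\<^bsub>Hx\<^esub> \<tau> = \<phi> \<cdot>\<^bsub>Hx\<^esub> \<kappa>1 \<and> \<psi> \<cdot>\<^bsub>Hx\<^esub> \<tau> = \<psi> \<cdot>\<^bsub>Hx\<^esub> \<kappa>2)"
    using er unfolding is_equivalence_relation_def Let_def by blast+
  obtain X p R t where A: "A = (X, p)" and R: "Dom Hx \<phi> = (R, t)" by (cases A, cases "Dom Hx \<phi>")
  obtain r1 where r1: "r1 \<in> hex_map C (R, t) (X, p)" "\<phi> = hx (R, t) (X, p) r1" and t: "her R t" and p: "her X p"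
    using hom0(1) unfolding R A by (rule Hex_homE)
  obtain r2 where r2: "r2 \<in> hex_map C (R, t) (X, p)" "\<psi> = hx (R, t) (X, p) r2"
    using hom0(2) unfolding R A by (rule Hex_homE)
  note h1 = hex_map_hom[OF r1(1)] and h2 = hex_map_hom[OF r2(1)]
  note P' = herD[OF p]
  have X: "X \<in> Obj C" and RO: "R \<in> Obj C" using herD(1) p t by blast+
  have I: "Ide C X \<in> hom C X X" by (rule Ide_in_hom[OF X])
  have comp_rel: "rel p (r \<cdot> f) (r' \<cdot> g)"
    if "hx (R, t) (X, p) r \<cdot>\<^bsub>Hx\<^esub> hx (S, s) (R, t) f = hx (R, t) (X, p) r' \<cdot>\<^bsub>Hx\<^esub> hx (S, s) (R, t) g"
      "her S s" "r \<in> hex_map C (R, t) (X, p)" "r' \<in> hex_map C (R, t) (X, p)"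
      "f \<in> hex_map C (S, s) (R, t)" "g \<in> hex_map C (S, s) (R, t)" for S s r r' f g
    using that(1) hx_eq_iff[OF that(2) p hex_map_Comp[OF that(2) t p that(5,3)] hex_map_Comp[OF that(2) t p that(6,4)]]
    unfolding Hex_Comp[OF that(2) t p that(5,3)] Hex_Comp[OF that(2) t p that(6,4)] by simp
  \<comment> \<open>\<open>r1\<close> and \<open>r2\<close> are jointly monic on generalized elements, these being arrows out of \<open>(U, P U)\<close>\<close>
  have monic: "rel t a b" if ab: "a \<in> hom C U R" "b \<in> hom C U R" "rel p (r1 \<cdot> a) (r1 \<cdot> b)" "rel p (r2 \<cdot> a) (r2 \<cdot> b)"
    for U a b
  proof -
    note PU = her_P[OF hom_Obj(1)[OF ab(1)]]
    have m: "a \<in> hex_map C (U, P U) (R, t)" "b \<in> hex_map C (U, P U) (R, t)" using ab hex_map_P[OF t] by simp_all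
    have "hx (U, P U) (R, t) a = hx (U, P U) (R, t) b"
    proof (rule monic0)
      show "hx (U, P U) (R, t) a \<in> hom Hx (U, P U) (Dom Hx \<phi>)" "hx (U, P U) (R, t) b \<in> hom Hx (U, P U) (Dom Hx \<phi>)"
        unfolding R using hx_hom[OF PU t] m by blast+
      show "\<phi> \<cdot>\<^bsub>Hx\<^esub> hx (U, P U) (R, t) a = \<phi> \<cdot>\<^bsub>Hx\<^esub> hx (U, P U) (R, t) b"
        unfolding r1(2) Hex_Comp[OF PU t p m(1) r1(1)] Hex_Comp[OF PU t p m(2) r1(1)]
        using hx_eq_iff[OF PU p hex_map_Comp[OF PU t p m(1) r1(1)] hex_map_Comp[OF PU t p m(2) r1(1)]] ab(3) by simp
      show "\<psi> \<cdot>\<^bsub>Hx\<^esub> hx (U, P U) (R, t) a = \<psi> \<cdot>\<^bsub>Hx\<^esub> hx (U, P U) (R, t) b"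
        unfolding r2(2) Hex_Comp[OF PU t p m(1) r2(1)] Hex_Comp[OF PU t p m(2) r2(1)]
        using hx_eq_iff[OF PU p hex_map_Comp[OF PU t p m(1) r2(1)] hex_map_Comp[OF PU t p m(2) r2(1)]] ab(4) by simp
    qed
    then show ?thesis using hx_eq_iff[OF PU t m] by simp
  qed
  obtain \<rho> where \<rho>: "\<rho> \<in> hom C X R" "rel p (r1 \<cdot> \<rho>) (Ide C X)" "rel p (r2 \<cdot> \<rho>) (Ide C X)"
  proof -
    obtain \<rho>' where \<rho>': "\<rho>' \<in> hom Hx (X, p) (R, t)" "\<phi> \<cdot>\<^bsub>Hx\<^esub> \<rho>' = Ide Hx A" "\<psi> \<cdot>\<^bsub>Hx\<^esub> \<rho>' = Ide Hx A"
      using refl0 unfolding R A by blast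
    obtain \<rho> where m: "\<rho> \<in> hex_map C (X, p) (R, t)" "\<rho>' = hx (X, p) (R, t) \<rho>" using \<rho>'(1) by (rule Hex_homE)
    have "rel p (r1 \<cdot> \<rho>) (Ide C X)" "rel p (r2 \<cdot> \<rho>) (Ide C X)"
      using \<rho>'(2,3) hx_eq_iff[OF p p hex_map_Comp[OF p t p m(1) r1(1)] hex_map_Ide[OF p]]
        hx_eq_iff[OF p p hex_map_Comp[OF p t p m(1) r2(1)] hex_map_Ide[OF p]]
      unfolding r1(2) r2(2) m(2) Hex_Comp[OF p t p m(1) r1(1)] Hex_Comp[OF p t p m(1) r2(1)] A by simp_all
    then show ?thesis using that hex_map_hom[OF m(1)] by blast
  qed
  obtain \<sigma> where \<sigma>: "\<sigma> \<in> hom C R R" "rel p (r1 \<cdot> \<sigma>) r2" "rel p (r2 \<cdot> \<sigma>) r1"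
  proof -
    obtain \<sigma>' where \<sigma>': "\<sigma>' \<in> hom Hx (R, t) (R, t)" "\<phi> \<cdot>\<^bsub>Hx\<^esub> \<sigma>' = \<psi>" "\<psi> \<cdot>\<^bsub>Hx\<^esub> \<sigma>' = \<phi>"
      using sym0 unfolding R by blast
    obtain \<sigma> where m: "\<sigma> \<in> hex_map C (R, t) (R, t)" "\<sigma>' = hx (R, t) (R, t) \<sigma>" using \<sigma>'(1) by (rule Hex_homE)
    have "rel p (r1 \<cdot> \<sigma>) r2" "rel p (r2 \<cdot> \<sigma>) r1"
      using \<sigma>'(2,3) hx_eq_iff[OF t p hex_map_Comp[OF t t p m(1) r1(1)] r2(1)]
        hx_eq_iff[OF t p hex_map_Comp[OF t t p m(1) r2(1)] r1(1)]
      unfolding r1(2) r2(2) m(2) Hex_Comp[OF t t p m(1) r1(1)] Hex_Comp[OF t t p m(1) r2(1)] by simp_all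
    then show ?thesis using that hex_map_hom[OF m(1)] by blast
  qed
  have trans: "\<exists>c \<in> hom C U R. rel p (r1 \<cdot> c) (r1 \<cdot> a) \<and> rel p (r2 \<cdot> c) (r2 \<cdot> b)"
    if ab: "a \<in> hom C U R" "b \<in> hom C U R" "rel p (r2 \<cdot> a) (r1 \<cdot> b)" for U a b
  proof -
    obtain \<kappa>1 \<kappa>2 \<tau>' where pb: "is_pullback Hx \<psi> \<phi> \<kappa>1 \<kappa>2" and \<tau>': "\<tau>' \<in> hom Hx (Dom Hx \<kappa>1) (R, t)"
      "\<phi> \<cdot>\<^bsub>Hx\<^esub> \<tau>' = \<phi> \<cdot>\<^bsub>Hx\<^esub> \<kappa>1" "\<psi> \<cdot>\<^bsub>Hx\<^esub> \<tau>' = \<psi> \<cdot>\<^bsub>Hx\<^esub> \<kappa>2"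
      using trans0 unfolding R by blast
    obtain S s where S: "Dom Hx \<kappa>1 = (S, s)" by (cases "Dom Hx \<kappa>1")
    have "\<kappa>1 \<in> hom Hx (S, s) (R, t)" "\<kappa>2 \<in> hom Hx (S, s) (R, t)"
      using Hex.is_pullbackD[OF pb] S by (simp_all add: hom_iff r1(2) r2(2))
    then obtain k1 k2 where k1: "k1 \<in> hex_map C (S, s) (R, t)" "\<kappa>1 = hx (S, s) (R, t) k1" and s: "her S s"
      and k2: "k2 \<in> hex_map C (S, s) (R, t)" "\<kappa>2 = hx (S, s) (R, t) k2" by (metis Hex_homE)
    obtain \<tau> where m: "\<tau> \<in> hex_map C (S, s) (R, t)" "\<tau>' = hx (S, s) (R, t) \<tau>"
      using \<tau>'(1) unfolding S by (rule Hex_homE)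
    note \<tau>h = hex_map_hom[OF m(1)] and kh1 = hex_map_hom[OF k1(1)] and kh2 = hex_map_hom[OF k2(1)]
    have \<tau>: "rel p (r1 \<cdot> \<tau>) (r1 \<cdot> k1)" "rel p (r2 \<cdot> \<tau>) (r2 \<cdot> k2)"
      using comp_rel[OF \<tau>'(2)[unfolded r1(2) m(2) k1(2)] s r1(1,1) m(1) k1(1)]
        comp_rel[OF \<tau>'(3)[unfolded r2(2) m(2) k2(2)] s r2(1,1) m(1) k2(1)] by blast+
    obtain d where d: "d \<in> hom C U S" "rel t (k1 \<cdot> d) a" "rel t (k2 \<cdot> d) b"
      using Hex_pullback_element[OF pb[unfolded r1(2) r2(2) k1(2) k2(2)] t t p s r2(1) r1(1) k1(1) k2(1) ab] by blast
    note kd1 = Comp_in_hom[OF d(1) kh1] and kd2 = Comp_in_hom[OF d(1) kh2] and \<tau>d = Comp_in_hom[OF d(1) \<tau>h]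
    have "rel p (r1 \<cdot> (\<tau> \<cdot> d)) (r1 \<cdot> (k1 \<cdot> d))"
      using rel_Comp[OF P'(3) Comp_in_hom[OF \<tau>h h1] Comp_in_hom[OF kh1 h1] \<tau>(1) d(1)]
        Comp_assoc[OF d(1) \<tau>h h1] Comp_assoc[OF d(1) kh1 h1] by simp
    moreover have "rel p (r1 \<cdot> (k1 \<cdot> d)) (r1 \<cdot> a)" by (rule hex_map_rel[OF t p r1(1) d(2) kd1 ab(1)])
    ultimately have 1: "rel p (r1 \<cdot> (\<tau> \<cdot> d)) (r1 \<cdot> a)"
      by (rule P'(6)) (rule Comp_in_hom[OF _ h1] \<tau>d kd1 ab(1))+
    have "rel p (r2 \<cdot> (\<tau> \<cdot> d)) (r2 \<cdot> (k2 \<cdot> d))"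
      using rel_Comp[OF P'(3) Comp_in_hom[OF \<tau>h h2] Comp_in_hom[OF kh2 h2] \<tau>(2) d(1)]
        Comp_assoc[OF d(1) \<tau>h h2] Comp_assoc[OF d(1) kh2 h2] by simp
    moreover have "rel p (r2 \<cdot> (k2 \<cdot> d)) (r2 \<cdot> b)" by (rule hex_map_rel[OF t p r2(1) d(3) kd2 ab(2)])
    ultimately have 2: "rel p (r2 \<cdot> (\<tau> \<cdot> d)) (r2 \<cdot> b)"
      by (rule P'(6)) (rule Comp_in_hom[OF _ h2] \<tau>d kd2 ab(2))+
    show ?thesis using 1 2 \<tau>d by blast
  qed
  \<comment> \<open>Over \<open>(X \<times> X) \<times> R\<close> take the fibration of all \<open>((a, b), c)\<close> with \<open>a\<close> related to \<open>r1 c\<close> and \<open>b\<close> to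
    \<open>r2 c\<close>. Its projection to \<open>X \<times> X\<close> is the relation of the quotient.\<close>
  define XX where "XX = prod_obj C X X"
  have XX: "XX \<in> Obj C" unfolding XX_def using X by simp
  note pX = proj_hom[OF X X, folded XX_def] and pR = proj_hom[OF XX RO]
  define N where "N = prod_obj C XX R"
  note pR = pR[folded N_def]
  define x1 where "x1 = proj\<^sub>1 C X X \<cdot> proj\<^sub>1 C XX R"
  define x2 where "x2 = proj\<^sub>2 C X X \<cdot> proj\<^sub>1 C XX R"
  define z where "z = proj\<^sub>2 C XX R"
  have x12: "x1 \<in> hom C N X" "x2 \<in> hom C N X" and zh: "z \<in> hom C N R"
    unfolding x1_def x2_def z_def using Comp_in_hom[OF pR(1)] pX pR(2) by blast+
  note rz = Comp_in_hom[OF zh h1] Comp_in_hom[OF zh h2]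
  obtain e1 where e1: "e1 \<in> Fib" "Cod C e1 = N"
    "\<And>V a. a \<in> hom C V N \<Longrightarrow> lifts e1 a \<longleftrightarrow> rel p (x1 \<cdot> a) ((r1 \<cdot> z) \<cdot> a)"
    using rel_fibration[OF p x12(1) rz(1)] by metis
  obtain e2 where e2: "e2 \<in> Fib" "Cod C e2 = N"
    "\<And>V a. a \<in> hom C V N \<Longrightarrow> lifts e2 a \<longleftrightarrow> rel p (x2 \<cdot> a) ((r2 \<cdot> z) \<cdot> a)"
    using rel_fibration[OF p x12(2) rz(2)] by metis
  obtain e where e: "e \<in> Fib" "Cod C e = N" "\<And>V a. a \<in> hom C V N \<Longrightarrow> lifts e a \<longleftrightarrow> lifts e1 a \<and> lifts e2 a"
    using fibration_conjunction[OF e1(1,2) e2(1,2)] by metis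
  obtain q where q: "q \<in> Fib" "Cod C q = XX"
    "\<And>V a. a \<in> hom C V XX \<Longrightarrow> lifts q a \<longleftrightarrow> (\<exists>c \<in> hom C V R. lifts e (pairing C a c))"
    using fibration_projection[OF e(1) e(2)[unfolded N_def] XX RO] by metis
  have rel_q: "rel q a b \<longleftrightarrow> (\<exists>c \<in> hom C U R. rel p a (r1 \<cdot> c) \<and> rel p b (r2 \<cdot> c))"
    if ab: "a \<in> hom C U X" "b \<in> hom C U X" for U a b
  proof -
    note pab = pairing[OF ab, folded XX_def]
    have "lifts e (pairing C (pairing C a b) c) \<longleftrightarrow> rel p a (r1 \<cdot> c) \<and> rel p b (r2 \<cdot> c)"
      if c: "c \<in> hom C U R" for c
    proof -
      note n = pairing[OF pab(1) c, folded N_def]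
      have "x1 \<cdot> pairing C (pairing C a b) c = a" "x2 \<cdot> pairing C (pairing C a b) c = b"
        unfolding x1_def x2_def Comp_assoc[OF n(1) pR(1) pX(1)] Comp_assoc[OF n(1) pR(1) pX(2)] n(2)
        using pab(2,3) by simp_all
      moreover have "(r1 \<cdot> z) \<cdot> pairing C (pairing C a b) c = r1 \<cdot> c"
        "(r2 \<cdot> z) \<cdot> pairing C (pairing C a b) c = r2 \<cdot> c"
        unfolding Comp_assoc[OF n(1) zh h1] Comp_assoc[OF n(1) zh h2] using n(3) by (simp_all add: z_def)
      ultimately show ?thesis using e(3)[OF n(1)] e1(3)[OF n(1)] e2(3)[OF n(1)] by simp
    qed
    then show ?thesis unfolding rel_def[of q] q(3)[OF pab(1)] by blast
  qed
  have pq: "rel q a b" if ab: "a \<in> hom C U X" "b \<in> hom C U X" "rel p a b" for U a b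
  proof -
    note rb = Comp_in_hom[OF ab(2) \<rho>(1)]
    have 1: "rel p (r1 \<cdot> (\<rho> \<cdot> b)) b" "rel p (r2 \<cdot> (\<rho> \<cdot> b)) b"
      using rel_Comp[OF P'(3) Comp_in_hom[OF \<rho>(1) h1] I \<rho>(2) ab(2)] rel_Comp[OF P'(3) Comp_in_hom[OF \<rho>(1) h2] I \<rho>(3) ab(2)]
        Comp_assoc[OF ab(2) \<rho>(1) h1] Comp_assoc[OF ab(2) \<rho>(1) h2] Comp_Ide_left[OF ab(2)] by simp_all
    note h = Comp_in_hom[OF rb h1] Comp_in_hom[OF rb h2]
    have "rel p a (r1 \<cdot> (\<rho> \<cdot> b))" using P'(6)[OF ab(3) P'(5)[OF 1(1) h(1) ab(2)] ab(1,2) h(1)] .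
    moreover have "rel p b (r2 \<cdot> (\<rho> \<cdot> b))" using P'(5)[OF 1(2) h(2) ab(2)] .
    ultimately show ?thesis using rel_q[OF ab(1,2)] rb by blast
  qed
  have her_q: "her X q"
  proof (rule herI[OF X q(1) q(2)[unfolded XX_def]])
    show "rel q a a" if "a \<in> hom C U X" for U a using pq[OF that that P'(4)[OF that]] .
    show "rel q b a" if ab: "a \<in> hom C U X" "b \<in> hom C U X" and r: "rel q a b" for U a b
    proof -
      obtain c where c: "c \<in> hom C U R" "rel p a (r1 \<cdot> c)" "rel p b (r2 \<cdot> c)" using r rel_q[OF ab] by blast
      note sc = Comp_in_hom[OF c(1) \<sigma>(1)]
      have 1: "rel p (r1 \<cdot> (\<sigma> \<cdot> c)) (r2 \<cdot> c)" "rel p (r2 \<cdot> (\<sigma> \<cdot> c)) (r1 \<cdot> c)"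
        using rel_Comp[OF P'(3) Comp_in_hom[OF \<sigma>(1) h1] h2 \<sigma>(2) c(1)] rel_Comp[OF P'(3) Comp_in_hom[OF \<sigma>(1) h2] h1 \<sigma>(3) c(1)]
          Comp_assoc[OF c(1) \<sigma>(1) h1] Comp_assoc[OF c(1) \<sigma>(1) h2] by simp_all
      note h = Comp_in_hom[OF sc h1] Comp_in_hom[OF sc h2] Comp_in_hom[OF c(1) h1] Comp_in_hom[OF c(1) h2]
      have "rel p b (r1 \<cdot> (\<sigma> \<cdot> c))" using P'(6)[OF c(3) P'(5)[OF 1(1) h(1,4)] ab(2) h(4,1)] .
      moreover have "rel p a (r2 \<cdot> (\<sigma> \<cdot> c))" using P'(6)[OF c(2) P'(5)[OF 1(2) h(2,3)] ab(1) h(3,2)] .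
      ultimately show ?thesis using rel_q[OF ab(2,1)] sc by blast
    qed
    show "rel q a d" if abd: "a \<in> hom C U X" "b \<in> hom C U X" "d \<in> hom C U X" and r: "rel q a b" "rel q b d" for U a b d
    proof -
      obtain c where c: "c \<in> hom C U R" "rel p a (r1 \<cdot> c)" "rel p b (r2 \<cdot> c)"
        using r(1) rel_q[OF abd(1,2)] by blast
      obtain c' where c': "c' \<in> hom C U R" "rel p b (r1 \<cdot> c')" "rel p d (r2 \<cdot> c')"
        using r(2) rel_q[OF abd(2,3)] by blast
      note h = Comp_in_hom[OF c(1) h1] Comp_in_hom[OF c(1) h2] Comp_in_hom[OF c'(1) h1] Comp_in_hom[OF c'(1) h2]
      have "rel p (r2 \<cdot> c) (r1 \<cdot> c')" using P'(6)[OF P'(5)[OF c(3) abd(2) h(2)] c'(2) h(2) abd(2) h(3)] .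
      then obtain w where w: "w \<in> hom C U R" "rel p (r1 \<cdot> w) (r1 \<cdot> c)" "rel p (r2 \<cdot> w) (r2 \<cdot> c')"
        using trans[OF c(1) c'(1)] by blast
      note hw = Comp_in_hom[OF w(1) h1] Comp_in_hom[OF w(1) h2]
      have "rel p a (r1 \<cdot> w)" using P'(6)[OF c(2) P'(5)[OF w(2) hw(1) h(1)] abd(1) h(1) hw(1)] .
      moreover have "rel p d (r2 \<cdot> w)" using P'(6)[OF c'(3) P'(5)[OF w(3) hw(2) h(4)] abd(3) h(4) hw(2)] .
      ultimately show ?thesis using rel_q[OF abd(1,3)] w(1) by blast
    qed
  qed
  have Im: "Ide C X \<in> hex_map C (X, p) (X, q)"
    using hex_mapI[OF p her_q I] pq Comp_Ide_left by simp
  let ?f = "hx (X, p) (X, q) (Ide C X)"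
  have If: "?f \<cdot>\<^bsub>Hx\<^esub> hx (S, s) (X, p) a = hx (S, s) (X, q) a" if "her S s" "a \<in> hex_map C (S, s) (X, p)" for S s a
    using Hex_Comp[OF that(1) p her_q that(2) Im] Comp_Ide_left[OF hex_map_hom[OF that(2)]] by simp
  have Im': "a \<in> hex_map C (S, s) (X, q)" if "her S s" "a \<in> hex_map C (S, s) (X, p)" for S s a
    using hex_map_Comp[OF that(1) p her_q that(2) Im] Comp_Ide_left[OF hex_map_hom[OF that(2)]] by simp
  have "is_pullback Hx ?f ?f \<phi> \<psi>"
  proof (rule Hex.is_pullbackI)
    show "?f \<in> hom Hx (X, p) (X, q)" "?f \<in> hom Hx (X, p) (X, q)" using hx_hom[OF p her_q Im] by blast+
    show "\<phi> \<in> hom Hx (R, t) (X, p)" "\<psi> \<in> hom Hx (R, t) (X, p)" using hom0 unfolding R A by blast+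
    have "Ide C R \<in> hom C R R" by (rule Ide_in_hom[OF RO])
    then have "rel q r1 r2"
      using rel_q[OF h1 h2] P'(4)[OF h1] P'(4)[OF h2] Comp_Ide_right[OF h1] Comp_Ide_right[OF h2] by force
    then show "?f \<cdot>\<^bsub>Hx\<^esub> \<phi> = ?f \<cdot>\<^bsub>Hx\<^esub> \<psi>"
      unfolding r1(2) r2(2) If[OF t r1(1)] If[OF t r2(1)]
      using hx_eq_iff[OF t her_q Im'[OF t r1(1)] Im'[OF t r2(1)]] by simp
    show "\<eta> = \<eta>'" if "\<eta> \<in> hom Hx U (R, t)" "\<eta>' \<in> hom Hx U (R, t)" "\<phi> \<cdot>\<^bsub>Hx\<^esub> \<eta> = \<phi> \<cdot>\<^bsub>Hx\<^esub> \<eta>'" "\<psi> \<cdot>\<^bsub>Hx\<^esub> \<eta> = \<psi> \<cdot>\<^bsub>Hx\<^esub> \<eta>'" for U \<eta> \<eta>'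
      using monic0 that unfolding R by blast
    fix U \<alpha> \<beta> assume \<alpha>: "\<alpha> \<in> hom Hx U (X, p)" and \<beta>: "\<beta> \<in> hom Hx U (X, p)" and eq: "?f \<cdot>\<^bsub>Hx\<^esub> \<alpha> = ?f \<cdot>\<^bsub>Hx\<^esub> \<beta>"
    obtain S s where U: "U = (S, s)" by (cases U)
    obtain a where a: "a \<in> hex_map C (S, s) (X, p)" "\<alpha> = hx (S, s) (X, p) a" and s: "her S s"
      using \<alpha> unfolding U by (rule Hex_homE)
    obtain b where b: "b \<in> hex_map C (S, s) (X, p)" "\<beta> = hx (S, s) (X, p) b"
      using \<beta> unfolding U by (rule Hex_homE)
    note ah = hex_map_hom[OF a(1)] and bh = hex_map_hom[OF b(1)]
    have "rel q a b"
      using eq hx_eq_iff[OF s her_q Im'[OF s a(1)] Im'[OF s b(1)]] unfolding a(2) b(2) If[OF s a(1)] If[OF s b(1)] by simp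
    then obtain c where c: "c \<in> hom C S R" "rel p a (r1 \<cdot> c)" "rel p b (r2 \<cdot> c)" using rel_q[OF ah bh] by blast
    have transfer: "rel p (r \<cdot> (c \<cdot> x)) (r \<cdot> (c \<cdot> y))"
      if xy: "x \<in> hom C V S" "y \<in> hom C V S" "rel s x y" and d: "d \<in> hex_map C (S, s) (X, p)"
        and r: "r \<in> hom C R X" "rel p d (r \<cdot> c)" for V x y d r
    proof -
      note dh = hex_map_hom[OF d] and rc = Comp_in_hom[OF c(1) r(1)]
      have 1: "rel p (d \<cdot> v) (r \<cdot> (c \<cdot> v))" if "v \<in> hom C V S" for v
        using rel_Comp[OF P'(3) dh rc r(2) that] Comp_assoc[OF that c(1) r(1)] by simp
      have 2: "rel p (d \<cdot> x) (d \<cdot> y)" by (rule hex_map_rel[OF s p d xy(3,1,2)])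
      note h = Comp_in_hom[OF xy(1) dh] Comp_in_hom[OF xy(2) dh] Comp_in_hom[OF Comp_in_hom[OF xy(1) c(1)] r(1)]
        Comp_in_hom[OF Comp_in_hom[OF xy(2) c(1)] r(1)]
      show ?thesis using P'(6)[OF P'(5)[OF 1[OF xy(1)] h(1,3)] P'(6)[OF 2 1[OF xy(2)] h(1,2,4)] h(3,1,4)] .
    qed
    have cm: "c \<in> hex_map C (S, s) (R, t)"
    proof (rule hex_mapI[OF s t c(1)])
      fix V x y assume xy: "x \<in> hom C V S" "y \<in> hom C V S" "rel s x y"
      show "rel t (c \<cdot> x) (c \<cdot> y)"
        by (rule monic[OF Comp_in_hom[OF xy(1) c(1)] Comp_in_hom[OF xy(2) c(1)]
              transfer[OF xy a(1) h1 c(2)] transfer[OF xy b(1) h2 c(3)]])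
    qed
    have "\<phi> \<cdot>\<^bsub>Hx\<^esub> hx (S, s) (R, t) c = \<alpha>" "\<psi> \<cdot>\<^bsub>Hx\<^esub> hx (S, s) (R, t) c = \<beta>"
      unfolding r1(2) r2(2) a(2) b(2) Hex_Comp[OF s t p cm r1(1)] Hex_Comp[OF s t p cm r2(1)]
      using hx_eq_iff[OF s p hex_map_Comp[OF s t p cm r1(1)] a(1)] hx_eq_iff[OF s p hex_map_Comp[OF s t p cm r2(1)] b(1)]
        P'(5)[OF c(2) ah Comp_in_hom[OF c(1) h1]] P'(5)[OF c(3) bh Comp_in_hom[OF c(1) h2]] by simp_all
    then show "\<exists>\<eta> \<in> hom Hx U (R, t). \<phi> \<cdot>\<^bsub>Hx\<^esub> \<eta> = \<alpha> \<and> \<psi> \<cdot>\<^bsub>Hx\<^esub> \<eta> = \<beta>"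
      unfolding U using hx_hom[OF s t cm] by blast
  qed
  then show "\<exists>\<chi>. is_kernel_pair Hx \<chi> \<phi> \<psi>" unfolding is_kernel_pair_def by blast
qed

end


section \<open>The homotopy category as a category of projectives\<close>

context chosen_path_objects
begin

abbreviation "HoC \<equiv> Ho C Fib Weq"

definition ho :: "'a \<Rightarrow> 'o \<times> 'o \<times> 'a set" where
  "ho f = (Dom C f, Cod C f, ho_class C Fib Weq f)"

lemma Ho_simps [simp]:
  "Obj HoC = Obj C"
  "Dom HoC (ho f) = Dom C f"
  "Cod HoC (ho f) = Cod C f"
  "Ide HoC X = (X, X, ho_class C Fib Weq (Ide C X))"
  by (simp_all add: Ho_def ho_def)

lemma Ho_Arr: "\<phi> \<in> Arr HoC \<longleftrightarrow> (\<exists>f \<in> Arr C. \<phi> = ho f)"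
  by (auto simp: Ho_def ho_def)

lemma Ho_Ide: "X \<in> Obj C \<Longrightarrow> Ide HoC X = ho (Ide C X)"
  by (simp add: ho_def)

text \<open>By \<open>hex_map_P\<close> every map \<open>X \<rightarrow> Y\<close> is an arrow between the objects given by path objects, and by
  \<open>homotopic_iff\<close> the two equivalence relations on such maps agree.\<close>

lemma ho_class_eq:
  assumes f: "f \<in> hom C X Y"
  shows "ho_class C Fib Weq f = hex_class C (X, P X) (Y, P Y) f"
proof -
  have Y: "Y \<in> Obj C" using hom_Obj[OF f] by simp
  obtain r where r: "is_path_object C Fib Weq Y r (P Y)" using path_object[OF Y] by blast
  have D: "Dom C f = X" "Cod C f = Y" using f by (simp_all add: hom_iff)
  have "homotopic C Fib Weq f g \<longleftrightarrow> g \<in> hom C X Y \<and> rel (P Y) f g" for g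
    using homotopic_iff[OF f _ r, of g] D unfolding homotopic_def by blast
  then show ?thesis
    unfolding ho_class_def using hex_class_iff[OF f] hex_map_P[OF her_P[OF Y]] by blast
qed

lemma hex_map_PP: "f \<in> hom C X Y \<Longrightarrow> f \<in> hex_map C (X, P X) (Y, P Y)"
  using hex_map_P[OF her_P] hom_Obj by blast

lemma ho_eq_iff:
  assumes f: "f \<in> hom C X Y" and g: "g \<in> hom C X Y"
  shows "ho f = ho g \<longleftrightarrow> rel (P Y) f g"
proof -
  have ob: "X \<in> Obj C" "Y \<in> Obj C" using hom_Obj[OF f] by auto
  have "Dom C f = X" "Cod C f = Y" "Dom C g = X" "Cod C g = Y" using f g by (simp_all add: hom_iff)
  then show ?thesis
    using hex_class_eq_iff[OF her_P[OF ob(1)] her_P[OF ob(2)] hex_map_PP[OF f] hex_map_PP[OF g]]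
    by (simp add: ho_def ho_class_eq[OF f] ho_class_eq[OF g])
qed

lemma ho_hom: "f \<in> hom C X Y \<Longrightarrow> ho f \<in> hom HoC X Y"
  unfolding hom_iff Ho_Arr by auto

lemma Ho_homE:
  assumes "\<phi> \<in> hom HoC X Y"
  obtains f where "f \<in> hom C X Y" "\<phi> = ho f"
proof -
  have "\<phi> \<in> Arr HoC" and D: "Dom HoC \<phi> = X" "Cod HoC \<phi> = Y" using assms by (simp_all add: hom_iff)
  then obtain f where "f \<in> Arr C" "\<phi> = ho f" unfolding Ho_Arr by blast
  then show ?thesis using that D by (simp add: hom_iff)
qed

lemma Ho_Comp:
  assumes f: "f \<in> hom C X Y" and g: "g \<in> hom C Y Z"
  shows "ho g \<cdot>\<^bsub>HoC\<^esub> ho f = ho (g \<cdot> f)"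
proof -
  have ob: "X \<in> Obj C" "Y \<in> Obj C" "Z \<in> Obj C" using hom_Obj[OF f] hom_Obj[OF g] by auto
  have gf: "g \<cdot> f \<in> hom C X Z" using f g by (rule Comp_in_hom)
  have "(\<Union>g' \<in> ho_class C Fib Weq g. \<Union>f' \<in> ho_class C Fib Weq f. ho_class C Fib Weq (g' \<cdot> f'))
      = (\<Union>g' \<in> hex_class C (Y, P Y) (Z, P Z) g. \<Union>f' \<in> hex_class C (X, P X) (Y, P Y) f.
          hex_class C (X, P X) (Z, P Z) (g' \<cdot> f'))"
    unfolding ho_class_eq[OF f] ho_class_eq[OF g]
  proof (intro SUP_cong refl)
    fix g' f' assume "g' \<in> hex_class C (Y, P Y) (Z, P Z) g" "f' \<in> hex_class C (X, P X) (Y, P Y) f"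
    then have "g' \<in> hom C Y Z" "f' \<in> hom C X Y"
      using hex_class_iff[OF g] hex_class_iff[OF f] hex_map_hom by blast+
    then show "ho_class C Fib Weq (g' \<cdot> f') = hex_class C (X, P X) (Z, P Z) (g' \<cdot> f')"
      using ho_class_eq Comp_in_hom by blast
  qed
  also have "\<dots> = ho_class C Fib Weq (g \<cdot> f)"
    unfolding ho_class_eq[OF gf]
    by (rule hex_class_Comp[OF her_P[OF ob(1)] her_P[OF ob(2)] her_P[OF ob(3)] hex_map_PP[OF f] hex_map_PP[OF g]])
  finally show ?thesis using f g gf by (simp add: ho_def Ho_def hom_iff)
qed

lemma category_Ho: "category HoC"
proof
  show "Dom HoC \<phi> \<in> Obj HoC" "Cod HoC \<phi> \<in> Obj HoC" if "\<phi> \<in> Arr HoC" for \<phi>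
    using that unfolding Ho_Arr by auto
  show "Ide HoC X \<in> hom HoC X X" if "X \<in> Obj HoC" for X
    using that ho_hom[OF Ide_in_hom] Ho_Ide by simp
  fix \<phi> X Y assume "\<phi> \<in> hom HoC X Y"
  then obtain f where f: "f \<in> hom C X Y" "\<phi> = ho f" by (rule Ho_homE)
  have ob: "X \<in> Obj C" "Y \<in> Obj C" using hom_Obj[OF f(1)] by auto
  show "\<phi> \<cdot>\<^bsub>HoC\<^esub> Ide HoC X = \<phi>" "Ide HoC Y \<cdot>\<^bsub>HoC\<^esub> \<phi> = \<phi>"
    unfolding Ho_Ide[OF ob(1)] Ho_Ide[OF ob(2)] f(2) Ho_Comp[OF Ide_in_hom[OF ob(1)] f(1)]
      Ho_Comp[OF f(1) Ide_in_hom[OF ob(2)]] Comp_Ide_left[OF f(1)] Comp_Ide_right[OF f(1)] by (rule refl)+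
  fix \<psi> Z assume "\<psi> \<in> hom HoC Y Z"
  then obtain g where g: "g \<in> hom C Y Z" "\<psi> = ho g" by (rule Ho_homE)
  show "\<psi> \<cdot>\<^bsub>HoC\<^esub> \<phi> \<in> hom HoC X Z"
    unfolding f(2) g(2) Ho_Comp[OF f(1) g(1)] by (rule ho_hom[OF Comp_in_hom[OF f(1) g(1)]])
  fix \<chi> V assume "\<chi> \<in> hom HoC Z V"
  then obtain h where h: "h \<in> hom C Z V" "\<chi> = ho h" by (rule Ho_homE)
  show "(\<chi> \<cdot>\<^bsub>HoC\<^esub> \<psi>) \<cdot>\<^bsub>HoC\<^esub> \<phi> = \<chi> \<cdot>\<^bsub>HoC\<^esub> (\<psi> \<cdot>\<^bsub>HoC\<^esub> \<phi>)"
    unfolding f(2) g(2) h(2) Ho_Comp[OF f(1) g(1)] Ho_Comp[OF g(1) h(1)]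
      Ho_Comp[OF f(1) Comp_in_hom[OF g(1) h(1)]] Ho_Comp[OF Comp_in_hom[OF f(1) g(1)] h(1)]
      Comp_assoc[OF f(1) g(1) h(1)] ..
qed

lemma ho_quotient_simps [simp]:
  "X \<in> Obj C \<Longrightarrow> FO (ho_quotient C Fib Weq) X = X"
  "f \<in> Arr C \<Longrightarrow> FA (ho_quotient C Fib Weq) f = ho f"
  by (simp_all add: ho_quotient_def ho_def)

lemma is_functor_ho_quotient: "is_functor C HoC (ho_quotient C Fib Weq)"
  unfolding is_functor_def
proof (intro conjI ballI impI category_axioms category_Ho)
  show "FO (ho_quotient C Fib Weq) \<in> Obj C \<rightarrow>\<^sub>E Obj HoC" "FA (ho_quotient C Fib Weq) \<in> extensional (Arr C)"
    by (auto simp: ho_quotient_def)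
  show "FA (ho_quotient C Fib Weq) f \<in> hom HoC (FO (ho_quotient C Fib Weq) (Dom C f)) (FO (ho_quotient C Fib Weq) (Cod C f))"
    if "f \<in> Arr C" for f
    using ho_hom[of f "Dom C f" "Cod C f"] that by (simp add: hom_def)
  show "FA (ho_quotient C Fib Weq) (Ide C X) = Ide HoC (FO (ho_quotient C Fib Weq) X)" if "X \<in> Obj C" for X
    using that Ho_Ide by simp
  show "FA (ho_quotient C Fib Weq) (g \<cdot> f)
      = FA (ho_quotient C Fib Weq) g \<cdot>\<^bsub>HoC\<^esub> FA (ho_quotient C Fib Weq) f"
    if "f \<in> Arr C" "g \<in> Arr C" "Dom C g = Cod C f" for f g
    using Ho_Comp[of f "Dom C f" "Cod C f" g "Cod C g"] that by (simp add: hom_def)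
qed

text \<open>A homotopy class of maps \<open>X \<rightarrow> Y\<close> is, as a set, the same as an arrow \<open>(X, P X) \<rightarrow> (Y, P Y)\<close>.\<close>

definition ho_incl :: "('o, 'o \<times> 'o \<times> 'a set, 'o \<times> 'a, ('o \<times> 'a) \<times> ('o \<times> 'a) \<times> 'a set) ftr" where
  "ho_incl = \<lparr>FO = (\<lambda>X \<in> Obj C. (X, P X)),
     FA = restrict (\<lambda>(X, Y, c). ((X, P X), (Y, P Y), c)) (Arr HoC)\<rparr>"

lemma ho_incl_simps [simp]:
  "X \<in> Obj C \<Longrightarrow> FO ho_incl X = (X, P X)"
  "f \<in> hom C X Y \<Longrightarrow> FA ho_incl (ho f) = hx (X, P X) (Y, P Y) f"
proof -
  show "X \<in> Obj C \<Longrightarrow> FO ho_incl X = (X, P X)" by (simp add: ho_incl_def)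
  assume f: "f \<in> hom C X Y"
  then have "ho f \<in> Arr HoC" and "Dom C f = X" "Cod C f = Y" using ho_hom[OF f] by (simp_all add: hom_iff)
  then show "FA ho_incl (ho f) = hx (X, P X) (Y, P Y) f"
    by (simp add: ho_incl_def) (simp add: ho_def hx_def ho_class_eq[OF f])
qed

lemma is_functor_ho_incl: "is_functor HoC Hx ho_incl"
  unfolding is_functor_def
proof (intro conjI ballI impI category_Ho category_Hex)
  show "FO ho_incl \<in> Obj HoC \<rightarrow>\<^sub>E Obj Hx" using her_P by (auto simp: ho_incl_def)
  show "FA ho_incl \<in> extensional (Arr HoC)" by (simp add: ho_incl_def)
  show "FA ho_incl \<phi> \<in> hom Hx (FO ho_incl (Dom HoC \<phi>)) (FO ho_incl (Cod HoC \<phi>))" if \<phi>: "\<phi> \<in> Arr HoC" for \<phi>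
  proof -
    obtain f where f: "f \<in> Arr C" "\<phi> = ho f" using \<phi> unfolding Ho_Arr by blast
    then have fh: "f \<in> hom C (Dom C f) (Cod C f)" by (simp add: hom_iff)
    have ob: "Dom C f \<in> Obj C" "Cod C f \<in> Obj C" using f(1) by simp_all
    show ?thesis
      unfolding f(2) ho_incl_simps(2)[OF fh] Ho_simps ho_incl_simps(1)[OF ob(1)] ho_incl_simps(1)[OF ob(2)]
      by (rule hx_hom[OF her_P[OF ob(1)] her_P[OF ob(2)] hex_map_PP[OF fh]])
  qed
  show "FA ho_incl (Ide HoC X) = Ide Hx (FO ho_incl X)" if "X \<in> Obj HoC" for X
    using that ho_incl_simps(2)[OF Ide_in_hom[of X]] Ho_Ide[of X] by simp
  fix \<phi> \<psi> assume "\<phi> \<in> Arr HoC" "\<psi> \<in> Arr HoC" "Dom HoC \<psi> = Cod HoC \<phi>"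
  then obtain f g where f: "f \<in> Arr C" "\<phi> = ho f" and g: "g \<in> Arr C" "\<psi> = ho g" and eq: "Dom C g = Cod C f"
    unfolding Ho_Arr by auto
  have fh: "f \<in> hom C (Dom C f) (Cod C f)" and gh: "g \<in> hom C (Cod C f) (Cod C g)"
    using f g eq by (simp_all add: hom_iff)
  have ob: "Dom C f \<in> Obj C" "Cod C f \<in> Obj C" "Cod C g \<in> Obj C" using f(1) g(1) by simp_all
  show "FA ho_incl (\<psi> \<cdot>\<^bsub>HoC\<^esub> \<phi>) = FA ho_incl \<psi> \<cdot>\<^bsub>Hx\<^esub> FA ho_incl \<phi>"
    unfolding f(2) g(2) Ho_Comp[OF fh gh] ho_incl_simps(2)[OF fh] ho_incl_simps(2)[OF gh]
      ho_incl_simps(2)[OF Comp_in_hom[OF fh gh]]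
      Hex_Comp[OF her_P[OF ob(1)] her_P[OF ob(2)] her_P[OF ob(3)] hex_map_PP[OF fh] hex_map_PP[OF gh]] ..
qed

lemma hex_incl_factorisation: "comp_ftr C ho_incl (ho_quotient C Fib Weq) = hex_incl C P"
proof -
  have "FA ho_incl (FA (ho_quotient C Fib Weq) f)
      = (let A = (Dom C f, P (Dom C f)); B = (Cod C f, P (Cod C f)) in (A, B, hex_class C A B f))"
    if "f \<in> Arr C" for f
    using that ho_incl_simps(2)[of f "Dom C f" "Cod C f"] by (simp add: hom_def hx_def Let_def)
  then show ?thesis by (simp add: comp_ftr_def hex_incl_def cong: restrict_cong)
qed

lemma factorisation_unique:
  assumes G: "is_functor HoC Hx \<Gamma>" and eq: "comp_ftr C \<Gamma> (ho_quotient C Fib Weq) = hex_incl C P"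
  shows "\<Gamma> = ho_incl"
proof (rule ftr.equality)
  have eq': "comp_ftr C \<Gamma> (ho_quotient C Fib Weq) = comp_ftr C ho_incl (ho_quotient C Fib Weq)"
    using eq hex_incl_factorisation by simp
  have "FO \<Gamma> X = FO ho_incl X" if X: "X \<in> Obj HoC" for X
    using arg_cong[OF eq', of "\<lambda>F. FO F X"] X by (simp add: comp_ftr_def)
  then show "FO \<Gamma> = FO ho_incl"
    using G is_functor_ho_incl by (intro extensionalityI[of _ "Obj HoC"]) (auto simp: is_functor_def PiE_def)
  have "FA \<Gamma> \<phi> = FA ho_incl \<phi>" if \<phi>: "\<phi> \<in> Arr HoC" for \<phi>
  proof -
    obtain f where f: "f \<in> Arr C" "\<phi> = ho f" using \<phi> unfolding Ho_Arr by blast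
    show ?thesis using arg_cong[OF eq', of "\<lambda>F. FA F f"] f by (simp add: comp_ftr_def)
  qed
  then show "FA \<Gamma> = FA ho_incl"
    using G is_functor_ho_incl by (intro extensionalityI[of _ "Arr HoC"]) (simp_all add: is_functor_def)
qed simp

text \<open>Projectivity of \<open>(V, P V)\<close>: compose with the section given by \<open>Hex_cover_iff\<close>; the composite is an
  arrow because every map out of \<open>V\<close> is one. The identity of \<open>X\<close> is a cover of \<open>(X, p)\<close> by \<open>(X, P X)\<close>.\<close>

lemma Ho_presents_Hex: "projective_presentation HoC Hx ho_incl"
proof (intro projective_presentation.intro projective_presentation_axioms.intro exact_cat.intro
    exact_cat_axioms.intro category_notation.intro category_Ho category_Hex exact_Hex is_functor_ho_incl)
  fix V T a assume V: "V \<in> Obj HoC" and T: "T \<in> Obj HoC" and a: "a \<in> hom Hx (FO ho_incl V) (FO ho_incl T)"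
  then have "a \<in> hom Hx (V, P V) (T, P T)" by simp
  then obtain f where f: "f \<in> hex_map C (V, P V) (T, P T)" "a = hx (V, P V) (T, P T) f" by (rule Hex_homE)
  note fh = hex_map_hom[OF f(1)]
  show "\<exists>g \<in> hom HoC V T. FA ho_incl g = a" using ho_hom[OF fh] ho_incl_simps(2)[OF fh] f(2) by blast
next
  fix \<phi> \<psi> V T assume ph: "\<phi> \<in> hom HoC V T" and ps: "\<psi> \<in> hom HoC V T" and eq: "FA ho_incl \<phi> = FA ho_incl \<psi>"
  obtain f where f: "f \<in> hom C V T" "\<phi> = ho f" using ph by (rule Ho_homE)
  obtain g where g: "g \<in> hom C V T" "\<psi> = ho g" using ps by (rule Ho_homE)
  have ob: "V \<in> Obj C" "T \<in> Obj C" using hom_Obj[OF f(1)] by auto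
  have "rel (P T) f g"
    using eq hx_eq_iff[OF her_P[OF ob(1)] her_P[OF ob(2)] hex_map_PP[OF f(1)] hex_map_PP[OF g(1)]]
    unfolding f(2) g(2) ho_incl_simps(2)[OF f(1)] ho_incl_simps(2)[OF g(1)] by simp
  then show "\<phi> = \<psi>" using ho_eq_iff[OF f(1) g(1)] f(2) g(2) by simp
next
  fix V \<epsilon> A B \<alpha> assume V: "V \<in> Obj HoC" and e: "is_cover Hx \<epsilon> A B" and a: "\<alpha> \<in> hom Hx (FO ho_incl V) B"
  have VC: "V \<in> Obj C" using V by simp
  note PV = her_P[OF VC]
  obtain X p Y q where AB: "A = (X, p)" "B = (Y, q)" by (cases A, cases B)
  have "\<epsilon> \<in> hom Hx (X, p) (Y, q)" using e by (simp add: is_cover_def AB)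
  then obtain f where f: "f \<in> hex_map C (X, p) (Y, q)" "\<epsilon> = hx (X, p) (Y, q) f" and p: "her X p" and q: "her Y q"
    by (rule Hex_homE)
  obtain s where s: "s \<in> hom C Y X" "rel q (f \<cdot> s) (Ide C Y)"
    using Hex_cover_iff[OF p q f(1)] e unfolding AB f(2) by blast
  have "\<alpha> \<in> hom Hx (V, P V) (Y, q)" using a VC AB by simp
  then obtain a where a: "a \<in> hex_map C (V, P V) (Y, q)" "\<alpha> = hx (V, P V) (Y, q) a" by (rule Hex_homE)
  note fh = hex_map_hom[OF f(1)] and ah = hex_map_hom[OF a(1)]
  have sa: "s \<cdot> a \<in> hex_map C (V, P V) (X, p)" using Comp_in_hom[OF ah s(1)] hex_map_P[OF p] by simp
  have I: "Ide C Y \<in> hom C Y Y" using herD(1)[OF q] by (rule Ide_in_hom)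
  have "rel q (f \<cdot> (s \<cdot> a)) a"
    using rel_Comp[OF herD(3)[OF q] Comp_in_hom[OF s(1) fh] I s(2) ah] Comp_assoc[OF ah s(1) fh] Comp_Ide_left[OF ah]
    by simp
  then have "\<epsilon> \<cdot>\<^bsub>Hx\<^esub> hx (V, P V) (X, p) (s \<cdot> a) = \<alpha>"
    unfolding f(2) a(2) Hex_Comp[OF PV p q sa f(1)]
    using hx_eq_iff[OF PV q hex_map_Comp[OF PV p q sa f(1)] a(1)] by simp
  moreover have "hx (V, P V) (X, p) (s \<cdot> a) \<in> hom Hx (FO ho_incl V) A"
    using hx_hom[OF PV p sa] VC AB by simp
  ultimately show "\<exists>\<beta> \<in> hom Hx (FO ho_incl V) A. \<epsilon> \<cdot>\<^bsub>Hx\<^esub> \<beta> = \<alpha>" by blast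
next
  fix A assume "A \<in> Obj Hx"
  moreover obtain X p where A: "A = (X, p)" by (cases A)
  ultimately have p: "her X p" by simp
  have X: "X \<in> Obj C" by (rule herD(1)[OF p])
  have I: "Ide C X \<in> hom C X X" by (rule Ide_in_hom[OF X])
  then have Im: "Ide C X \<in> hex_map C (X, P X) (X, p)" using hex_map_P[OF p] by simp
  have "rel p (Ide C X \<cdot> Ide C X) (Ide C X)" using herD(4)[OF p I] Comp_Ide_left[OF I] by simp
  then have "is_cover Hx (hx (X, P X) (X, p) (Ide C X)) (X, P X) (X, p)"
    using Hex_cover_iff[OF her_P[OF X] p Im] I by blast
  then have "is_cover Hx (hx (X, P X) (X, p) (Ide C X)) (FO ho_incl X) A" using X A by simp
  then show "\<exists>V \<in> Obj HoC. \<exists>\<epsilon>. is_cover Hx \<epsilon> (FO ho_incl V) A"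
    using X unfolding Ho_simps by blast
qed

end

theorem proposition3p18:
  fixes C :: "('o, 'a) cat" and Fib Weq :: "'a set" and P :: "'o \<Rightarrow> 'a"
  assumes "path_category C Fib Weq"
    and "\<And>X. X \<in> Obj C \<Longrightarrow> \<exists>r. is_path_object C Fib Weq X r (P X)"
  shows "is_functor C (Hex C Fib) (hex_incl C P) \<and>
    (\<exists>!\<Gamma>. is_functor (Ho C Fib Weq) (Hex C Fib) \<Gamma> \<and>
          comp_ftr C \<Gamma> (ho_quotient C Fib Weq) = hex_incl C P) \<and>
    (\<forall>\<Gamma>. is_functor (Ho C Fib Weq) (Hex C Fib) \<Gamma> \<and>
          comp_ftr C \<Gamma> (ho_quotient C Fib Weq) = hex_incl C P \<longrightarrow>
       exact_completion TYPE(('p, 'b) cat) (Ho C Fib Weq) (Hex C Fib) \<Gamma>)"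
proof -
  interpret path_category C Fib Weq by (rule assms(1))
  interpret chosen_path_objects C Fib Weq P by unfold_locales (rule assms(2))
  interpret pres: projective_presentation "Ho C Fib Weq" "Hex C Fib" ho_incl by (rule Ho_presents_Hex)
  have "is_functor C (Hex C Fib) (hex_incl C P)"
    using is_functor_comp[OF is_functor_ho_quotient is_functor_ho_incl] hex_incl_factorisation by simp
  moreover have "\<exists>!\<Gamma>. is_functor (Ho C Fib Weq) (Hex C Fib) \<Gamma> \<and>
      comp_ftr C \<Gamma> (ho_quotient C Fib Weq) = hex_incl C P"
    using is_functor_ho_incl hex_incl_factorisation factorisation_unique by blast
  moreover have "exact_completion TYPE(('p, 'b) cat) (Ho C Fib Weq) (Hex C Fib) ho_incl"
    by (rule pres.exact_completion)
  ultimately show ?thesis using factorisation_unique by blast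
qed

end
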